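(* Let $X,A,Q$ satisfy the assumptions (A1) and (A2) stated in the context, with exponent $\theta>0$, and let $T>0$. For every $f\in C_b(X)$, $g\in C_b([0,T]\times X)$ let $v$ be the mild solution to $$v_t(t,x)=Lv(t,x)+g(t,x),\quad t\in[0,T],\ x\in X;\qquad v(0,\cdot)=f,$$ where $L$ is the generator of the Ornstein–Uhlenbeck semigroup $P_t$. (i) If $1/\theta\notin\mathbb{N}$ and $f\in C^{1/\theta}_b(X)$, then $v\in C^{0,1/\theta}_b([0,T]\times X)$, and there exists $C=C(T)>0$, independent of $f$ and $g$, such that $\|v\|_{C^{0,1/\theta}_b([0,T]\times X)}\le C(\|f\|_{C^{1/\theta}_b(X)}+\|g\|_\infty)$. (ii) If $\alpha\in(0,1)$ and $\alpha+1/\theta\notin\mathbb{N}$, $f\in C^{\alpha+1/\theta}_b(X)$ and $g\in C^{0,\alpha}_b([0,T]\times X)$, then $v\in C^{0,\alpha+1/\theta}_b([0,T]\times X)$, and there exists $C=C(T,\alpha)>0$, independent of $f$ and $g$, such that $\|v\|_{C^{0,\alpha+1/\theta}_b([0,T]\times X)}\le C(\|f\|_{C^{\alpha+1/\theta}_b(X)}+\|g\|_{C^{0,\alpha}_b([0,T]\times X)})$.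
   Context: Assumptions. (A1) $X$ is a real separable (infinite dimensional) Hilbert space, $A:D(A)\subset X\to X$ is the infinitesimal generator of a strongly continuous semigroup $e^{tA}$, and $Q\in\mathcal{L}(X)$ is self-adjoint and nonnegative, such that the operators $Q_t=\int_0^te^{sA}Qe^{sA^*}ds$ have finite trace for every $t>0$; moreover $e^{tA}$ maps $X$ into $Q_t^{1/2}(X)$ for every $t>0$. (A2) There are $\omega\in\mathbb{R}$, $C,\theta>0$ such that $\|Q_t^{-1/2}e^{tA}\|_{\mathcal{L}(X)}\le Ce^{\omega t}t^{-\theta}$ for every $t>0$, where $Q_t^{-1/2}$ is the pseudo-inverse of $Q_t^{1/2}$. The semigroup. $P_tf(x)=\int_Xf(e^{tA}x+y)\,\mu_t(dy)$, where $\mu_t=\mathcal{N}(0,Q_t)$ is the centered Gaussian measure on $X$ with covariance $Q_t$ ($t>0$), $P_0=I$. Its generator $L$ is the unique closed operator in $C_b(X)$ with $R(\lambda,L)f(x)=\int_0^\infty e^{-\lambda t}P_tf(x)\,dt$, $\lambda>0$. The mild solution of the Cauchy problem is by definition $v(t,x)=P_tf(x)+\int_0^tP_{t-s}g(s,\cdot)(x)\,ds$. Function spaces. $\mathbb{N}=\{1,2,\dots\}$. $C_b$: bounded continuous real functions, sup norm. $\mathcal{L}^n(X)$: continuous $n$-linear forms on $X^n$ with the usual norm. $C^n_b(X)$: $f\in C_b(X)$ that are $n$ times Gateaux differentiable at every point ($D^kf:X\to\mathcal{L}^k(X)$ being the Gateaux derivative of $D^{k-1}f:X\to\mathcal{L}^{k-1}(X)$)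 with $x\mapsto D^kf(x)(h_1,\dots,h_k)$ continuous and bounded for all $k\le n$, $h_i\in X$; norm $\|f\|_\infty+\sum_{k=1}^n\sup_x\|D^kf(x)\|_{\mathcal{L}^k(X)}$. For $\sigma\in(0,1)$ and $F$ from $X$ to a Banach space, $[F]_\sigma=\sup_{x,\,h\ne0}\|F(x+h)-F(x)\|/\|h\|^\sigma$; $C^\sigma_b(X)=\{f\in C_b(X):[f]_\sigma<\infty\}$ with norm $\|f\|_\infty+[f]_\sigma$; $C^{\sigma+n}_b(X)=\{f\in C^n_b(X):[D^nf]_\sigma<\infty\}$ with norm $\|f\|_{C^n_b}+[D^nf]_\sigma$. For $\gamma>0$, $C^{0,\gamma}_b([0,T]\times X)$: bounded continuous $g:[0,T]\times X\to\mathbb{R}$ with $g(t,\cdot)\in C^\gamma_b(X)$ for all $t$, norm $\sup_t\|g(t,\cdot)\|_{C^\gamma_b(X)}<\infty$, and, if $\gamma\ge1$, $(t,x)\mapsto\frac{\partial^kg}{\partial h_1\cdots\partial h_k}(t,x)$ continuous on $[0,T]\times X$ for all $k\le[\gamma]$, $h_i\in X$. *)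

theory Defs
  imports "HOL-Probability.Probability"
begin

section \<open>Semigroups and operators on a Hilbert space\<close>

text \<open>A separable real Hilbert space is a type of sort
  \<open>{real_inner, banach, polish_space}\<close>. Everywhere \<open>S t\<close> stands for \<open>e\<^sup>t\<^sup>A\<close>, and only
  times \<open>t \<ge> 0\<close> are relevant.\<close>

definition C0_semigroup :: "(real \<Rightarrow> 'a \<Rightarrow> 'a::real_normed_vector) \<Rightarrow> bool" where
  "C0_semigroup S \<longleftrightarrow>
     (\<forall>t\<ge>0. bounded_linear (S t)) \<and> S 0 = id \<and>
     (\<forall>s\<ge>0. \<forall>t\<ge>0. S (s + t) = S s \<circ> S t) \<and>
     (\<forall>x. continuous_on {0..} (\<lambda>t. S t x))"

definition infinitesimal_generator ::
    "'a set \<Rightarrow> ('a \<Rightarrow> 'a) \<Rightarrow> (real \<Rightarrow> 'a \<Rightarrow> 'a::real_normed_vector) \<Rightarrow> bool" where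
  "infinitesimal_generator D A S \<longleftrightarrow>
     D = {x. \<exists>y. ((\<lambda>t. (S t x - x) /\<^sub>R t) \<longlongrightarrow> y) (at_right 0)} \<and>
     (\<forall>x\<in>D. ((\<lambda>t. (S t x - x) /\<^sub>R t) \<longlongrightarrow> A x) (at_right 0))"

definition selfadjoint_nonneg :: "('a \<Rightarrow> 'a::real_inner) \<Rightarrow> bool" where
  "selfadjoint_nonneg B \<longleftrightarrow>
     bounded_linear B \<and> (\<forall>x y. B x \<bullet> y = x \<bullet> B y) \<and> (\<forall>x. 0 \<le> B x \<bullet> x)"

definition orthonormal_basis :: "'a::real_inner set \<Rightarrow> bool" where
  "orthonormal_basis B \<longleftrightarrow>
     pairwise orthogonal B \<and> (\<forall>e\<in>B. norm e = 1) \<and> closure (span B) = UNIV"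

text \<open>For a nonnegative self-adjoint operator, finiteness of the trace does not depend on
  the orthonormal basis.\<close>

definition finite_trace :: "('a \<Rightarrow> 'a::real_inner) \<Rightarrow> bool" where
  "finite_trace B \<longleftrightarrow> (\<exists>E. orthonormal_basis E \<and> (\<lambda>e. B e \<bullet> e) summable_on E)"

text \<open>The nonnegative square root of a nonnegative self-adjoint bounded operator on a Hilbert
  space exists and is unique, so \<open>SOME\<close> does not leave a choice here.\<close>

definition op_sqrt :: "('a \<Rightarrow> 'a) \<Rightarrow> 'a \<Rightarrow> 'a::{real_inner, banach}" where
  "op_sqrt B = (SOME R. selfadjoint_nonneg R \<and> R \<circ> R = B)"

text \<open>The pseudo-inverse: on the range of \<open>R\<close>, the preimage of minimal norm.\<close>

definition pseudo_inverse :: "('a \<Rightarrow> 'a) \<Rightarrow> 'a \<Rightarrow> 'a::{real_inner, banach}" where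
  "pseudo_inverse R y = arg_min norm (\<lambda>x. R x = y)"

text \<open>\<open>Q\<^sub>t = \<integral>\<^sub>0\<^sup>t e\<^sup>s\<^sup>A Q e\<^sup>s\<^sup>A\<^sup>* ds\<close> as a strong integral, \<open>e\<^sup>s\<^sup>A\<^sup>*\<close> being the adjoint of \<open>e\<^sup>s\<^sup>A\<close>.\<close>

definition Qt ::
    "(real \<Rightarrow> 'a \<Rightarrow> 'a) \<Rightarrow> ('a \<Rightarrow> 'a) \<Rightarrow> real \<Rightarrow> 'a \<Rightarrow> 'a::{real_inner, banach}" where
  "Qt S Q t x = integral {0..t} (\<lambda>s. S s (Q (adjoint (S s) x)))"

definition assumption_A1 ::
    "'a set \<Rightarrow> ('a \<Rightarrow> 'a) \<Rightarrow> (real \<Rightarrow> 'a \<Rightarrow> 'a) \<Rightarrow> ('a \<Rightarrow> 'a::{real_inner, banach, polish_space}) \<Rightarrow> bool"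
where
  "assumption_A1 D A S Q \<longleftrightarrow>
     (\<nexists>B::'a set. finite B \<and> span B = UNIV) \<and>
     C0_semigroup S \<and> infinitesimal_generator D A S \<and>
     selfadjoint_nonneg Q \<and>
     (\<forall>t>0. finite_trace (Qt S Q t)) \<and>
     (\<forall>t>0. range (S t) \<subseteq> range (op_sqrt (Qt S Q t)))"

text \<open>Boundedness is made explicit because \<^const>\<open>onorm\<close> is only meaningful for bounded
  operators (here it also follows from the closed graph theorem).\<close>

definition assumption_A2 ::
    "(real \<Rightarrow> 'a \<Rightarrow> 'a) \<Rightarrow> ('a \<Rightarrow> 'a::{real_inner, banach, polish_space}) \<Rightarrow> real \<Rightarrow> bool" where
  "assumption_A2 S Q \<theta> \<longleftrightarrow> \<theta> > 0 \<and>
     (\<exists>\<omega>. \<exists>C>0. \<forall>t>0.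
        bounded_linear (pseudo_inverse (op_sqrt (Qt S Q t)) \<circ> S t) \<and>
        onorm (pseudo_inverse (op_sqrt (Qt S Q t)) \<circ> S t) \<le> C * exp (\<omega> * t) * t powr (- \<theta>))"

section \<open>The Ornstein--Uhlenbeck semigroup\<close>

text \<open>A centered Gaussian measure with covariance \<open>B\<close>: every linear functional \<open>y \<mapsto> h \<bullet> y\<close>
  is Gaussian with mean \<open>0\<close> and variance \<open>B h \<bullet> h\<close> (a Dirac mass at \<open>0\<close> if that is \<open>0\<close>).\<close>

definition centered_gaussian :: "('a \<Rightarrow> 'a::real_inner) \<Rightarrow> 'a measure \<Rightarrow> bool" where
  "centered_gaussian B \<mu> \<longleftrightarrow>
     prob_space \<mu> \<and> sets \<mu> = sets borel \<and>
     (\<forall>h. distr \<mu> borel (\<lambda>y. h \<bullet> y) =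
        (if B h \<bullet> h = 0 then return borel 0
         else density lborel (normal_density 0 (sqrt (B h \<bullet> h)))))"

text \<open>\<open>\<N>(0, B)\<close>; existence and uniqueness hold for nonnegative self-adjoint \<open>B\<close> of finite
  trace on a separable Hilbert space.\<close>

definition gaussian :: "('a \<Rightarrow> 'a::{real_inner, banach, polish_space}) \<Rightarrow> 'a measure" where
  "gaussian B = (SOME \<mu>. centered_gaussian B \<mu>)"

definition OU ::
    "(real \<Rightarrow> 'a \<Rightarrow> 'a) \<Rightarrow> ('a \<Rightarrow> 'a) \<Rightarrow> real \<Rightarrow> ('a \<Rightarrow> real) \<Rightarrow>
       'a::{real_inner, banach, polish_space} \<Rightarrow> real" where
  "OU S Q t f x = (if t = 0 then f x else (\<integral>y. f (S t x + y) \<partial>gaussian (Qt S Q t)))"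

text \<open>The graph \<open>L\<close> of a closed operator in \<open>C\<^sub>b(X)\<close> such that, for all \<open>c > 0\<close>,
  \<open>R(c, L) f (x) = \<integral>\<^sub>0\<^sup>\<infinity> e\<^sup>-\<^sup>c\<^sup>t P\<^sub>t f(x) dt\<close>; note that \<open>c u - L u = f\<close> means
  \<open>(u, c u - f) \<in> L\<close>.\<close>

definition OU_generator ::
    "(real \<Rightarrow> 'a \<Rightarrow> 'a) \<Rightarrow> ('a \<Rightarrow> 'a::{real_inner, banach, polish_space}) \<Rightarrow>
       (('a \<Rightarrow>\<^sub>C real) \<times> ('a \<Rightarrow>\<^sub>C real)) set \<Rightarrow> bool" where
  "OU_generator S Q L \<longleftrightarrow>
     subspace L \<and> single_valued L \<and> closed L \<and>
     (\<forall>c>0. \<forall>f u. (u, c *\<^sub>R u - f) \<in> L \<longleftrightarrow>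
        (\<forall>x. apply_bcontfun u x =
           integral {0..} (\<lambda>t. exp (- c * t) * OU S Q t (apply_bcontfun f) x)))"

definition mild_solution ::
    "(real \<Rightarrow> 'a \<Rightarrow> 'a) \<Rightarrow> ('a \<Rightarrow> 'a) \<Rightarrow> ('a \<Rightarrow> real) \<Rightarrow> (real \<Rightarrow> 'a \<Rightarrow> real) \<Rightarrow>
       real \<Rightarrow> 'a::{real_inner, banach, polish_space} \<Rightarrow> real" where
  "mild_solution S Q f g t x = OU S Q t f x + integral {0..t} (\<lambda>s. OU S Q (t - s) (g s) x)"

section \<open>Function spaces\<close>

text \<open>A \<open>k\<close>-linear form on \<open>X\<close> is represented by a function on lists; only lists of length
  \<open>k\<close> matter. For \<open>k = 0\<close> the forms are real numbers and the norm is the absolute value.\<close>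

definition continuous_multilinear :: "nat \<Rightarrow> ('a::real_normed_vector list \<Rightarrow> real) \<Rightarrow> bool" where
  "continuous_multilinear k M \<longleftrightarrow>
     (\<forall>hs i. length hs = k \<and> i < k \<longrightarrow> linear (\<lambda>h. M (hs[i := h]))) \<and>
     (\<exists>C. \<forall>hs. length hs = k \<longrightarrow> \<bar>M hs\<bar> \<le> C * prod_list (map norm hs))"

definition form_norm :: "nat \<Rightarrow> ('a::real_normed_vector list \<Rightarrow> real) \<Rightarrow> real" where
  "form_norm k M = (SUP hs\<in>{hs. length hs = k \<and> (\<forall>h\<in>set hs. norm h \<le> 1)}. \<bar>M hs\<bar>)"

text \<open>\<open>G\<close> is the Gateaux derivative at \<open>x\<close> of the map \<open>F\<close> into the continuous \<open>k\<close>-linear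
  forms. It is a bounded operator from \<open>X\<close> to the \<open>k\<close>-linear forms, identified with a
  continuous \<open>(k + 1)\<close>-linear form. Difference quotients converge in the norm of
  \<open>k\<close>-linear forms.\<close>

definition has_gateaux_derivative ::
    "nat \<Rightarrow> ('a \<Rightarrow> 'a list \<Rightarrow> real) \<Rightarrow> ('a list \<Rightarrow> real) \<Rightarrow> 'a::real_normed_vector \<Rightarrow> bool" where
  "has_gateaux_derivative k F G x \<longleftrightarrow>
     continuous_multilinear (Suc k) G \<and>
     (\<forall>h. ((\<lambda>r. form_norm k (\<lambda>hs. (F (x + r *\<^sub>R h) hs - F x hs) / r - G (h # hs)))
             \<longlongrightarrow> 0) (at 0))"

text \<open>\<open>D f [h\<^sub>1, \<dots>, h\<^sub>k] x = \<partial>\<^sup>k f / \<partial>h\<^sub>1 \<dots> \<partial>h\<^sub>k (x)\<close>, which is the only possible value of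
  \<open>D\<^sup>k f(x)(h\<^sub>1, \<dots>, h\<^sub>k)\<close>.\<close>

primrec dir_deriv :: "('a::real_normed_vector \<Rightarrow> real) \<Rightarrow> 'a list \<Rightarrow> 'a \<Rightarrow> real" where
  "dir_deriv f [] x = f x"
| "dir_deriv f (h # hs) x = deriv (\<lambda>r. dir_deriv f hs (x + r *\<^sub>R h)) 0"

definition Cn_b :: "nat \<Rightarrow> ('a::real_normed_vector \<Rightarrow> real) set" where
  "Cn_b n = {f \<in> bcontfun.
     (\<forall>k<n. \<forall>x. has_gateaux_derivative k (\<lambda>z hs. dir_deriv f hs z) (\<lambda>hs. dir_deriv f hs x) x) \<and>
     (\<forall>hs. length hs \<le> n \<longrightarrow> dir_deriv f hs \<in> bcontfun)}"

definition sup_norm :: "('a \<Rightarrow> real) \<Rightarrow> real" where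
  "sup_norm f = (SUP x. \<bar>f x\<bar>)"

definition Cn_b_norm :: "nat \<Rightarrow> ('a::real_normed_vector \<Rightarrow> real) \<Rightarrow> real" where
  "Cn_b_norm n f = sup_norm f + (\<Sum>k=1..n. SUP x. form_norm k (\<lambda>hs. dir_deriv f hs x))"

text \<open>The set of quotients whose supremum is \<open>[D\<^sup>n f]\<^sub>\<sigma>\<close> (for \<open>n = 0\<close> this is \<open>[f]\<^sub>\<sigma>\<close>).\<close>

definition holder_quotients :: "nat \<Rightarrow> real \<Rightarrow> ('a::real_normed_vector \<Rightarrow> real) \<Rightarrow> real set" where
  "holder_quotients n \<sigma> f =
     {form_norm n (\<lambda>hs. dir_deriv f hs (x + h) - dir_deriv f hs x) / norm h powr \<sigma> | x h. h \<noteq> 0}"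

text \<open>\<open>C\<^sup>\<gamma>\<^sub>b(X)\<close> for \<open>\<gamma> > 0\<close>: with \<open>n = \<lfloor>\<gamma>\<rfloor>\<close> and \<open>\<sigma> = \<gamma> - n\<close> this is \<open>C\<^sup>\<sigma>\<^sup>+\<^sup>n\<^sub>b(X)\<close> if
  \<open>\<sigma> > 0\<close> and \<open>C\<^sup>n\<^sub>b(X)\<close> if \<open>\<sigma> = 0\<close>.\<close>

definition C_b :: "real \<Rightarrow> ('a::real_normed_vector \<Rightarrow> real) set" where
  "C_b \<gamma> = {f \<in> Cn_b (nat \<lfloor>\<gamma>\<rfloor>).
     frac \<gamma> \<noteq> 0 \<longrightarrow> bdd_above (holder_quotients (nat \<lfloor>\<gamma>\<rfloor>) (frac \<gamma>) f)}"

definition C_b_norm :: "real \<Rightarrow> ('a::real_normed_vector \<Rightarrow> real) \<Rightarrow> real" where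
  "C_b_norm \<gamma> f = Cn_b_norm (nat \<lfloor>\<gamma>\<rfloor>) f +
     (if frac \<gamma> = 0 then 0 else Sup (holder_quotients (nat \<lfloor>\<gamma>\<rfloor>) (frac \<gamma>) f))"

text \<open>Functions on \<open>[0,T] \<times> X\<close> are curried; their values for \<open>t \<notin> [0,T]\<close> are irrelevant.\<close>

definition C_b_cyl :: "real \<Rightarrow> (real \<Rightarrow> 'a::real_normed_vector \<Rightarrow> real) set" where
  "C_b_cyl T = {g. continuous_on ({0..T} \<times> UNIV) (\<lambda>(t, x). g t x) \<and>
                   bounded ((\<lambda>(t, x). g t x) ` ({0..T} \<times> UNIV))}"

definition sup_norm_cyl :: "real \<Rightarrow> (real \<Rightarrow> 'a \<Rightarrow> real) \<Rightarrow> real" where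
  "sup_norm_cyl T g = (SUP (t, x)\<in>{0..T} \<times> UNIV. \<bar>g t x\<bar>)"

definition C0_b :: "real \<Rightarrow> real \<Rightarrow> (real \<Rightarrow> 'a::real_normed_vector \<Rightarrow> real) set" where
  "C0_b T \<gamma> = {g \<in> C_b_cyl T.
     (\<forall>t\<in>{0..T}. g t \<in> C_b \<gamma>) \<and>
     bdd_above ((\<lambda>t. C_b_norm \<gamma> (g t)) ` {0..T}) \<and>
     (\<gamma> \<ge> 1 \<longrightarrow> (\<forall>hs. length hs \<le> nat \<lfloor>\<gamma>\<rfloor> \<longrightarrow>
        continuous_on ({0..T} \<times> UNIV) (\<lambda>(t, x). dir_deriv (g t) hs x)))}"

definition C0_b_norm :: "real \<Rightarrow> real \<Rightarrow> (real \<Rightarrow> 'a::real_normed_vector \<Rightarrow> real) \<Rightarrow> real" where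
  "C0_b_norm T \<gamma> g = (SUP t\<in>{0..T}. C_b_norm \<gamma> (g t))"

end

theory Submission
  imports Defs
begin

text \<open>Since \<open>e\<^sup>t\<^sup>A h = Q\<^sub>t\<^sup>1\<^sup>/\<^sup>2 k\<close> with \<open>\<parallel>k\<parallel> \<le> C t powr (- \<theta>) \<parallel>h\<parallel>\<close>, the measure \<open>\<N>(0, Q\<^sub>t)\<close> contains an
  independent one-dimensional Gaussian component \<open>(u / \<parallel>k\<parallel>) e\<^sup>t\<^sup>A h\<close>, and a derivative along \<open>e\<^sup>t\<^sup>A h\<close>
  can be moved to the density of \<open>u\<close>. Splitting \<open>\<N>(0, Q\<^sub>t)\<close> into several equal convolution factors,
  one per derivative, this bounds the derivatives of order \<open>m\<close> of \<open>P\<^sub>t f\<close> by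
  \<open>C t powr (- m \<theta>) \<parallel>f\<parallel>\<^sub>\<infinity>\<close>. As \<open>u\<close> has mean zero, the first of these derivatives only sees the increments
  of \<open>f\<close> along \<open>e\<^sup>t\<^sup>A h\<close>, which improves the bound to \<open>C t powr (- (m - \<alpha>) \<theta>) [f]\<^sub>\<alpha>\<close> for
  \<open>\<alpha>\<close>-Hoelder \<open>f\<close> and \<open>m \<ge> 1\<close>, without interpolation theory. With \<open>n = \<lfloor>\<alpha> + 1 / \<theta>\<rfloor>\<close>, the bound of order
  \<open>n\<close> is integrable at \<open>t = 0\<close> and the bound of order \<open>n + 1\<close> at infinity, so the integral term of the
  mild solution has derivatives up to order \<open>n\<close>; their increments over \<open>y\<close> are estimated by splitting
  the time integral at \<open>\<parallel>y\<parallel> powr (1 / \<theta>)\<close>.\<close>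

section \<open>Hilbert space preliminaries\<close>

text \<open>Roots, pseudo-inverses and Gaussian measures are given by choice operators, so each
  needs an existence proof before it can be used. Characteristic functions supply uniqueness for the
  measures and turn every splitting of a Gaussian measure into an identity between quadratic forms.
  A derivative of \<open>P_t f\<close> is an integral against a signed measure, but only linearity,
  a sup bound, translation invariance and bounded pointwise continuity matter, and
  \<open>conv_op\<close> records these. The semigroup \<open>e^{tA}\<close> is in general continuous
  in time only strongly, so joint continuity in (t, x) cannot come from norm estimates: time
  increments are controlled for Lipschitz functions, and continuous functions are reached from
  below. That \<alpha> + 1 / \<theta> is no integer gives the strict inequalities (n - \<alpha>)
  \<theta> < 1 < (n + 1 - \<alpha>) \<theta>; equality in either would produce a logarithmic
  divergence. The function spaces ask for boundedness only direction by direction but for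
  convergence in the norm of forms: uniform boundedness repairs the first, Hoelder continuity of the
  top derivative gives the second.\<close>

lemma projection_exists:
  fixes Y :: "'a::{real_inner, banach} set"
  assumes "closed Y" "subspace Y"
  shows "\<exists>p\<in>Y. \<forall>y\<in>Y. (x - p) \<bullet> y = 0"
proof -
  define D where "D = (INF y\<in>Y. (norm (x - y))\<^sup>2)"
  have ne: "Y \<noteq> {}" using assms(2) subspace_0 by auto
  have bdd: "bdd_below ((\<lambda>y. (norm (x - y))\<^sup>2) ` Y)"
    by (rule bdd_belowI[of _ 0]) auto
  have D_le: "D \<le> (norm (x - y))\<^sup>2" if "y \<in> Y" for y
    unfolding D_def using bdd that by (rule cINF_lower)
  have "\<exists>y\<in>Y. (norm (x - y))\<^sup>2 < D + 1 / Suc n" for n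
  proof -
    have "(INF y\<in>Y. (norm (x - y))\<^sup>2) < D + 1 / Suc n" by (simp add: D_def)
    then show ?thesis by (subst (asm) cINF_less_iff[OF ne bdd])
  qed
  then obtain s where sY: "\<And>n. s n \<in> Y" and s: "\<And>n. (norm (x - s n))\<^sup>2 < D + 1 / Suc n"
    by metis
  have diff: "(norm (s m - s n))\<^sup>2 \<le> 2 / Suc m + 2 / Suc n" for m n
  proof -
    \<comment> \<open>The midpoint of two near-minimisers lies in \<open>Y\<close> and is no closer
      to \<open>x\<close> than the infimum, so the parallelogram identity forces the two to be
      close.\<close>
    have "(1/2) *\<^sub>R (s m + s n) \<in> Y"
      using sY assms(2) by (intro subspace_scale subspace_add)
    from D_le[OF this] have "4 * D \<le> 4 * (norm (x - (1/2) *\<^sub>R (s m + s n)))\<^sup>2" by simp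
    also have "\<dots> = 2 * (norm (x - s m))\<^sup>2 + 2 * (norm (x - s n))\<^sup>2 - (norm (s m - s n))\<^sup>2"
      by (simp add: power2_norm_eq_inner inner_simps inner_commute algebra_simps)
    finally show ?thesis using s[of m] s[of n] by linarith
  qed
  have "Cauchy s"
  proof (rule metric_CauchyI)
    fix e :: real assume "e > 0"
    then obtain N where N: "4 / e\<^sup>2 < real N" using reals_Archimedean2 by blast
    have "dist (s m) (s n) < e" if "m \<ge> N" "n \<ge> N" for m n
    proof -
      have "4 < e\<^sup>2 * real N" using N \<open>e > 0\<close> by (simp add: field_simps)
      then have "4 < e\<^sup>2 * Suc N" using \<open>e > 0\<close>
        by (smt (verit) mult_left_mono of_nat_Suc zero_le_power2)
      then have a: "4 / Suc N < e\<^sup>2" by (simp add: field_simps)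
      have "2 / real (Suc m) \<le> 2 / Suc N" "2 / real (Suc n) \<le> 2 / Suc N"
        using that by (auto intro!: divide_left_mono)
      with diff[of m n] a have "(norm (s m - s n))\<^sup>2 < e\<^sup>2" by linarith
      then show ?thesis using \<open>e > 0\<close> by (simp add: dist_norm power2_less_imp_less)
    qed
    then show "\<exists>M. \<forall>m\<ge>M. \<forall>n\<ge>M. dist (s m) (s n) < e" by blast
  qed
  then obtain p where p: "s \<longlonglongrightarrow> p" using Cauchy_convergent_iff convergent_def by blast
  have pY: "p \<in> Y" using assms(1) sY p closed_sequentially by blast
  have "(\<lambda>n. (norm (x - s n))\<^sup>2) \<longlonglongrightarrow> (norm (x - p))\<^sup>2"
    by (intro tendsto_intros p)
  moreover have "(\<lambda>n. D + 1 / Suc n) \<longlonglongrightarrow> D + 0"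
    by (intro tendsto_intros LIMSEQ_Suc[OF lim_1_over_n])
  ultimately have "(norm (x - p))\<^sup>2 \<le> D + 0"
    by (rule LIMSEQ_le) (use s less_imp_le in blast)
  then have pD: "(norm (x - p))\<^sup>2 \<le> D" by simp
  have "(x - p) \<bullet> y = 0" if "y \<in> Y" for y
  proof (cases "y = 0")
    case False
    \<comment> \<open>The minimiser of the distance from \<open>x\<close> to the line through
      \<open>p\<close> along \<open>y\<close>. Optimality of \<open>p\<close> makes the resulting
      gain, a square, vanish.\<close>
    define r where "r = ((x - p) \<bullet> y) / (y \<bullet> y)"
    have yy: "y \<bullet> y > 0" using False by simp
    have "p + r *\<^sub>R y \<in> Y" using pY that assms(2) by (intro subspace_add subspace_scale)
    from D_le[OF this] pD have "(norm (x - p))\<^sup>2 \<le> (norm (x - (p + r *\<^sub>R y)))\<^sup>2" by linarith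
    then have "0 \<le> r * r * (y \<bullet> y) - 2 * r * ((x - p) \<bullet> y)"
      by (simp add: power2_norm_eq_inner inner_simps inner_commute algebra_simps)
    also have "\<dots> = - (((x - p) \<bullet> y)\<^sup>2 / (y \<bullet> y))"
      using yy by (simp add: r_def power2_eq_square field_simps)
    finally have "((x - p) \<bullet> y)\<^sup>2 / (y \<bullet> y) \<le> 0" by simp
    then have "((x - p) \<bullet> y)\<^sup>2 \<le> 0" using yy by (simp add: divide_le_0_iff)
    then show ?thesis by simp
  qed simp
  then show ?thesis using pY by blast
qed

text \<open>For nonzero \<open>\<phi>\<close>, let \<open>w\<close> be the part of a non-kernel
  vector orthogonal to the kernel. Every vector differs from a multiple of \<open>w\<close> by a
  kernel element, so \<open>\<phi>\<close> is a multiple of the inner product with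
  \<open>w\<close>.\<close>

lemma riesz_representation:
  fixes \<phi> :: "'a::{real_inner, banach} \<Rightarrow> real"
  assumes "bounded_linear \<phi>"
  shows "\<exists>y. \<forall>x. \<phi> x = x \<bullet> y"
proof (cases "\<forall>x. \<phi> x = 0")
  case True
  then show ?thesis by (intro exI[of _ 0]) simp
next
  case False
  interpret bounded_linear \<phi> by fact
  from False obtain x where x: "\<phi> x \<noteq> 0" by blast
  define Y where "Y = {x. \<phi> x = 0}"
  have "closed Y" unfolding Y_def
    by (intro closed_Collect_eq linear_continuous_on assms continuous_on_const)
  moreover have "subspace Y" unfolding Y_def subspace_def by (auto simp: add scaleR)
  ultimately obtain p where p: "p \<in> Y" "\<forall>y\<in>Y. (x - p) \<bullet> y = 0"
    using projection_exists by blast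
  define w where "w = x - p"
  have w: "\<phi> w \<noteq> 0" using x p(1) by (simp add: w_def Y_def diff)
  then have ww: "w \<bullet> w \<noteq> 0" by auto
  show ?thesis
  proof (intro exI allI)
    fix z
    have "z - (\<phi> z / \<phi> w) *\<^sub>R w \<in> Y" using w by (simp add: Y_def diff scaleR)
    then have "w \<bullet> (z - (\<phi> z / \<phi> w) *\<^sub>R w) = 0" using p(2) w_def by blast
    then have "w \<bullet> z = \<phi> z / \<phi> w * (w \<bullet> w)" by (simp add: inner_diff_right)
    then show "\<phi> z = z \<bullet> ((\<phi> w / (w \<bullet> w)) *\<^sub>R w)"
      using w ww by (simp add: field_simps inner_commute)
  qed
qed

text \<open>\<open>adjoint\<close> is a choice, so its defining identity holds once some adjoint
  exists; completeness of the domain provides one through Riesz.\<close>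

lemma adjoint_inner:
  fixes f :: "'a::{real_inner, banach} \<Rightarrow> 'b::real_inner"
  assumes "bounded_linear f"
  shows "f x \<bullet> y = x \<bullet> adjoint f y"
proof -
  have "\<exists>z. \<forall>x. f x \<bullet> y = x \<bullet> z" for y
    by (rule riesz_representation) (intro bounded_linear_inner_left_comp assms)
  then have "\<exists>f'. \<forall>x y. f x \<bullet> y = x \<bullet> f' y" by metis
  from someI_ex[OF this] show ?thesis unfolding adjoint_def by blast
qed

lemma norm_le_if_inner_le:
  fixes y :: "'a::real_inner"
  assumes "\<And>x. x \<bullet> y \<le> c * norm x" "0 \<le> c"
  shows "norm y \<le> c"
proof (cases "y = 0")
  case False
  have "norm y * norm y \<le> c * norm y" using assms(1)[of y]
    by (simp add: dot_square_norm power2_eq_square)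
  then show ?thesis using False by simp
qed (simp add: assms)

lemma norm_adjoint_le:
  fixes f :: "'a::{real_inner, banach} \<Rightarrow> 'b::real_inner"
  assumes "bounded_linear f" "\<And>x. norm (f x) \<le> c * norm x" "0 \<le> c"
  shows "norm (adjoint f y) \<le> c * norm y"
proof (rule norm_le_if_inner_le)
  fix x
  have "x \<bullet> adjoint f y = f x \<bullet> y" by (simp add: adjoint_inner[OF assms(1)])
  also have "\<dots> \<le> norm (f x) * norm y" by (rule norm_cauchy_schwarz)
  also have "\<dots> \<le> c * norm x * norm y" by (intro mult_right_mono assms) auto
  finally show "x \<bullet> adjoint f y \<le> c * norm y * norm x" by (simp add: mult_ac)
qed (simp add: assms)

lemma bounded_linear_adjoint:
  fixes f :: "'a::{real_inner, banach} \<Rightarrow> 'b::real_inner"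
  assumes "bounded_linear f"
  shows "bounded_linear (adjoint f)"
proof -
  note [simp] = adjoint_inner[OF assms, symmetric]
  obtain K where K: "\<And>x. norm (f x) \<le> norm x * K" "0 \<le> K"
    using bounded_linear.nonneg_bounded[OF assms] by blast
  show ?thesis
  proof (rule bounded_linear_intro[where K = K])
    show "adjoint f (x + y) = adjoint f x + adjoint f y" for x y
      by (subst vector_eq_ldot[symmetric]) (simp add: inner_add_right)
    show "adjoint f (r *\<^sub>R x) = r *\<^sub>R adjoint f x" for r x
      by (subst vector_eq_ldot[symmetric]) simp
    show "norm (adjoint f x) \<le> norm x * K" for x
      using norm_adjoint_le[OF assms, of K x] K by (simp add: mult.commute)
  qed
qed

section \<open>Square roots and pseudo-inverses of nonnegative operators\<close>

text \<open>The form may be degenerate, so the discriminant argument splits: where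
  \<open>B y \<bullet> y = 0\<close> the quadratic polynomial in \<open>r\<close> is affine, and a
  nonnegative affine function is constant.\<close>

lemma selfadjoint_nonneg_Cauchy_Schwarz:
  assumes "selfadjoint_nonneg B"
  shows "(B x \<bullet> y)\<^sup>2 \<le> (B x \<bullet> x) * (B y \<bullet> y)"
proof -
  from assms interpret bounded_linear B by (simp add: selfadjoint_nonneg_def)
  have sym: "B x \<bullet> y = x \<bullet> B y" and pos: "0 \<le> B x \<bullet> x" for x y
    using assms by (auto simp: selfadjoint_nonneg_def)
  define a b c where "a = B x \<bullet> x" "b = B x \<bullet> y" "c = B y \<bullet> y"
  have q: "0 \<le> a + 2 * r * b + r * r * c" for r
  proof -
    have "0 \<le> B (x + r *\<^sub>R y) \<bullet> (x + r *\<^sub>R y)" by (rule pos)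
    also have "\<dots> = a + 2 * r * b + r * r * c"
      using sym[of y x] by (simp add: a_b_c_def add scaleR inner_simps inner_commute algebra_simps)
    finally show ?thesis .
  qed
  have "b\<^sup>2 \<le> a * c"
  proof (cases "c = 0")
    case True
    have "b = 0"
    proof (rule ccontr)
      assume "b \<noteq> 0"
      then show False using q[of "- (a + 1) / (2 * b)"] True by (simp add: field_simps)
    qed
    then show ?thesis using True by simp
  next
    case False
    then have "c > 0" using pos[of y] by (simp add: a_b_c_def)
    then show ?thesis using q[of "- b / c"] by (simp add: field_simps power2_eq_square)
  qed
  then show ?thesis by (simp add: a_b_c_def)
qed

text \<open>Cauchy-Schwarz for the form of \<open>C\<close>, applied to \<open>x\<close> and
  \<open>C x\<close>, turns a bound on the numerical range into a bound on the operator
  norm.\<close>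

lemma selfadjoint_contraction:
  assumes "selfadjoint_nonneg C" "\<And>x. C x \<bullet> x \<le> x \<bullet> x"
  shows "norm (C x) \<le> norm x"
proof (cases "C x = 0")
  case False
  have pos: "0 \<le> C z \<bullet> z" for z using assms(1) unfolding selfadjoint_nonneg_def by blast
  have "(C x \<bullet> C x)\<^sup>2 \<le> (C x \<bullet> x) * (C (C x) \<bullet> C x)"
    by (rule selfadjoint_nonneg_Cauchy_Schwarz[OF assms(1)])
  also have "\<dots> \<le> (x \<bullet> x) * (C x \<bullet> C x)"
    by (intro mult_mono assms(2) pos inner_ge_zero)
  finally have "C x \<bullet> C x \<le> x \<bullet> x" using False by (simp add: power2_eq_square)
  then show ?thesis by (simp add: norm_le)
qed simp

text \<open>The iteration \<open>Y \<mapsto> (A + Y\<^sup>2) / 2\<close> with \<open>A = 1 - B\<close> converges in operator norm, because its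
  increments are dominated by those of the scalar iteration \<open>y \<mapsto> (1 + y\<^sup>2) / 2\<close>.\<close>

lemma sqrt_exists_contraction:
  fixes B :: "'a \<Rightarrow> 'a::{real_inner, banach}"
  assumes B: "selfadjoint_nonneg B" and B1: "\<And>x. norm (B x) \<le> norm x"
  shows "\<exists>R. selfadjoint_nonneg R \<and> R \<circ> R = B"
proof -
  have blB: "bounded_linear B" and symB: "\<And>x y. B x \<bullet> y = x \<bullet> B y"
    and posB: "\<And>x. 0 \<le> B x \<bullet> x" using B by (auto simp: selfadjoint_nonneg_def)
  define A :: "'a \<Rightarrow>\<^sub>L 'a" where "A = Blinfun (\<lambda>x. x - B x)"
  have blA: "bounded_linear (\<lambda>x. x - B x)"
    by (intro bounded_linear_sub bounded_linear_ident blB)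
  then have A: "blinfun_apply A x = x - B x" for x
    by (simp add: A_def bounded_linear_Blinfun_apply)
  have "selfadjoint_nonneg (\<lambda>x. x - B x)"
    unfolding selfadjoint_nonneg_def
  proof (intro conjI allI blA)
    show "(x - B x) \<bullet> y = x \<bullet> (y - B y)" for x y using symB by (simp add: inner_simps)
    have "B x \<bullet> x \<le> x \<bullet> x" for x
      using norm_cauchy_schwarz[of "B x" x] mult_right_mono[OF B1[of x] norm_ge_zero[of x]]
      by (simp add: dot_square_norm power2_eq_square)
    then show "0 \<le> (x - B x) \<bullet> x" for x by (simp add: inner_diff_left)
  qed
  then have "norm (x - B x) \<le> norm x" for x
    by (rule selfadjoint_contraction) (use posB in \<open>simp add: inner_diff_left\<close>)
  then have normA: "norm A \<le> 1" by (intro norm_blinfun_bound) (auto simp: A)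
  have symA: "blinfun_apply A x \<bullet> y = x \<bullet> blinfun_apply A y" for x y
    using symB by (simp add: A inner_simps)
  define Y where "Y = rec_nat (0 :: 'a \<Rightarrow>\<^sub>L 'a) (\<lambda>_ Z. (1/2) *\<^sub>R (A + (Z o\<^sub>L Z)))"
  define y where "y = rec_nat (0::real) (\<lambda>_ z. (1/2) * (1 + z * z))"
  have Y0: "Y 0 = 0" and YS: "Y (Suc n) = (1/2) *\<^sub>R (A + (Y n o\<^sub>L Y n))" for n
    by (simp_all add: Y_def)
  have y0: "y 0 = 0" and yS: "y (Suc n) = (1/2) * (1 + y n * y n)" for n
    by (simp_all add: y_def)
  have y01: "0 \<le> y n \<and> y n \<le> 1" for n
  proof (induction n)
    case (Suc n)
    then have "y n * y n \<le> 1 * 1" by (intro mult_mono) auto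
    then show ?case using Suc by (simp add: yS)
  qed (simp add: y0)
  have yinc: "y n \<le> y (Suc n)" for n
    using sum_squares_ge_zero[of "1 - y n" 0] by (simp add: yS algebra_simps)
  have ymono: "incseq y" using yinc by (rule incseq_SucI)
  have nY: "norm (Y n) \<le> y n" for n
  proof (induction n)
    case (Suc n)
    have "norm (Y n o\<^sub>L Y n) \<le> y n * y n"
      using Suc y01[of n] by (intro order_trans[OF norm_blinfun_compose] mult_mono) auto
    moreover have "norm (A + (Y n o\<^sub>L Y n)) \<le> norm A + norm (Y n o\<^sub>L Y n)" by (rule norm_triangle_ineq)
    ultimately show ?case using normA by (simp add: YS yS)
  qed (simp add: Y0 y0)
  have dY: "norm (Y (Suc n) - Y n) \<le> y (Suc n) - y n" for n
  proof (induction n)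
    case 0
    then show ?case using normA by (simp add: Y0 YS y0 yS)
  next
    case (Suc n)
    \<comment> \<open>The difference of squares is factored without commuting the operators. The
      scalar iteration factors in the same way, so the bounds agree term by term.\<close>
    have "Y (Suc (Suc n)) - Y (Suc n) =
        (1/2) *\<^sub>R (((Y (Suc n) - Y n) o\<^sub>L Y (Suc n)) + (Y n o\<^sub>L (Y (Suc n) - Y n)))"
      unfolding YS[of "Suc n"] by (subst (3) YS)
         (simp add: bounded_bilinear.diff_left[OF bounded_bilinear_blinfun_compose]
            bounded_bilinear.diff_right[OF bounded_bilinear_blinfun_compose] algebra_simps)
    also have "norm \<dots> \<le> (1/2) * ((y (Suc n) - y n) * y (Suc n) + y n * (y (Suc n) - y n))"
    proof -
      have "norm ((Y (Suc n) - Y n) o\<^sub>L Y (Suc n)) \<le> (y (Suc n) - y n) * y (Suc n)"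
        using Suc nY y01 yinc by (intro order_trans[OF norm_blinfun_compose] mult_mono) auto
      moreover have "norm (Y n o\<^sub>L (Y (Suc n) - Y n)) \<le> y n * (y (Suc n) - y n)"
        using Suc nY y01 by (intro order_trans[OF norm_blinfun_compose] mult_mono) auto
      ultimately show ?thesis by (simp add: norm_triangle_le)
    qed
    also have "\<dots> = y (Suc (Suc n)) - y (Suc n)"
      unfolding yS[of "Suc n"] by (subst (5) yS) (simp add: algebra_simps)
    finally show ?case .
  qed
  have dYk: "norm (Y (n + k) - Y n) \<le> y (n + k) - y n" for n k
  proof (induction k)
    case (Suc k)
    have "norm (Y (n + Suc k) - Y n) \<le> norm (Y (n + Suc k) - Y (n + k)) + norm (Y (n + k) - Y n)"
      using norm_triangle_ineq[of "Y (n + Suc k) - Y (n + k)" "Y (n + k) - Y n"] by simp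
    then show ?case using Suc dY[of "n + k"] by simp
  qed simp
  obtain l where "y \<longlonglongrightarrow> l" using incseq_convergent[OF ymono] y01 by blast
  then have "Cauchy y" by (rule LIMSEQ_imp_Cauchy)
  have "Cauchy Y"
  proof (rule metric_CauchyI)
    fix e :: real assume "e > 0"
    with \<open>Cauchy y\<close> obtain N where N: "\<And>m n. m \<ge> N \<Longrightarrow> n \<ge> N \<Longrightarrow> dist (y m) (y n) < e"
      by (metis metric_CauchyD)
    have "dist (Y m) (Y n) < e" if "N \<le> n" "n \<le> m" for m n
      using dYk[of n "m - n"] N[of m n] that by (simp add: dist_norm)
    then show "\<exists>M. \<forall>m\<ge>M. \<forall>n\<ge>M. dist (Y m) (Y n) < e"
      by (metis dist_commute nle_le)
  qed
  then obtain Z where Z: "Y \<longlonglongrightarrow> Z" using Cauchy_convergent_iff convergent_def by blast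
  have normZ: "norm Z \<le> 1"
    by (rule LIMSEQ_le_const2[OF tendsto_norm[OF Z]]) (use nY y01 order_trans in blast)
  have "(\<lambda>n. Y (Suc n)) \<longlonglongrightarrow> (1/2) *\<^sub>R (A + (Z o\<^sub>L Z))"
    unfolding YS by (intro tendsto_intros bounded_bilinear.tendsto[OF bounded_bilinear_blinfun_compose] Z)
  then have ZZ: "Z = (1/2) *\<^sub>R (A + (Z o\<^sub>L Z))"
    using LIMSEQ_Suc[OF Z] LIMSEQ_unique by blast
  have symY: "blinfun_apply (Y n) u \<bullet> v = u \<bullet> blinfun_apply (Y n) v" for n u v
    by (induction n arbitrary: u v)
       (simp_all add: Y0 YS blinfun.scaleR_left blinfun.add_left inner_simps symA)
  have lim: "(\<lambda>n. blinfun_apply (Y n) u) \<longlonglongrightarrow> blinfun_apply Z u" for u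
    by (intro blinfun.tendsto Z tendsto_const)
  have symZ: "blinfun_apply Z u \<bullet> v = u \<bullet> blinfun_apply Z v" for u v
    by (rule LIMSEQ_unique[OF tendsto_inner[OF lim tendsto_const]])
       (simp add: symY, intro tendsto_intros lim)
  \<comment> \<open>The fixed point equation \<open>2 Z = A + Z Z\<close> with
    \<open>A = 1 - B\<close> says exactly that \<open>1 - Z\<close> squares to
    \<open>B\<close>.\<close>
  define R where "R = (\<lambda>x. x - blinfun_apply Z x)"
  have "selfadjoint_nonneg R"
    unfolding selfadjoint_nonneg_def
  proof (intro conjI allI)
    show "bounded_linear R" unfolding R_def
      by (intro bounded_linear_sub bounded_linear_ident blinfun.bounded_linear_right)
    show "R x \<bullet> y = x \<bullet> R y" for x y by (simp add: R_def inner_simps symZ)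
    have "blinfun_apply Z x \<bullet> x \<le> x \<bullet> x" for x
    proof -
      have "blinfun_apply Z x \<bullet> x \<le> norm (blinfun_apply Z x) * norm x" by (rule norm_cauchy_schwarz)
      also have "\<dots> \<le> (1 * norm x) * norm x"
        using normZ by (intro mult_right_mono order_trans[OF norm_blinfun]) auto
      finally show ?thesis by (simp add: dot_square_norm power2_eq_square)
    qed
    then show "0 \<le> R x \<bullet> x" for x by (simp add: R_def inner_diff_left)
  qed
  moreover have "R (R x) = B x" for x
  proof -
    have "2 *\<^sub>R blinfun_apply Z x = blinfun_apply (A + (Z o\<^sub>L Z)) x"
      by (subst ZZ) (simp add: blinfun.scaleR_left)
    then show ?thesis
      by (simp add: R_def blinfun.add_left A blinfun.diff_right scaleR_2 algebra_simps)
  qed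
  ultimately show ?thesis by (auto simp: fun_eq_iff)
qed

lemma sqrt_exists:
  fixes B :: "'a \<Rightarrow> 'a::{real_inner, banach}"
  assumes B: "selfadjoint_nonneg B"
  shows "\<exists>R. selfadjoint_nonneg R \<and> R \<circ> R = B"
proof -
  have blB: "bounded_linear B" using B by (simp add: selfadjoint_nonneg_def)
  obtain K where K: "K > 0" "\<And>x. norm (B x) \<le> norm x * K"
    using bounded_linear.pos_bounded[OF blB] by blast
  have "selfadjoint_nonneg (\<lambda>x. (1 / K) *\<^sub>R B x)"
    using B K(1) bounded_linear_scaleR_right bounded_linear_compose blB
    by (auto simp: selfadjoint_nonneg_def intro!: bounded_linear_const_scaleR)
  moreover have "norm ((1 / K) *\<^sub>R B x) \<le> norm x" for x using K by (simp add: field_simps)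
  ultimately obtain R where R: "selfadjoint_nonneg R" "R \<circ> R = (\<lambda>x. (1 / K) *\<^sub>R B x)"
    using sqrt_exists_contraction by blast
  then interpret R: bounded_linear R by (simp add: selfadjoint_nonneg_def)
  have "selfadjoint_nonneg (\<lambda>x. sqrt K *\<^sub>R R x)"
    using R(1) K(1) by (auto simp: selfadjoint_nonneg_def intro!: bounded_linear_const_scaleR)
  moreover have "(\<lambda>x. sqrt K *\<^sub>R R x) \<circ> (\<lambda>x. sqrt K *\<^sub>R R x) = B"
    using K(1) R(2) by (auto simp: fun_eq_iff R.scaleR simp flip: power2_eq_square)
  ultimately show ?thesis by blast
qed

lemma op_sqrt:
  fixes B :: "'a \<Rightarrow> 'a::{real_inner, banach}"
  assumes "selfadjoint_nonneg B"
  shows "selfadjoint_nonneg (op_sqrt B)" "op_sqrt B (op_sqrt B x) = B x"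
proof -
  have "selfadjoint_nonneg (op_sqrt B) \<and> op_sqrt B \<circ> op_sqrt B = B"
    unfolding op_sqrt_def by (rule someI_ex[OF sqrt_exists[OF assms]])
  then show "selfadjoint_nonneg (op_sqrt B)" "op_sqrt B (op_sqrt B x) = B x"
    by (auto simp: fun_eq_iff)
qed

text \<open>The minimum in \<open>arg_min\<close> is attained: any preimage minus its projection
  onto the kernel of \<open>R\<close> is orthogonal to the kernel, hence shortest by
  Pythagoras.\<close>

lemma pseudo_inverse:
  fixes R :: "'a \<Rightarrow> 'a::{real_inner, banach}"
  assumes "bounded_linear R" "y \<in> range R"
  shows "R (pseudo_inverse R y) = y"
proof -
  interpret bounded_linear R by fact
  from assms obtain x where x: "y = R x" by blast
  define Y where "Y = {x. R x = 0}"
  have "closed Y" unfolding Y_def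
    by (intro closed_Collect_eq linear_continuous_on assms continuous_on_const)
  moreover have "subspace Y" unfolding Y_def subspace_def by (auto simp: add scaleR)
  ultimately obtain p where p: "p \<in> Y" "\<forall>y\<in>Y. (x - p) \<bullet> y = 0"
    using projection_exists by blast
  have "is_arg_min norm (\<lambda>z. R z = y) (x - p)"
    unfolding is_arg_min_linorder
  proof (intro conjI allI impI)
    show "R (x - p) = y" using p(1) x by (simp add: Y_def diff)
    fix z assume "R z = y"
    then have "z - (x - p) \<in> Y" using p(1) x by (simp add: Y_def diff)
    then have "orthogonal (x - p) (z - (x - p))" using p(2) by (simp add: orthogonal_def)
    then have "(norm ((x - p) + (z - (x - p))))\<^sup>2 = (norm (x - p))\<^sup>2 + (norm (z - (x - p)))\<^sup>2"
      by (rule norm_add_Pythagorean)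
    then show "norm (x - p) \<le> norm z" by (simp add: power2_le_imp_le)
  qed
  then show ?thesis unfolding pseudo_inverse_def arg_min_def is_arg_min_def
    by (rule someI2) simp
qed

text \<open>The vectors need not be orthonormal, and some of them may be zero.\<close>

definition parseval :: "(nat \<Rightarrow> 'a::real_inner) \<Rightarrow> bool" where
  "parseval e \<longleftrightarrow> (\<forall>x. (\<lambda>n. (x \<bullet> e n)\<^sup>2) sums (norm x)\<^sup>2)"

section \<open>Orthonormal bases of a separable space\<close>

text \<open>Distinct members are at distance at least 1, so balls of radius 1/2 around them are
  disjoint open sets, and a second countable space has only countably many of those.\<close>

lemma countable_orthonormal:
  fixes E :: "'a::{real_inner, second_countable_topology} set"
  assumes "pairwise orthogonal E" "\<And>e. e \<in> E \<Longrightarrow> norm e = 1"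
  shows "countable E"
proof -
  have dist: "dist e e' \<ge> 1" if "e \<in> E" "e' \<in> E" "e \<noteq> e'" for e e'
  proof -
    have "e \<bullet> e' = 0" using assms(1) that by (auto simp: pairwise_def orthogonal_def)
    then have "(dist e e')\<^sup>2 = (norm e)\<^sup>2 + (norm e')\<^sup>2"
      by (simp add: dist_norm power2_norm_eq_inner inner_simps inner_commute)
    then have "(dist e e')\<^sup>2 = 2" using assms(2) that by simp
    then have "1\<^sup>2 \<le> (dist e e')\<^sup>2" by simp
    then show ?thesis by (rule power2_le_imp_le) simp
  qed
  have disj: "ball e (1/2) \<inter> ball e' (1/2) = {}" if "e \<in> E" "e' \<in> E" "e \<noteq> e'" for e e'
  proof -
    have "False" if "z \<in> ball e (1/2)" "z \<in> ball e' (1/2)" for z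
      using dist[OF \<open>e \<in> E\<close> \<open>e' \<in> E\<close> \<open>e \<noteq> e'\<close>] that dist_triangle2[of e e' z]
      by (simp add: dist_commute)
    then show ?thesis by blast
  qed
  have "pairwise disjnt ((\<lambda>e. ball e (1/2)) ` E)"
    unfolding pairwise_def disjnt_def using disj by fast
  then have "countable ((\<lambda>e. ball e (1/2)) ` E)"
    by (rule countable_disjoint_open_subsets[rotated]) auto
  moreover have "inj_on (\<lambda>e. ball e (1/2)) E"
    by (rule inj_onI) (metis disj centre_in_ball Int_iff empty_iff half_gt_zero zero_less_one)
  ultimately show ?thesis by (rule countable_image_inj_on)
qed

lemma orthonormal_basis_has_sum:
  assumes "orthonormal_basis E"
  shows "((\<lambda>e. (x \<bullet> e)\<^sup>2) has_sum (norm x)\<^sup>2) E"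
proof -
  from assms have orth: "\<And>e e'. e \<in> E \<Longrightarrow> e' \<in> E \<Longrightarrow> e \<noteq> e' \<Longrightarrow> e \<bullet> e' = 0"
    and nrm: "\<And>e. e \<in> E \<Longrightarrow> e \<bullet> e = 1" and dense: "closure (span E) = UNIV"
    by (auto simp: orthonormal_basis_def pairwise_def orthogonal_def norm_eq_1)
  \<comment> \<open>With coefficients \<open>x \<bullet> e\<close> this is Bessel's inequality; with
    the coefficients of an approximant in the span it bounds the defect from above by the squared
    error of the approximant.\<close>
  have expand: "(norm (x - (\<Sum>e\<in>F. c e *\<^sub>R e)))\<^sup>2
      = (norm x)\<^sup>2 - (\<Sum>e\<in>F. (x \<bullet> e)\<^sup>2) + (\<Sum>e\<in>F. (c e - x \<bullet> e)\<^sup>2)"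
    if F: "finite F" "F \<subseteq> E" for F c
  proof -
    have "(\<Sum>e'\<in>F. c e * c e' * (e' \<bullet> e)) = c e * c e" if "e \<in> F" for e
    proof -
      have "(\<Sum>e'\<in>F. c e * c e' * (e' \<bullet> e)) = (\<Sum>e'\<in>F. if e = e' then c e * c e' else 0)"
      proof (rule sum.cong[OF refl])
        fix e' assume "e' \<in> F"
        then show "c e * c e' * (e' \<bullet> e) = (if e = e' then c e * c e' else 0)"
          using orth[of e' e] nrm[of e] F(2) \<open>e \<in> F\<close> by auto
      qed
      then show ?thesis using that F(1) by simp
    qed
    then have "(\<Sum>e\<in>F. c e *\<^sub>R e) \<bullet> (\<Sum>e\<in>F. c e *\<^sub>R e) = (\<Sum>e\<in>F. c e * c e)"
      by (simp add: inner_sum_left inner_sum_right sum_distrib_left mult.assoc)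
    moreover have "x \<bullet> (\<Sum>e\<in>F. c e *\<^sub>R e) = (\<Sum>e\<in>F. c e * (x \<bullet> e))"
      by (simp add: inner_sum_right)
    ultimately have "(norm (x - (\<Sum>e\<in>F. c e *\<^sub>R e)))\<^sup>2
        = (norm x)\<^sup>2 - 2 * (\<Sum>e\<in>F. c e * (x \<bullet> e)) + (\<Sum>e\<in>F. c e * c e)"
      by (simp add: power2_norm_eq_inner inner_diff_left inner_diff_right inner_commute)
    also have "\<dots> = (norm x)\<^sup>2 - (\<Sum>e\<in>F. (x \<bullet> e)\<^sup>2) + (\<Sum>e\<in>F. (c e - x \<bullet> e)\<^sup>2)"
      by (simp add: sum_distrib_left power2_eq_square algebra_simps sum.distrib sum_subtractf)
    finally show ?thesis .
  qed
  show ?thesis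
    unfolding has_sum_def tendsto_iff eventually_finite_subsets_at_top
  proof (intro allI impI)
    fix \<epsilon> :: real assume "\<epsilon> > 0"
    have "x \<in> closure (span E)" using dense by simp
    then obtain y where y: "y \<in> span E" "dist y x < sqrt \<epsilon>"
      unfolding closure_approachable using \<open>\<epsilon> > 0\<close> by (meson real_sqrt_gt_zero)
    then obtain F c where F: "finite F" "F \<subseteq> E" "y = (\<Sum>e\<in>F. c e *\<^sub>R e)"
      unfolding span_explicit by blast
    have "dist (\<Sum>e\<in>G. (x \<bullet> e)\<^sup>2) ((norm x)\<^sup>2) < \<epsilon>" if G: "finite G" "F \<subseteq> G" "G \<subseteq> E" for G
    proof -
      have "y = (\<Sum>e\<in>G. (if e \<in> F then c e else 0) *\<^sub>R e)"
        unfolding F(3) using G by (intro sum.mono_neutral_cong_left) auto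
      then have "(norm (x - y))\<^sup>2 \<ge> (norm x)\<^sup>2 - (\<Sum>e\<in>G. (x \<bullet> e)\<^sup>2)"
        using expand[OF G(1,3)] by (simp add: sum_nonneg)
      moreover have "(norm x)\<^sup>2 - (\<Sum>e\<in>G. (x \<bullet> e)\<^sup>2) \<ge> 0"
        using expand[OF G(1,3), of "\<lambda>e. x \<bullet> e"]
          zero_le_power2[of "norm (x - (\<Sum>e\<in>G. (x \<bullet> e) *\<^sub>R e))"] by simp
      moreover have "(norm (x - y))\<^sup>2 < \<epsilon>"
        using y(2) \<open>\<epsilon> > 0\<close> power_strict_mono[of "norm (x - y)" "sqrt \<epsilon>" 2]
        by (simp add: dist_norm norm_minus_commute)
      ultimately show ?thesis by (simp add: dist_real_def)
    qed
    then show "\<exists>X. finite X \<and> X \<subseteq> E \<and> (\<forall>Y. finite Y \<and> X \<subseteq> Y \<and> Y \<subseteq> E \<longrightarrow>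
          dist (\<Sum>e\<in>Y. (x \<bullet> e)\<^sup>2) ((norm x)\<^sup>2) < \<epsilon>)"
      using F by blast
  qed
qed

text \<open>A countable basis is an injective image of some set of naturals, finite or not. Outside
  that set the zero vector is inserted, whence the condition \<open>h 0 = 0\<close>.\<close>

lemma has_sum_imp_sums_padded:
  fixes h :: "'a::real_vector \<Rightarrow> real"
  assumes "(h has_sum s) (f ` K)" "inj_on f (K :: nat set)" "h 0 = 0"
  shows "(\<lambda>n. h (if n \<in> K then f n else 0)) sums s"
proof (rule has_sum_imp_sums)
  have "((h \<circ> f) has_sum s) K" using assms by (simp add: has_sum_reindex)
  then show "((\<lambda>n. h (if n \<in> K then f n else 0)) has_sum s) UNIV"
    by (rule has_sum_cong_neutral[THEN iffD1, rotated 3]) (auto simp: assms)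
qed

text \<open>Replaces the unordered sum over an orthonormal basis by an ordinary series along one
  sequence, the form in which traces are used from here on.\<close>

lemma finite_trace_parseval:
  fixes B :: "'a \<Rightarrow> 'a::{real_inner, second_countable_topology}"
  assumes "finite_trace B" "B 0 = 0"
  shows "\<exists>e. parseval e \<and> summable (\<lambda>n. B (e n) \<bullet> e n)"
proof -
  from assms obtain E where E: "orthonormal_basis E" and tr: "(\<lambda>e. B e \<bullet> e) summable_on E"
    by (auto simp: finite_trace_def)
  have "countable E"
    using E by (intro countable_orthonormal) (auto simp: orthonormal_basis_def)
  then obtain f and K :: "nat set" where fK: "E = f ` K" "inj_on f K"
    unfolding countable_as_injective_image_subset by blast
  have "(\<lambda>n. (x \<bullet> (if n \<in> K then f n else 0))\<^sup>2) sums (norm x)\<^sup>2" for x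
    using orthonormal_basis_has_sum[OF E, of x] unfolding fK(1)
    by (rule has_sum_imp_sums_padded[OF _ fK(2)]) simp
  moreover obtain s where "((\<lambda>e. B e \<bullet> e) has_sum s) (f ` K)"
    using tr unfolding summable_on_def fK(1) by blast
  from has_sum_imp_sums_padded[OF this fK(2)]
  have "summable (\<lambda>n. B (if n \<in> K then f n else 0) \<bullet> (if n \<in> K then f n else 0))"
    using sums_summable by auto
  ultimately show ?thesis unfolding parseval_def
    by (intro exI[of _ "\<lambda>n. if n \<in> K then f n else 0"] conjI allI)
qed

section \<open>Uniform boundedness\<close>

text \<open>By Baire one of the closed sets \<open>A n\<close> contains a ball, and linearity
  spreads the bound on that ball over the whole space.\<close>

lemma uniform_boundedness:
  fixes F :: "('a::banach \<Rightarrow> 'b::real_normed_vector) set"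
  assumes bl: "\<And>f. f \<in> F \<Longrightarrow> bounded_linear f"
    and pt: "\<And>x. \<exists>K. \<forall>f\<in>F. norm (f x) \<le> K"
  shows "\<exists>K\<ge>0. \<forall>f\<in>F. \<forall>x. norm (f x) \<le> K * norm x"
proof -
  define A where "A n = {x. \<forall>f\<in>F. norm (f x) \<le> real n}" for n
  have A_Int: "A n = (\<Inter>f\<in>F. {x. norm (f x) \<le> real n})" for n by (auto simp: A_def)
  have cl: "closed (A n)" for n
    unfolding A_Int using bl
    by (intro closed_INT ballI closed_Collect_le continuous_on_norm linear_continuous_on
        continuous_on_const)
  have un: "(\<Union>n. A n) = UNIV"
  proof -
    have "\<exists>n. x \<in> A n" for x
    proof -
      obtain K where "\<forall>f\<in>F. norm (f x) \<le> K" using pt by blast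
      moreover obtain n where "K \<le> real n" using real_arch_simple by blast
      ultimately show ?thesis unfolding A_def using order_trans by blast
    qed
    then show ?thesis by blast
  qed
  have "\<exists>n. interior (A n) \<noteq> {}"
  proof (rule ccontr)
    assume "\<not> ?thesis"
    then have "Met_TC.mtopology interior_of (\<Union>(range A)) = {}"
      by (intro Met_TC.metric_Baire_category_alt) (auto simp: cl complete_UNIV)
    then show False using un by simp
  qed
  then obtain n x0 where "x0 \<in> interior (A n)" by blast
  then obtain e where e: "e > 0" "ball x0 e \<subseteq> A n"
    by (meson mem_interior)
  define K where "K = 4 * real n / e"
  have "norm (f x) \<le> K * norm x" if f: "f \<in> F" for f x
  proof (cases "x = 0")
    case True
    then show ?thesis using linear_0[OF bounded_linear.linear[OF bl[OF f]]] by simp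
  next
    case False
    interpret f: bounded_linear f by (rule bl[OF f])
    \<comment> \<open>Chosen so that \<open>r *\<^sub>R x\<close> has norm \<open>e / 2\<close>:
      then \<open>f (r *\<^sub>R x)\<close> is a difference of two values on the ball, each at most
      \<open>n\<close>.\<close>
    define r where "r = e / (2 * norm x)"
    have r: "r > 0" using e False by (simp add: r_def)
    have "norm (r *\<^sub>R x) < e" using e False by (simp add: r_def)
    then have "x0 + r *\<^sub>R x \<in> A n" using e(2) by (auto simp: dist_norm)
    moreover have "x0 \<in> A n" using e by auto
    ultimately have "norm (f (x0 + r *\<^sub>R x)) \<le> n" "norm (f x0) \<le> n" using f by (auto simp: A_def)
    moreover have "f (x0 + r *\<^sub>R x) - f x0 = r *\<^sub>R f x" by (simp add: f.add f.scaleR)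
    ultimately have "norm (r *\<^sub>R f x) \<le> 2 * n"
      using norm_triangle_ineq4[of "f (x0 + r *\<^sub>R x)" "f x0"] by simp
    then have "r * norm (f x) \<le> 2 * n" using r by simp
    then have "norm (f x) \<le> 2 * n / r" using r by (simp add: field_simps)
    also have "\<dots> = K * norm x" using e False by (simp add: r_def K_def field_simps)
    finally show ?thesis .
  qed
  moreover have "K \<ge> 0" using e by (simp add: K_def)
  ultimately show ?thesis by blast
qed

lemma continuous_multilinear_Cons:
  assumes "continuous_multilinear (Suc k) M"
  shows "continuous_multilinear k (\<lambda>hs. M (h # hs))"
  unfolding continuous_multilinear_def
proof (intro conjI allI impI)
  fix hs :: "'a list" and i assume *: "length hs = k \<and> i < k"
  then have "linear (\<lambda>z. M ((h # hs)[Suc i := z]))"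
    using assms unfolding continuous_multilinear_def by (metis Suc_less_eq length_Cons)
  then show "linear (\<lambda>z. M (h # hs[i := z]))" by simp
next
  obtain C where C: "\<And>hs. length hs = Suc k \<Longrightarrow> \<bar>M hs\<bar> \<le> C * prod_list (map norm hs)"
    using assms unfolding continuous_multilinear_def by blast
  have "\<bar>M (h # hs)\<bar> \<le> (C * norm h) * prod_list (map norm hs)" if "length hs = k" for hs
    using C[of "h # hs"] that by (simp add: mult.assoc)
  then show "\<exists>C. \<forall>hs. length hs = k \<longrightarrow> \<bar>M (h # hs)\<bar> \<le> C * prod_list (map norm hs)" by blast
qed

lemma continuous_multilinear_linear_Cons:
  assumes "continuous_multilinear (Suc k) M" "length hs = k"
  shows "bounded_linear (\<lambda>h. M (h # hs))"
proof -
  have "linear (\<lambda>z. M ((0 # hs)[0 := z]))"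
    using assms unfolding continuous_multilinear_def by (metis zero_less_Suc length_Cons)
  then have lin: "linear (\<lambda>z. M (z # hs))" by simp
  obtain C where C: "\<And>hs. length hs = Suc k \<Longrightarrow> \<bar>M hs\<bar> \<le> C * prod_list (map norm hs)"
    using assms unfolding continuous_multilinear_def by blast
  have bd: "norm (M (h # hs)) \<le> norm h * (C * prod_list (map norm hs))" for h
    using C[of "h # hs"] assms by (simp add: mult_ac)
  show ?thesis
    by (rule bounded_linear_intro[OF _ _ bd]) (simp_all add: linear_add[OF lin] linear_scale[OF lin])
qed

lemma prod_list_norm_nonneg: "0 \<le> prod_list (map norm hs)"
  by (induction hs) auto

text \<open>Membership in \<open>Cn_b\<close> bounds each derivative only for fixed directions,
  while the norm takes a supremum of form norms. The induction freezes the first argument to get a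
  bound depending on it, and then applies uniform boundedness in that argument.\<close>

lemma multilinear_uniform_boundedness:
  fixes M :: "'i \<Rightarrow> 'a::banach list \<Rightarrow> real"
  assumes "\<And>i. continuous_multilinear k (M i)"
    and "\<And>hs. length hs = k \<Longrightarrow> \<exists>K. \<forall>i. \<bar>M i hs\<bar> \<le> K"
  shows "\<exists>K\<ge>0. \<forall>i hs. length hs = k \<longrightarrow> \<bar>M i hs\<bar> \<le> K * prod_list (map norm hs)"
  using assms
proof (induction k arbitrary: M)
  case 0
  then obtain K where K: "\<And>i. \<bar>M i []\<bar> \<le> K" by force
  have "0 \<le> K" using K abs_ge_zero order_trans by blast
  with K show ?case by auto
next
  case (Suc k)
  \<comment> \<open>Dividing by the norms of the remaining arguments makes the induction hypothesis
    a pointwise bound for this family. Arguments with vanishing product are covered by the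
    continuity of each single form.\<close>
  define F where "F = {\<lambda>h. M i (h # hs) / prod_list (map norm hs) | i hs.
    length hs = k \<and> prod_list (map norm hs) > 0}"
  have "\<exists>K\<ge>0. \<forall>f\<in>F. \<forall>x. norm (f x) \<le> K * norm x"
  proof (rule uniform_boundedness)
    fix f assume "f \<in> F"
    then obtain i hs where "length hs = k" "f = (\<lambda>h. M i (h # hs) / prod_list (map norm hs))"
      by (auto simp: F_def)
    then show "bounded_linear f"
      using bounded_linear_compose[OF bounded_linear_divide continuous_multilinear_linear_Cons[OF Suc.prems(1)]]
      by simp
  next
    fix h
    have "\<exists>K. \<forall>i. \<bar>M i (h # hs)\<bar> \<le> K" if "length hs = k" for hs
      using Suc.prems(2)[of "h # hs"] that by simp
    then obtain K where K: "\<And>i hs. length hs = k \<Longrightarrow> \<bar>M i (h # hs)\<bar> \<le> K * prod_list (map norm hs)"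
      using Suc.IH[of "\<lambda>i hs. M i (h # hs)", OF continuous_multilinear_Cons[OF Suc.prems(1)]] by metis
    then have "\<forall>f\<in>F. norm (f h) \<le> K"
      by (auto simp: F_def field_simps)
    then show "\<exists>K. \<forall>f\<in>F. norm (f h) \<le> K" by blast
  qed
  then obtain K where K: "K \<ge> 0" "\<And>f x. f \<in> F \<Longrightarrow> norm (f x) \<le> K * norm x" by blast
  have "\<bar>M i hs\<bar> \<le> K * prod_list (map norm hs)" if hs: "length hs = Suc k" for i hs
  proof -
    from hs obtain h hs' where h: "hs = h # hs'" "length hs' = k" by (cases hs) auto
    show ?thesis
    proof (cases "prod_list (map norm hs') = 0")
      case True
      obtain C where C: "\<And>hs. length hs = Suc k \<Longrightarrow> \<bar>M i hs\<bar> \<le> C * prod_list (map norm hs)"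
        using Suc.prems(1)[of i] unfolding continuous_multilinear_def by blast
      then show ?thesis using C[OF hs] True h by simp
    next
      case False
      then have pos: "prod_list (map norm hs') > 0"
        using prod_list_norm_nonneg[of hs'] by linarith
      then have "(\<lambda>h. M i (h # hs') / prod_list (map norm hs')) \<in> F"
        using h(2) by (auto simp: F_def)
      from K(2)[OF this, of h] pos show ?thesis by (simp add: h field_simps)
    qed
  qed
  with K(1) show ?case by blast
qed

section \<open>Strongly continuous semigroups and the operators \<open>Q\<^sub>t\<close>\<close>

lemma selfadjoint_nonnegD:
  assumes "selfadjoint_nonneg B"
  shows "bounded_linear B" "B x \<bullet> y = x \<bullet> B y" "0 \<le> B x \<bullet> x"
  using assms unfolding selfadjoint_nonneg_def by blast+

locale c0_semigroup =
  fixes S :: "real \<Rightarrow> 'a \<Rightarrow> 'a::{real_inner, banach, polish_space}"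
  assumes C0: "C0_semigroup S"
begin

lemma bounded_linear_S: "t \<ge> 0 \<Longrightarrow> bounded_linear (S t)"
  and S_0: "S 0 x = x"
  and S_add: "s \<ge> 0 \<Longrightarrow> t \<ge> 0 \<Longrightarrow> S (s + t) x = S s (S t x)"
  and continuous_on_S: "continuous_on {0..} (\<lambda>t. S t x)"
  using C0 by (auto simp: C0_semigroup_def)

text \<open>Orbits over a compact interval are bounded by strong continuity, and uniform boundedness
  removes the dependence on the vector. The normalisation \<open>M \<ge> 1\<close> makes powers of
  \<open>M\<close> increase with the exponent.\<close>

lemma S_bound:
  assumes "T \<ge> 0"
  shows "\<exists>M\<ge>1. \<forall>t\<in>{0..T}. \<forall>x. norm (S t x) \<le> M * norm x"
proof -
  have "\<exists>K\<ge>0. \<forall>f\<in>S ` {0..T}. \<forall>x. norm (f x) \<le> K * norm x"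
  proof (rule uniform_boundedness)
    show "bounded_linear f" if "f \<in> S ` {0..T}" for f using that bounded_linear_S by auto
    fix x
    have "compact ((\<lambda>t. S t x) ` {0..T})"
      by (intro compact_continuous_image continuous_on_subset[OF continuous_on_S]) auto
    then have "bounded ((\<lambda>t. S t x) ` {0..T})" by (rule compact_imp_bounded)
    then show "\<exists>K. \<forall>f\<in>S ` {0..T}. norm (f x) \<le> K" unfolding bounded_iff by auto
  qed
  then obtain K where K: "K \<ge> 0" "\<And>t x. t \<in> {0..T} \<Longrightarrow> norm (S t x) \<le> K * norm x" by auto
  have "norm (S t x) \<le> max K 1 * norm x" if "t \<in> {0..T}" for t x
    using K(2)[OF that, of x] mult_right_mono[of K "max K 1" "norm x"] by simp
  then show ?thesis by (intro exI[of _ "max K 1"]) auto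
qed

lemma S_diff: "t \<ge> 0 \<Longrightarrow> S t (x - y) = S t x - S t y"
  using bounded_linear_S[of t] by (simp add: linear_diff bounded_linear.linear)

text \<open>Local boundedness of the operator norms upgrades strong continuity to joint continuity
  in time and vector.\<close>

lemma tendsto_S:
  assumes \<tau>: "(\<tau> \<longlongrightarrow> t) F" and \<xi>: "(\<xi> \<longlongrightarrow> x) F" and pos: "\<forall>\<^sub>F n in F. 0 \<le> \<tau> n" "0 \<le> t"
  shows "((\<lambda>n. S (\<tau> n) (\<xi> n)) \<longlongrightarrow> S t x) F"
proof -
  obtain M where M: "M \<ge> 1" "\<And>s z. s \<in> {0..t + 1} \<Longrightarrow> norm (S s z) \<le> M * norm z"
    using S_bound[of "t + 1"] pos by force
  have "((\<lambda>n. S (\<tau> n) x) \<longlongrightarrow> S t x) F"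
    by (rule continuous_on_tendsto_compose[OF continuous_on_S \<tau>]) (use pos in auto)
  moreover have "((\<lambda>n. S (\<tau> n) (\<xi> n) - S (\<tau> n) x) \<longlongrightarrow> 0) F"
  proof (rule Lim_null_comparison)
    have "\<forall>\<^sub>F n in F. \<tau> n < t + 1" using order_tendstoD(2)[OF \<tau>, of "t + 1"] by simp
    then show "\<forall>\<^sub>F n in F. norm (S (\<tau> n) (\<xi> n) - S (\<tau> n) x) \<le> M * norm (\<xi> n - x)"
      using pos(1)
    proof eventually_elim
      case (elim n)
      then show ?case using M(2)[of "\<tau> n" "\<xi> n - x"] by (simp add: S_diff)
    qed
    show "((\<lambda>n. M * norm (\<xi> n - x)) \<longlongrightarrow> 0) F"
      using tendsto_mult_left[OF tendsto_norm[OF LIM_zero[OF \<xi>]], of M] by simp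
  qed
  ultimately show ?thesis using tendsto_add by fastforce
qed

abbreviation S_adj :: "real \<Rightarrow> 'a \<Rightarrow> 'a" where
  "S_adj t \<equiv> adjoint (S t)"

lemma inner_S_adj: "t \<ge> 0 \<Longrightarrow> x \<bullet> S_adj t y = S t x \<bullet> y"
  by (simp add: adjoint_inner bounded_linear_S)

lemma bounded_linear_S_adj: "t \<ge> 0 \<Longrightarrow> bounded_linear (S_adj t)"
  by (simp add: bounded_linear_adjoint bounded_linear_S)

lemma S_adj_add:
  assumes "s \<ge> 0" "t \<ge> 0"
  shows "S_adj (s + t) x = S_adj t (S_adj s x)"
  by (subst vector_eq_ldot[symmetric]) (simp add: inner_S_adj S_add assms)

lemma S_adj_diff: "t \<ge> 0 \<Longrightarrow> S_adj t (x - y) = S_adj t x - S_adj t y"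
  using bounded_linear_S_adj[of t] by (simp add: linear_diff bounded_linear.linear)

lemma S_adj_bound:
  assumes "T \<ge> 0"
  shows "\<exists>M\<ge>1. \<forall>t\<in>{0..T}. \<forall>x. norm (S_adj t x) \<le> M * norm x"
proof -
  obtain M where M: "M \<ge> 1" "\<And>s z. s \<in> {0..T} \<Longrightarrow> norm (S s z) \<le> M * norm z"
    using S_bound[OF assms] by blast
  then have "norm (S_adj t x) \<le> M * norm x" if "t \<in> {0..T}" for t x
    using that by (intro norm_adjoint_le) (auto simp: bounded_linear_S)
  then show ?thesis using M(1) by blast
qed

lemma inner_S_integrable: "0 \<le> a \<Longrightarrow> (\<lambda>s. x \<bullet> S s z) integrable_on {a..b}"
  by (intro integrable_continuous_interval continuous_intros
      continuous_on_subset[OF continuous_on_S]) auto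

text \<open>The vectors \<open>w\<close> are the weak integrals \<open>\<integral>\<^sub>0\<^sup>\<epsilon> e\<^sup>s\<^sup>A\<^sup>* x ds\<close>; the adjoint semigroup is strongly
  continuous on them, and they have a dense span.\<close>

lemma S_adj_weak_integral:
  assumes "\<epsilon> > 0"
  shows "\<exists>w. (\<forall>z. z \<bullet> w = integral {0..\<epsilon>} (\<lambda>s. x \<bullet> S s z))
            \<and> ((\<lambda>h. S_adj h w) \<longlongrightarrow> w) (at_right 0)"
proof -
  obtain M where M: "M \<ge> 1" "\<And>s z. s \<in> {0..2 * \<epsilon>} \<Longrightarrow> norm (S s z) \<le> M * norm z"
    using S_bound[of "2 * \<epsilon>"] assms by (auto simp: less_imp_le)
  have int_bound: "\<bar>integral {a..b} (\<lambda>s. x \<bullet> S s z)\<bar> \<le> norm x * M * norm z * (b - a)"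
    if "0 \<le> a" "a \<le> b" "b \<le> 2 * \<epsilon>" for a b z
  proof -
    have "norm (integral {a..b} (\<lambda>s. x \<bullet> S s z)) \<le> norm x * (M * norm z) * (b - a)"
    proof (rule integral_bound)
      show "continuous_on {a..b} (\<lambda>s. x \<bullet> S s z)"
        using that by (intro continuous_intros continuous_on_subset[OF continuous_on_S]) auto
      fix s assume "s \<in> {a..b}"
      then have "norm x * norm (S s z) \<le> norm x * (M * norm z)"
        using that by (intro mult_left_mono M(2)) auto
      then show "norm (x \<bullet> S s z) \<le> norm x * (M * norm z)"
        using Cauchy_Schwarz_ineq2[of x "S s z"] by simp
    qed fact
    then show ?thesis by (simp add: mult.assoc)
  qed
  have "bounded_linear (\<lambda>z. integral {0..\<epsilon>} (\<lambda>s. x \<bullet> S s z))"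
  proof (rule bounded_linear_intro[where K = "norm x * M * \<epsilon>"])
    fix z y :: 'a and r :: real
    have "integral {0..\<epsilon>} (\<lambda>s. x \<bullet> S s (z + y)) = integral {0..\<epsilon>} (\<lambda>s. x \<bullet> S s z + x \<bullet> S s y)"
      using bounded_linear_S
      by (intro integral_cong) (simp add: linear_add bounded_linear.linear inner_add_right)
    also have "\<dots> = integral {0..\<epsilon>} (\<lambda>s. x \<bullet> S s z) + integral {0..\<epsilon>} (\<lambda>s. x \<bullet> S s y)"
      by (intro integral_add inner_S_integrable) auto
    finally show "integral {0..\<epsilon>} (\<lambda>s. x \<bullet> S s (z + y)) = \<dots>" .
    have "integral {0..\<epsilon>} (\<lambda>s. x \<bullet> S s (r *\<^sub>R z)) = integral {0..\<epsilon>} (\<lambda>s. r * (x \<bullet> S s z))"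
      using bounded_linear_S by (intro integral_cong) (simp add: linear_scale bounded_linear.linear)
    then show "integral {0..\<epsilon>} (\<lambda>s. x \<bullet> S s (r *\<^sub>R z)) = r *\<^sub>R integral {0..\<epsilon>} (\<lambda>s. x \<bullet> S s z)"
      by simp
    show "norm (integral {0..\<epsilon>} (\<lambda>s. x \<bullet> S s z)) \<le> norm z * (norm x * M * \<epsilon>)"
      using int_bound[of 0 \<epsilon> z] assms by (simp add: mult_ac)
  qed
  then obtain w where w: "\<And>z. integral {0..\<epsilon>} (\<lambda>s. x \<bullet> S s z) = z \<bullet> w"
    using riesz_representation by blast
  have diff: "norm (S_adj h w - w) \<le> 2 * norm x * M * h" if h: "0 \<le> h" "h \<le> \<epsilon>" for h
  proof (rule norm_le_if_inner_le)
    fix z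
    let ?f = "\<lambda>s. x \<bullet> S s z"
    have "S h z \<bullet> w = integral {0..\<epsilon>} (\<lambda>s. ?f (s + h))"
      unfolding w[symmetric] using h by (intro integral_cong) (simp add: S_add)
    also have "\<dots> = integral {h..\<epsilon> + h} ?f"
      using integral_shift_real_ivl[of h h "\<epsilon> + h" ?f] by simp
    finally have "z \<bullet> (S_adj h w - w) = integral {h..\<epsilon> + h} ?f - integral {0..\<epsilon>} ?f"
      using h by (simp add: inner_diff_right inner_S_adj w)
    \<comment> \<open>The two intervals of integration overlap; after cancellation only two strips
      of length \<open>h\<close> remain, each contributing a multiple of \<open>h\<close>.\<close>
    also have "\<dots> = integral {\<epsilon>..\<epsilon> + h} ?f - integral {0..h} ?f"
      using Henstock_Kurzweil_Integration.integral_combine[of 0 h "\<epsilon> + h" ?f]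
        Henstock_Kurzweil_Integration.integral_combine[of 0 \<epsilon> "\<epsilon> + h" ?f] h
        inner_S_integrable[of 0 x z "\<epsilon> + h"] by simp
    also have "\<dots> \<le> norm x * M * norm z * h + norm x * M * norm z * h"
      using int_bound[of \<epsilon> "\<epsilon> + h" z] int_bound[of 0 h z] h by (simp only: abs_le_iff) (simp add: algebra_simps)
    finally show "z \<bullet> (S_adj h w - w) \<le> 2 * norm x * M * h * norm z" by (simp add: mult_ac)
  qed (use M h in auto)
  have "((\<lambda>h. S_adj h w - w) \<longlongrightarrow> 0) (at_right 0)"
  proof (rule Lim_null_comparison)
    show "\<forall>\<^sub>F h in at_right 0. norm (S_adj h w - w) \<le> 2 * norm x * M * h"
      using eventually_at_right_real[OF assms] by eventually_elim (use diff in auto)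
    show "((\<lambda>h. 2 * norm x * M * h) \<longlongrightarrow> 0) (at_right 0)"
      by (rule tendsto_mult_right_zero) (rule tendsto_ident_at)
  qed
  then have "((\<lambda>h. S_adj h w) \<longlongrightarrow> w) (at_right 0)" by (rule LIM_zero_cancel)
  then show ?thesis using w by (intro exI[of _ w]) simp
qed

text \<open>The adjoint semigroup is a priori only weakly continuous. Its vectors of strong
  continuity form a closed subspace containing the weak integrals. A nonzero \<open>z\<close>
  orthogonal to this subspace would make the integral of \<open>z \<bullet> S s z\<close> over a
  short interval vanish, although the integrand exceeds half of \<open>z \<bullet> z\<close>
  there.\<close>

lemma S_adj_tendsto_0: "((\<lambda>h. S_adj h x) \<longlongrightarrow> x) (at_right 0)"
proof -
  define Y where "Y = {x. ((\<lambda>h. S_adj h x) \<longlongrightarrow> x) (at_right 0)}"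
  have pos: "\<forall>\<^sub>F h in at_right 0. (h::real) \<in> {0<..<1}"
    by (rule eventually_at_right_real) simp
  obtain M where M: "M \<ge> 1" "\<And>s z. s \<in> {0..1} \<Longrightarrow> norm (S_adj s z) \<le> M * norm z"
    using S_adj_bound[of 1] by auto
  have "subspace Y"
    unfolding subspace_def
  proof (intro conjI ballI allI)
    show "0 \<in> Y" unfolding Y_def
      by (auto intro!: tendsto_eventually eventually_mono[OF pos]
          simp: linear_0 bounded_linear.linear bounded_linear_S_adj)
    show "x + y \<in> Y" if "x \<in> Y" "y \<in> Y" for x y
    proof -
      have "((\<lambda>h. S_adj h x + S_adj h y) \<longlongrightarrow> x + y) (at_right 0)"
        using that by (intro tendsto_add) (auto simp: Y_def)
      then show ?thesis unfolding Y_def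
        by (auto elim!: Lim_transform_eventually intro!: eventually_mono[OF pos]
            simp: linear_add bounded_linear.linear bounded_linear_S_adj)
    qed
    show "c *\<^sub>R x \<in> Y" if "x \<in> Y" for x c
    proof -
      have "((\<lambda>h. c *\<^sub>R S_adj h x) \<longlongrightarrow> c *\<^sub>R x) (at_right 0)"
        using that by (intro tendsto_scaleR tendsto_const) (auto simp: Y_def)
      then show ?thesis unfolding Y_def
        by (auto elim!: Lim_transform_eventually intro!: eventually_mono[OF pos]
            simp: linear_scale bounded_linear.linear bounded_linear_S_adj)
    qed
  qed
  moreover have "closed Y"
  proof -
    have "x \<in> Y" if "x \<in> closure Y" for x
      unfolding Y_def
    proof (intro CollectI tendstoI)
      fix \<epsilon> :: real assume "\<epsilon> > 0"
      then have "\<epsilon> / (2 * (M + 1)) > 0" using M by simp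
      with that obtain y where y: "y \<in> Y" "dist y x < \<epsilon> / (2 * (M + 1))"
        unfolding closure_approachable by blast
      have "\<forall>\<^sub>F h in at_right 0. dist (S_adj h y) y < \<epsilon> / 2"
        using y(1) \<open>\<epsilon> > 0\<close> unfolding Y_def by (intro tendstoD) auto
      then show "\<forall>\<^sub>F h in at_right 0. dist (S_adj h x) x < \<epsilon>"
        using pos
      proof eventually_elim
        case (elim h)
        have "dist (S_adj h x) (S_adj h y) \<le> M * dist x y"
          using M(2)[of h "x - y"] elim by (simp add: dist_norm S_adj_diff)
        then have "dist (S_adj h x) x \<le> M * dist x y + dist (S_adj h y) y + dist y x"
          using dist_triangle[of "S_adj h x" x "S_adj h y"] dist_triangle[of "S_adj h y" x y] by simp
        moreover have "(M + 1) * dist y x < \<epsilon> / 2"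
          using y(2) M by (simp add: field_simps)
        ultimately show ?case using elim by (simp add: dist_commute algebra_simps)
      qed
    qed
    then show ?thesis using closure_subset_eq by blast
  qed
  ultimately obtain p where p: "p \<in> Y" "\<forall>y\<in>Y. (x - p) \<bullet> y = 0"
    using projection_exists by blast
  define z where "z = x - p"
  have "z = 0"
  proof (rule ccontr)
    assume "z \<noteq> 0"
    have "((\<lambda>s. z \<bullet> S s z) \<longlongrightarrow> z \<bullet> S 0 z) (at 0 within {0..})"
      using continuous_on_S[of z] by (intro tendsto_inner tendsto_const) (simp add: continuous_on_def)
    then have "\<forall>\<^sub>F s in at 0 within {0..}. z \<bullet> S s z > z \<bullet> z / 2"
      by (rule order_tendstoD(1)) (use \<open>z \<noteq> 0\<close> in \<open>simp add: S_0\<close>)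
    then obtain d where d: "d > 0" "\<And>s. 0 < s \<Longrightarrow> s < d \<Longrightarrow> z \<bullet> S s z > z \<bullet> z / 2"
      unfolding eventually_at by (auto simp: dist_real_def)
    obtain w where w: "\<And>y. y \<bullet> w = integral {0..d/2} (\<lambda>s. z \<bullet> S s y)" "w \<in> Y"
      using S_adj_weak_integral[of "d/2" z] d(1) unfolding Y_def by auto
    have "0 = z \<bullet> w" using p(2) w(2) by (simp add: z_def)
    also have "\<dots> = integral {0..d/2} (\<lambda>s. z \<bullet> S s z)" by (rule w(1))
    also have "\<dots> \<ge> integral {0..d/2} (\<lambda>s. z \<bullet> z / 2)"
    proof (rule integral_le)
      fix s assume s: "s \<in> {0..d/2}"
      show "z \<bullet> z / 2 \<le> z \<bullet> S s z"
        by (cases "s = 0") (use d(1) d(2)[of s] s in \<open>auto simp: S_0\<close>)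
    qed (auto intro: inner_S_integrable)
    finally show False using d(1) \<open>z \<noteq> 0\<close> by simp (smt (verit) inner_gt_zero_iff mult_pos_pos)
  qed
  then show ?thesis using p(1) by (simp add: z_def Y_def)
qed

text \<open>An increment between two times is the adjoint at the earlier time applied to
  \<open>S_adj h x - x\<close>, where \<open>h\<close> is the time difference. The uniform bound
  thus reduces both one-sided limits to continuity at 0.\<close>

lemma continuous_on_S_adj: "continuous_on {0..} (\<lambda>t. S_adj t x)"
  unfolding continuous_on_def
proof
  fix t :: real assume t: "t \<in> {0..}"
  obtain M where M: "M \<ge> 1" "\<And>s z. s \<in> {0..t + 1} \<Longrightarrow> norm (S_adj s z) \<le> M * norm z"
    using S_adj_bound[of "t + 1"] t by auto
  have est: "norm (S_adj (s + h) x - S_adj s x) \<le> M * norm (S_adj h x - x)"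
    if "0 \<le> s" "s \<le> t + 1" "0 \<le> h" for s h
    using M(2)[of s "S_adj h x - x"] that S_adj_add[of h s x] by (simp add: S_adj_diff add.commute)
  have lim: "((\<lambda>h. S_adj h x) \<longlongrightarrow> x) (at 0 within {0..})"
  proof -
    have "at 0 within {0..} = at_right (0::real)"
      by (rule at_within_nhd[of _ UNIV]) auto
    then show ?thesis using S_adj_tendsto_0 by simp
  qed
  have "((\<lambda>s. \<bar>s - t\<bar>) \<longlongrightarrow> 0) (at t within {0..})"
    by (rule tendsto_eq_intros refl | simp)+
  then have "filterlim (\<lambda>s. \<bar>s - t\<bar>) (at 0 within {0..}) (at t within {0..})"
    unfolding filterlim_at by (auto simp: eventually_at_filter)
  from filterlim_compose[OF lim this]
  have lim': "((\<lambda>s. S_adj \<bar>s - t\<bar> x - x) \<longlongrightarrow> 0) (at t within {0..})"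
    by (rule LIM_zero)
  have "((\<lambda>s. S_adj s x - S_adj t x) \<longlongrightarrow> 0) (at t within {0..})"
  proof (rule Lim_null_comparison)
    have "\<forall>\<^sub>F s in at t within {0..}. s \<ge> 0" by (simp add: eventually_at_filter)
    moreover have "\<forall>\<^sub>F s in at t within {0..}. s < t + 1"
      by (rule order_tendstoD(2)[OF tendsto_ident_at]) simp
    ultimately show "\<forall>\<^sub>F s in at t within {0..}.
        norm (S_adj s x - S_adj t x) \<le> M * norm (S_adj \<bar>s - t\<bar> x - x)"
    proof eventually_elim
      case (elim s)
      show ?case
      proof (cases "s \<le> t")
        case True
        then show ?thesis using est[of s "t - s"] elim by (simp add: norm_minus_commute)
      next
        case False
        then show ?thesis using est[of t "s - t"] elim t by simp
      qed
    qed
    show "((\<lambda>s. M * norm (S_adj \<bar>s - t\<bar> x - x)) \<longlongrightarrow> 0) (at t within {0..})"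
      using tendsto_mult_left[OF tendsto_norm[OF lim'], of M] by simp
  qed
  then show "((\<lambda>s. S_adj s x) \<longlongrightarrow> S_adj t x) (at t within {0..})" by (rule LIM_zero_cancel)
qed

end

locale ou_operators = c0_semigroup S for S :: "real \<Rightarrow> 'a \<Rightarrow> 'a::{real_inner, banach, polish_space}" +
  fixes Q :: "'a \<Rightarrow> 'a"
  assumes Q: "selfadjoint_nonneg Q"
begin

lemma bounded_linear_Q: "bounded_linear Q"
  and Q_sym: "Q x \<bullet> y = x \<bullet> Q y"
  and Q_nonneg: "0 \<le> Q x \<bullet> x"
  using Q unfolding selfadjoint_nonneg_def by blast+

lemma continuous_on_Q_S_adj: "A \<subseteq> {0..} \<Longrightarrow> continuous_on A (\<lambda>s. Q (S_adj s x))"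
  by (intro bounded_linear.continuous_on[OF bounded_linear_Q] continuous_on_subset[OF continuous_on_S_adj])

lemma continuous_on_Qt_form: "A \<subseteq> {0..} \<Longrightarrow> continuous_on A (\<lambda>s. Q (S_adj s x) \<bullet> S_adj s y)"
  by (intro continuous_on_inner continuous_on_Q_S_adj continuous_on_subset[OF continuous_on_S_adj])

lemma Qt_form_integrable: "0 \<le> a \<Longrightarrow> (\<lambda>s. Q (S_adj s x) \<bullet> S_adj s y) integrable_on {a..b}"
  by (intro integrable_continuous_interval continuous_on_Qt_form) auto

text \<open>Joint continuity of \<open>S\<close> and strong continuity of the adjoint make the
  integrand continuous, so that the strong integral exists and may be tested against
  \<open>y\<close>. All further properties of \<open>Qt\<close> are read off this form.\<close>

lemma inner_Qt:
  assumes "t \<ge> 0"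
  shows "Qt S Q t x \<bullet> y = integral {0..t} (\<lambda>s. Q (S_adj s x) \<bullet> S_adj s y)"
proof -
  let ?F = "\<lambda>s. S s (Q (S_adj s x))"
  have "continuous_on {0..t} ?F"
    unfolding continuous_on_def
  proof
    fix s assume s: "s \<in> {0..t}"
    have c: "((\<lambda>s. Q (S_adj s x)) \<longlongrightarrow> Q (S_adj s x)) (at s within {0..t})"
      using continuous_on_Q_S_adj[of "{0..t}" x] s by (auto simp: continuous_on_def)
    show "(?F \<longlongrightarrow> ?F s) (at s within {0..t})"
      by (rule tendsto_S[OF tendsto_ident_at c]) (use s in \<open>auto simp: eventually_at_filter\<close>)
  qed
  then have "?F integrable_on {0..t}" by (rule integrable_continuous_interval)
  from integral_linear[OF this bounded_linear_inner_left[of y]]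
  have "Qt S Q t x \<bullet> y = integral {0..t} (\<lambda>s. ?F s \<bullet> y)"
    by (simp add: Qt_def o_def)
  also have "\<dots> = integral {0..t} (\<lambda>s. Q (S_adj s x) \<bullet> S_adj s y)"
    by (intro integral_cong) (simp add: inner_S_adj)
  finally show ?thesis .
qed

lemma S_adj_linear:
  assumes "s \<ge> 0"
  shows "S_adj s (x + y) = S_adj s x + S_adj s y" "S_adj s (r *\<^sub>R x) = r *\<^sub>R S_adj s x"
  using bounded_linear_S_adj[OF assms]
  by (simp_all add: linear_add linear_scale bounded_linear.linear)

lemma Q_linear: "Q (x + y) = Q x + Q y" "Q (r *\<^sub>R x) = r *\<^sub>R Q x"
  using bounded_linear_Q by (simp_all add: linear_add linear_scale bounded_linear.linear)

lemma Qt_form_bound: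
  assumes "T \<ge> 0"
  shows "\<exists>K\<ge>0. \<forall>t\<in>{0..T}. \<forall>x y. \<bar>Qt S Q t x \<bullet> y\<bar> \<le> K * norm x * norm y * t"
proof -
  obtain M where M: "M \<ge> 1" "\<And>s z. s \<in> {0..T} \<Longrightarrow> norm (S_adj s z) \<le> M * norm z"
    using S_adj_bound[OF assms] by auto
  obtain q where q: "q \<ge> 0" "\<And>x. norm (Q x) \<le> q * norm x"
    using bounded_linear.nonneg_bounded[OF bounded_linear_Q] by (metis mult.commute)
  have "\<bar>Qt S Q t x \<bullet> y\<bar> \<le> (q * M * M) * norm x * norm y * t" if t: "t \<in> {0..T}" for t x y
  proof -
    have "norm (integral {0..t} (\<lambda>s. Q (S_adj s x) \<bullet> S_adj s y))
        \<le> (q * (M * norm x)) * (M * norm y) * (t - 0)"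
    proof (rule integral_bound)
      show "continuous_on {0..t} (\<lambda>s. Q (S_adj s x) \<bullet> S_adj s y)"
        by (rule continuous_on_Qt_form) auto
      fix s assume s: "s \<in> {0..t}"
      then have sT: "s \<in> {0..T}" using t by auto
      have "norm (Q (S_adj s x)) \<le> q * (M * norm x)"
        using q(2)[of "S_adj s x"] mult_left_mono[OF M(2)[OF sT, of x] q(1)] by linarith
      moreover have "norm (S_adj s y) \<le> M * norm y" by (rule M(2)[OF sT])
      ultimately have "norm (Q (S_adj s x)) * norm (S_adj s y) \<le> (q * (M * norm x)) * (M * norm y)"
        using q(1) M(1) by (intro mult_mono) auto
      then show "norm (Q (S_adj s x) \<bullet> S_adj s y) \<le> (q * (M * norm x)) * (M * norm y)"
        using Cauchy_Schwarz_ineq2[of "Q (S_adj s x)" "S_adj s y"] by (simp only: real_norm_def)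
    qed (use t in auto)
    then show ?thesis using t by (simp add: inner_Qt mult_ac)
  qed
  then show ?thesis using q(1) M(1) by (intro exI[of _ "q * M * M"]) auto
qed

lemma Qt_selfadjoint_nonneg:
  assumes "t \<ge> 0"
  shows "selfadjoint_nonneg (Qt S Q t)"
  unfolding selfadjoint_nonneg_def
proof (intro conjI allI)
  obtain K where K: "K \<ge> 0" "\<And>x y. \<bar>Qt S Q t x \<bullet> y\<bar> \<le> K * norm x * norm y * t"
    using Qt_form_bound[OF assms] assms by fastforce
  show "bounded_linear (Qt S Q t)"
  proof (rule bounded_linear_intro[where K = "K * t"])
    show "Qt S Q t (x + y) = Qt S Q t x + Qt S Q t y" for x y
    proof (subst vector_eq_rdot[symmetric], intro allI)
      fix z
      have "integral {0..t} (\<lambda>s. Q (S_adj s (x + y)) \<bullet> S_adj s z)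
          = integral {0..t} (\<lambda>s. Q (S_adj s x) \<bullet> S_adj s z + Q (S_adj s y) \<bullet> S_adj s z)"
        by (intro integral_cong) (simp add: S_adj_linear Q_linear inner_add_left)
      also have "\<dots> = integral {0..t} (\<lambda>s. Q (S_adj s x) \<bullet> S_adj s z)
          + integral {0..t} (\<lambda>s. Q (S_adj s y) \<bullet> S_adj s z)"
        by (intro integral_add Qt_form_integrable) auto
      finally show "Qt S Q t (x + y) \<bullet> z = (Qt S Q t x + Qt S Q t y) \<bullet> z"
        by (simp add: inner_Qt assms inner_add_left)
    qed
    show "Qt S Q t (r *\<^sub>R x) = r *\<^sub>R Qt S Q t x" for r x
    proof (subst vector_eq_rdot[symmetric], intro allI)
      fix z
      have "integral {0..t} (\<lambda>s. Q (S_adj s (r *\<^sub>R x)) \<bullet> S_adj s z)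
          = integral {0..t} (\<lambda>s. r * (Q (S_adj s x) \<bullet> S_adj s z))"
        by (intro integral_cong) (simp add: S_adj_linear Q_linear)
      then show "Qt S Q t (r *\<^sub>R x) \<bullet> z = (r *\<^sub>R Qt S Q t x) \<bullet> z"
        by (simp add: inner_Qt assms)
    qed
    show "norm (Qt S Q t x) \<le> norm x * (K * t)" for x
    proof (rule norm_le_if_inner_le)
      show "y \<bullet> Qt S Q t x \<le> norm x * (K * t) * norm y" for y
        using K(2)[of x y] by (simp add: inner_commute mult_ac)
    qed (use K assms in auto)
  qed
  show "Qt S Q t x \<bullet> y = x \<bullet> Qt S Q t y" for x y
  proof -
    have "Qt S Q t x \<bullet> y = integral {0..t} (\<lambda>s. Q (S_adj s y) \<bullet> S_adj s x)"
      unfolding inner_Qt[OF assms] by (intro integral_cong) (metis Q_sym inner_commute)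
    also have "\<dots> = x \<bullet> Qt S Q t y"
      unfolding inner_Qt[OF assms, symmetric] by (rule inner_commute)
    finally show ?thesis .
  qed
  show "0 \<le> Qt S Q t x \<bullet> x" for x
    unfolding inner_Qt[OF assms] by (intro integral_nonneg Qt_form_integrable Q_nonneg) auto
qed

text \<open>The form version of \<open>Q_{s+t} = Q_s + e^{sA} Q_t e^{sA^*}\<close>. It yields
  monotonicity in time, and it lets the Gaussian measure at time \<open>s + t\<close> be split into
  the one at time \<open>s\<close> and an independent image under \<open>S s\<close>.\<close>

lemma Qt_add:
  assumes "s \<ge> 0" "t \<ge> 0"
  shows "Qt S Q (s + t) x \<bullet> y = Qt S Q s x \<bullet> y + Qt S Q t (S_adj s x) \<bullet> S_adj s y"
proof -
  let ?f = "\<lambda>r. Q (S_adj r x) \<bullet> S_adj r y"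
  have "integral {0..s + t} ?f = integral {0..s} ?f + integral {s..s + t} ?f"
    using Henstock_Kurzweil_Integration.integral_combine[of 0 s "s + t" ?f] assms
      Qt_form_integrable[of 0 x y "s + t"] by simp
  also have "integral {s..s + t} ?f = integral {0..t} (\<lambda>r. ?f (r + s))"
    using integral_shift_real_ivl[of s s "s + t" ?f] by simp
  also have "\<dots> = integral {0..t} (\<lambda>r. Q (S_adj r (S_adj s x)) \<bullet> S_adj r (S_adj s y))"
    using assms(1) by (intro integral_cong) (simp add: S_adj_add[of s] add.commute[of _ s])
  finally show ?thesis using assms by (simp add: inner_Qt)
qed

lemma Qt_mono:
  assumes "0 \<le> s" "s \<le> t"
  shows "Qt S Q s x \<bullet> x \<le> Qt S Q t x \<bullet> x"
  using Qt_add[of s "t - s" x x] selfadjoint_nonnegD(3)[OF Qt_selfadjoint_nonneg, of "t - s" "S_adj s x"]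
    assms by simp

lemma Qt_0: "Qt S Q 0 x = 0"
  by (simp add: Qt_def)

text \<open>Each diagonal entry is of order \<open>t\<close>, and monotonicity in time dominates all
  of them by the entries at time \<open>T\<close>, so the limit passes through the series.\<close>

lemma Qt_trace_tendsto_0:
  assumes "T > 0" "summable (\<lambda>n. Qt S Q T (e n) \<bullet> e n)"
  shows "((\<lambda>t. \<Sum>n. Qt S Q t (e n) \<bullet> e n) \<longlongrightarrow> 0) (at_right 0)"
proof -
  obtain K where K: "K \<ge> 0" "\<And>t x y. t \<in> {0..T} \<Longrightarrow> \<bar>Qt S Q t x \<bullet> y\<bar> \<le> K * norm x * norm y * t"
    using Qt_form_bound[of T] assms by fastforce
  have ev: "\<forall>\<^sub>F t in at_right 0. t \<in> {0<..<T}"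
    using assms(1) by (rule eventually_at_right_real)
  have "((\<lambda>t. \<Sum>n. Qt S Q t (e n) \<bullet> e n) \<longlongrightarrow> (\<Sum>n. 0)) (at_right 0)"
  proof (rule tannerys_theorem[THEN conjunct2, THEN conjunct2, OF _ _ assms(2)])
    fix n
    show "((\<lambda>t. Qt S Q t (e n) \<bullet> e n) \<longlongrightarrow> 0) (at_right 0)"
    proof (rule Lim_null_comparison)
      show "\<forall>\<^sub>F t in at_right 0. norm (Qt S Q t (e n) \<bullet> e n) \<le> K * norm (e n) * norm (e n) * t"
        using ev by eventually_elim (use K(2) in auto)
      show "((\<lambda>t. K * norm (e n) * norm (e n) * t) \<longlongrightarrow> 0) (at_right 0)"
        by (rule tendsto_mult_right_zero) (rule tendsto_ident_at)
    qed
  next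
    have "\<forall>\<^sub>F (k, t) in at_top \<times>\<^sub>F at_right 0. t \<in> {0<..<T}"
      using eventually_prodI[OF eventually_True ev] by (simp add: case_prod_unfold)
    then show "\<forall>\<^sub>F (k, t) in at_top \<times>\<^sub>F at_right 0. norm (Qt S Q t (e k) \<bullet> e k) \<le> Qt S Q T (e k) \<bullet> e k"
    proof eventually_elim
      case (elim p)
      then show ?case
        using Qt_mono[of "snd p" T "e (fst p)"]
          selfadjoint_nonnegD(3)[OF Qt_selfadjoint_nonneg, of "snd p" "e (fst p)"]
        by (auto simp: case_prod_unfold)
    qed
  qed simp
  then show ?thesis by simp
qed

end

section \<open>Gaussian measures\<close>

text \<open>Pettis' argument: membership in a closed ball is tested by countably many linear
  functionals from a dense set, so balls have measurable preimages, and by Lindelof open sets are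
  countable unions of balls.\<close>

lemma borel_measurable_inner_all:
  fixes f :: "'b \<Rightarrow> 'a::{real_inner, second_countable_topology}"
  assumes "\<And>k. (\<lambda>x. k \<bullet> f x) \<in> borel_measurable M"
  shows "f \<in> borel_measurable M"
proof (rule borel_measurableI)
  obtain D :: "'a set" where D: "countable D" "\<And>X. open X \<Longrightarrow> X \<noteq> {} \<Longrightarrow> \<exists>d\<in>D. d \<in> X"
    using countable_dense_exists by blast
  have ball: "f -` ball c r \<inter> space M \<in> sets M" for c r
  proof -
    have norm_le_iff: "norm y \<le> s \<longleftrightarrow> (\<forall>d\<in>D. d \<bullet> y \<le> s * norm d)" if s: "s \<ge> 0" for y :: 'a and s
    proof
      assume "norm y \<le> s"
      then have "norm d * norm y \<le> norm d * s" for d :: 'a by (rule mult_left_mono) simp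
      then show "\<forall>d\<in>D. d \<bullet> y \<le> s * norm d"
        using norm_cauchy_schwarz order_trans by (metis mult.commute)
    next
      assume le: "\<forall>d\<in>D. d \<bullet> y \<le> s * norm d"
      have "d \<bullet> y \<le> s * norm d" for d
      proof (rule ccontr)
        assume "\<not> ?thesis"
        then have "d \<in> {d. s * norm d < d \<bullet> y}" by simp
        moreover have "open {d. s * norm d < d \<bullet> y}"
          by (intro open_Collect_less continuous_intros)
        ultimately obtain d' where "d' \<in> D" "s * norm d' < d' \<bullet> y" using D(2) by blast
        then show False using le by force
      qed
      then show "norm y \<le> s" using s by (rule norm_le_if_inner_le)
    qed
    have "(\<lambda>x. norm (f x - c)) \<in> borel_measurable M"
      unfolding borel_measurable_iff_le
    proof
      fix s :: real
      show "{x \<in> space M. norm (f x - c) \<le> s} \<in> sets M"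
      proof (cases "s \<ge> 0")
        case True
        have "{x \<in> space M. \<forall>d\<in>D. d \<bullet> f x - d \<bullet> c \<le> s * norm d} \<in> sets M"
          using assms D(1) by measurable
        then show ?thesis by (simp add: norm_le_iff[OF True] inner_diff_right)
      next
        case False
        then have "\<not> norm (f x - c) \<le> s" for x using norm_ge_zero[of "f x - c"] by linarith
        then have "{x \<in> space M. norm (f x - c) \<le> s} = {}" by auto
        then show ?thesis by (simp only: sets.empty_sets)
      qed
    qed
    then have "{x \<in> space M. norm (f x - c) < r} \<in> sets M" by measurable
    also have "{x \<in> space M. norm (f x - c) < r} = f -` ball c r \<inter> space M"
      by (auto simp: dist_norm norm_minus_commute)
    finally show ?thesis .
  qed
  fix U :: "'a set" assume "open U"
  define \<F> where "\<F> = {B. \<exists>c r. B = ball c r \<and> B \<subseteq> U}"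
  have "\<Union>\<F> = U"
    using \<open>open U\<close> unfolding open_contains_ball \<F>_def by (auto, metis centre_in_ball)
  moreover obtain \<G> where \<G>: "\<G> \<subseteq> \<F>" "countable \<G>" "\<Union>\<G> = \<Union>\<F>"
    by (rule Lindelof[of \<F>]) (auto simp: \<F>_def)
  ultimately have "U = \<Union>\<G>" by simp
  then have "f -` U \<inter> space M = (\<Union>B\<in>\<G>. f -` B \<inter> space M)" by auto
  also have "\<dots> \<in> sets M"
    using \<G> ball by (intro sets.countable_UN') (auto simp: \<F>_def)
  finally show "f -` U \<inter> space M \<in> sets M" .
qed

section \<open>Uniqueness through characteristic functions\<close>

text \<open>Levy's theorem concerns probability measures, so the weight is divided by its total
  mass. The hypothesis at \<open>t = 0\<close> shows that the mass is the same under both measures;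
  if it is 0, both sides vanish.\<close>

lemma weighted_charfun_unique:
  fixes k w :: "'a \<Rightarrow> real"
  assumes "prob_space \<mu>" "prob_space \<nu>" and sets: "sets \<nu> = sets \<mu>"
    and [measurable]: "k \<in> borel_measurable \<mu>" "w \<in> borel_measurable \<mu>" "B \<in> sets borel"
    and w: "\<And>y. 0 \<le> w y" "\<And>y. w y \<le> K"
    and eq: "\<And>t. (CLINT y|\<mu>. complex_of_real (w y) * iexp (t * k y))
                 = (CLINT y|\<nu>. complex_of_real (w y) * iexp (t * k y))"
  shows "(LINT y|\<mu>. w y * indicator B (k y)) = (LINT y|\<nu>. w y * indicator B (k y))"
proof -
  interpret \<mu>: prob_space \<mu> by fact
  interpret \<nu>: prob_space \<nu> by fact
  have [measurable]: "k \<in> borel_measurable \<nu>" "w \<in> borel_measurable \<nu>"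
    using assms(4,5) by (simp_all only: measurable_cong_sets[OF sets refl])
  have int: "integrable \<mu> w" "integrable \<nu> w"
    using w by (auto intro!: \<mu>.integrable_const_bound[where B = K] \<nu>.integrable_const_bound[where B = K])
  have K: "0 \<le> K" using w(1)[of undefined] w(2)[of undefined] by linarith
  have intind: "integrable \<mu> (\<lambda>y. w y * indicator B (k y))" "integrable \<nu> (\<lambda>y. w y * indicator B (k y))"
    using K by (intro \<mu>.integrable_const_bound[where B = K] \<nu>.integrable_const_bound[where B = K]
      AE_I2; simp add: w indicator_def)+
  define m where "m = (LINT y|\<mu>. w y)"
  have m': "m = (LINT y|\<nu>. w y)"
    using eq[of 0] by (simp add: m_def)
  show ?thesis
  proof (cases "m = 0")
    case True
    have "AE y in \<mu>. w y = 0" "AE y in \<nu>. w y = 0"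
      using integral_nonneg_eq_0_iff_AE[OF int(1)] integral_nonneg_eq_0_iff_AE[OF int(2)] w True m'
      by (auto simp: m_def)
    then have "AE y in \<mu>. w y * indicator B (k y) = 0" "AE y in \<nu>. w y * indicator B (k y) = 0"
      by auto
    then show ?thesis by (simp add: integral_eq_zero_AE)
  next
    case False
    have "m \<ge> 0" unfolding m_def using w by (intro Bochner_Integration.integral_nonneg) auto
    with False have m: "m > 0" by simp
    define M where "M \<rho> = distr (density \<rho> (\<lambda>y. ennreal (w y / m))) borel k" for \<rho>
    have *: "real_distribution (M \<rho>)
        \<and> char (M \<rho>) t = (CLINT y|\<rho>. complex_of_real (w y) * iexp (t * k y)) / m
        \<and> measure (M \<rho>) B = (LINT y|\<rho>. w y * indicator B (k y)) / m"
      if [measurable]: "k \<in> borel_measurable \<rho>" "w \<in> borel_measurable \<rho>" and "integrable \<rho> w"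
        and "m = (LINT y|\<rho>. w y)" and ii: "integrable \<rho> (\<lambda>y. w y * indicator B (k y))" for \<rho> t
    proof (intro conjI)
      have nn: "(\<integral>\<^sup>+y. ennreal (w y / m) \<partial>\<rho>) = 1"
        using that(3,4) m w by (subst nn_integral_eq_integral) auto
      have "prob_space (density \<rho> (\<lambda>y. ennreal (w y / m)))"
        by (rule prob_spaceI) (simp add: emeasure_density nn)
      then show "real_distribution (M \<rho>)"
        unfolding M_def by (intro prob_space.real_distribution_distr) auto
      have "char (M \<rho>) t = (CLINT y|density \<rho> (\<lambda>y. ennreal (w y / m)). iexp (t * k y))"
        unfolding M_def char_def by (subst integral_distr) auto
      also have "\<dots> = (CLINT y|\<rho>. (w y / m) *\<^sub>R iexp (t * k y))"
        using m w by (subst integral_density) auto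
      also have "\<dots> = (CLINT y|\<rho>. complex_of_real (w y) * iexp (t * k y) / m)"
        by (intro Bochner_Integration.integral_cong) (auto simp: scaleR_conv_of_real)
      finally show "char (M \<rho>) t = (CLINT y|\<rho>. complex_of_real (w y) * iexp (t * k y)) / m" by simp
      have "emeasure (M \<rho>) B = (\<integral>\<^sup>+y. ennreal (w y / m) * indicator (k -` B \<inter> space \<rho>) y \<partial>\<rho>)"
        unfolding M_def by (simp add: emeasure_distr emeasure_density)
      also have "\<dots> = (\<integral>\<^sup>+y. ennreal (w y * indicator B (k y) / m) \<partial>\<rho>)"
        by (intro nn_integral_cong) (auto simp: indicator_def)
      also have "\<dots> = ennreal (LINT y|\<rho>. w y * indicator B (k y) / m)"
        using ii m w by (intro nn_integral_eq_integral) (auto simp: indicator_def)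
      finally show "measure (M \<rho>) B = (LINT y|\<rho>. w y * indicator B (k y)) / m"
        using m w unfolding measure_def
        by (subst enn2real_ennreal[symmetric]) (auto intro!: divide_nonneg_pos integral_nonneg_AE simp: indicator_def)
    qed
    note \<mu> = *[OF _ _ int(1) m_def intind(1)] and \<nu> = *[OF _ _ int(2) m' intind(2)]
    have "char (M \<mu>) t = char (M \<nu>) t" for t using \<mu>[of t] \<nu>[of t] eq[of t] by simp
    then have "M \<mu> = M \<nu>" using \<mu> \<nu> by (intro Levy_uniqueness) auto
    then show ?thesis using \<mu> \<nu> m by simp
  qed
qed

text \<open>Levy's uniqueness theorem on the line is applied to the densities \<open>1 + cos \<langle>h, \<cdot>\<rangle>\<close> and
  \<open>1 + sin \<langle>h, \<cdot>\<rangle>\<close>, one direction of the cylinder set at a time.\<close>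

lemma charfun_cylinder_step:
  fixes \<mu> \<nu> :: "'a::{real_inner, second_countable_topology} measure" and k :: 'a
  assumes \<mu>: "prob_space \<mu>" "sets \<mu> = sets borel" and \<nu>: "prob_space \<nu>" "sets \<nu> = sets borel"
    and C: "C \<in> sets borel" and B: "B \<in> sets borel"
    and eq: "\<And>h. (CLINT y|\<mu>. complex_of_real (indicator C y) * iexp (h \<bullet> y))
                 = (CLINT y|\<nu>. complex_of_real (indicator C y) * iexp (h \<bullet> y))"
  defines "C' \<equiv> C \<inter> {y. k \<bullet> y \<in> B}"
  shows "(CLINT y|\<mu>. complex_of_real (indicator C' y) * iexp (h \<bullet> y))
       = (CLINT y|\<nu>. complex_of_real (indicator C' y) * iexp (h \<bullet> y))"
proof -
  interpret \<mu>: prob_space \<mu> by fact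
  interpret \<nu>: prob_space \<nu> by fact
  note [measurable_cong] = \<mu>(2) \<nu>(2)
  note [measurable] = C B
  have ind: "integrable \<rho> (\<lambda>y. complex_of_real (indicator C y) * iexp (u \<bullet> y))"
    if "prob_space \<rho>" "sets \<rho> = sets borel" for u \<rho>
  proof -
    interpret prob_space \<rho> by fact
    note [measurable_cong] = that(2)
    show ?thesis
      by (rule integrable_const_bound[where B = 1]) (auto simp: indicator_def)
  qed
  \<comment> \<open>These weights are nonnegative for
    \<open>\<bar>c\<bar> + \<bar>d\<bar> \<le> 1\<close>. Subtracting the case (0, 0) from (1, 0)
    and (0, 1) recovers the real and imaginary parts of the exponential.\<close>
  define W where "W c d y = indicator C y * (1 + c * cos (h \<bullet> y) + d * sin (h \<bullet> y))" for c d y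
  have W_eq: "(LINT y|\<mu>. W c d y * indicator B (k \<bullet> y)) = (LINT y|\<nu>. W c d y * indicator B (k \<bullet> y))"
    if cd: "\<bar>c\<bar> + \<bar>d\<bar> \<le> 1" for c d
  proof (rule weighted_charfun_unique[where K = 2])
    have cs: "\<bar>c * cos (h \<bullet> y) + d * sin (h \<bullet> y)\<bar> \<le> 1" for y
    proof -
      have "\<bar>c * cos (h \<bullet> y)\<bar> \<le> \<bar>c\<bar>" "\<bar>d * sin (h \<bullet> y)\<bar> \<le> \<bar>d\<bar>"
        by (simp_all add: abs_mult mult_left_le)
      then show ?thesis using cd by linarith
    qed
    show "0 \<le> W c d y" "W c d y \<le> 2" for y
      using cs[of y] by (auto simp: W_def indicator_def)
    fix t :: real
    \<comment> \<open>Cosine and sine are combinations of exponentials in \<open>h\<close> and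
      \<open>- h\<close>, so the weighted characteristic function is a combination of the given ones
      at \<open>t k\<close>, \<open>t k + h\<close> and \<open>t k - h\<close>.\<close>
    have "(CLINT y|\<rho>. complex_of_real (W c d y) * iexp (t * (k \<bullet> y)))
        = (CLINT y|\<rho>. complex_of_real (indicator C y) * iexp ((t *\<^sub>R k) \<bullet> y))
        + (c / 2 - \<i> * d / 2) * (CLINT y|\<rho>. complex_of_real (indicator C y) * iexp ((t *\<^sub>R k + h) \<bullet> y))
        + (c / 2 + \<i> * d / 2) * (CLINT y|\<rho>. complex_of_real (indicator C y) * iexp ((t *\<^sub>R k - h) \<bullet> y))"
      (is "_ = ?R \<rho>") if \<rho>: "prob_space \<rho>" "sets \<rho> = sets borel" for \<rho>
    proof -
      have "complex_of_real (W c d y) * iexp (t * (k \<bullet> y))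
        = complex_of_real (indicator C y) * iexp ((t *\<^sub>R k) \<bullet> y)
        + (c / 2 - \<i> * d / 2) * (complex_of_real (indicator C y) * iexp ((t *\<^sub>R k + h) \<bullet> y))
        + (c / 2 + \<i> * d / 2) * (complex_of_real (indicator C y) * iexp ((t *\<^sub>R k - h) \<bullet> y))" for y
      proof -
        have e: "iexp ((t *\<^sub>R k + h) \<bullet> y) = iexp (t * (k \<bullet> y)) * iexp (h \<bullet> y)"
          "iexp ((t *\<^sub>R k - h) \<bullet> y) = iexp (t * (k \<bullet> y)) * iexp (- (h \<bullet> y))"
          by (simp_all add: inner_simps ring_distribs flip: exp_add)
        have cs: "complex_of_real (cos (h \<bullet> y)) = (iexp (h \<bullet> y) + iexp (- (h \<bullet> y))) / 2"
          "complex_of_real (sin (h \<bullet> y)) = - \<i> * (iexp (h \<bullet> y) - iexp (- (h \<bullet> y))) / 2"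
          by (simp_all add: complex_eq_iff Re_exp Im_exp)
        show ?thesis unfolding W_def e
          by (simp add: cs field_simps)
      qed
      then show ?thesis
        by (simp only: Bochner_Integration.integral_add Bochner_Integration.integrable_add
            integrable_mult_right integral_mult_right_zero ind[OF \<rho>])
    qed
    from this[OF \<mu>] this[OF \<nu>] show "(CLINT y|\<mu>. complex_of_real (W c d y) * iexp (t * (k \<bullet> y)))
        = (CLINT y|\<nu>. complex_of_real (W c d y) * iexp (t * (k \<bullet> y)))"
      by (simp only: eq)
    show "W c d \<in> borel_measurable \<mu>" unfolding W_def by measurable
  qed (use \<mu> \<nu> in auto)
  have lin: "(CLINT y|\<rho>. complex_of_real (indicator C' y) * iexp (h \<bullet> y))
      = complex_of_real ((LINT y|\<rho>. W 1 0 y * indicator B (k \<bullet> y)) - (LINT y|\<rho>. W 0 0 y * indicator B (k \<bullet> y)))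
      + \<i> * complex_of_real ((LINT y|\<rho>. W 0 1 y * indicator B (k \<bullet> y)) - (LINT y|\<rho>. W 0 0 y * indicator B (k \<bullet> y)))"
    if \<rho>: "prob_space \<rho>" "sets \<rho> = sets borel" for \<rho>
  proof -
    interpret prob_space \<rho> by fact
    note [measurable_cong] = that(2)
    have "\<bar>1 + c * cos (h \<bullet> y) + d * sin (h \<bullet> y)\<bar> \<le> 2" if "(c, d) \<in> {(0, 0), (1, 0), (0, 1)}" for c d y
    proof -
      have "\<bar>1 + c * a + d * b\<bar> \<le> 2" if "- 1 \<le> a" "a \<le> 1" "- 1 \<le> b" "b \<le> 1" for a b :: real
        using that \<open>(c, d) \<in> _\<close> by auto
      then show ?thesis by simp
    qed
    then have i: "integrable \<rho> (\<lambda>y. W c d y * indicator B (k \<bullet> y))" if "(c, d) \<in> {(0, 0), (1, 0), (0, 1)}" for c d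
      using that unfolding W_def
      by (intro integrable_const_bound[where B = 2] AE_I2) (auto simp: indicator_def)
    have "complex_of_real ((LINT y|\<rho>. W 1 0 y * indicator B (k \<bullet> y)) - (LINT y|\<rho>. W 0 0 y * indicator B (k \<bullet> y)))
      + \<i> * complex_of_real ((LINT y|\<rho>. W 0 1 y * indicator B (k \<bullet> y)) - (LINT y|\<rho>. W 0 0 y * indicator B (k \<bullet> y)))
      = (CLINT y|\<rho>. complex_of_real (W 1 0 y * indicator B (k \<bullet> y) - W 0 0 y * indicator B (k \<bullet> y))
        + \<i> * complex_of_real (W 0 1 y * indicator B (k \<bullet> y) - W 0 0 y * indicator B (k \<bullet> y)))"
      using i[of 1 0] i[of 0 1] i[of 0 0] by (simp del: of_real_mult)
    also have "\<dots> = (CLINT y|\<rho>. complex_of_real (indicator C' y) * iexp (h \<bullet> y))"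
      by (intro Bochner_Integration.integral_cong)
         (auto simp: W_def C'_def indicator_def complex_eq_iff Re_exp Im_exp)
    finally show ?thesis by simp
  qed
  show ?thesis using lin[OF \<mu>] lin[OF \<nu>] W_eq[of 1 0] W_eq[of 0 1] W_eq[of 0 0] by simp
qed

text \<open>The induction over the constraints of a cylinder carries the factor
  \<open>iexp (h \<bullet> y)\<close> along, because the next constraint needs the characteristic
  function of the measure restricted so far. At \<open>h = 0\<close> it gives the probabilities of
  cylinders, which are stable under intersection and generate the Borel sets.\<close>

theorem charfun_unique:
  fixes \<mu> \<nu> :: "'a::{real_inner, second_countable_topology} measure"
  assumes \<mu>: "prob_space \<mu>" "sets \<mu> = sets borel" and \<nu>: "prob_space \<nu>" "sets \<nu> = sets borel"
    and eq: "\<And>h. (CLINT y|\<mu>. iexp (h \<bullet> y)) = (CLINT y|\<nu>. iexp (h \<bullet> y))"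
  shows "\<mu> = \<nu>"
proof -
  interpret \<mu>: prob_space \<mu> by fact
  interpret \<nu>: prob_space \<nu> by fact
  define cyl where "cyl L = {y::'a. \<forall>(k, B)\<in>set L. k \<bullet> y \<in> B}" for L
  define E where "E = cyl ` {L. \<forall>(k, B)\<in>set L. B \<in> sets borel}"
  have cyl_Cons: "cyl ((k, B) # L) = cyl L \<inter> {y. k \<bullet> y \<in> B}" for k B L
    by (auto simp: cyl_def)
  have cyl_sets: "cyl L \<in> sets borel" if "\<forall>(k, B)\<in>set L. B \<in> sets borel" for L
    using that
  proof (induction L)
    case (Cons p L)
    obtain k B where p: "p = (k, B)" by force
    have [measurable]: "cyl L \<in> sets borel" "B \<in> sets borel" using Cons p by auto
    have "{y. k \<bullet> y \<in> B} \<in> sets borel" by measurable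
    then show ?case unfolding p cyl_Cons by measurable
  qed (simp add: cyl_def)
  have cyl_eq: "(CLINT y|\<mu>. complex_of_real (indicator (cyl L) y) * iexp (h \<bullet> y))
       = (CLINT y|\<nu>. complex_of_real (indicator (cyl L) y) * iexp (h \<bullet> y))"
    if "\<forall>(k, B)\<in>set L. B \<in> sets borel" for L h
    using that
  proof (induction L arbitrary: h)
    case Nil
    then show ?case using eq by (simp add: cyl_def)
  next
    case (Cons p L)
    obtain k B where p: "p = (k, B)" by force
    show ?case unfolding p cyl_Cons
      by (rule charfun_cylinder_step[OF \<mu> \<nu>]) (use Cons p cyl_sets in auto)
  qed
  show ?thesis
  proof (rule measure_eqI_generator_eq[where E = E and \<Omega> = UNIV and A = "\<lambda>_. UNIV"])
    show "Int_stable E"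
      unfolding Int_stable_def
    proof (intro ballI)
      fix X Y assume "X \<in> E" "Y \<in> E"
      then obtain L L' where L: "X = cyl L" "Y = cyl L'" "\<forall>(k, B)\<in>set L. B \<in> sets borel"
        "\<forall>(k, B)\<in>set L'. B \<in> sets borel" by (auto simp: E_def)
      then have "X \<inter> Y = cyl (L @ L')" by (auto simp: cyl_def)
      moreover have "\<forall>(k, B)\<in>set (L @ L'). B \<in> sets borel" using L by auto
      ultimately show "X \<inter> Y \<in> E" unfolding E_def by blast
    qed
    show "emeasure \<mu> X = emeasure \<nu> X" if "X \<in> E" for X
    proof -
      from that obtain L where L: "X = cyl L" "\<forall>(k, B)\<in>set L. B \<in> sets borel" by (auto simp: E_def)
      have X: "X \<in> sets \<mu>" "X \<in> sets \<nu>" using cyl_sets[OF L(2)] L \<mu> \<nu> by auto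
      have "complex_of_real (measure \<mu> X) = complex_of_real (measure \<nu> X)"
        using cyl_eq[OF L(2), of 0] X unfolding L(1)[symmetric] by simp
      then show ?thesis by (simp add: \<mu>.emeasure_eq_measure \<nu>.emeasure_eq_measure)
    qed
    have "sigma_sets UNIV E = sets borel"
    proof
      have "E \<subseteq> sets borel" using cyl_sets by (auto simp: E_def)
      then show "sigma_sets UNIV E \<subseteq> sets borel"
        using sets.sigma_sets_subset[of E borel] by simp
      have sE: "sets (sigma UNIV E) = sigma_sets UNIV E" by (rule sets_measure_of) simp
      have "(\<lambda>y. y) \<in> borel_measurable (sigma UNIV E)"
      proof (rule borel_measurable_inner_all, rule measurableI)
        fix k :: 'a and B :: "real set" assume "B \<in> sets borel"
        then have "cyl [(k, B)] \<in> E" unfolding E_def by auto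
        then show "(\<lambda>y. k \<bullet> y) -` B \<inter> space (sigma UNIV E) \<in> sets (sigma UNIV E)"
          unfolding sE by (auto simp: cyl_def vimage_def space_measure_of_conv intro: sigma_sets.Basic)
      qed simp
      then have "X \<in> sigma_sets UNIV E" if "X \<in> sets borel" for X
        using measurable_sets[OF _ that, of "\<lambda>y. y" "sigma UNIV E"] unfolding sE
        by (simp add: space_measure_of_conv)
      then show "sets borel \<subseteq> sigma_sets UNIV E" by blast
    qed
    then show "sets \<mu> = sigma_sets UNIV E" "sets \<nu> = sigma_sets UNIV E" using \<mu> \<nu> by auto
    have "cyl [] \<in> E" unfolding E_def by auto
    then show "range (\<lambda>_. UNIV) \<subseteq> E" by (auto simp: cyl_def)
  qed auto
qed

section \<open>Gaussian laws and their second moments\<close>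

text \<open>Dirac mass and normal density are both the law of \<open>sqrt v * u\<close> with
  \<open>u\<close> standard normal, which removes the case distinction of
  \<open>centered_gaussian\<close>.\<close>

lemma normal_law_conv_distr:
  assumes "v \<ge> 0"
  shows "(if v = 0 then return borel 0 else density lborel (normal_density 0 (sqrt v)))
       = distr std_normal_distribution borel (\<lambda>u. sqrt v * u)"
proof -
  interpret N: real_distribution std_normal_distribution by (rule real_dist_normal_dist)
  show ?thesis
  proof (cases "v = 0")
    case False
    have "distributed std_normal_distribution lborel (\<lambda>u. u) std_normal_density"
      by (auto simp: distributed_def intro!: measure_eqI simp: emeasure_distr)
    from N.normal_density_affine[OF this, of "sqrt v" 0]
    have "distr std_normal_distribution lborel (\<lambda>u. sqrt v * u) = density lborel (normal_density 0 (sqrt v))"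
      using False assms by (simp add: distributed_def)
    moreover have "distr std_normal_distribution lborel (\<lambda>u. sqrt v * u)
        = distr std_normal_distribution borel (\<lambda>u. sqrt v * u)"
      by (rule distr_cong) auto
    ultimately show ?thesis using False by simp
  qed simp
qed

lemma char_normal_law:
  "char (distr std_normal_distribution borel (\<lambda>u. c * u)) t = exp (- complex_of_real ((c * t)\<^sup>2 / 2))"
proof -
  have "char (distr std_normal_distribution borel (\<lambda>u. c * u)) t
      = (CLINT u|std_normal_distribution. iexp ((c * t) * u))"
    unfolding char_def by (subst integral_distr) (auto simp: mult_ac)
  also have "\<dots> = char std_normal_distribution (c * t)" by (simp add: char_def)
  finally show ?thesis by (simp add: char_std_normal_distribution exp_of_real[symmetric])
qed

definition has_gaussian_charfun :: "('a \<Rightarrow> 'a::real_inner) \<Rightarrow> 'a measure \<Rightarrow> bool" where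
  "has_gaussian_charfun B \<mu> \<longleftrightarrow> prob_space \<mu> \<and> sets \<mu> = sets borel \<and>
     (\<forall>h. (CLINT y|\<mu>. iexp (h \<bullet> y)) = exp (- complex_of_real ((B h \<bullet> h) / 2)))"

text \<open>On the line a law is determined by its characteristic function, and the value at
  \<open>t\<close> for the functional of \<open>h\<close> is the value at 1 for that of
  \<open>t *\<^sub>R h\<close>. One function of \<open>h\<close> therefore encodes all
  one-dimensional marginals.\<close>

lemma centered_gaussian_iff_charfun:
  fixes \<mu> :: "'a::{real_inner, second_countable_topology} measure"
  assumes B: "selfadjoint_nonneg B"
  shows "centered_gaussian B \<mu> \<longleftrightarrow> has_gaussian_charfun B \<mu>"
proof -
  have law: "(if B h \<bullet> h = 0 then return borel 0 else density lborel (normal_density 0 (sqrt (B h \<bullet> h))))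
      = distr std_normal_distribution borel (\<lambda>u. sqrt (B h \<bullet> h) * u)" for h
    using selfadjoint_nonnegD(3)[OF B] by (rule normal_law_conv_distr)
  have char_distr: "char (distr \<mu> borel (\<lambda>y. h \<bullet> y)) t = (CLINT y|\<mu>. iexp ((t *\<^sub>R h) \<bullet> y))"
    if [measurable_cong]: "sets \<mu> = sets borel" for t h
    unfolding char_def by (subst integral_distr) auto
  have quad: "B (t *\<^sub>R h) \<bullet> (t *\<^sub>R h) = (sqrt (B h \<bullet> h) * t)\<^sup>2" for t h
    using selfadjoint_nonnegD(1,3)[OF B]
    by (simp add: linear_scale bounded_linear.linear power_mult_distrib power2_eq_square)
  show ?thesis
    unfolding centered_gaussian_def law has_gaussian_charfun_def
  proof (intro iffI conjI allI; elim conjE)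
    fix h assume s: "sets \<mu> = sets borel"
      and "\<forall>h. distr \<mu> borel (\<lambda>y. h \<bullet> y) = distr std_normal_distribution borel (\<lambda>u. sqrt (B h \<bullet> h) * u)"
    then have "(CLINT y|\<mu>. iexp (h \<bullet> y))
        = char (distr std_normal_distribution borel (\<lambda>u. sqrt (B h \<bullet> h) * u)) 1"
      using char_distr[OF s, of h 1] by simp
    then show "(CLINT y|\<mu>. iexp (h \<bullet> y)) = exp (- complex_of_real ((B h \<bullet> h) / 2))"
      using quad[of 1 h] by (simp only: char_normal_law scaleR_one)
  next
    fix h assume p: "prob_space \<mu>" and s: "sets \<mu> = sets borel"
      and eq: "\<forall>h. (CLINT y|\<mu>. iexp (h \<bullet> y)) = exp (- complex_of_real ((B h \<bullet> h) / 2))"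
    interpret N: real_distribution std_normal_distribution by (rule real_dist_normal_dist)
    note [measurable_cong] = s
    show "distr \<mu> borel (\<lambda>y. h \<bullet> y) = distr std_normal_distribution borel (\<lambda>u. sqrt (B h \<bullet> h) * u)"
    proof (rule Levy_uniqueness)
      show "real_distribution (distr \<mu> borel (\<lambda>y. h \<bullet> y))"
        by (rule prob_space.real_distribution_distr[OF p]) measurable
      show "real_distribution (distr std_normal_distribution borel (\<lambda>u. sqrt (B h \<bullet> h) * u))"
        by (rule N.real_distribution_distr) measurable
      show "char (distr \<mu> borel (\<lambda>y. h \<bullet> y))
          = char (distr std_normal_distribution borel (\<lambda>u. sqrt (B h \<bullet> h) * u))"
        by (rule ext) (simp only: char_distr[OF s] eq[rule_format] quad char_normal_law)
    qed
  qed auto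
qed

lemma has_gaussian_charfun_unique:
  fixes \<mu> :: "'a::{real_inner, second_countable_topology} measure"
  assumes "has_gaussian_charfun B \<mu>" "has_gaussian_charfun B \<nu>"
  shows "\<mu> = \<nu>"
  using assms by (intro charfun_unique) (auto simp: has_gaussian_charfun_def)

text \<open>The nonnegative self-adjoint trace class operators, with a sequence along which squared
  norms can be expanded.\<close>

definition covariance :: "('a \<Rightarrow> 'a::real_inner) \<Rightarrow> bool" where
  "covariance B \<longleftrightarrow> selfadjoint_nonneg B \<and> (\<exists>e. parseval e \<and> summable (\<lambda>n. B (e n) \<bullet> e n))"

text \<open>Parseval's identity reduces the squared norm to one-dimensional variances. With
  nonnegative integrals the sum can be exchanged with the integral before integrability is
  known.\<close>

lemma gaussian_second_moment:
  fixes \<mu> :: "'a::{real_inner, second_countable_topology} measure"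
  assumes B: "selfadjoint_nonneg B" and \<mu>: "centered_gaussian B \<mu>"
    and e: "parseval e" "summable (\<lambda>n. B (e n) \<bullet> e n)"
  shows "(\<integral>\<^sup>+y. ennreal ((norm y)\<^sup>2) \<partial>\<mu>) = ennreal (\<Sum>n. B (e n) \<bullet> e n)"
proof -
  have [measurable_cong]: "sets \<mu> = sets borel" using \<mu> by (simp add: centered_gaussian_def)
  have mom: "(\<integral>\<^sup>+y. ennreal ((y \<bullet> h)\<^sup>2) \<partial>\<mu>) = ennreal (B h \<bullet> h)" for h
  proof -
    have pos: "0 \<le> B h \<bullet> h" by (rule selfadjoint_nonnegD(3)[OF B])
    have "(\<integral>\<^sup>+y. ennreal ((y \<bullet> h)\<^sup>2) \<partial>\<mu>) = (\<integral>\<^sup>+u. ennreal (u\<^sup>2) \<partial>distr \<mu> borel (\<lambda>y. h \<bullet> y))"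
      by (subst nn_integral_distr) (auto simp: inner_commute)
    also have "distr \<mu> borel (\<lambda>y. h \<bullet> y) = distr std_normal_distribution borel (\<lambda>u. sqrt (B h \<bullet> h) * u)"
      using \<mu> normal_law_conv_distr[OF pos] by (simp add: centered_gaussian_def)
    also have "(\<integral>\<^sup>+u. ennreal (u\<^sup>2) \<partial>\<dots>) = (\<integral>\<^sup>+u. ennreal (B h \<bullet> h) * ennreal (u\<^sup>2) \<partial>std_normal_distribution)"
      using pos by (subst nn_integral_distr) (auto simp: power_mult_distrib ennreal_mult)
    also have "\<dots> = ennreal (B h \<bullet> h) * (\<integral>\<^sup>+u. ennreal (u\<^sup>2) \<partial>std_normal_distribution)"
      by (rule nn_integral_cmult) simp
    also have "(\<integral>\<^sup>+u. ennreal (u\<^sup>2) \<partial>std_normal_distribution) = ennreal 1"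
      using std_normal_distribution_even_moments[of 1]
      by (subst nn_integral_eq_integral) (auto simp: fact_2)
    finally show ?thesis by simp
  qed
  have "(\<integral>\<^sup>+y. ennreal ((norm y)\<^sup>2) \<partial>\<mu>) = (\<integral>\<^sup>+y. (\<Sum>n. ennreal ((y \<bullet> e n)\<^sup>2)) \<partial>\<mu>)"
  proof (rule nn_integral_cong)
    fix y
    have "(\<lambda>n. (y \<bullet> e n)\<^sup>2) sums (norm y)\<^sup>2" using e(1) by (simp add: parseval_def)
    then show "ennreal ((norm y)\<^sup>2) = (\<Sum>n. ennreal ((y \<bullet> e n)\<^sup>2))"
      by (subst suminf_ennreal2) (auto simp: sums_iff)
  qed
  also have "\<dots> = (\<Sum>n. \<integral>\<^sup>+y. ennreal ((y \<bullet> e n)\<^sup>2) \<partial>\<mu>)"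
    by (rule nn_integral_suminf) measurable
  also have "\<dots> = ennreal (\<Sum>n. B (e n) \<bullet> e n)"
    unfolding mom using selfadjoint_nonnegD(3)[OF B] e(2) by (intro suminf_ennreal2)
  finally show ?thesis .
qed

section \<open>Existence of Gaussian measures\<close>

lemma white_noise_charfun:
  fixes c :: "nat \<Rightarrow> real"
  defines "P \<equiv> PiM UNIV (\<lambda>_::nat. std_normal_distribution)"
  assumes "finite A"
  shows "(CLINT \<omega>|P. iexp (\<Sum>i\<in>A. c i * \<omega> i)) = exp (- complex_of_real ((\<Sum>i\<in>A. (c i)\<^sup>2) / 2))"
proof -
  interpret N: real_distribution std_normal_distribution by (rule real_dist_normal_dist)
  interpret P: product_prob_space "\<lambda>_::nat. std_normal_distribution" UNIV ..
  interpret prob_space P unfolding P_def by (rule P.P.prob_space_axioms)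
  have comp: "distr P std_normal_distribution (\<lambda>\<omega>. \<omega> i) = std_normal_distribution" for i
    unfolding P_def by (rule P.PiM_component) simp
  have rv: "(\<lambda>\<omega>. \<omega> i) \<in> measurable P std_normal_distribution" for i
    unfolding P_def by measurable
  then have [measurable]: "(\<lambda>\<omega>. \<omega> i) \<in> borel_measurable P" for i by simp
  have "distr P (\<Pi>\<^sub>M i\<in>UNIV. std_normal_distribution) (\<lambda>x. \<lambda>i\<in>UNIV. x i) = P"
    by (simp add: P_def restrict_UNIV)
  then have "indep_vars (\<lambda>_. std_normal_distribution) (\<lambda>i \<omega>. \<omega> i) UNIV"
    by (subst indep_vars_iff_distr_eq_PiM[OF _ rv]) (simp_all only: comp, simp_all add: P_def)
  then have "indep_vars (\<lambda>_. std_normal_distribution) (\<lambda>i \<omega>. \<omega> i) A"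
    by (rule indep_vars_subset) simp
  then have "indep_vars (\<lambda>_. borel) (\<lambda>i \<omega>. c i * \<omega> i) A"
    by (rule indep_vars_compose2) auto
  note ind = this
  have law: "distr P borel (\<lambda>\<omega>. c i * \<omega> i) = distr std_normal_distribution borel (\<lambda>u. c i * u)" for i
  proof -
    have "distr P borel (\<lambda>\<omega>. c i * \<omega> i)
        = distr (distr P std_normal_distribution (\<lambda>\<omega>. \<omega> i)) borel (\<lambda>u. c i * u)"
      by (subst distr_distr[OF _ rv]) (auto simp: o_def)
    then show ?thesis by (simp only: comp)
  qed
  from char_distr_sum[OF ind, of 1]
  have "char (distr P borel (\<lambda>\<omega>. \<Sum>i\<in>A. c i * \<omega> i)) 1 = (\<Prod>i\<in>A. char (distr P borel (\<lambda>\<omega>. c i * \<omega> i)) 1)" .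
  also have "char (distr P borel (\<lambda>\<omega>. \<Sum>i\<in>A. c i * \<omega> i)) 1 = (CLINT \<omega>|P. iexp (\<Sum>i\<in>A. c i * \<omega> i))"
    unfolding char_def by (subst integral_distr) auto
  finally show ?thesis
    by (simp add: law char_normal_law exp_sum[symmetric] assms(2) sum_negf sum_divide_distrib)
qed

text \<open>The Gaussian vector is the almost sure limit, along a subsequence, of the partial sums of
  \<open>\<Sum> \<omega>\<^sub>n R e\<^sub>n\<close>, where \<open>R\<^sup>2 = B\<close> and the \<open>\<omega>\<^sub>n\<close> are independent standard Gaussian variables.\<close>

theorem gaussian_exists:
  fixes B :: "'a \<Rightarrow> 'a::{real_inner, banach, second_countable_topology}"
  assumes "covariance B"
  shows "\<exists>\<mu>. centered_gaussian B \<mu>"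
proof -
  from assms obtain e where B: "selfadjoint_nonneg B" and e: "parseval e" "summable (\<lambda>n. B (e n) \<bullet> e n)"
    by (auto simp: covariance_def)
  define v where "v n = op_sqrt B (e n)" for n
  note R = selfadjoint_nonnegD(2)[OF op_sqrt(1)[OF B]] op_sqrt(2)[OF B]
  have norm_v: "(norm (v n))\<^sup>2 = B (e n) \<bullet> e n" for n
    unfolding v_def power2_norm_eq_inner by (metis R)
  have v_sums: "(\<lambda>n. (h \<bullet> v n)\<^sup>2) sums (B h \<bullet> h)" for h
  proof -
    have "(\<lambda>n. (op_sqrt B h \<bullet> e n)\<^sup>2) sums (norm (op_sqrt B h))\<^sup>2"
      using e(1) by (simp add: parseval_def)
    moreover have "(norm (op_sqrt B h))\<^sup>2 = B h \<bullet> h"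
      unfolding power2_norm_eq_inner by (metis R)
    moreover have "op_sqrt B h \<bullet> e n = h \<bullet> v n" for n unfolding v_def by (rule R)
    ultimately show ?thesis by simp
  qed
  interpret N: real_distribution std_normal_distribution by (rule real_dist_normal_dist)
  interpret PP: product_prob_space "\<lambda>_::nat. std_normal_distribution" UNIV ..
  define P where "P = PiM UNIV (\<lambda>_::nat. std_normal_distribution)"
  interpret prob_space P unfolding P_def by (rule PP.P.prob_space_axioms)
  have [measurable]: "(\<lambda>\<omega>. \<omega> i) \<in> borel_measurable P" for i
  proof -
    have "(\<lambda>\<omega>. \<omega> i) \<in> measurable P std_normal_distribution" unfolding P_def by measurable
    then show ?thesis by simp
  qed
  have char: "(CLINT \<omega>|P. iexp (h \<bullet> (\<Sum>n\<in>A. \<omega> n *\<^sub>R v n))) = exp (- complex_of_real ((\<Sum>n\<in>A. (h \<bullet> v n)\<^sup>2) / 2))"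
    if "finite A" for A h
    unfolding P_def using white_noise_charfun[OF that, of "\<lambda>n. h \<bullet> v n"]
    by (simp add: inner_sum_right mult.commute)
  have mom: "(\<integral>\<^sup>+\<omega>. ennreal ((norm (\<Sum>n\<in>A. \<omega> n *\<^sub>R v n))\<^sup>2) \<partial>P) = ennreal (\<Sum>n\<in>A. (norm (v n))\<^sup>2)"
    if A: "finite A" for A
  proof -
    \<comment> \<open>The finite rank covariance of the partial sum; its second moment is the trace
      of this operator.\<close>
    define C where "C h = (\<Sum>n\<in>A. (h \<bullet> v n) *\<^sub>R v n)" for h
    have Ch: "C h \<bullet> h = (\<Sum>n\<in>A. (h \<bullet> v n)\<^sup>2)" for h
      by (simp add: C_def inner_sum_left inner_sum_right power2_eq_square inner_commute)
    have C: "selfadjoint_nonneg C"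
      unfolding selfadjoint_nonneg_def
    proof (intro conjI allI)
      show "bounded_linear C" unfolding C_def
        by (intro bounded_linear_sum bounded_linear_scaleR_const
            bounded_linear_inner_left)
      show "C x \<bullet> y = x \<bullet> C y" for x y
        by (simp add: C_def inner_sum_left inner_sum_right inner_commute mult.commute)
      show "0 \<le> C x \<bullet> x" for x by (simp add: Ch sum_nonneg)
    qed
    have [measurable]: "(\<lambda>\<omega>. \<Sum>n\<in>A. \<omega> n *\<^sub>R v n) \<in> borel_measurable P" by measurable
    let ?\<gamma> = "distr P borel (\<lambda>\<omega>. \<Sum>n\<in>A. \<omega> n *\<^sub>R v n)"
    have "has_gaussian_charfun C ?\<gamma>"
      unfolding has_gaussian_charfun_def
      by (auto simp: integral_distr char[OF A] Ch prob_space_distr)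
    then have \<gamma>: "centered_gaussian C ?\<gamma>" using centered_gaussian_iff_charfun[OF C] by blast
    have "(\<lambda>j. \<Sum>n\<in>A. (e j \<bullet> v n)\<^sup>2) sums (\<Sum>n\<in>A. (norm (v n))\<^sup>2)"
      using e(1) unfolding parseval_def by (intro sums_sum) (subst inner_commute, blast)
    then have tr: "(\<lambda>j. C (e j) \<bullet> e j) sums (\<Sum>n\<in>A. (norm (v n))\<^sup>2)"
      by (simp only: Ch)
    have "(\<integral>\<^sup>+\<omega>. ennreal ((norm (\<Sum>n\<in>A. \<omega> n *\<^sub>R v n))\<^sup>2) \<partial>P) = (\<integral>\<^sup>+y. ennreal ((norm y)\<^sup>2) \<partial>?\<gamma>)"
      by (subst nn_integral_distr) auto
    also have "\<dots> = ennreal (\<Sum>n\<in>A. (norm (v n))\<^sup>2)"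
      using gaussian_second_moment[OF C \<gamma> e(1)] tr by (simp add: sums_iff)
    finally show ?thesis .
  qed
  have "summable (\<lambda>n. (norm (v n))\<^sup>2)" using e(2) by (simp add: norm_v)
  \<comment> \<open>Tails below \<open>(1/4) ^ j\<close> make the first moments of consecutive
    blocks of order \<open>(1/2) ^ j\<close>, hence summable.\<close>
  then have "\<exists>N. \<forall>k\<ge>N. \<forall>m. (\<Sum>n\<in>{k..<m}. (norm (v n))\<^sup>2) < (1/4) ^ j" for j
    unfolding summable_Cauchy by (auto simp: sum_nonneg dest: spec[of _ "(1/4) ^ j"])
  then obtain N where N: "\<And>j k m. N j \<le> k \<Longrightarrow> (\<Sum>n\<in>{k..<m}. (norm (v n))\<^sup>2) < (1/4) ^ j"
    by metis
  \<comment> \<open>The cumulative sum makes the subsequence increasing and at least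
    \<open>N j\<close>; the summand \<open>j\<close> sends it to infinity, so that it exhausts the
    series.\<close>
  define \<sigma> where "\<sigma> j = (\<Sum>i\<le>j. N i) + j" for j
  have "N j \<le> (\<Sum>i\<le>j. N i)" for j by (rule member_le_sum) auto
  then have \<sigma>: "N j \<le> \<sigma> j" "\<sigma> j \<le> \<sigma> (Suc j)" for j
    by (auto simp: \<sigma>_def intro: trans_le_add1)
  define Y where "Y m \<omega> = (\<Sum>n\<in>{..<m}. \<omega> n *\<^sub>R v n)" for m \<omega>
  have [measurable]: "Y m \<in> borel_measurable P" for m unfolding Y_def by measurable
  have "AE \<omega> in P. convergent (\<lambda>j. Y (\<sigma> j) \<omega>)"
  proof -
    have "(\<integral>\<^sup>+\<omega>. ennreal (norm (Y (\<sigma> (Suc j)) \<omega> - Y (\<sigma> j) \<omega>)) \<partial>P) \<le> ennreal (2 * (1/2) ^ j)" for j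
    proof -
      have D: "Y (\<sigma> (Suc j)) \<omega> - Y (\<sigma> j) \<omega> = (\<Sum>n\<in>{\<sigma> j..<\<sigma> (Suc j)}. \<omega> n *\<^sub>R v n)" for \<omega>
        unfolding Y_def lessThan_atLeast0 by (rule sum_diff_nat_ivl) (use \<sigma> in auto)
      \<comment> \<open>A pointwise substitute for Cauchy-Schwarz, passing from second to first
        moments. The weights are balanced so that each of the two terms contributes at most
        \<open>(1/2) ^ j\<close>.\<close>
      have pt: "norm x \<le> (1/2) ^ j + 2 ^ j * (norm x)\<^sup>2" for x :: 'a
      proof (cases "norm x \<le> (1/2) ^ j")
        case True
        then show ?thesis by (meson add_increasing2 mult_nonneg_nonneg zero_le_power zero_le_numeral zero_le_power2)
      next
        case False
        then have "1 \<le> 2 ^ j * norm x" by (simp add: field_simps power_one_over)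
        then have "1 * norm x \<le> 2 ^ j * norm x * norm x" by (rule mult_right_mono) simp
        also have "\<dots> \<le> (1/2) ^ j + 2 ^ j * (norm x)\<^sup>2" by (simp add: power2_eq_square)
        finally show ?thesis by simp
      qed
      have "(\<integral>\<^sup>+\<omega>. ennreal (norm (Y (\<sigma> (Suc j)) \<omega> - Y (\<sigma> j) \<omega>)) \<partial>P)
          \<le> (\<integral>\<^sup>+\<omega>. ennreal ((1/2) ^ j) + ennreal (2 ^ j) *
                ennreal ((norm (\<Sum>n\<in>{\<sigma> j..<\<sigma> (Suc j)}. \<omega> n *\<^sub>R v n))\<^sup>2) \<partial>P)"
        unfolding D using pt
        by (intro nn_integral_mono) (simp flip: ennreal_mult ennreal_plus)
      also have "\<dots> = ennreal ((1/2) ^ j) + ennreal (2 ^ j) *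
                (\<integral>\<^sup>+\<omega>. ennreal ((norm (\<Sum>n\<in>{\<sigma> j..<\<sigma> (Suc j)}. \<omega> n *\<^sub>R v n))\<^sup>2) \<partial>P)"
        by (subst nn_integral_add) (auto simp: nn_integral_cmult emeasure_space_1)
      also have "\<dots> = ennreal ((1/2) ^ j + 2 ^ j * (\<Sum>n\<in>{\<sigma> j..<\<sigma> (Suc j)}. (norm (v n))\<^sup>2))"
        by (subst mom) (auto simp: sum_nonneg simp flip: ennreal_mult ennreal_plus)
      also have "\<dots> \<le> ennreal ((1/2) ^ j + 2 ^ j * (1/4) ^ j)"
        using N[OF \<sigma>(1), of j] by (intro ennreal_leI add_left_mono mult_left_mono less_imp_le) auto
      also have "2 ^ j * (1/4) ^ j = (1/2 :: real) ^ j" by (simp flip: power_mult_distrib)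
      finally show ?thesis by simp
    qed
    then have "(\<integral>\<^sup>+\<omega>. (\<Sum>j. ennreal (norm (Y (\<sigma> (Suc j)) \<omega> - Y (\<sigma> j) \<omega>))) \<partial>P) \<le> (\<Sum>j. ennreal (2 * (1/2) ^ j))"
      by (subst nn_integral_suminf) (auto intro!: suminf_le)
    also have "\<dots> = ennreal (\<Sum>j. 2 * (1/2) ^ j)"
      by (intro suminf_ennreal2 summable_mult summable_geometric) auto
    finally have "(\<integral>\<^sup>+\<omega>. (\<Sum>j. ennreal (norm (Y (\<sigma> (Suc j)) \<omega> - Y (\<sigma> j) \<omega>))) \<partial>P) \<noteq> \<infinity>"
      by (auto simp: top_unique)
    then have "AE \<omega> in P. (\<Sum>j. ennreal (norm (Y (\<sigma> (Suc j)) \<omega> - Y (\<sigma> j) \<omega>))) \<noteq> \<infinity>"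
      by (intro nn_integral_PInf_AE) measurable
    then show ?thesis
    proof eventually_elim
      case (elim \<omega>)
      then have "summable (\<lambda>j. norm (Y (\<sigma> (Suc j)) \<omega> - Y (\<sigma> j) \<omega>))"
        by (intro summable_suminf_not_top) auto
      then have "summable (\<lambda>j. Y (\<sigma> (Suc j)) \<omega> - Y (\<sigma> j) \<omega>)" by (rule summable_norm_cancel)
      then have "convergent (\<lambda>n. (\<Sum>j<n. Y (\<sigma> (Suc j)) \<omega> - Y (\<sigma> j) \<omega>))"
        by (simp add: summable_iff_convergent)
      then have "convergent (\<lambda>n. Y (\<sigma> n) \<omega> - Y (\<sigma> 0) \<omega>)"
        using sum_lessThan_telescope[of "\<lambda>j. Y (\<sigma> j) \<omega>"] by simp
      then have "convergent (\<lambda>n. Y (\<sigma> n) \<omega> - Y (\<sigma> 0) \<omega> + Y (\<sigma> 0) \<omega>)"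
        by (intro convergent_add convergent_const)
      then show ?case by simp
    qed
  qed
  then have lim: "AE \<omega> in P. (\<lambda>j. Y (\<sigma> j) \<omega>) \<longlonglongrightarrow> lim (\<lambda>j. Y (\<sigma> j) \<omega>)"
    by eventually_elim (simp add: convergent_LIMSEQ_iff)
  define Z where "Z \<omega> = lim (\<lambda>j. Y (\<sigma> j) \<omega>)" for \<omega>
  have [measurable]: "Z \<in> borel_measurable P" unfolding Z_def by measurable
  have "(CLINT \<omega>|P. iexp (h \<bullet> Z \<omega>)) = exp (- complex_of_real ((B h \<bullet> h) / 2))" for h
  proof (rule LIMSEQ_unique)
    show "(\<lambda>j. CLINT \<omega>|P. iexp (h \<bullet> Y (\<sigma> j) \<omega>)) \<longlonglongrightarrow> (CLINT \<omega>|P. iexp (h \<bullet> Z \<omega>))"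
    proof (rule integral_dominated_convergence[where w = "\<lambda>_. 1"])
      show "AE \<omega> in P. (\<lambda>j. iexp (h \<bullet> Y (\<sigma> j) \<omega>)) \<longlonglongrightarrow> iexp (h \<bullet> Z \<omega>)"
        using lim by eventually_elim (auto simp: Z_def intro!: tendsto_intros)
    qed auto
    have \<sigma>_lim: "filterlim \<sigma> at_top sequentially"
      by (rule filterlim_at_top_mono[OF filterlim_ident]) (simp add: \<sigma>_def)
    have "(\<lambda>j. \<Sum>n\<in>{..<\<sigma> j}. (h \<bullet> v n)\<^sup>2) \<longlonglongrightarrow> B h \<bullet> h"
      using v_sums[of h] \<sigma>_lim unfolding sums_def by (rule filterlim_compose)
    then have "(\<lambda>j. exp (- complex_of_real ((\<Sum>n\<in>{..<\<sigma> j}. (h \<bullet> v n)\<^sup>2) / 2))) \<longlonglongrightarrow> exp (- complex_of_real ((B h \<bullet> h) / 2))"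
      by (intro tendsto_intros) auto
    then show "(\<lambda>j. CLINT \<omega>|P. iexp (h \<bullet> Y (\<sigma> j) \<omega>)) \<longlonglongrightarrow> exp (- complex_of_real ((B h \<bullet> h) / 2))"
      unfolding Y_def by (simp add: char)
  qed
  then have "has_gaussian_charfun B (distr P borel Z)"
    unfolding has_gaussian_charfun_def by (auto simp: integral_distr prob_space_distr)
  then show ?thesis using centered_gaussian_iff_charfun[OF B] by blast
qed

lemma gaussian_charfun:
  assumes "covariance B"
  shows "has_gaussian_charfun B (gaussian B)"
proof -
  have "centered_gaussian B (gaussian B)"
    unfolding gaussian_def by (rule someI_ex[OF gaussian_exists[OF assms]])
  then show ?thesis using assms centered_gaussian_iff_charfun by (auto simp: covariance_def)
qed

lemma gaussian_prob_space: "covariance B \<Longrightarrow> prob_space (gaussian B)"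
  and sets_gaussian: "covariance B \<Longrightarrow> sets (gaussian B) = sets borel"
  using gaussian_charfun by (auto simp: has_gaussian_charfun_def)

lemma gaussian_eqI: "covariance B \<Longrightarrow> has_gaussian_charfun B \<mu> \<Longrightarrow> gaussian B = \<mu>"
  using gaussian_charfun has_gaussian_charfun_unique by blast

text \<open>Characteristic functions of independent summands multiply, and quadratic forms add. The
  second summand is the image under \<open>L\<close> of an arbitrary probability space, so that one
  statement serves for images under the semigroup, for scaled copies of a covariance and for a
  one-dimensional component.\<close>

lemma gaussian_convolution:
  fixes L :: "'b \<Rightarrow> 'a::{real_inner, banach, polish_space}"
  assumes B: "covariance B" and B1: "covariance B1"
    and N: "prob_space N" and L: "L \<in> borel_measurable N"
    and char: "\<And>h. (CLINT z|N. iexp (h \<bullet> L z)) = exp (- complex_of_real (q h / 2))"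
    and q: "\<And>h. B h \<bullet> h = B1 h \<bullet> h + q h"
  shows "gaussian B = distr (N \<Otimes>\<^sub>M gaussian B1) borel (\<lambda>(z, y). y + L z)"
proof (rule gaussian_eqI[OF B])
  interpret G: prob_space "gaussian B1" by (rule gaussian_prob_space[OF B1])
  interpret N: prob_space N by fact
  interpret pair_prob_space N "gaussian B1" ..
  note [measurable_cong] = sets_gaussian[OF B1]
  note [measurable] = L
  have "(CLINT y|distr (N \<Otimes>\<^sub>M gaussian B1) borel (\<lambda>(z, y). y + L z). iexp (h \<bullet> y))
      = exp (- complex_of_real ((B h \<bullet> h) / 2))" for h
  proof -
    have "(CLINT y|distr (N \<Otimes>\<^sub>M gaussian B1) borel (\<lambda>(z, y). y + L z). iexp (h \<bullet> y))
        = (CLINT p|N \<Otimes>\<^sub>M gaussian B1. iexp (h \<bullet> L (fst p)) * iexp (h \<bullet> snd p))"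
      by (subst integral_distr) (auto simp: case_prod_unfold inner_add_right ring_distribs exp_add mult.commute)
    also have "\<dots> = (CLINT z|N. CLINT y|gaussian B1. iexp (h \<bullet> L z) * iexp (h \<bullet> y))"
      by (subst integral_fst'[symmetric])
         (auto intro!: P.integrable_const_bound[where B = 1] simp: norm_mult)
    also have "\<dots> = exp (- complex_of_real (B1 h \<bullet> h / 2)) * exp (- complex_of_real (q h / 2))"
      using gaussian_charfun[OF B1] by (simp add: char has_gaussian_charfun_def)
    also have "\<dots> = exp (- complex_of_real ((B h \<bullet> h) / 2))"
      unfolding q by (simp add: exp_add[symmetric] add_divide_distrib)
    finally show ?thesis .
  qed
  moreover have "prob_space (distr (N \<Otimes>\<^sub>M gaussian B1) borel (\<lambda>(z, y). y + L z))"
    by (rule P.prob_space_distr) measurable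
  ultimately show "has_gaussian_charfun B (distr (N \<Otimes>\<^sub>M gaussian B1) borel (\<lambda>(z, y). y + L z))"
    by (simp add: has_gaussian_charfun_def)
qed

section \<open>Translation invariant operators\<close>

text \<open>The properties of \<open>f \<mapsto> (\<lambda>z. \<integral> f (z + y) m(dy))\<close> for a signed measure \<open>m\<close> of total variation at
  most \<open>N\<close>.\<close>

definition conv_op :: "real \<Rightarrow> (('a::real_normed_vector \<Rightarrow> real) \<Rightarrow> 'a \<Rightarrow> real) \<Rightarrow> bool" where
  "conv_op N K \<longleftrightarrow> 0 \<le> N \<and>
     (\<forall>f g c. f \<in> bcontfun \<longrightarrow> g \<in> bcontfun \<longrightarrow> K (\<lambda>x. f x + c * g x) = (\<lambda>x. K f x + c * K g x)) \<and>
     (\<forall>f c z. f \<in> bcontfun \<longrightarrow> (\<forall>x. \<bar>f x\<bar> \<le> c) \<longrightarrow> \<bar>K f z\<bar> \<le> N * c) \<and>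
     (\<forall>f w. f \<in> bcontfun \<longrightarrow> K (\<lambda>x. f (x + w)) = (\<lambda>z. K f (z + w))) \<and>
     (\<forall>F f c z. (\<forall>j. F j \<in> bcontfun) \<longrightarrow> f \<in> bcontfun \<longrightarrow> (\<forall>j x. \<bar>F j x\<bar> \<le> c) \<longrightarrow>
        (\<forall>x. (\<lambda>j. F j x) \<longlonglongrightarrow> f x) \<longrightarrow> (\<lambda>j. K (F j) z) \<longlonglongrightarrow> K f z)"

lemma bcontfunI:
  fixes f :: "'a::topological_space \<Rightarrow> real"
  assumes "continuous_on UNIV f" "\<And>x. \<bar>f x\<bar> \<le> c"
  shows "f \<in> bcontfun"
  using assms by (auto simp: bcontfun_def bounded_iff)

lemma bcontfunD:
  fixes f :: "'a::topological_space \<Rightarrow> real"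
  assumes "f \<in> bcontfun"
  shows "continuous_on UNIV f \<and> (\<exists>c\<ge>0. \<forall>x. \<bar>f x\<bar> \<le> c)"
proof -
  from assms obtain c where "continuous_on UNIV f" "\<And>x. \<bar>f x\<bar> \<le> c"
    by (auto simp: bcontfun_def bounded_iff)
  moreover then have "c \<ge> 0" using abs_ge_zero order_trans by blast
  ultimately show ?thesis by blast
qed

lemma bcontfun_shift:
  fixes f :: "'a::real_normed_vector \<Rightarrow> real"
  assumes "f \<in> bcontfun"
  shows "(\<lambda>x. f (x + w)) \<in> bcontfun"
proof -
  obtain c where c: "continuous_on UNIV f" "\<And>x. \<bar>f x\<bar> \<le> c" using assms bcontfunD by blast
  have "continuous_on UNIV (\<lambda>x. f (x + w))"
    by (intro continuous_on_compose2[OF c(1)] continuous_intros) auto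
  then show ?thesis using c(2) by (rule bcontfunI)
qed

lemma bcontfun_lincomb:
  fixes f g :: "'a::topological_space \<Rightarrow> real"
  assumes "f \<in> bcontfun" "g \<in> bcontfun"
  shows "(\<lambda>x. f x + c * g x) \<in> bcontfun"
proof -
  obtain a where a: "continuous_on UNIV f" "\<And>x. \<bar>f x\<bar> \<le> a" using assms bcontfunD by blast
  obtain b where b: "continuous_on UNIV g" "\<And>x. \<bar>g x\<bar> \<le> b" using assms bcontfunD by blast
  have "\<bar>f x + c * g x\<bar> \<le> a + \<bar>c\<bar> * b" for x
    using a(2)[of x] mult_left_mono[OF b(2)[of x], of "\<bar>c\<bar>"] by (simp add: abs_mult[symmetric])
  moreover have "continuous_on UNIV (\<lambda>x. f x + c * g x)" by (intro continuous_intros a b)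
  ultimately show ?thesis by (intro bcontfunI)
qed

context
  fixes N :: real and K :: "('a::real_normed_vector \<Rightarrow> real) \<Rightarrow> 'a \<Rightarrow> real"
  assumes K: "conv_op N K"
begin

lemma conv_op_nonneg: "0 \<le> N"
  using K by (simp add: conv_op_def)

lemma conv_op_lincomb:
  "f \<in> bcontfun \<Longrightarrow> g \<in> bcontfun \<Longrightarrow> K (\<lambda>x. f x + c * g x) z = K f z + c * K g z"
  using K by (simp add: conv_op_def)

lemma conv_op_bound: "f \<in> bcontfun \<Longrightarrow> (\<And>x. \<bar>f x\<bar> \<le> c) \<Longrightarrow> \<bar>K f z\<bar> \<le> N * c"
  using K by (simp add: conv_op_def)

lemma conv_op_shift: "f \<in> bcontfun \<Longrightarrow> K (\<lambda>x. f (x + w)) z = K f (z + w)"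
  using K by (simp add: conv_op_def)

lemma conv_op_tendsto:
  "(\<And>j. F j \<in> bcontfun) \<Longrightarrow> f \<in> bcontfun \<Longrightarrow> (\<And>j x. \<bar>F j x\<bar> \<le> c) \<Longrightarrow>
    (\<And>x. (\<lambda>j. F j x) \<longlonglongrightarrow> f x) \<Longrightarrow> (\<lambda>j. K (F j) z) \<longlonglongrightarrow> K f z"
  using K unfolding conv_op_def by blast

text \<open>Translation invariance absorbs the moving evaluation point into the function, which
  leaves a limit at the fixed point 0. This is why the functions must converge along every
  convergent sequence of points.\<close>

lemma conv_op_tendsto2:
  assumes "\<And>j. F j \<in> bcontfun" "f \<in> bcontfun" "\<And>j x. \<bar>F j x\<bar> \<le> c"
    and lim: "\<And>x \<xi>. \<xi> \<longlonglongrightarrow> x \<Longrightarrow> (\<lambda>j. F j (\<xi> j)) \<longlonglongrightarrow> f x" and z: "\<zeta> \<longlonglongrightarrow> z"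
  shows "(\<lambda>j. K (F j) (\<zeta> j)) \<longlonglongrightarrow> K f z"
proof -
  have "(\<lambda>j. K (\<lambda>x. F j (x + \<zeta> j)) 0) \<longlonglongrightarrow> K (\<lambda>x. f (x + z)) 0"
    using assms by (intro conv_op_tendsto[where c = c] bcontfun_shift lim tendsto_intros) auto
  then show ?thesis using assms by (simp add: conv_op_shift)
qed

text \<open>Continuity of \<open>K f\<close> is the limit property applied to translates of
  \<open>f\<close>.\<close>

lemma conv_op_bcontfun:
  assumes f: "f \<in> bcontfun"
  shows "K f \<in> bcontfun"
proof -
  obtain c where c: "continuous_on UNIV f" "\<And>x. \<bar>f x\<bar> \<le> c" using bcontfunD[OF f] by blast
  have "continuous_on UNIV (K f)"
    unfolding continuous_on_sequentially
  proof (intro ballI allI impI; elim conjE)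
    fix x :: 'a and z :: "nat \<Rightarrow> 'a" assume z: "z \<longlonglongrightarrow> x"
    have "(\<lambda>j. K f (z j)) \<longlonglongrightarrow> K f x"
      using f c z by (intro conv_op_tendsto2[where c = c] continuous_on_tendsto_compose[OF c(1)]) auto
    then show "(K f \<circ> z) \<longlonglongrightarrow> K f x" by (simp add: o_def)
  qed
  then show ?thesis using conv_op_bound[OF f c(2)] by (rule bcontfunI)
qed

lemma conv_op_diff_bound:
  assumes f: "f \<in> bcontfun" and le: "\<And>x. \<bar>f (x + w) - f x\<bar> \<le> c"
  shows "\<bar>K f (z + w) - K f z\<bar> \<le> N * c"
proof -
  have "K f (z + w) - K f z = K (\<lambda>x. f (x + w) + (- 1) * f x) z"
    by (subst conv_op_lincomb) (auto simp: conv_op_shift f bcontfun_shift)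
  moreover have "(\<lambda>x. f (x + w) + (- 1) * f x) \<in> bcontfun"
    using f by (intro bcontfun_lincomb bcontfun_shift)
  ultimately show ?thesis using le by (simp add: conv_op_bound)
qed

end

lemma conv_op_compose:
  assumes K: "conv_op N K" and K': "conv_op N' K'"
  shows "conv_op (N * N') (\<lambda>f. K (K' f))"
  unfolding conv_op_def
proof (intro conjI allI impI)
  show "0 \<le> N * N'" using conv_op_nonneg[OF K] conv_op_nonneg[OF K'] by simp
  show "K (K' (\<lambda>x. f x + c * g x)) = (\<lambda>x. K (K' f) x + c * K (K' g) x)"
    if f: "f \<in> bcontfun" "g \<in> bcontfun" for f g c
  proof -
    have "K' (\<lambda>x. f x + c * g x) = (\<lambda>x. K' f x + c * K' g x)"
      by (rule ext) (rule conv_op_lincomb[OF K' f])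
    then show ?thesis
      using conv_op_lincomb[OF K conv_op_bcontfun[OF K' f(1)] conv_op_bcontfun[OF K' f(2)]]
      by (intro ext) simp
  qed
  show "\<bar>K (K' f) z\<bar> \<le> N * N' * c" if "f \<in> bcontfun" "\<forall>x. \<bar>f x\<bar> \<le> c" for f c z
  proof -
    have "\<bar>K' f x\<bar> \<le> N' * c" for x using that by (intro conv_op_bound[OF K']) auto
    from conv_op_bound[OF K conv_op_bcontfun[OF K' that(1)] this, of z]
    show ?thesis by (simp add: mult.assoc)
  qed
  show "K (K' (\<lambda>x. f (x + w))) = (\<lambda>z. K (K' f) (z + w))" if f: "f \<in> bcontfun" for f w
  proof -
    have "K' (\<lambda>x. f (x + w)) = (\<lambda>x. K' f (x + w))"
      by (rule ext) (rule conv_op_shift[OF K' f])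
    then show ?thesis
      using conv_op_shift[OF K conv_op_bcontfun[OF K' f], of w] by (intro ext) simp
  qed
  show "(\<lambda>j. K (K' (F j)) z) \<longlonglongrightarrow> K (K' f) z"
    if "\<forall>j. F j \<in> bcontfun" "f \<in> bcontfun" "\<forall>j x. \<bar>F j x\<bar> \<le> c" "\<forall>x. (\<lambda>j. F j x) \<longlonglongrightarrow> f x" for F f c z
    using that
    by (intro conv_op_tendsto[OF K, where c = "N' * c"] conv_op_tendsto[OF K'] conv_op_bcontfun[OF K']
        conv_op_bound[OF K']) auto
qed

lemma conv_op_zero: "conv_op 0 (\<lambda>f z. 0)"
  by (simp add: conv_op_def)

lemma conv_op_mono:
  assumes K: "conv_op N K" and "N \<le> N'"
  shows "conv_op N' K"
proof -
  have "\<bar>K f z\<bar> \<le> N' * c" if "f \<in> bcontfun" "\<forall>x. \<bar>f x\<bar> \<le> c" for f c z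
  proof -
    have "0 \<le> c" using that(2) abs_ge_zero order_trans by blast
    then have "N * c \<le> N' * c" using \<open>N \<le> N'\<close> by (rule mult_right_mono[rotated])
    then show ?thesis using conv_op_bound[OF K that(1), of c z] that(2) by simp
  qed
  then show ?thesis using K \<open>N \<le> N'\<close> unfolding conv_op_def by (intro conjI) (auto intro: order_trans)
qed

lemma conv_op_integral:
  fixes \<psi> :: "'b \<Rightarrow> 'a::{real_normed_vector, second_countable_topology}"
  assumes [measurable]: "\<psi> \<in> borel_measurable M" and \<rho>: "integrable M \<rho>"
    and N: "(LINT w|M. \<bar>\<rho> w\<bar>) \<le> N"
  shows "conv_op N (\<lambda>f z. LINT w|M. \<rho> w * f (z + \<psi> w))"
proof -
  have [measurable]: "\<rho> \<in> borel_measurable M" using \<rho> by simp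
  have meas: "(\<lambda>w. f (z + \<psi> w)) \<in> borel_measurable M" if "f \<in> bcontfun" for f :: "'a \<Rightarrow> real" and z
  proof -
    have [measurable]: "f \<in> borel_measurable borel"
      using that by (auto simp: bcontfun_def intro: borel_measurable_continuous_onI)
    show ?thesis by measurable
  qed
  have dom: "integrable M (\<lambda>w. c * \<bar>\<rho> w\<bar>)" for c using \<rho> by auto
  have le: "\<bar>\<rho> w * y\<bar> \<le> c * \<bar>\<rho> w\<bar>" if "\<bar>y\<bar> \<le> c" for w y c
    using mult_right_mono[OF that, of "\<bar>\<rho> w\<bar>"] by (simp add: abs_mult mult.commute)
  have int: "integrable M (\<lambda>w. \<rho> w * f (z + \<psi> w))" if f: "f \<in> bcontfun" for f :: "'a \<Rightarrow> real" and z
  proof -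
    obtain c where c: "\<And>x. \<bar>f x\<bar> \<le> c" using bcontfunD[OF f] by blast
    note [measurable] = meas[OF f]
    show ?thesis
      by (rule Bochner_Integration.integrable_bound[OF dom[of c]]) (use order_trans[OF le[OF c] abs_ge_self] in simp_all)
  qed
  show ?thesis
    unfolding conv_op_def
  proof (intro conjI allI impI)
    have "0 \<le> (LINT w|M. \<bar>\<rho> w\<bar>)" by simp
    then show "0 \<le> N" using N by linarith
    show "(\<lambda>z. LINT w|M. \<rho> w * (f (z + \<psi> w) + c * g (z + \<psi> w)))
        = (\<lambda>x. (LINT w|M. \<rho> w * f (x + \<psi> w)) + c * (LINT w|M. \<rho> w * g (x + \<psi> w)))"
      if "f \<in> bcontfun" "g \<in> bcontfun" for f g c
      using int[OF that(1)] int[OF that(2)] by (simp add: ring_distribs mult.left_commute[of _ c])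
    show "\<bar>LINT w|M. \<rho> w * f (z + \<psi> w)\<bar> \<le> N * c" if f: "f \<in> bcontfun" "\<forall>x. \<bar>f x\<bar> \<le> c" for f c z
    proof -
      have "\<bar>LINT w|M. \<rho> w * f (z + \<psi> w)\<bar> \<le> (LINT w|M. \<bar>\<rho> w * f (z + \<psi> w)\<bar>)"
        by (rule integral_abs_bound)
      also have "\<dots> \<le> (LINT w|M. c * \<bar>\<rho> w\<bar>)"
        using int[OF f(1)] le f(2) by (intro integral_mono dom) auto
      also have "\<dots> = c * (LINT w|M. \<bar>\<rho> w\<bar>)" by simp
      also have "\<dots> \<le> c * N"
        using N f(2) abs_ge_zero order_trans by (intro mult_left_mono) blast+
      finally show ?thesis by (simp add: mult.commute)
    qed
    show "(\<lambda>z. LINT w|M. \<rho> w * f (z + \<psi> w + u)) = (\<lambda>z. LINT w|M. \<rho> w * f (z + u + \<psi> w))" for f u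
      by (simp add: ac_simps)
    show "(\<lambda>j. LINT w|M. \<rho> w * F j (z + \<psi> w)) \<longlonglongrightarrow> (LINT w|M. \<rho> w * f (z + \<psi> w))"
      if "\<forall>j. F j \<in> bcontfun" "f \<in> bcontfun" "\<forall>j x. \<bar>F j x\<bar> \<le> c" "\<forall>x. (\<lambda>j. F j x) \<longlonglongrightarrow> f x" for F f c z
      using that le meas
      by (intro integral_dominated_convergence[where w = "\<lambda>w. c * \<bar>\<rho> w\<bar>"] dom)
         (auto intro!: tendsto_intros)
  qed
qed

section \<open>Directional derivatives\<close>

definition has_dir_deriv :: "('a::real_normed_vector \<Rightarrow> real) \<Rightarrow> 'a \<Rightarrow> ('a \<Rightarrow> real) \<Rightarrow> bool" where
  "has_dir_deriv f h f' \<longleftrightarrow> (\<forall>x. ((\<lambda>r. f (x + r *\<^sub>R h)) has_real_derivative f' x) (at 0))"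

lemma has_dir_deriv_line:
  assumes "has_dir_deriv f h f'"
  shows "((\<lambda>r. f (x + r *\<^sub>R h)) has_real_derivative f' (x + r *\<^sub>R h)) (at r)"
proof -
  have "((\<lambda>s. f (x + r *\<^sub>R h + s *\<^sub>R h)) has_real_derivative f' (x + r *\<^sub>R h)) (at 0)"
    using assms by (simp add: has_dir_deriv_def)
  then have "((\<lambda>s. f (x + (s + r) *\<^sub>R h)) has_real_derivative f' (x + r *\<^sub>R h)) (at 0)"
    by (simp add: algebra_simps)
  then show ?thesis using DERIV_shift[of "\<lambda>s. f (x + s *\<^sub>R h)" _ 0 r] by simp
qed

text \<open>The mean value theorem on the segment. With \<open>b = 0\<close> it bounds increments,
  and with \<open>b\<close> the derivative at \<open>x\<close> it bounds first order
  remainders.\<close>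

lemma has_dir_deriv_diff_le:
  assumes "has_dir_deriv f h f'" and "\<And>r. 0 < r \<Longrightarrow> r < 1 \<Longrightarrow> \<bar>f' (x + r *\<^sub>R h) - b\<bar> \<le> c"
  shows "\<bar>f (x + h) - f x - b\<bar> \<le> c"
proof -
  obtain z where "0 < z" "z < 1" "f (x + 1 *\<^sub>R h) - f (x + 0 *\<^sub>R h) = (1 - 0) * f' (x + z *\<^sub>R h)"
    using MVT2[of 0 1 "\<lambda>r. f (x + r *\<^sub>R h)" "\<lambda>r. f' (x + r *\<^sub>R h)"] has_dir_deriv_line[OF assms(1)]
    by auto
  then show ?thesis using assms(2)[of z] by simp
qed

lemma has_dir_deriv_unique: "has_dir_deriv f h f' \<Longrightarrow> has_dir_deriv f h f'' \<Longrightarrow> f' = f''"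
  unfolding has_dir_deriv_def using DERIV_unique by blast

lemma has_dir_deriv_scaleR:
  assumes "has_dir_deriv f h f'"
  shows "has_dir_deriv f (c *\<^sub>R h) (\<lambda>x. c * f' x)"
  unfolding has_dir_deriv_def
proof
  fix x
  have "((\<lambda>r. f (x + r *\<^sub>R h)) has_real_derivative f' x) (at (0 * c))"
    using assms by (simp add: has_dir_deriv_def)
  moreover have "((\<lambda>r::real. r * c) has_real_derivative c) (at 0)"
    by (auto intro!: derivative_eq_intros)
  ultimately have "((\<lambda>r. f (x + (r * c) *\<^sub>R h)) has_real_derivative f' x * c) (at 0)"
    by (rule DERIV_chain2)
  then show "((\<lambda>r. f (x + r *\<^sub>R c *\<^sub>R h)) has_real_derivative c * f' x) (at 0)"
    by (simp add: mult.commute)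
qed

text \<open>The difference quotients of \<open>f\<close> are bounded by the bound of
  \<open>f'\<close> and converge pointwise, so the limit property of \<open>K\<close> applies
  without any formula for \<open>K\<close>.\<close>

lemma conv_op_has_dir_deriv:
  assumes K: "conv_op N K" and f: "f \<in> bcontfun" "f' \<in> bcontfun" and d: "has_dir_deriv f h f'"
  shows "has_dir_deriv (K f) h (K f')"
  unfolding has_dir_deriv_def
proof
  fix z
  obtain c where c: "\<And>x. \<bar>f' x\<bar> \<le> c" using bcontfunD[OF f(2)] by blast
  have "((\<lambda>r. (K f (z + r *\<^sub>R h) - K f z) / r) \<longlongrightarrow> K f' z) (at 0)"
    unfolding tendsto_at_iff_sequentially
  proof (intro allI impI)
    fix r :: "nat \<Rightarrow> real" assume r: "\<forall>i. r i \<in> UNIV - {0}" "r \<longlonglongrightarrow> 0"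
    \<comment> \<open>The difference quotient is written as \<open>u + (1 / r j - 1) * u\<close>,
      since linearity of \<open>conv_op\<close> is available for combinations whose first
      coefficient is one.\<close>
    define F where "F j x = (f (x + r j *\<^sub>R h) + (- 1) * f x) + (1 / r j - 1) * (f (x + r j *\<^sub>R h) + (- 1) * f x)" for j x
    have F: "F j x = (f (x + r j *\<^sub>R h) - f x) / r j" for j x
      using r(1) by (simp add: F_def field_simps)
    have b: "(\<lambda>x. f (x + r j *\<^sub>R h) + (- 1) * f x) \<in> bcontfun" for j
      using f(1) by (intro bcontfun_lincomb bcontfun_shift)
    have bF: "F j \<in> bcontfun" for j
      unfolding F_def by (rule bcontfun_lincomb[OF b b])
    have KF: "K (F j) z = (K f (z + r j *\<^sub>R h) - K f z) / r j" for j
    proof -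
      have "K (\<lambda>x. f (x + r j *\<^sub>R h) + (- 1) * f x) z = K f (z + r j *\<^sub>R h) - K f z"
        by (subst conv_op_lincomb[OF K]) (auto simp: conv_op_shift[OF K] f bcontfun_shift)
      moreover have "K (F j) z = K (\<lambda>x. f (x + r j *\<^sub>R h) + (- 1) * f x) z
          + (1 / r j - 1) * K (\<lambda>x. f (x + r j *\<^sub>R h) + (- 1) * f x) z"
        unfolding F_def by (rule conv_op_lincomb[OF K b b])
      ultimately show ?thesis using r(1) by (simp add: field_simps)
    qed
    have "(\<lambda>j. K (F j) z) \<longlonglongrightarrow> K f' z"
    proof (rule conv_op_tendsto[OF K bF f(2), where c = c])
      show "\<bar>F j x\<bar> \<le> c" for j x
      proof -
        have "\<bar>r j * f' y\<bar> \<le> \<bar>r j\<bar> * c" for y using c[of y] by (simp add: abs_mult mult_left_mono)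
        then have "\<bar>f (x + r j *\<^sub>R h) - f x - 0\<bar> \<le> \<bar>r j\<bar> * c"
          by (intro has_dir_deriv_diff_le[OF has_dir_deriv_scaleR[OF d]]) auto
        then show ?thesis using r(1) by (simp add: F field_simps)
      qed
      show "(\<lambda>j. F j x) \<longlonglongrightarrow> f' x" for x
      proof -
        have "((\<lambda>r. (f (x + r *\<^sub>R h) - f x) / r) \<longlongrightarrow> f' x) (at 0)"
          using d by (simp add: has_dir_deriv_def has_field_derivative_iff)
        then show ?thesis
          unfolding tendsto_at_iff_sequentially F using r by (auto simp: o_def)
      qed
    qed
    then show "((\<lambda>r. (K f (z + r *\<^sub>R h) - K f z) / r) \<circ> r) \<longlonglongrightarrow> K f' z"
      by (simp add: KF o_def)
  qed
  then show "((\<lambda>r. K f (z + r *\<^sub>R h)) has_real_derivative K f' z) (at 0)"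
    by (simp add: has_field_derivative_iff)
qed

section \<open>Smoothing by Gaussian convolution\<close>

abbreviation std_normal :: "real measure" where
  "std_normal \<equiv> std_normal_distribution"

lemma std_normal_prob_space: "prob_space std_normal"
  using prob_space_normal_density[of 1 0] by simp

lemma std_normal_density_shift:
  "std_normal_density u * exp (s * u - s\<^sup>2 / 2) = normal_density s 1 u"
proof -
  have "- u\<^sup>2 / 2 + (s * u - s\<^sup>2 / 2) = - (u - s)\<^sup>2 / 2"
    by (simp add: power2_eq_square field_simps)
  then have "exp (- u\<^sup>2 / 2) * exp (s * u - s\<^sup>2 / 2) = exp (- (u - s)\<^sup>2 / 2)"
    by (simp only: exp_add[symmetric])
  then show ?thesis by (simp add: normal_density_def)
qed

lemma integrable_std_normal_exp: "integrable std_normal (\<lambda>u. exp (s * u))"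
proof -
  have "integrable lborel (\<lambda>u. exp (s\<^sup>2 / 2) * normal_density s 1 u)" by simp
  also have "(\<lambda>u. exp (s\<^sup>2 / 2) * normal_density s 1 u) = (\<lambda>u. std_normal_density u *\<^sub>R exp (s * u))"
  proof
    show "exp (s\<^sup>2 / 2) * normal_density s 1 u = std_normal_density u *\<^sub>R exp (s * u)" for u
      unfolding std_normal_density_shift[of u s, symmetric] by (simp add: exp_diff)
  qed
  finally show ?thesis by (subst integrable_density) auto
qed

text \<open>The one-dimensional Cameron-Martin formula. It moves the shift from \<open>F\<close>,
  which is merely measurable, to a smooth weight.\<close>

lemma integral_std_normal_shift:
  assumes [measurable]: "F \<in> borel_measurable borel"
  shows "(LINT u|std_normal. F (s + u)) = (LINT u|std_normal. F u * exp (s * u - s\<^sup>2 / 2))"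
proof -
  have pt: "std_normal_density u * (F u * exp (s * u - s\<^sup>2 / 2)) = normal_density s 1 u * F u" for u
    unfolding std_normal_density_shift[of u s, symmetric] by (simp only: mult_ac)
  have "(LINT u|std_normal. F u * exp (s * u - s\<^sup>2 / 2))
      = (LINT u|lborel. std_normal_density u * (F u * exp (s * u - s\<^sup>2 / 2)))"
    by (subst integral_density) auto
  also have "\<dots> = (LINT u|lborel. normal_density s 1 u * F u)"
    by (simp only: pt)
  also have "\<dots> = (LINT u|lborel. normal_density s 1 (s + 1 * u) * F (s + 1 * u))"
    by (subst lborel_integral_real_affine[where c = 1 and t = s]) auto
  also have "\<dots> = (LINT u|lborel. std_normal_density u * F (s + u))"
    by (simp add: normal_density_def)
  also have "\<dots> = (LINT u|std_normal. F (s + u))"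
    by (subst integral_density) auto
  finally show ?thesis by simp
qed

lemma abs_exp_minus_one_le: "\<bar>exp x - 1\<bar> \<le> \<bar>x\<bar> * exp \<bar>x :: real\<bar>"
proof (cases "x \<ge> 0")
  case True
  have "1 - x \<le> exp (- x)" using exp_ge_add_one_self[of "- x"] by simp
  then have "(1 - x) * exp x \<le> exp (- x) * exp x" by (rule mult_right_mono) simp
  then show ?thesis using True by (simp add: exp_minus_inverse algebra_simps)
next
  case False
  have "\<bar>exp x - 1\<bar> \<le> \<bar>x\<bar> * 1"
    using exp_ge_add_one_self[of x] exp_le_one_iff[of x] False by linarith
  also have "\<dots> \<le> \<bar>x\<bar> * exp \<bar>x\<bar>" by (intro mult_left_mono) auto
  finally show ?thesis .
qed

text \<open>After the shift formula only the weight \<open>exp (s * u - s\<^sup>2 / 2)\<close>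
  depends on \<open>s\<close>, and its derivative at 0 is \<open>u\<close>. No regularity of
  \<open>F\<close> enters.\<close>

lemma std_normal_convolution_derivative:
  assumes [measurable]: "F \<in> borel_measurable borel" and c: "\<And>u. \<bar>F u\<bar> \<le> c"
  shows "((\<lambda>s. LINT u|std_normal. F (s + u)) has_real_derivative (LINT u|std_normal. F u * u)) (at 0)"
proof -
  interpret N: prob_space std_normal by (rule std_normal_prob_space)
  have c0: "0 \<le> c" using c[of 0] by linarith
  define E where "E s u = exp (s * u - s\<^sup>2 / 2)" for s u :: real
  have int: "integrable std_normal (\<lambda>u. F u * E s u)" for s
  proof (rule Bochner_Integration.integrable_bound)
    show "integrable std_normal (\<lambda>u. c * exp (s * u))"
      by (intro integrable_mult_right integrable_std_normal_exp)
    have "\<bar>F u\<bar> * E s u \<le> c * exp (s * u)" for u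
      using c by (intro mult_mono) (auto simp: E_def c0)
    then show "AE u in std_normal. norm (F u * E s u) \<le> norm (c * exp (s * u))"
      using c0 by (auto simp: abs_mult E_def)
  qed (simp add: E_def)
  \<comment> \<open>The majorant for dominated convergence, valid for
    \<open>\<bar>s\<bar> \<le> 1\<close>; hence the later passage to a tail of the sequence. Two
    exponentials replace \<open>exp (2 * \<bar>u\<bar>)\<close>, as each is integrable by the
    density formula.\<close>
  have quot: "\<bar>(E s u - 1) / s\<bar> \<le> exp 2 * (exp (2 * u) + exp (- 2 * u))" if s: "s \<noteq> 0" "\<bar>s\<bar> \<le> 1" for s u
  proof -
    have x: "\<bar>s * u - s\<^sup>2 / 2\<bar> \<le> \<bar>s\<bar> * (\<bar>u\<bar> + 1)"
    proof -
      have "\<bar>s * u - s\<^sup>2 / 2\<bar> = \<bar>s\<bar> * \<bar>u - s / 2\<bar>"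
        by (simp add: abs_mult[symmetric] power2_eq_square algebra_simps)
      also have "\<dots> \<le> \<bar>s\<bar> * (\<bar>u\<bar> + 1)" using s by (intro mult_left_mono) auto
      finally show ?thesis .
    qed
    also have "\<dots> \<le> 1 * (\<bar>u\<bar> + 1)" using s by (intro mult_right_mono) auto
    finally have x1: "\<bar>s * u - s\<^sup>2 / 2\<bar> \<le> \<bar>u\<bar> + 1" by simp
    have "\<bar>E s u - 1\<bar> \<le> \<bar>s * u - s\<^sup>2 / 2\<bar> * exp \<bar>s * u - s\<^sup>2 / 2\<bar>"
      unfolding E_def by (rule abs_exp_minus_one_le)
    also have "\<dots> \<le> (\<bar>s\<bar> * (\<bar>u\<bar> + 1)) * exp (\<bar>u\<bar> + 1)"
      using x x1 by (intro mult_mono) auto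
    also have "\<dots> \<le> \<bar>s\<bar> * (exp (\<bar>u\<bar> + 1) * exp (\<bar>u\<bar> + 1))"
      using exp_ge_add_one_self[of "\<bar>u\<bar> + 1"]
      by (simp only: mult.assoc, intro mult_left_mono mult_right_mono) auto
    also have "exp (\<bar>u\<bar> + 1) * exp (\<bar>u\<bar> + 1) = exp 2 * exp (2 * \<bar>u\<bar>)"
      by (simp flip: exp_add)
    also have "\<bar>s\<bar> * (exp 2 * exp (2 * \<bar>u\<bar>)) \<le> \<bar>s\<bar> * (exp 2 * (exp (2 * u) + exp (- 2 * u)))"
      by (intro mult_left_mono) (auto simp: abs_if)
    finally show ?thesis using s by (simp add: field_simps)
  qed
  have "((\<lambda>s. ((LINT u|std_normal. F (s + u)) - (LINT u|std_normal. F (0 + u))) / s)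
      \<longlongrightarrow> (LINT u|std_normal. F u * u)) (at 0)"
    unfolding tendsto_at_iff_sequentially
  proof (intro allI impI)
    fix s :: "nat \<Rightarrow> real" assume s: "\<forall>i. s i \<in> UNIV - {0}" "s \<longlonglongrightarrow> 0"
    have "\<forall>\<^sub>F i in sequentially. \<bar>s i\<bar> < 1"
      using order_tendstoD(2)[OF tendsto_rabs[OF s(2)], of 1] by simp
    then obtain n where n: "\<And>i. \<bar>s (i + n)\<bar> \<le> 1"
      unfolding eventually_sequentially by (metis le_add2 less_imp_le)
    have eq: "((LINT u|std_normal. F (s i + u)) - (LINT u|std_normal. F (0 + u))) / s i
        = (LINT u|std_normal. F u * ((E (s i) u - 1) / s i))" for i
    proof -
      have "(LINT u|std_normal. F (s i + u)) - (LINT u|std_normal. F (0 + u))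
          = (LINT u|std_normal. F u * E (s i) u - F u * E 0 u)"
        unfolding integral_std_normal_shift[OF assms(1)] E_def[symmetric]
        by (intro Bochner_Integration.integral_diff[symmetric] int)
      then have "((LINT u|std_normal. F (s i + u)) - (LINT u|std_normal. F (0 + u))) / s i
          = (LINT u|std_normal. (F u * E (s i) u - F u * E 0 u) / s i)" by simp
      also have "\<dots> = (LINT u|std_normal. F u * ((E (s i) u - 1) / s i))"
        by (intro Bochner_Integration.integral_cong refl) (simp add: E_def[of 0] diff_divide_distrib right_diff_distrib)
      finally show ?thesis .
    qed
    have "(\<lambda>i. LINT u|std_normal. F u * ((E (s (i + n)) u - 1) / s (i + n))) \<longlonglongrightarrow> (LINT u|std_normal. F u * u)"
    proof (rule integral_dominated_convergence[where w = "\<lambda>u. c * (exp 2 * (exp (2 * u) + exp (- 2 * u)))"])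
      show "integrable std_normal (\<lambda>u. c * (exp 2 * (exp (2 * u) + exp (- 2 * u))))"
        by (intro integrable_mult_right Bochner_Integration.integrable_add integrable_std_normal_exp)
      have "(\<lambda>i. (E (s (i + n)) u - 1) / s (i + n)) \<longlonglongrightarrow> u" for u
      proof -
        have "((\<lambda>s. E s u) has_real_derivative u) (at 0)"
          unfolding E_def by (auto intro!: derivative_eq_intros)
        then have "((\<lambda>s. (E s u - 1) / s) \<longlongrightarrow> u) (at 0)"
          by (simp add: has_field_derivative_iff E_def)
        moreover have "filterlim (\<lambda>i. s (i + n)) (at 0) sequentially"
          using s(1) LIMSEQ_ignore_initial_segment[OF s(2), of n] by (simp add: filterlim_at)
        ultimately show ?thesis by (rule filterlim_compose)
      qed
      then show "AE u in std_normal. (\<lambda>i. F u * ((E (s (i + n)) u - 1) / s (i + n))) \<longlonglongrightarrow> F u * u"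
        by (intro AE_I2 tendsto_mult_left)
      show "AE u in std_normal. norm (F u * ((E (s (i + n)) u - 1) / s (i + n)))
          \<le> c * (exp 2 * (exp (2 * u) + exp (- 2 * u)))" for i
        unfolding real_norm_def abs_mult using s(1) n c c0
        by (intro AE_I2 mult_mono quot) auto
    qed (simp_all add: E_def)
    then show "((\<lambda>s. ((LINT u|std_normal. F (s + u)) - (LINT u|std_normal. F (0 + u))) / s) \<circ> s)
        \<longlonglongrightarrow> (LINT u|std_normal. F u * u)"
      unfolding o_def eq by (rule LIMSEQ_offset)
  qed
  then show ?thesis by (simp add: has_field_derivative_iff)
qed

definition gauss_op :: "('a \<Rightarrow> 'a::{real_inner, banach, polish_space}) \<Rightarrow> ('a \<Rightarrow> real) \<Rightarrow> 'a \<Rightarrow> real" where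
  "gauss_op B f z = (LINT y|gaussian B. f (z + y))"

lemma conv_op_gauss:
  assumes "covariance B"
  shows "conv_op 1 (gauss_op B)"
proof -
  interpret prob_space "gaussian B" by (rule gaussian_prob_space[OF assms])
  note [measurable_cong] = sets_gaussian[OF assms]
  have "conv_op 1 (\<lambda>f z. LINT w|gaussian B. 1 * f (z + w))"
    by (rule conv_op_integral) (auto simp: prob_space)
  then show ?thesis by (simp add: gauss_op_def[abs_def])
qed

lemma std_normal_abs_moment:
  "integrable std_normal (\<lambda>u. \<bar>u\<bar>)" "(LINT u|std_normal. \<bar>u\<bar>) \<le> 1"
  "integrable std_normal (\<lambda>u. u\<^sup>2)" "(LINT u|std_normal. u\<^sup>2) = 1" "(LINT u|std_normal. u) = 0"
proof -
  interpret N: prob_space std_normal by (rule std_normal_prob_space)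
  show sq: "integrable std_normal (\<lambda>u. u\<^sup>2)" by (rule integrable_std_normal_distribution_moment)
  show sq1: "(LINT u|std_normal. u\<^sup>2) = 1"
    using std_normal_distribution_even_moments(1)[of 1] by (simp add: fact_2)
  show a: "integrable std_normal (\<lambda>u. \<bar>u\<bar>)"
    using integrable_abs[OF integrable_std_normal_distribution_moment[of 1]] by simp
  show "(LINT u|std_normal. u) = 0" using integral_std_normal_distribution_moment_odd[of 1] by simp
  have "\<bar>u\<bar> \<le> (1 + u\<^sup>2) / 2" for u :: real
    using zero_le_power2[of "\<bar>u\<bar> - 1"] by (simp add: power2_diff)
  then have "(LINT u|std_normal. \<bar>u\<bar>) \<le> (LINT u|std_normal. (1 + u\<^sup>2) / 2)"
    using a sq by (intro integral_mono) auto
  also have "\<dots> = 1" using sq sq1 N.prob_space by simp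
  finally show "(LINT u|std_normal. \<bar>u\<bar>) \<le> 1" .
qed

text \<open>The inequality for \<open>a\<close> states that the rank one form with vector
  \<open>a / c\<close> lies below that of \<open>B\<close>. What is left is nonnegative, and its
  diagonal entries are dominated by those of \<open>B\<close>.\<close>

lemma covariance_minus_rank_one:
  fixes B :: "'a \<Rightarrow> 'a::{real_inner, banach, polish_space}"
  assumes B: "covariance B" and c: "c > 0" and a: "\<And>x. (a \<bullet> x)\<^sup>2 \<le> c\<^sup>2 * (B x \<bullet> x)"
  shows "covariance (\<lambda>x. B x - ((a \<bullet> x) / c\<^sup>2) *\<^sub>R a)"
proof -
  let ?B = "\<lambda>x. B x - ((a \<bullet> x) / c\<^sup>2) *\<^sub>R a"
  from B obtain e where B: "selfadjoint_nonneg B" and e: "parseval e" "summable (\<lambda>n. B (e n) \<bullet> e n)"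
    by (auto simp: covariance_def)
  have q: "?B x \<bullet> x = B x \<bullet> x - (a \<bullet> x)\<^sup>2 / c\<^sup>2" for x
    by (simp add: inner_diff_left power2_eq_square)
  have pos: "0 \<le> ?B x \<bullet> x" for x using a[of x] c by (simp only: q) (simp add: field_simps)
  have "selfadjoint_nonneg ?B"
    unfolding selfadjoint_nonneg_def
  proof (intro conjI allI pos)
    have "bounded_linear (\<lambda>x. (a \<bullet> x) / c\<^sup>2)"
      by (rule bounded_linear_compose[OF bounded_linear_divide bounded_linear_inner_right])
    then show "bounded_linear ?B"
      by (intro bounded_linear_sub selfadjoint_nonnegD(1)[OF B] bounded_linear_scaleR_const)
    show "?B x \<bullet> y = x \<bullet> ?B y" for x y
      using selfadjoint_nonnegD(2)[OF B, of x y]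
      by (simp add: inner_diff_left inner_diff_right inner_commute[of x a] mult.commute)
  qed
  moreover have "summable (\<lambda>n. ?B (e n) \<bullet> e n)"
  proof (rule summable_comparison_test'[OF e(2), of 0])
    show "norm (?B (e n) \<bullet> e n) \<le> B (e n) \<bullet> e n" for n
    proof -
      have "?B (e n) \<bullet> e n \<le> B (e n) \<bullet> e n" by (simp add: q)
      then show ?thesis using pos[of "e n"] by simp
    qed
  qed
  ultimately show ?thesis using e(1) unfolding covariance_def by blast
qed

text \<open>The direction \<open>a\<close> splits off \<open>\<N>(0, B)\<close> as an independent Gaussian component \<open>(u / c) a\<close>, with
  \<open>u\<close> standard normal. Derivatives along \<open>a\<close> fall on the density of \<open>u\<close>, and since \<open>u\<close> has mean
  zero, only the increments of \<open>f\<close> along \<open>a\<close> matter in the last estimate.\<close>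

lemma gauss_op_smoothing:
  fixes B :: "'a \<Rightarrow> 'a::{real_inner, banach, polish_space}"
  assumes B: "covariance B" and c: "c \<ge> 0" and a: "\<And>x. (a \<bullet> x)\<^sup>2 \<le> c\<^sup>2 * (B x \<bullet> x)"
  shows "\<exists>K. conv_op c K \<and> (\<forall>f\<in>bcontfun. has_dir_deriv (gauss_op B f) a (K f)) \<and>
    (\<forall>f H \<alpha> z. f \<in> bcontfun \<and> 0 < \<alpha> \<and> \<alpha> < 1 \<and> (\<forall>x w. \<bar>f (x + w) - f x\<bar> \<le> H * norm w powr \<alpha>) \<longrightarrow>
        \<bar>K f z\<bar> \<le> 2 * H * norm a powr \<alpha> * c powr (1 - \<alpha>))"
proof (cases "c = 0")
  case True
  \<comment> \<open>For \<open>c = 0\<close> nothing can be split off, but then the direction itself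
    is zero and so is the derivative.\<close>
  then have "a = 0" using a[of a] by simp
  then show ?thesis
    using True conv_op_zero by (intro exI[of _ "\<lambda>f z. 0"]) (auto simp: has_dir_deriv_def)
next
  case False
  with c have c: "c > 0" by simp
  define B' where "B' x = B x - ((a \<bullet> x) / c\<^sup>2) *\<^sub>R a" for x
  have B': "covariance B'"
    unfolding B'_def[abs_def] by (rule covariance_minus_rank_one[OF B c a])
  let ?\<gamma> = "gaussian B'"
  interpret N: prob_space std_normal by (rule std_normal_prob_space)
  interpret G: prob_space ?\<gamma> by (rule gaussian_prob_space[OF B'])
  interpret pair_prob_space std_normal ?\<gamma> ..
  note [measurable_cong] = sets_gaussian[OF B']
  define M where "M = std_normal \<Otimes>\<^sub>M ?\<gamma>"
  have [measurable]: "fst \<in> borel_measurable M" "snd \<in> borel_measurable M"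
    unfolding M_def by measurable
  define \<psi> where "\<psi> p = snd p + (fst p / c) *\<^sub>R a" for p :: "real \<times> 'a"
  have [measurable]: "\<psi> \<in> borel_measurable M" unfolding \<psi>_def by measurable
  have law: "gaussian B = distr M borel \<psi>"
  proof -
    have "(CLINT u|std_normal. iexp (h \<bullet> ((u / c) *\<^sub>R a))) = exp (- complex_of_real (((h \<bullet> a) / c)\<^sup>2 / 2))" for h
    proof -
      have "(CLINT u|std_normal. iexp (h \<bullet> ((u / c) *\<^sub>R a))) = char std_normal ((h \<bullet> a) / c)"
        unfolding char_def by (intro Bochner_Integration.integral_cong) (auto simp: mult.commute)
      then show ?thesis by (simp add: char_std_normal_distribution exp_of_real[symmetric])
    qed
    moreover have "B h \<bullet> h = B' h \<bullet> h + ((h \<bullet> a) / c)\<^sup>2" for h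
      by (simp add: B'_def inner_diff_left inner_diff_right power2_eq_square inner_commute)
    ultimately have "gaussian B = distr M borel (\<lambda>(u, y). y + (u / c) *\<^sub>R a)"
      unfolding M_def
      by (intro gaussian_convolution[where q = "\<lambda>h. ((h \<bullet> a) / c)\<^sup>2", OF B B' std_normal_prob_space]) auto
    then show ?thesis by (simp add: \<psi>_def[abs_def] case_prod_unfold)
  qed
  have law_fst: "distr M std_normal fst = std_normal"
    unfolding M_def by (rule G.distr_pair_fst)
  have fst_abs: "integrable M (\<lambda>p. \<bar>fst p\<bar>)" "(LINT p|M. \<bar>fst p\<bar>) = (LINT u|std_normal. \<bar>u\<bar>)"
  proof -
    have [measurable]: "fst \<in> measurable M std_normal" unfolding M_def by simp
    have "integrable (distr M std_normal fst) (\<lambda>u. \<bar>u\<bar>)"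
      using std_normal_abs_moment(1) by (simp only: law_fst)
    then show "integrable M (\<lambda>p. \<bar>fst p\<bar>)" by (subst (asm) integrable_distr_eq) auto
    have "(LINT u|distr M std_normal fst. \<bar>u\<bar>) = (LINT p|M. \<bar>fst p\<bar>)"
      by (rule integral_distr) auto
    then show "(LINT p|M. \<bar>fst p\<bar>) = (LINT u|std_normal. \<bar>u\<bar>)" by (simp only: law_fst)
  qed
  \<comment> \<open>Moving \<open>z\<close> by \<open>r *\<^sub>R a\<close> moves \<open>u\<close>
    by \<open>r * c\<close>, so the chain rule turns the density factor \<open>u\<close> into
    \<open>c * u\<close>.\<close>
  define K where "K f z = (LINT p|M. (c * fst p) * f (z + \<psi> p))" for f :: "'a \<Rightarrow> real" and z :: 'a
  have K: "conv_op c K"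
    unfolding K_def[abs_def]
  proof (rule conv_op_integral)
    show "integrable M (\<lambda>p. c * fst p)"
      using fst_abs(1) by (subst integrable_abs_iff[symmetric]) (auto simp: abs_mult)
    show "(LINT p|M. \<bar>c * fst p\<bar>) \<le> c"
      using c std_normal_abs_moment(2) by (simp add: abs_mult fst_abs(2) mult_left_le)
  qed measurable
  define F where "F f z s = (LINT y|?\<gamma>. f (z + (y + (s / c) *\<^sub>R a)))" for f :: "'a \<Rightarrow> real" and z :: 'a and s :: real
  have fb: "f \<in> borel_measurable borel" if "f \<in> bcontfun" for f :: "'a \<Rightarrow> real"
    using that by (auto simp: bcontfun_def intro: borel_measurable_continuous_onI)
  have F: "F f z \<in> borel_measurable borel \<and> (\<forall>u. \<bar>F f z u\<bar> \<le> b) \<and>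
      (\<forall>r. gauss_op B f (z + r *\<^sub>R a) = (LINT u|std_normal. F f z (r * c + u))) \<and>
      K f z = c * (LINT u|std_normal. F f z u * u)"
    if f: "f \<in> bcontfun" and b: "\<And>x. \<bar>f x\<bar> \<le> b" for f z b
  proof (intro conjI allI)
    note [measurable] = fb[OF f]
    show "F f z \<in> borel_measurable borel" unfolding F_def[abs_def] by measurable
    show "\<bar>F f z u\<bar> \<le> b" for u
    proof -
      have "conv_op 1 (gauss_op B')" by (rule conv_op_gauss[OF B'])
      from conv_op_bound[OF this f b, of "z + (u / c) *\<^sub>R a"] show ?thesis
        by (simp add: gauss_op_def F_def ac_simps)
    qed
    have "gauss_op B f (z + r *\<^sub>R a) = (LINT p|M. f (z + r *\<^sub>R a + \<psi> p))" for r
      unfolding gauss_op_def law by (subst integral_distr) auto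
    also have "\<dots> r = (LINT u|std_normal. LINT y|?\<gamma>. f (z + r *\<^sub>R a + \<psi> (u, y)))" for r
      unfolding M_def
      by (subst integral_fst'[symmetric])
         (auto intro!: P.integrable_const_bound[where B = b] simp: b \<psi>_def)
    finally show "gauss_op B f (z + r *\<^sub>R a) = (LINT u|std_normal. F f z (r * c + u))" for r
      using c by (simp add: F_def \<psi>_def add_divide_distrib scaleR_add_left ac_simps)
    have "integrable M (\<lambda>p. (c * fst p) * f (z + \<psi> p))"
    proof (rule Bochner_Integration.integrable_bound)
      show "integrable M (\<lambda>p. b * (c * \<bar>fst p\<bar>))" using fst_abs by simp
      have "\<bar>c * fst p\<bar> * \<bar>f (z + \<psi> p)\<bar> \<le> (c * \<bar>fst p\<bar>) * b" for p
        using c b by (intro mult_mono) (auto simp: abs_mult)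
      then show "AE p in M. norm ((c * fst p) * f (z + \<psi> p)) \<le> norm (b * (c * \<bar>fst p\<bar>))"
        by (intro AE_I2, unfold real_norm_def abs_mult[of "c * fst _"])
           (rule order_trans[OF _ abs_ge_self], simp add: mult_ac)
    qed measurable
    then have "K f z = (LINT u|std_normal. LINT y|?\<gamma>. (c * u) * f (z + \<psi> (u, y)))"
      unfolding K_def M_def by (subst integral_fst'[symmetric]) auto
    then show "K f z = c * (LINT u|std_normal. F f z u * u)"
      by (simp add: F_def \<psi>_def mult.assoc) (simp add: mult.commute)
  qed
  have "has_dir_deriv (gauss_op B f) a (K f)" if f: "f \<in> bcontfun" for f
    unfolding has_dir_deriv_def
  proof
    fix z
    obtain b where b: "\<And>x. \<bar>f x\<bar> \<le> b" using bcontfunD[OF f] by blast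
    note F = F[OF f b, of z]
    have "((\<lambda>s. LINT u|std_normal. F f z (s + u)) has_real_derivative (LINT u|std_normal. F f z u * u)) (at (0 * c))"
      using std_normal_convolution_derivative[of "F f z" b] F by simp
    moreover have "((\<lambda>r::real. r * c) has_real_derivative c) (at 0)"
      by (auto intro!: derivative_eq_intros)
    ultimately have "((\<lambda>r. LINT u|std_normal. F f z (r * c + u)) has_real_derivative
        (LINT u|std_normal. F f z u * u) * c) (at 0)"
      by (rule DERIV_chain2)
    then show "((\<lambda>r. gauss_op B f (z + r *\<^sub>R a)) has_real_derivative K f z) (at 0)"
      using F by (simp add: mult.commute)
  qed
  moreover have "\<bar>K f z\<bar> \<le> 2 * H * norm a powr \<alpha> * c powr (1 - \<alpha>)"
    if f: "f \<in> bcontfun" and \<alpha>: "0 < \<alpha>" "\<alpha> < 1"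
      and H: "\<And>x w. \<bar>f (x + w) - f x\<bar> \<le> H * norm w powr \<alpha>" for f H \<alpha> z
  proof -
    obtain b where b: "\<And>x. \<bar>f x\<bar> \<le> b" using bcontfunD[OF f] by blast
    note F = F[OF f b, of z]
    note [measurable] = fb[OF f]
    \<comment> \<open>The Hoelder constant of \<open>u \<mapsto> F f z u\<close>: a unit step in
      \<open>u\<close> moves the argument of \<open>f\<close> by \<open>a / c\<close>.\<close>
    define A where "A = H * (norm a / c) powr \<alpha>"
    have "0 \<le> H * norm w powr \<alpha>" for w :: 'a using H[of 0 w] by linarith
    then have "0 \<le> H * norm ((1 / c) *\<^sub>R a) powr \<alpha>" .
    then have "0 \<le> A" using c by (simp add: A_def)
    have diff: "\<bar>F f z u - F f z 0\<bar> \<le> A * \<bar>u\<bar> powr \<alpha>" for u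
    proof -
      have 1: "F f z u = gauss_op B' f (z + (u / c) *\<^sub>R a)" for u
        by (simp add: F_def gauss_op_def ac_simps)
      have "\<bar>gauss_op B' f (z + (u / c) *\<^sub>R a) - gauss_op B' f z\<bar> \<le> 1 * (H * norm ((u / c) *\<^sub>R a) powr \<alpha>)"
        by (rule conv_op_diff_bound[OF conv_op_gauss[OF B'] f]) (rule H)
      also have "norm ((u / c) *\<^sub>R a) powr \<alpha> = (norm a / c) powr \<alpha> * \<bar>u\<bar> powr \<alpha>"
        using c by (simp add: powr_mult powr_divide)
      finally show ?thesis using 1[of 0] by (simp add: 1 A_def)
    qed
    have Fi: "integrable std_normal (\<lambda>u. F f z u * u)"
    proof (rule Bochner_Integration.integrable_bound)
      show "integrable std_normal (\<lambda>u. b * \<bar>u\<bar>)" using std_normal_abs_moment(1) by simp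
      show "AE u in std_normal. norm (F f z u * u) \<le> norm (b * \<bar>u\<bar>)"
        using F by (intro AE_I2, unfold real_norm_def abs_mult[of "F f z _"])
           (rule order_trans[OF _ abs_ge_self], simp add: mult_right_mono)
    qed (use F in \<open>auto intro!: borel_measurable_times\<close>)
    have i0: "integrable std_normal (\<lambda>u. F f z 0 * u)"
      using integrable_std_normal_distribution_moment[of 1] by simp
    have eq: "(LINT u|std_normal. F f z u * u) = (LINT u|std_normal. F f z u * u - F f z 0 * u)"
      using Fi i0 std_normal_abs_moment(5) by simp
    have "\<bar>LINT u|std_normal. F f z u * u\<bar> \<le> (LINT u|std_normal. \<bar>F f z u * u - F f z 0 * u\<bar>)"
      unfolding eq by (rule integral_abs_bound)
    also have "\<dots> \<le> (LINT u|std_normal. A * (1 + u\<^sup>2))"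
    proof (rule integral_mono)
      show "integrable std_normal (\<lambda>u. \<bar>F f z u * u - F f z 0 * u\<bar>)" using Fi i0 by simp
      show "integrable std_normal (\<lambda>u. A * (1 + u\<^sup>2))" using std_normal_abs_moment(3) by simp
      fix u
      have "\<bar>F f z u * u - F f z 0 * u\<bar> = \<bar>F f z u - F f z 0\<bar> * \<bar>u\<bar>"
        by (simp add: abs_mult[symmetric] algebra_simps)
      also have "\<dots> \<le> (A * \<bar>u\<bar> powr \<alpha>) * \<bar>u\<bar>" by (intro mult_right_mono diff) simp
      also have "\<dots> \<le> A * (1 + u\<^sup>2)"
      proof -
        \<comment> \<open>The majorant \<open>1 + u\<^sup>2\<close> has mean 2 for every \<alpha>;
          this is the factor 2 in the estimate.\<close>
        have "\<bar>u\<bar> powr \<alpha> * \<bar>u\<bar> \<le> 1 + u\<^sup>2"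
        proof (cases "\<bar>u\<bar> \<le> 1")
          case True
          then have "\<bar>u\<bar> powr \<alpha> * \<bar>u\<bar> \<le> 1 * 1" using \<alpha> by (intro mult_mono powr_le1) auto
          then show ?thesis using zero_le_power2[of u] by linarith
        next
          case False
          then have "\<bar>u\<bar> powr \<alpha> \<le> \<bar>u\<bar> powr 1" using \<alpha> by (intro powr_mono) auto
          then have "\<bar>u\<bar> powr \<alpha> * \<bar>u\<bar> \<le> \<bar>u\<bar> * \<bar>u\<bar>" by (intro mult_right_mono) auto
          then show ?thesis by (simp add: power2_eq_square)
        qed
        from mult_left_mono[OF this \<open>0 \<le> A\<close>] show ?thesis by (simp add: mult.assoc)
      qed
      finally show "\<bar>F f z u * u - F f z 0 * u\<bar> \<le> A * (1 + u\<^sup>2)" .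
    qed
    also have "\<dots> = 2 * A" using std_normal_abs_moment(3,4) N.prob_space by simp
    finally have "\<bar>K f z\<bar> \<le> c * (2 * A)" using F c by (simp add: abs_mult)
    also have "\<dots> = 2 * H * norm a powr \<alpha> * c powr (1 - \<alpha>)"
      using c by (simp add: A_def powr_divide powr_diff field_simps)
    finally show ?thesis .
  qed
  ultimately show ?thesis using K by blast
qed

lemma borel_measurable_bcontfun:
  fixes f :: "'a::topological_space \<Rightarrow> real"
  shows "f \<in> bcontfun \<Longrightarrow> f \<in> borel_measurable borel"
  by (auto simp: bcontfun_def intro: borel_measurable_continuous_onI)

lemma gauss_op_convolution:
  fixes L :: "'b \<Rightarrow> 'a::{real_inner, banach, polish_space}"
  assumes B: "covariance B" and B1: "covariance B1"
    and N: "prob_space N" and L: "L \<in> borel_measurable N"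
    and char: "\<And>h. (CLINT z|N. iexp (h \<bullet> L z)) = exp (- complex_of_real (q h / 2))"
    and q: "\<And>h. B h \<bullet> h = B1 h \<bullet> h + q h" and f: "f \<in> bcontfun"
  shows "gauss_op B f w = (LINT z|N. gauss_op B1 f (w + L z))"
proof -
  interpret G: prob_space "gaussian B1" by (rule gaussian_prob_space[OF B1])
  interpret N: prob_space N by fact
  interpret pair_prob_space N "gaussian B1" ..
  note [measurable_cong] = sets_gaussian[OF B1]
  note [measurable] = L borel_measurable_bcontfun[OF f]
  obtain c where c: "\<And>x. \<bar>f x\<bar> \<le> c" using bcontfunD[OF f] by blast
  have "gauss_op B f w = (LINT p|(N \<Otimes>\<^sub>M gaussian B1). f (w + (snd p + L (fst p))))"
    unfolding gauss_op_def gaussian_convolution[OF B B1 N L char q]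
    by (subst integral_distr) (auto simp: case_prod_unfold)
  also have "\<dots> = (LINT z|N. LINT y|gaussian B1. f (w + (y + L z)))"
    by (subst integral_fst'[symmetric]) (auto intro!: P.integrable_const_bound[where B = c] simp: c)
  finally show ?thesis by (simp add: gauss_op_def ac_simps)
qed

lemma covariance_scaleR:
  assumes "covariance B" "a \<ge> 0"
  shows "covariance (\<lambda>x. a *\<^sub>R B x)"
proof -
  from assms obtain e where B: "selfadjoint_nonneg B" and e: "parseval e" "summable (\<lambda>n. B (e n) \<bullet> e n)"
    by (auto simp: covariance_def)
  have "selfadjoint_nonneg (\<lambda>x. a *\<^sub>R B x)"
    unfolding selfadjoint_nonneg_def
    using selfadjoint_nonnegD[OF B] assms(2) by (auto intro: bounded_linear_const_scaleR)
  then show ?thesis using e summable_mult[OF e(2), of a] by (auto simp: covariance_def)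
qed

lemma gaussian_zero:
  fixes e :: "nat \<Rightarrow> 'a::{real_inner, banach, polish_space}"
  assumes "parseval e"
  shows "covariance (\<lambda>_::'a. 0)" "gaussian (\<lambda>_::'a. 0) = return borel 0"
proof -
  show c: "covariance (\<lambda>_::'a. 0)"
    unfolding covariance_def selfadjoint_nonneg_def using assms by auto
  have "has_gaussian_charfun (\<lambda>_. 0) (return borel (0::'a))"
    by (auto simp: has_gaussian_charfun_def prob_space_return integral_return)
  then show "gaussian (\<lambda>_::'a. 0) = return borel 0" by (rule gaussian_eqI[OF c])
qed

lemma gauss_op_zero:
  fixes f :: "'a::{real_inner, banach, polish_space} \<Rightarrow> real"
  assumes "parseval (e :: nat \<Rightarrow> 'a)" "f \<in> bcontfun"
  shows "gauss_op (\<lambda>_. 0) f = f"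
  using borel_measurable_bcontfun[OF assms(2)]
  by (intro ext) (simp add: gauss_op_def gaussian_zero(2)[OF assms(1)] integral_return)

lemma gauss_op_mono:
  assumes B: "covariance B" and f: "f \<in> bcontfun" "g \<in> bcontfun" and le: "\<And>x. f x \<le> g x"
  shows "gauss_op B f z \<le> gauss_op B g z"
proof -
  interpret prob_space "gaussian B" by (rule gaussian_prob_space[OF B])
  note [measurable_cong] = sets_gaussian[OF B]
  have "integrable (gaussian B) (\<lambda>y. f (z + y))" if f: "f \<in> bcontfun" for f :: "'a \<Rightarrow> real"
  proof -
    obtain c where c: "\<And>x. \<bar>f x\<bar> \<le> c" using bcontfunD[OF f] by blast
    note [measurable] = borel_measurable_bcontfun[OF f]
    show ?thesis by (rule integrable_const_bound[where B = c]) (auto simp: c)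
  qed
  then show ?thesis unfolding gauss_op_def using f le by (intro integral_mono) auto
qed

lemma conv_op_diff_le:
  assumes K: "conv_op N K" and f: "f \<in> bcontfun" "g \<in> bcontfun" and le: "\<And>x. \<bar>f x - g x\<bar> \<le> c"
  shows "\<bar>K f z - K g z\<bar> \<le> N * c"
proof -
  have "K (\<lambda>x. f x + (- 1) * g x) z = K f z - K g z"
    by (subst conv_op_lincomb[OF K f]) simp
  moreover have "\<bar>K (\<lambda>x. f x + (- 1) * g x) z\<bar> \<le> N * c"
    using le by (intro conv_op_bound[OF K] bcontfun_lincomb f) simp
  ultimately show ?thesis by simp
qed

section \<open>Lipschitz minorants\<close>

text \<open>The Pasch-Hausdorff envelope, that is, the largest \<open>k\<close>-Lipschitz minorant
  on \<open>D\<close>. It serves because time increments of the Gaussian operators are estimated for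
  Lipschitz functions.\<close>

definition lip_minorant :: "'z::metric_space set \<Rightarrow> ('z \<Rightarrow> real) \<Rightarrow> real \<Rightarrow> 'z \<Rightarrow> real" where
  "lip_minorant D \<phi> k z = (INF w\<in>D. \<phi> w + k * dist z w)"

context
  fixes D :: "'z::metric_space set" and \<phi> :: "'z \<Rightarrow> real" and c :: real
  assumes ne: "D \<noteq> {}" and c: "\<And>w. w \<in> D \<Longrightarrow> \<bar>\<phi> w\<bar> \<le> c"
begin

lemma lip_minorant_bdd: "k \<ge> 0 \<Longrightarrow> bdd_below ((\<lambda>w. \<phi> w + k * dist z w) ` D)"
proof (rule bdd_belowI2)
  fix w assume "k \<ge> 0" "w \<in> D"
  then have "0 \<le> k * dist z w" "\<bar>\<phi> w\<bar> \<le> c" using c by auto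
  then show "- c \<le> \<phi> w + k * dist z w" by linarith
qed

lemma lip_minorant_le: "k \<ge> 0 \<Longrightarrow> z \<in> D \<Longrightarrow> lip_minorant D \<phi> k z \<le> \<phi> z"
  unfolding lip_minorant_def by (rule cINF_lower2[OF lip_minorant_bdd, of _ z]) auto

lemma lip_minorant_ge: "(\<And>w. w \<in> D \<Longrightarrow> b \<le> \<phi> w + k * dist z w) \<Longrightarrow> b \<le> lip_minorant D \<phi> k z"
  unfolding lip_minorant_def by (rule cINF_greatest[OF ne])

lemma lip_minorant_abs_le:
  assumes "k \<ge> 0" "z \<in> D"
  shows "\<bar>lip_minorant D \<phi> k z\<bar> \<le> c"
proof -
  have "- c \<le> \<phi> w + k * dist z w" if "w \<in> D" for w
  proof -
    have "0 \<le> k * dist z w" using assms(1) by simp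
    then show ?thesis using c[OF that] by linarith
  qed
  then have "- c \<le> lip_minorant D \<phi> k z" by (rule lip_minorant_ge)
  then show ?thesis using lip_minorant_le[OF assms] c[OF assms(2)] by simp
qed

lemma lip_minorant_lipschitz:
  assumes k: "k \<ge> 0"
  shows "\<bar>lip_minorant D \<phi> k z - lip_minorant D \<phi> k z'\<bar> \<le> k * dist z z'"
proof -
  have "lip_minorant D \<phi> k z - k * dist z z' \<le> lip_minorant D \<phi> k z'" for z z'
  proof (rule lip_minorant_ge)
    fix w assume w: "w \<in> D"
    have "lip_minorant D \<phi> k z \<le> \<phi> w + k * dist z w"
      unfolding lip_minorant_def by (rule cINF_lower[OF lip_minorant_bdd[OF k] w])
    also have "k * dist z w \<le> k * (dist z z' + dist z' w)"
      using k by (intro mult_left_mono dist_triangle)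
    finally show "lip_minorant D \<phi> k z - k * dist z z' \<le> \<phi> w + k * dist z' w"
      by (simp add: distrib_left)
  qed
  from this[of z z'] this[of z' z] show ?thesis by (simp add: dist_commute abs_le_iff)
qed

text \<open>Close to \<open>z\<close> continuity keeps \<open>\<phi>\<close> near
  \<open>\<phi> z\<close>; away from \<open>z\<close> the penalty outweighs the largest possible
  drop \<open>2 * c\<close> once \<open>k\<close> is large.\<close>

lemma lip_minorant_tendsto:
  assumes cont: "continuous_on D \<phi>" and z: "z \<in> D"
  shows "(\<lambda>k. lip_minorant D \<phi> (real k) z) \<longlonglongrightarrow> \<phi> z"
proof (rule LIMSEQ_I)
  fix e :: real assume e: "e > 0"
  obtain d where d: "d > 0" "\<And>w. w \<in> D \<Longrightarrow> dist w z < d \<Longrightarrow> dist (\<phi> w) (\<phi> z) < e / 2"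
    using cont z e unfolding continuous_on_iff by (meson half_gt_zero)
  obtain k0 :: nat where k0: "2 * c / d < k0" using reals_Archimedean2 by blast
  have "norm (lip_minorant D \<phi> (real k) z - \<phi> z) < e" if "k \<ge> k0" for k
  proof -
    have "\<phi> z - e / 2 \<le> \<phi> w + k * dist z w" if w: "w \<in> D" for w
    proof (cases "dist w z < d")
      case True
      have "0 \<le> k * dist z w" by simp
      then show ?thesis using d(2)[OF w True] unfolding dist_real_def by linarith
    next
      case False
      have "2 * c \<le> k0 * d" using k0 d(1) by (simp add: field_simps)
      also have "\<dots> \<le> k * dist z w"
        using False \<open>k \<ge> k0\<close> d(1) by (intro mult_mono) (auto simp: dist_commute)
      finally show ?thesis using c[OF w] c[OF z] e by linarith
    qed
    then have "\<phi> z - e / 2 \<le> lip_minorant D \<phi> (real k) z" by (rule lip_minorant_ge)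
    then show ?thesis using lip_minorant_le[of k z] z e by simp
  qed
  then show "\<exists>no. \<forall>n\<ge>no. norm (lip_minorant D \<phi> (real n) z - \<phi> z) < e" by blast
qed

end

section \<open>Continuity of the Ornstein--Uhlenbeck semigroup\<close>

locale ou_setting = ou_operators S Q
  for S :: "real \<Rightarrow> 'a \<Rightarrow> 'a::{real_inner, banach, polish_space}" and Q :: "'a \<Rightarrow> 'a" +
  fixes \<theta> :: real
  assumes trace: "\<And>t. t > 0 \<Longrightarrow> finite_trace (Qt S Q t)"
    and range_S: "\<And>t. t > 0 \<Longrightarrow> range (S t) \<subseteq> range (op_sqrt (Qt S Q t))"
    and A2: "assumption_A2 S Q \<theta>"
begin

abbreviation cov :: "real \<Rightarrow> 'a \<Rightarrow> 'a" where
  "cov t \<equiv> Qt S Q t"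

lemma parseval_cov:
  assumes "t > 0"
  shows "\<exists>e. parseval e \<and> summable (\<lambda>n. cov t (e n) \<bullet> e n)"
  using finite_trace_parseval[OF trace[OF assms]] selfadjoint_nonnegD(1)[OF Qt_selfadjoint_nonneg, of t] assms
  by (simp add: linear_0 bounded_linear.linear)

lemma parseval_exists: "\<exists>e :: nat \<Rightarrow> 'a. parseval e"
  using parseval_cov[of 1] by auto

lemma cov_0: "cov 0 = (\<lambda>_. 0)"
  using Qt_0 by auto

lemma covariance_cov: "t \<ge> 0 \<Longrightarrow> covariance (cov t)"
  using parseval_cov[of t] Qt_selfadjoint_nonneg[of t] parseval_exists gaussian_zero(1) cov_0
  by (cases "t = 0") (auto simp: covariance_def)

lemma conv_op_gauss_cov: "t \<ge> 0 \<Longrightarrow> conv_op 1 (gauss_op (cov t))"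
  by (rule conv_op_gauss[OF covariance_cov])

lemma gauss_op_cov_0: "f \<in> bcontfun \<Longrightarrow> gauss_op (cov 0) f = f"
  using parseval_exists gauss_op_zero cov_0 by metis

lemma OU_eq_gauss_op:
  assumes "t \<ge> 0" "f \<in> bcontfun"
  shows "OU S Q t f x = gauss_op (cov t) f (S t x)"
  using assms gauss_op_cov_0[of f] by (cases "t = 0") (auto simp: OU_def gauss_op_def S_0)

text \<open>The Gaussian variable at time \<open>s + t\<close> is that at time \<open>s\<close> plus
  an independent image under \<open>S s\<close> of that at time \<open>t\<close>. A time increment
  thereby becomes a random displacement of the argument.\<close>

lemma gauss_op_cov_add:
  assumes "s \<ge> 0" "t \<ge> 0" "f \<in> bcontfun"
  shows "gauss_op (cov (s + t)) f w = (LINT z|gaussian (cov t). gauss_op (cov s) f (w + S s z))"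
proof (rule gauss_op_convolution)
  show "S s \<in> borel_measurable (gaussian (cov t))"
    unfolding measurable_cong_sets[OF sets_gaussian[OF covariance_cov[OF assms(2)]] refl]
    by (intro borel_measurable_continuous_onI linear_continuous_on bounded_linear_S assms)
  show "cov (s + t) h \<bullet> h = cov s h \<bullet> h + cov t (S_adj s h) \<bullet> S_adj s h" for h
    using Qt_add assms by simp
  have "(CLINT z|gaussian (cov t). iexp (h \<bullet> S s z)) = (CLINT z|gaussian (cov t). iexp (S_adj s h \<bullet> z))" for h
    using inner_S_adj[OF assms(1)] by (simp add: inner_commute[of h] inner_commute[of "S_adj s h"])
  then show "(CLINT z|gaussian (cov t). iexp (h \<bullet> S s z))
      = exp (- complex_of_real ((cov t (S_adj s h) \<bullet> S_adj s h) / 2))" for h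
    using gaussian_charfun[OF covariance_cov[OF assms(2)]] by (simp add: has_gaussian_charfun_def)
qed (use assms in \<open>simp_all add: covariance_cov gaussian_prob_space\<close>)

text \<open>The first absolute moment, which serves as the modulus of continuity in time.\<close>

definition mean_norm :: "real \<Rightarrow> real" where
  "mean_norm t = (LINT z|gaussian (cov t). norm z)"

text \<open>Integrates \<open>norm y \<le> \<epsilon> + (norm y)\<^sup>2 / \<epsilon>\<close>; the
  free parameter stands in for the square root of the trace.\<close>

lemma mean_norm_estimate:
  assumes e: "parseval e" "summable (\<lambda>n. cov t (e n) \<bullet> e n)" and "t \<ge> 0" "\<epsilon> > 0"
  shows "integrable (gaussian (cov t)) norm" "mean_norm t \<le> \<epsilon> + (\<Sum>n. cov t (e n) \<bullet> e n) / \<epsilon>"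
proof -
  let ?\<mu> = "gaussian (cov t)"
  note B = Qt_selfadjoint_nonneg[OF \<open>t \<ge> 0\<close>] and cov = covariance_cov[OF \<open>t \<ge> 0\<close>]
  interpret prob_space ?\<mu> by (rule gaussian_prob_space[OF cov])
  note [measurable_cong] = sets_gaussian[OF cov]
  have "centered_gaussian (cov t) ?\<mu>"
    using gaussian_charfun[OF cov] centered_gaussian_iff_charfun[OF B] by blast
  note mom = gaussian_second_moment[OF B this e]
  have tr: "0 \<le> (\<Sum>n. cov t (e n) \<bullet> e n)"
    by (intro suminf_nonneg e(2) selfadjoint_nonnegD(3)[OF B])
  have sq: "integrable ?\<mu> (\<lambda>y. (norm y)\<^sup>2)"
    by (rule integrableI_nonneg) (auto simp: mom)
  have sqI: "(LINT y|?\<mu>. (norm y)\<^sup>2) = (\<Sum>n. cov t (e n) \<bullet> e n)"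
    using mom tr by (subst integral_eq_nn_integral) auto
  have pt: "norm y \<le> \<epsilon> + (norm y)\<^sup>2 / \<epsilon>" for y :: 'a
  proof (cases "norm y \<le> \<epsilon>")
    case True
    then show ?thesis using \<open>\<epsilon> > 0\<close> by (simp add: add_increasing2)
  next
    case False
    then have "norm y * \<epsilon> \<le> (norm y)\<^sup>2" by (simp add: power2_eq_square mult_left_mono)
    then have "norm y \<le> (norm y)\<^sup>2 / \<epsilon>" using \<open>\<epsilon> > 0\<close> by (simp add: field_simps)
    then show ?thesis using \<open>\<epsilon> > 0\<close> by simp
  qed
  have dom: "integrable ?\<mu> (\<lambda>y. \<epsilon> + (norm y)\<^sup>2 / \<epsilon>)" using sq by simp
  show int: "integrable ?\<mu> norm"
    by (rule Bochner_Integration.integrable_bound[OF dom]) (use order_trans[OF pt abs_ge_self] in auto)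
  have "mean_norm t \<le> (LINT y|?\<mu>. \<epsilon> + (norm y)\<^sup>2 / \<epsilon>)"
    unfolding mean_norm_def by (intro integral_mono int dom pt)
  also have "\<dots> = \<epsilon> + (\<Sum>n. cov t (e n) \<bullet> e n) / \<epsilon>" using sq sqI prob_space by simp
  finally show "mean_norm t \<le> \<epsilon> + (\<Sum>n. cov t (e n) \<bullet> e n) / \<epsilon>" .
qed

lemma integrable_norm: "t \<ge> 0 \<Longrightarrow> integrable (gaussian (cov t)) norm"
  using mean_norm_estimate(1)[of _ t 1] parseval_cov[of t] parseval_exists
  by (cases "t = 0") (auto simp: cov_0)

lemma mean_norm_nonneg: "0 \<le> mean_norm t"
  unfolding mean_norm_def by (rule Bochner_Integration.integral_nonneg) simp

lemma mean_norm_small: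
  assumes "\<epsilon> > 0"
  shows "\<exists>\<delta>>0. \<forall>t. 0 \<le> t \<and> t < \<delta> \<longrightarrow> mean_norm t < \<epsilon>"
proof -
  obtain e where e: "parseval e" "summable (\<lambda>n. cov 1 (e n) \<bullet> e n)" using parseval_cov[of 1] by auto
  define tr where "tr t = (\<Sum>n. cov t (e n) \<bullet> e n)" for t
  \<comment> \<open>A trace below \<open>\<eta>\<close> makes both terms of the estimate, taken with
    parameter \<open>\<epsilon> / 3\<close>, at most \<open>\<epsilon> / 3\<close>.\<close>
  define \<eta> where "\<eta> = (\<epsilon> / 3)\<^sup>2"
  have \<eta>: "\<eta> > 0" using assms by (simp add: \<eta>_def)
  have "(tr \<longlongrightarrow> 0) (at_right 0)"
    unfolding tr_def[abs_def] by (rule Qt_trace_tendsto_0[OF _ e(2)]) simp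
  then have "\<forall>\<^sub>F t in at_right 0. tr t < \<eta>" using order_tendstoD(2) \<eta> by blast
  then obtain \<delta> where \<delta>: "\<delta> > 0" "\<And>t. 0 < t \<Longrightarrow> t < \<delta> \<Longrightarrow> tr t < \<eta>"
    unfolding eventually_at_right_field by blast
  have "mean_norm t < \<epsilon>" if t: "0 \<le> t" "t < min \<delta> 1" for t
  proof -
    have "summable (\<lambda>n. cov t (e n) \<bullet> e n)"
      by (rule summable_comparison_test'[OF e(2), of 0])
         (use t Qt_mono[of t 1] selfadjoint_nonnegD(3)[OF Qt_selfadjoint_nonneg[of t]] in simp)
    note est = mean_norm_estimate(2)[OF e(1) this t(1), of "\<epsilon> / 3", folded tr_def]
    have "tr t < \<eta>"
      using \<delta>(2)[of t] t \<eta> by (cases "t = 0") (auto simp: tr_def cov_0)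
    then have "tr t / (\<epsilon> / 3) < \<eta> / (\<epsilon> / 3)" using assms by (intro divide_strict_right_mono) auto
    also have "\<dots> = \<epsilon> / 3" using assms by (simp add: \<eta>_def power2_eq_square)
    finally show ?thesis using est assms by simp
  qed
  then show ?thesis using \<delta>(1) by (intro exI[of _ "min \<delta> 1"]) auto
qed

text \<open>With the earlier time as base, the later operator averages over the displacement
  \<open>S s z\<close>, whose mean length is at most \<open>M\<close> times the first moment for the
  time difference. The Lipschitz constant survives averaging at the base time.\<close>

lemma gauss_op_time_lipschitz:
  assumes f: "f \<in> bcontfun" and lip: "\<And>x y. \<bar>f x - f y\<bar> \<le> k * norm (x - y)"
    and M: "\<And>s z. s \<in> {0..T} \<Longrightarrow> norm (S s z) \<le> M * norm z"
    and st: "s \<in> {0..T}" "t \<in> {0..T}" and k: "k \<ge> 0"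
  shows "\<bar>gauss_op (cov t) f w - gauss_op (cov s) f w\<bar> \<le> k * M * mean_norm \<bar>t - s\<bar>"
proof -
  have *: "\<bar>gauss_op (cov (s + r)) f w - gauss_op (cov s) f w\<bar> \<le> k * M * mean_norm r"
    if s: "s \<in> {0..T}" and r: "r \<ge> 0" for s r
  proof -
    let ?\<mu> = "gaussian (cov r)"
    have s0: "s \<ge> 0" using s by simp
    interpret prob_space ?\<mu> by (rule gaussian_prob_space[OF covariance_cov[OF r]])
    note [measurable_cong] = sets_gaussian[OF covariance_cov[OF r]]
    have bG: "gauss_op (cov s) f \<in> bcontfun"
      by (rule conv_op_bcontfun[OF conv_op_gauss_cov[OF s0] f])
    obtain c where c: "\<And>x. \<bar>gauss_op (cov s) f x\<bar> \<le> c" using bcontfunD[OF bG] by blast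
    have [measurable]: "gauss_op (cov s) f \<in> borel_measurable borel" "S s \<in> borel_measurable borel"
      using borel_measurable_bcontfun[OF bG] bounded_linear_S[OF s0]
      by (auto intro: borel_measurable_continuous_onI linear_continuous_on)
    have int: "integrable ?\<mu> (\<lambda>z. gauss_op (cov s) f (w + S s z))"
      by (rule integrable_const_bound[where B = c]) (auto simp: c)
    have "gauss_op (cov (s + r)) f w - gauss_op (cov s) f w
        = (LINT z|?\<mu>. gauss_op (cov s) f (w + S s z) - gauss_op (cov s) f w)"
      using int prob_space by (simp add: gauss_op_cov_add[OF s0 r f])
    then have "\<bar>gauss_op (cov (s + r)) f w - gauss_op (cov s) f w\<bar>
        \<le> (LINT z|?\<mu>. \<bar>gauss_op (cov s) f (w + S s z) - gauss_op (cov s) f w\<bar>)"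
      using integral_abs_bound by metis
    also have "\<dots> \<le> (LINT z|?\<mu>. k * M * norm z)"
    proof (rule integral_mono)
      show "integrable ?\<mu> (\<lambda>z. k * M * norm z)" using integrable_norm[OF r] by simp
      fix z
      have "\<bar>gauss_op (cov s) f (w + S s z) - gauss_op (cov s) f w\<bar> \<le> 1 * (k * norm (S s z))"
        by (rule conv_op_diff_bound[OF conv_op_gauss_cov[OF s0] f]) (use lip in \<open>metis add_diff_cancel_left'\<close>)
      also have "\<dots> \<le> 1 * (k * (M * norm z))" using M[OF s] k by (intro mult_left_mono) auto
      finally show "\<bar>gauss_op (cov s) f (w + S s z) - gauss_op (cov s) f w\<bar> \<le> k * M * norm z"
        by (simp add: mult.assoc)
    qed (use int in auto)
    finally show ?thesis by (simp add: mean_norm_def)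
  qed
  show ?thesis
  proof (cases "s \<le> t")
    case True
    then show ?thesis using *[OF st(1), of "t - s"] by simp
  next
    case False
    then show ?thesis using *[OF st(2), of "s - t"] by (simp add: abs_minus_commute)
  qed
qed

text \<open>A merely continuous \<open>\<phi>\<close> admits no uniform modulus in time. A fixed
  Lipschitz minorant does in all three variables, and by monotonicity it bounds the value for
  \<open>\<phi>\<close> from below.\<close>

lemma gauss_op_joint_lsc:
  fixes \<phi> :: "real \<Rightarrow> 'a \<Rightarrow> real"
  assumes cont: "continuous_on ({0..T} \<times> UNIV) (\<lambda>(s, x). \<phi> s x)"
    and c: "\<And>s x. s \<in> {0..T} \<Longrightarrow> \<bar>\<phi> s x\<bar> \<le> c"
    and p: "t0 \<ge> 0" "s0 \<in> {0..T}" and \<epsilon>: "\<epsilon> > 0"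
  shows "\<forall>\<^sub>F (t, s, w) in at (t0, s0, w0) within ({0..} \<times> {0..T} \<times> UNIV).
    gauss_op (cov t) (\<phi> s) w > gauss_op (cov t0) (\<phi> s0) w0 - \<epsilon>"
proof -
  let ?D = "{0..T} \<times> (UNIV :: 'a set)"
  let ?F = "at (t0, s0, w0) within ({0..} \<times> {0..T} \<times> UNIV)"
  have ne: "?D \<noteq> {}" using p by auto
  have c': "\<bar>case z of (s, x) \<Rightarrow> \<phi> s x\<bar> \<le> c" if "z \<in> ?D" for z using c that by auto
  define \<psi> where "\<psi> k s x = lip_minorant ?D (\<lambda>(s, x). \<phi> s x) k (s, x)" for k s x
  have bphi: "\<phi> s \<in> bcontfun" if "s \<in> {0..T}" for s
  proof (rule bcontfunI)
    have "continuous_on UNIV (\<lambda>x. (\<lambda>(s, x). \<phi> s x) (s, x))"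
      by (rule continuous_on_compose2[OF cont]) (use that in \<open>auto intro!: continuous_intros\<close>)
    then show "continuous_on UNIV (\<phi> s)" by simp
  qed (use c that in auto)
  have lip: "\<bar>\<psi> k s x - \<psi> k s' x'\<bar> \<le> k * \<bar>s - s'\<bar> + k * norm (x - x')" if "k \<ge> 0" for k s s' x x'
  proof -
    have "\<bar>\<psi> k s x - \<psi> k s' x'\<bar> \<le> k * dist (s, x) (s', x')"
      unfolding \<psi>_def by (rule lip_minorant_lipschitz[OF ne c' that])
    moreover
    have "dist (s, x) (s', x') \<le> \<bar>s - s'\<bar> + norm (x - x')"
      using sqrt_sum_squares_le_sum[of "\<bar>s - s'\<bar>" "norm (x - x')"]
      unfolding dist_Pair_Pair by (simp add: dist_norm)
    then have "k * dist (s, x) (s', x') \<le> k * (\<bar>s - s'\<bar> + norm (x - x'))"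
      using that by (rule mult_left_mono)
    ultimately show ?thesis by (simp add: distrib_left)
  qed
  have \<psi>c: "\<bar>\<psi> k s x\<bar> \<le> c" if "k \<ge> 0" "s \<in> {0..T}" for k s x
    unfolding \<psi>_def using that by (intro lip_minorant_abs_le[OF ne c']) auto
  have b\<psi>: "\<psi> k s \<in> bcontfun" if "k \<ge> 0" "s \<in> {0..T}" for k s
  proof (rule bcontfunI)
    have "continuous_on UNIV (\<psi> k s)"
      unfolding continuous_on_def
    proof
      fix x :: 'a
      have "((\<lambda>y. k * norm (y - x)) \<longlongrightarrow> k * norm (x - x)) (at x)" by (intro tendsto_intros)
      then have lim: "((\<lambda>y. k * norm (y - x)) \<longlongrightarrow> 0) (at x)" by simp
      have "norm (\<psi> k s y - \<psi> k s x) \<le> k * norm (y - x)" for y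
        using lip[OF that(1), of s y s x] by simp
      then have "\<forall>\<^sub>F y in at x. norm (\<psi> k s y - \<psi> k s x) \<le> k * norm (y - x)"
        by (intro always_eventually allI)
      from Lim_null_comparison[OF this lim] show "(\<psi> k s \<longlongrightarrow> \<psi> k s x) (at x)"
        by (rule LIM_zero_cancel)
    qed
    then show "continuous_on UNIV (\<psi> k s)" .
  qed (use \<psi>c that in auto)
  have "(\<lambda>k. gauss_op (cov t0) (\<psi> (real k) s0) w0) \<longlonglongrightarrow> gauss_op (cov t0) (\<phi> s0) w0"
  proof (rule conv_op_tendsto[OF conv_op_gauss_cov[OF p(1)], where c = c])
    show "(\<lambda>k. \<psi> (real k) s0 x) \<longlonglongrightarrow> \<phi> s0 x" for x
    proof -
      have "(\<lambda>k. lip_minorant ?D (\<lambda>(s, x). \<phi> s x) (real k) (s0, x)) \<longlonglongrightarrow> (case (s0, x) of (s, x) \<Rightarrow> \<phi> s x)"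
        by (rule lip_minorant_tendsto[OF ne _ cont, where c = c]) (use c' p in auto)
      then show ?thesis by (simp add: \<psi>_def)
    qed
  qed (use b\<psi> \<psi>c bphi p in auto)
  \<comment> \<open>Bounded pointwise convergence at the base point provides one minorant that loses
    less than \<open>\<epsilon> / 2\<close> there; the other half of \<open>\<epsilon>\<close> is
    left for moving the point.\<close>
  then have "\<forall>\<^sub>F k in sequentially. gauss_op (cov t0) (\<psi> (real k) s0) w0 > gauss_op (cov t0) (\<phi> s0) w0 - \<epsilon> / 2"
    by (rule order_tendstoD(1)) (use \<epsilon> in simp)
  then obtain n :: nat where n: "gauss_op (cov t0) (\<psi> (real n) s0) w0 > gauss_op (cov t0) (\<phi> s0) w0 - \<epsilon> / 2"
    using eventually_happens by force
  define k where "k = real n"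
  have k: "k \<ge> 0" by (simp add: k_def)
  obtain M where M: "M \<ge> 1" "\<And>s z. s \<in> {0..t0 + 1} \<Longrightarrow> norm (S s z) \<le> M * norm z"
    using S_bound[of "t0 + 1"] p by auto
  have tF: "(fst \<longlongrightarrow> t0) ?F" "((\<lambda>p. fst (snd p)) \<longlongrightarrow> s0) ?F" "((\<lambda>p. snd (snd p)) \<longlongrightarrow> w0) ?F"
    using tendsto_fst[OF tendsto_ident_at, of "(t0, s0, w0)" "{0..} \<times> {0..T} \<times> UNIV"]
      tendsto_fst[OF tendsto_snd[OF tendsto_ident_at], of "(t0, s0, w0)" "{0..} \<times> {0..T} \<times> UNIV"]
      tendsto_snd[OF tendsto_snd[OF tendsto_ident_at], of "(t0, s0, w0)" "{0..} \<times> {0..T} \<times> UNIV"]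
    by simp_all
  have "((\<lambda>p. mean_norm \<bar>fst p - t0\<bar>) \<longlongrightarrow> 0) ?F"
  proof (rule tendstoI)
    fix e :: real assume "e > 0"
    then obtain \<delta> where \<delta>: "\<delta> > 0" "\<And>t. 0 \<le> t \<Longrightarrow> t < \<delta> \<Longrightarrow> mean_norm t < e"
      using mean_norm_small by blast
    have "\<forall>\<^sub>F p in ?F. dist (fst p) t0 < \<delta>" using tendstoD[OF tF(1) \<delta>(1)] .
    then show "\<forall>\<^sub>F p in ?F. dist (mean_norm \<bar>fst p - t0\<bar>) 0 < e"
      by eventually_elim (use \<delta>(2) mean_norm_nonneg in \<open>simp add: dist_real_def\<close>)
  qed
  then have "((\<lambda>p. k * \<bar>fst (snd p) - s0\<bar> + k * norm (snd (snd p) - w0) + k * M * mean_norm \<bar>fst p - t0\<bar>)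
      \<longlongrightarrow> k * \<bar>s0 - s0\<bar> + k * norm (w0 - w0) + k * M * 0) ?F"
    by (intro tendsto_intros tF)
  then have "((\<lambda>p. k * \<bar>fst (snd p) - s0\<bar> + k * norm (snd (snd p) - w0) + k * M * mean_norm \<bar>fst p - t0\<bar>)
      \<longlongrightarrow> 0) ?F" by simp
  then have "\<forall>\<^sub>F p in ?F. k * \<bar>fst (snd p) - s0\<bar> + k * norm (snd (snd p) - w0) + k * M * mean_norm \<bar>fst p - t0\<bar> < \<epsilon> / 2"
    by (rule order_tendstoD(2)) (use \<epsilon> in simp)
  moreover have "\<forall>\<^sub>F p in ?F. p \<in> {0..} \<times> {0..T} \<times> UNIV" by (simp add: eventually_at_filter)
  moreover have "\<forall>\<^sub>F p in ?F. fst p < t0 + 1" by (rule order_tendstoD(2)[OF tF(1)]) simp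
  ultimately show ?thesis
  proof eventually_elim
    case (elim p)
    obtain t s w where pq: "p = (t, s, w)" by (cases p)
    have ts: "t \<ge> 0" "t \<le> t0 + 1" "s \<in> {0..T}" using elim pq by auto
    have "\<bar>gauss_op (cov t) (\<psi> k s) w - gauss_op (cov t) (\<psi> k s0) w\<bar> \<le> 1 * (k * \<bar>s - s0\<bar>)"
    proof (rule conv_op_diff_le[OF conv_op_gauss_cov[OF ts(1)] b\<psi>[OF k ts(3)] b\<psi>[OF k p(2)]])
      show "\<bar>\<psi> k s x - \<psi> k s0 x\<bar> \<le> k * \<bar>s - s0\<bar>" for x
        using lip[OF k, of s x s0 x] by simp
    qed
    moreover have "\<bar>gauss_op (cov t) (\<psi> k s0) (w0 + (w - w0)) - gauss_op (cov t) (\<psi> k s0) w0\<bar> \<le> 1 * (k * norm (w - w0))"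
    proof (rule conv_op_diff_bound[OF conv_op_gauss_cov[OF ts(1)] b\<psi>[OF k p(2)]])
      show "\<bar>\<psi> k s0 (x + (w - w0)) - \<psi> k s0 x\<bar> \<le> k * norm (w - w0)" for x
        using lip[OF k, of s0 "x + (w - w0)" s0 x] by simp
    qed
    moreover have "\<bar>gauss_op (cov t) (\<psi> k s0) w0 - gauss_op (cov t0) (\<psi> k s0) w0\<bar> \<le> k * M * mean_norm \<bar>t - t0\<bar>"
      using lip[OF k, of s0 _ s0] ts p by (intro gauss_op_time_lipschitz[OF b\<psi>[OF k p(2)] _ M(2) _ _ k]) auto
    moreover have "gauss_op (cov t) (\<psi> k s) w \<le> gauss_op (cov t) (\<phi> s) w"
    proof (rule gauss_op_mono[OF covariance_cov[OF ts(1)] b\<psi>[OF k ts(3)] bphi[OF ts(3)]])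
      show "\<psi> k s x \<le> \<phi> s x" for x
      proof -
        have "lip_minorant ?D (\<lambda>(s, x). \<phi> s x) k (s, x) \<le> (case (s, x) of (s, x) \<Rightarrow> \<phi> s x)"
          by (rule lip_minorant_le[OF ne _ k, where c = c]) (use c' ts in auto)
        then show ?thesis by (simp add: \<psi>_def)
      qed
    qed
    ultimately show ?case using elim(1) n unfolding pq k_def[symmetric] by (simp add: abs_le_iff)
  qed
qed

text \<open>Lower semicontinuity for \<open>\<phi>\<close> and for \<open>- \<phi>\<close> together
  give continuity.\<close>

theorem gauss_op_jointly_continuous:
  fixes \<phi> :: "real \<Rightarrow> 'a \<Rightarrow> real"
  assumes cont: "continuous_on ({0..T} \<times> UNIV) (\<lambda>(s, x). \<phi> s x)"
    and c: "\<And>s x. s \<in> {0..T} \<Longrightarrow> \<bar>\<phi> s x\<bar> \<le> c"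
  shows "continuous_on ({0..} \<times> {0..T} \<times> UNIV) (\<lambda>(t, s, w). gauss_op (cov t) (\<phi> s) w)"
  unfolding continuous_on_def
proof
  fix p assume p: "p \<in> {0::real..} \<times> {0..T} \<times> (UNIV :: 'a set)"
  obtain t0 s0 w0 where pq: "p = (t0, s0, w0)" by (cases p)
  have p0: "t0 \<ge> 0" "s0 \<in> {0..T}" using p pq by auto
  have neg: "gauss_op B (\<lambda>x. - f x) z = - gauss_op B f z" for B and f :: "'a \<Rightarrow> real" and z
    by (simp add: gauss_op_def)
  have c': "\<bar>- \<phi> s x\<bar> \<le> c" if "s \<in> {0..T}" for s x using c[OF that] by simp
  have cont': "continuous_on ({0..T} \<times> UNIV) (\<lambda>(s, x). - \<phi> s x)"
    using continuous_on_minus[OF cont] by (simp add: case_prod_unfold)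
  show "((\<lambda>(t, s, w). gauss_op (cov t) (\<phi> s) w) \<longlongrightarrow> (case p of (t, s, w) \<Rightarrow> gauss_op (cov t) (\<phi> s) w))
      (at p within {0..} \<times> {0..T} \<times> UNIV)"
    unfolding pq
  proof (rule tendstoI)
    fix \<epsilon> :: real assume \<epsilon>: "\<epsilon> > 0"
    have "\<forall>\<^sub>F (t, s, w) in at (t0, s0, w0) within ({0..} \<times> {0..T} \<times> UNIV).
        gauss_op (cov t) (\<phi> s) w > gauss_op (cov t0) (\<phi> s0) w0 - \<epsilon>"
      by (rule gauss_op_joint_lsc[OF cont _ p0 \<epsilon>]) (rule c)
    moreover have "\<forall>\<^sub>F (t, s, w) in at (t0, s0, w0) within ({0..} \<times> {0..T} \<times> UNIV).
        gauss_op (cov t) (\<lambda>x. - \<phi> s x) w > gauss_op (cov t0) (\<lambda>x. - \<phi> s0 x) w0 - \<epsilon>"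
      by (rule gauss_op_joint_lsc[OF cont' _ p0 \<epsilon>]) (rule c')
    ultimately show "\<forall>\<^sub>F p in at (t0, s0, w0) within {0..} \<times> {0..T} \<times> UNIV.
        dist (case p of (t, s, w) \<Rightarrow> gauss_op (cov t) (\<phi> s) w)
          (case (t0, s0, w0) of (t, s, w) \<Rightarrow> gauss_op (cov t) (\<phi> s) w) < \<epsilon>"
      by eventually_elim (auto simp: neg dist_real_def)
  qed
qed

end

section \<open>Smoothing estimates\<close>

lemma gauss_op_scale_add:
  assumes B: "covariance B" and ab: "a \<ge> 0" "b \<ge> 0" and f: "f \<in> bcontfun"
  shows "gauss_op (\<lambda>x. (a + b) *\<^sub>R B x) f = gauss_op (\<lambda>x. a *\<^sub>R B x) (gauss_op (\<lambda>x. b *\<^sub>R B x) f)"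
proof
  fix w
  have a: "covariance (\<lambda>x. a *\<^sub>R B x)" using B ab(1) by (rule covariance_scaleR)
  have "gauss_op (\<lambda>x. (a + b) *\<^sub>R B x) f w
      = (LINT z|gaussian (\<lambda>x. a *\<^sub>R B x). gauss_op (\<lambda>x. b *\<^sub>R B x) f (w + z))"
  proof (rule gauss_op_convolution[where q = "\<lambda>h. a * (B h \<bullet> h)"])
    show "(\<lambda>z. z) \<in> borel_measurable (gaussian (\<lambda>x. a *\<^sub>R B x))"
      unfolding measurable_cong_sets[OF sets_gaussian[OF a] refl] by simp
    show "(CLINT z|gaussian (\<lambda>x. a *\<^sub>R B x). iexp (h \<bullet> z)) = exp (- complex_of_real (a * (B h \<bullet> h) / 2))" for h
      using gaussian_charfun[OF a] by (simp add: has_gaussian_charfun_def)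
    show "covariance (\<lambda>x. (a + b) *\<^sub>R B x)" "covariance (\<lambda>x. b *\<^sub>R B x)"
      using ab by (auto intro: covariance_scaleR[OF B])
    show "((a + b) *\<^sub>R B h) \<bullet> h = (b *\<^sub>R B h) \<bullet> h + a * (B h \<bullet> h)" for h
      by (simp add: distrib_right)
  qed (use f in \<open>auto intro: gaussian_prob_space a\<close>)
  then show "gauss_op (\<lambda>x. (a + b) *\<^sub>R B x) f w = gauss_op (\<lambda>x. a *\<^sub>R B x) (gauss_op (\<lambda>x. b *\<^sub>R B x) f) w"
    by (simp add: gauss_op_def)
qed

lemma gauss_op_iterate:
  fixes B :: "'a \<Rightarrow> 'a::{real_inner, banach, polish_space}"
  assumes B: "covariance B" and b: "b \<ge> 0" and f: "f \<in> bcontfun"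
  shows "(gauss_op (\<lambda>x. b *\<^sub>R B x) ^^ m) f = gauss_op (\<lambda>x. (m * b) *\<^sub>R B x) f"
proof (induction m)
  case 0
  obtain e :: "nat \<Rightarrow> 'a" where "parseval e" using B by (auto simp: covariance_def)
  then show ?case using gauss_op_zero[OF _ f] by simp
next
  case (Suc m)
  have "(gauss_op (\<lambda>x. b *\<^sub>R B x) ^^ Suc m) f = gauss_op (\<lambda>x. (b + m * b) *\<^sub>R B x) f"
    using gauss_op_scale_add[OF B b _ f, of "m * b"] Suc b by simp
  then show ?case by (simp add: distrib_right)
qed

lemma conv_op_fold:
  assumes "\<And>h. conv_op (c h) (A h)"
  shows "conv_op (prod_list (map c hs)) (fold A hs)"
proof (induction hs)
  case Nil
  have "conv_op 1 (\<lambda>f. f)" by (simp add: conv_op_def)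
  then show ?case by (simp add: id_def)
next
  case (Cons h hs)
  have "conv_op (prod_list (map c hs) * c h) (\<lambda>f. fold A hs (A h f))"
    by (rule conv_op_compose[OF Cons assms])
  then show ?case by (simp add: mult.commute o_def)
qed

lemma conv_op_funpow_bcontfun:
  assumes "conv_op N G" "f \<in> bcontfun"
  shows "(G ^^ n) f \<in> bcontfun"
  by (induction n) (auto simp: assms conv_op_bcontfun[OF assms(1)])

lemma has_dir_deriv_imp_dir_deriv:
  assumes "has_dir_deriv (dir_deriv f hs) h g"
  shows "dir_deriv f (h # hs) = g"
  using assms by (intro ext) (simp add: has_dir_deriv_def DERIV_imp_deriv)

text \<open>One factor \<open>G\<close> is spent on each derivative. The remaining factors commute with directional
  derivatives, so the new operator \<open>A h\<close> ends up innermost.\<close>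

lemma dir_deriv_funpow:
  assumes G: "conv_op 1 G" and A: "\<And>h. conv_op (c h) (A h)"
    and d: "\<And>h f. f \<in> bcontfun \<Longrightarrow> has_dir_deriv (G f) (L h) (A h f)" and f: "f \<in> bcontfun"
  shows "dir_deriv ((G ^^ (length hs + n)) f) (map L hs) = fold A hs ((G ^^ n) f)"
    and "has_dir_deriv (dir_deriv ((G ^^ (Suc (length hs) + n)) f) (map L hs)) (L h)
           (dir_deriv ((G ^^ (Suc (length hs) + n)) f) (map L (h # hs)))"
proof -
  have step: "has_dir_deriv (fold A hs ((G ^^ Suc n) f)) (L h) (fold A hs (A h ((G ^^ n) f)))" for hs n h
  proof -
    have b: "(G ^^ n) f \<in> bcontfun" by (rule conv_op_funpow_bcontfun[OF G f])
    show ?thesis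
      using conv_op_has_dir_deriv[OF conv_op_fold[OF A] conv_op_bcontfun[OF G b] conv_op_bcontfun[OF A b] d[OF b]]
      by simp
  qed
  have eq: "dir_deriv ((G ^^ (length hs + n)) f) (map L hs) = fold A hs ((G ^^ n) f)" for hs n
  proof (induction hs arbitrary: n)
    case (Cons h hs)
    have "dir_deriv ((G ^^ (length hs + Suc n)) f) (map L hs) = fold A hs ((G ^^ Suc n) f)" by (rule Cons)
    with step[of hs n h] show ?case
      by (intro has_dir_deriv_imp_dir_deriv[where hs = "map L hs", simplified] ext)
         (simp add: has_dir_deriv_imp_dir_deriv)
  qed auto
  show "dir_deriv ((G ^^ (length hs + n)) f) (map L hs) = fold A hs ((G ^^ n) f)" by (rule eq)
  show "has_dir_deriv (dir_deriv ((G ^^ (Suc (length hs) + n)) f) (map L hs)) (L h)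
           (dir_deriv ((G ^^ (Suc (length hs) + n)) f) (map L (h # hs)))"
    using step[of hs n h] eq[of hs "Suc n"] eq[of "h # hs" n] by simp
qed

lemma dir_deriv_linear_comp:
  assumes "linear L"
  shows "dir_deriv (\<lambda>x. F (L x)) hs x = dir_deriv F (map L hs) (L x)"
  by (induction hs arbitrary: x) (simp_all add: linear_add[OF assms] linear_scale[OF assms])

lemma has_dir_deriv_linear_comp:
  assumes "linear L" "has_dir_deriv F (L h) F'"
  shows "has_dir_deriv (\<lambda>x. F (L x)) h (\<lambda>x. F' (L x))"
  using assms(2) by (simp add: has_dir_deriv_def linear_add[OF assms(1)] linear_scale[OF assms(1)])

lemma prod_list_map_mult:
  fixes c :: real
  shows "prod_list (map (\<lambda>h. c * f h) hs) = c ^ length hs * prod_list (map f hs)"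
  by (induction hs) auto

context ou_setting
begin

lemma \<theta>_pos: "\<theta> > 0"
  using A2 by (simp add: assumption_A2_def)

lemma linear_S: "t \<ge> 0 \<Longrightarrow> linear (S t)"
  using bounded_linear_S bounded_linear.linear by blast

text \<open>Recasts the bound on the pseudo-inverse as domination of a rank one form by the form of
  \<open>cov t\<close>, which is the hypothesis of the smoothing lemma for the direction
  \<open>S t h\<close>.\<close>

lemma cameron_martin_bound:
  assumes T: "T > 0"
  shows "\<exists>C>0. \<forall>t\<in>{0<..T}. \<forall>h x. (S t h \<bullet> x)\<^sup>2 \<le> (C * t powr (- \<theta>) * norm h)\<^sup>2 * (cov t x \<bullet> x)"
proof -
  obtain \<omega> C0 where C0: "C0 > 0"
    and bl: "\<And>t. t > 0 \<Longrightarrow> bounded_linear (pseudo_inverse (op_sqrt (cov t)) \<circ> S t)"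
    and le: "\<And>t. t > 0 \<Longrightarrow> onorm (pseudo_inverse (op_sqrt (cov t)) \<circ> S t) \<le> C0 * exp (\<omega> * t) * t powr (- \<theta>)"
    using A2 unfolding assumption_A2_def by blast
  \<comment> \<open>On bounded time intervals the exponential growth is absorbed into the
    constant.\<close>
  define C where "C = C0 * exp (\<bar>\<omega>\<bar> * T)"
  have "(S t h \<bullet> x)\<^sup>2 \<le> (C * t powr (- \<theta>) * norm h)\<^sup>2 * (cov t x \<bullet> x)" if t: "t \<in> {0<..T}" for t h x
  proof -
    define R where "R = op_sqrt (cov t)"
    define k where "k = pseudo_inverse R (S t h)"
    have t0: "t > 0" "t \<ge> 0" using t by auto
    note B = Qt_selfadjoint_nonneg[OF t0(2)]
    have R: "selfadjoint_nonneg R" "\<And>x. R (R x) = cov t x"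
      using op_sqrt[OF B] by (auto simp: R_def)
    have "S t h \<in> range R" using range_S[OF t0(1)] by (auto simp: R_def)
    then have Rk: "R k = S t h" unfolding k_def by (rule pseudo_inverse[OF selfadjoint_nonnegD(1)[OF R(1)]])
    have "norm k \<le> onorm (pseudo_inverse R \<circ> S t) * norm h"
      unfolding k_def using onorm[OF bl[OF t0(1)], of h] by (simp add: R_def)
    also have "\<dots> \<le> (C0 * exp (\<omega> * t) * t powr (- \<theta>)) * norm h"
      using le[OF t0(1)] by (intro mult_right_mono) (auto simp: R_def)
    also have "\<dots> \<le> (C * t powr (- \<theta>)) * norm h"
    proof -
      have "\<omega> * t \<le> \<bar>\<omega>\<bar> * t" using t0 by (intro mult_right_mono) auto
      also have "\<dots> \<le> \<bar>\<omega>\<bar> * T" using t by (intro mult_left_mono) auto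
      finally have "C0 * exp (\<omega> * t) \<le> C" using C0 by (simp add: C_def)
      then show ?thesis by (intro mult_right_mono) auto
    qed
    finally have "(norm k)\<^sup>2 \<le> (C * t powr (- \<theta>) * norm h)\<^sup>2" by (intro power_mono) auto
    moreover have "(S t h \<bullet> x)\<^sup>2 \<le> (norm k)\<^sup>2 * (cov t x \<bullet> x)"
    proof -
      have "(S t h \<bullet> x)\<^sup>2 = (k \<bullet> R x)\<^sup>2" unfolding Rk[symmetric] by (simp add: selfadjoint_nonnegD(2)[OF R(1)])
      also have "\<dots> \<le> (k \<bullet> k) * (R x \<bullet> R x)" by (rule Cauchy_Schwarz_ineq)
      also have "R x \<bullet> R x = cov t x \<bullet> x" by (metis R selfadjoint_nonnegD(2))
      finally show ?thesis by (simp add: power2_norm_eq_inner)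
    qed
    moreover have "0 \<le> cov t x \<bullet> x" by (rule selfadjoint_nonnegD(3)[OF B])
    ultimately show ?thesis using mult_right_mono order_trans by blast
  qed
  moreover have "C > 0" using C0 by (simp add: C_def)
  ultimately show ?thesis by blast
qed

lemma OU_eq_comp: "t \<ge> 0 \<Longrightarrow> f \<in> bcontfun \<Longrightarrow> OU S Q t f = (\<lambda>x. gauss_op (cov t) f (S t x))"
  using OU_eq_gauss_op by blast

text \<open>The derivative is exposed as an operator \<open>K\<close> evaluated at
  \<open>S t x\<close>, and not merely bounded, because limits in time and space and increments of
  \<open>f\<close> are later passed through \<open>K\<close>. Fixing \<open>N\<close> in advance
  gives one constant for all orders up to \<open>N\<close>.\<close>

theorem OU_smoothing:
  assumes T: "T > 0"
  shows "\<exists>C>0. \<forall>t\<in>{0<..T}. \<forall>hs. length hs \<le> N \<longrightarrow> (\<exists>K.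
     conv_op (C * t powr (- \<theta> * length hs) * prod_list (map norm hs)) K \<and>
     (\<forall>f\<in>bcontfun. \<forall>x. dir_deriv (OU S Q t f) hs x = K f (S t x)) \<and>
     (\<forall>f\<in>bcontfun. length hs < N \<longrightarrow>
        (\<forall>h. has_dir_deriv (dir_deriv (OU S Q t f) hs) h (dir_deriv (OU S Q t f) (h # hs)))) \<and>
     (hs \<noteq> [] \<longrightarrow> (\<forall>f H (\<alpha>::real) z. f \<in> bcontfun \<and> 0 < \<alpha> \<and> \<alpha> < 1 \<and> 0 \<le> H \<and>
        (\<forall>x w. \<bar>f (x + w) - f x\<bar> \<le> H * norm w powr \<alpha>) \<longrightarrow>
        \<bar>K f z\<bar> \<le> C * H * t powr (- \<theta> * (real (length hs) - \<alpha>)) * prod_list (map norm hs))))"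
proof (cases "N = 0")
  case True
  \<comment> \<open>No factor is available for splitting when \<open>N = 0\<close>; the Gaussian
    operator itself serves as \<open>K\<close>.\<close>
  have "conv_op 1 (gauss_op (cov t)) \<and> (\<forall>f\<in>bcontfun. \<forall>x. OU S Q t f x = gauss_op (cov t) f (S t x))"
    if "t \<in> {0<..T}" for t
    using that conv_op_gauss_cov OU_eq_gauss_op by auto
  then show ?thesis using True by (intro exI[of _ 1]) force
next
  case False
  then have N: "N > 0" by simp
  obtain C0 where C0: "C0 > 0"
    and cm: "\<And>t h x. t \<in> {0<..T} \<Longrightarrow> (S t h \<bullet> x)\<^sup>2 \<le> (C0 * t powr (- \<theta>) * norm h)\<^sup>2 * (cov t x \<bullet> x)"
    using cameron_martin_bound[OF T] by blast
  obtain M where M: "M \<ge> 1" "\<And>s z. s \<in> {0..T} \<Longrightarrow> norm (S s z) \<le> M * norm z"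
    using S_bound[of T] T by auto
  \<comment> \<open>Each of the \<open>N\<close> factors has covariance \<open>cov t\<close> divided
    by \<open>N\<close>, which costs \<open>sqrt N\<close> in the domination constant. The maximum
    with 1 makes powers of \<open>D\<close> increase up to \<open>D ^ N\<close>.\<close>
  define D where "D = max 1 (C0 * sqrt N)"
  have D: "D \<ge> 1" by (simp add: D_def)
  \<comment> \<open>The 2 is the constant of the Hoelder gain; \<open>M\<close> comes from
    \<open>norm (S t h) powr \<alpha>\<close>, which is at most
    \<open>M * norm h powr \<alpha>\<close>.\<close>
  define C where "C = 2 * M * D ^ N"
  have DN: "1 \<le> D ^ N" using D by simp
  have DC: "D ^ N \<le> C"
    using M(1) DN mult_mono[of 1 "2 * M" "D ^ N" "D ^ N"] by (simp add: C_def)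
  have C: "C > 0" using DN DC by linarith
  show ?thesis
  proof (intro exI[of _ C] conjI ballI allI impI C)
    fix t and hs :: "'a list" assume t: "t \<in> {0<..T}" and hs: "length hs \<le> N"
    have t0: "t > 0" "t \<ge> 0" "t \<in> {0..T}" using t by auto
    define B where "B x = (1 / real N) *\<^sub>R cov t x" for x
    have B: "covariance B" unfolding B_def[abs_def] by (rule covariance_scaleR[OF covariance_cov[OF t0(2)]]) simp
    define G where "G = gauss_op B"
    define c where "c h = D * t powr (- \<theta>) * norm h" for h :: 'a
    have G: "conv_op 1 G" unfolding G_def by (rule conv_op_gauss[OF B])
    have GN: "(G ^^ N) f = gauss_op (cov t) f" if "f \<in> bcontfun" for f
      using gauss_op_iterate[OF covariance_cov[OF t0(2)] _ that, of "1 / real N" N] N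
      by (simp add: G_def B_def[abs_def])
    have "(S t h \<bullet> x)\<^sup>2 \<le> (c h)\<^sup>2 * (B x \<bullet> x)" for h x
    proof -
      have "(S t h \<bullet> x)\<^sup>2 \<le> (C0 * t powr (- \<theta>) * norm h)\<^sup>2 * (cov t x \<bullet> x)" by (rule cm[OF t])
      also have "\<dots> = ((C0 * sqrt N) * t powr (- \<theta>) * norm h)\<^sup>2 * (B x \<bullet> x)"
        using N by (simp add: B_def power_mult_distrib)
      also have "\<dots> \<le> (c h)\<^sup>2 * (B x \<bullet> x)"
        using C0 B selfadjoint_nonnegD(3)
        by (intro mult_right_mono power_mono) (auto simp: c_def D_def covariance_def intro!: mult_right_mono)
      finally show ?thesis .
    qed
    moreover have "c h \<ge> 0" for h using D by (simp add: c_def)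
    ultimately have "\<forall>h. \<exists>K. conv_op (c h) K \<and> (\<forall>f\<in>bcontfun. has_dir_deriv (G f) (S t h) (K f)) \<and>
      (\<forall>f H (\<alpha>::real) z. f \<in> bcontfun \<and> 0 < \<alpha> \<and> \<alpha> < 1 \<and> (\<forall>x w. \<bar>f (x + w) - f x\<bar> \<le> H * norm w powr \<alpha>) \<longrightarrow>
        \<bar>K f z\<bar> \<le> 2 * H * norm (S t h) powr \<alpha> * c h powr (1 - \<alpha>))"
      unfolding G_def by (intro allI gauss_op_smoothing[OF B])
    then obtain A where A: "\<And>h. conv_op (c h) (A h)"
      and dA: "\<And>h f. f \<in> bcontfun \<Longrightarrow> has_dir_deriv (G f) (S t h) (A h f)"
      and gain: "\<And>h f H \<alpha> z. f \<in> bcontfun \<Longrightarrow> 0 < \<alpha> \<Longrightarrow> \<alpha> < 1 \<Longrightarrow>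
        (\<And>x w. \<bar>f (x + w) - f x\<bar> \<le> H * norm w powr \<alpha>) \<Longrightarrow>
        \<bar>A h f z\<bar> \<le> 2 * H * norm (S t h) powr \<alpha> * c h powr (1 - \<alpha>)"
      by metis
    define n where "n = N - length hs"
    have n: "N = length hs + n" using hs by (simp add: n_def)
    define K where "K f = fold A hs ((G ^^ n) f)" for f
    have Gn: "conv_op 1 (G ^^ n)"
    proof (induction n)
      case 0
      show ?case by (simp add: conv_op_def)
    next
      case (Suc n)
      then show ?case using conv_op_compose[OF G Suc] by (simp add: o_def)
    qed
    have prod_c: "prod_list (map c hs) = D ^ length hs * t powr (- \<theta> * length hs) * prod_list (map norm hs)" for hs
      unfolding c_def[abs_def] prod_list_map_mult using t0(1) by (simp add: power_mult_distrib powr_power mult.commute)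
    have DD: "D ^ m \<le> D ^ N" if "m \<le> N" for m using that D by (rule power_increasing)
    have "conv_op (prod_list (map c hs) * 1) K"
      unfolding K_def[abs_def] by (rule conv_op_compose[OF conv_op_fold[OF A] Gn])
    moreover have "prod_list (map c hs) * 1 \<le> C * t powr (- \<theta> * length hs) * prod_list (map norm hs)"
      unfolding prod_c using order_trans[OF DD[OF hs] DC]
      by (auto intro!: mult_right_mono prod_list_norm_nonneg)
    ultimately have K: "conv_op (C * t powr (- \<theta> * length hs) * prod_list (map norm hs)) K"
      by (rule conv_op_mono)
    have OU_eq: "OU S Q t f = (\<lambda>x. (G ^^ N) f (S t x))" if "f \<in> bcontfun" for f
      using OU_eq_comp[OF t0(2) that] GN[OF that] by simp
    have "dir_deriv (OU S Q t f) hs x = K f (S t x)" if f: "f \<in> bcontfun" for f x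
      unfolding OU_eq[OF f] dir_deriv_linear_comp[OF linear_S[OF t0(2)]] K_def n
      by (subst dir_deriv_funpow(1)[OF G A dA f]) auto
    moreover have "has_dir_deriv (dir_deriv (OU S Q t f) hs) h (dir_deriv (OU S Q t f) (h # hs))"
      if f: "f \<in> bcontfun" and l: "length hs < N" for f h
    proof -
      have N': "N = Suc (length hs) + (N - Suc (length hs))" using l by simp
      have "has_dir_deriv (dir_deriv ((G ^^ N) f) (map (S t) hs)) (S t h)
           (dir_deriv ((G ^^ N) f) (map (S t) (h # hs)))"
        by (subst (1 2) N', rule dir_deriv_funpow(2)[OF G A dA f])
      from has_dir_deriv_linear_comp[OF linear_S[OF t0(2)] this] show ?thesis
        unfolding OU_eq[OF f] dir_deriv_linear_comp[OF linear_S[OF t0(2)], abs_def] .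
    qed
    moreover have "\<bar>K f z\<bar> \<le> C * H * t powr (- \<theta> * (real (length hs) - \<alpha>)) * prod_list (map norm hs)"
      if ne: "hs \<noteq> []" and f: "f \<in> bcontfun" and \<alpha>: "0 < \<alpha>" "\<alpha> < 1" and H0: "0 \<le> H"
        and H: "\<And>x w. \<bar>f (x + w) - f x\<bar> \<le> H * norm w powr \<alpha>" for f H z and \<alpha> :: real
    proof -
      \<comment> \<open>The innermost derivative alone acts on a function with a known Hoelder bound
        and collects the gain; each of the others costs a full
        \<open>t powr (- \<theta>)\<close>.\<close>
      obtain h hs' where hs': "hs = h # hs'" using ne by (cases hs) auto
      let ?u = "(G ^^ n) f"
      have u: "?u \<in> bcontfun" by (rule conv_op_bcontfun[OF Gn f])
      have uH: "\<bar>?u (x + w) - ?u x\<bar> \<le> H * norm w powr \<alpha>" for x w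
        using conv_op_diff_bound[OF Gn f H, of x w] by simp
      have "\<bar>A h ?u y\<bar> \<le> (2 * M * D) * (H * t powr (- \<theta> * (1 - \<alpha>)) * norm h)" for y
      proof -
        have "\<bar>A h ?u y\<bar> \<le> 2 * (H * norm (S t h) powr \<alpha>) * c h powr (1 - \<alpha>)"
          using gain[OF u \<alpha> uH] by (simp add: mult.assoc)
        also have "\<dots> \<le> 2 * (H * (M * norm h) powr \<alpha>) * c h powr (1 - \<alpha>)"
          using M(2)[OF t0(3), of h] \<alpha> H0
          by (intro mult_right_mono mult_left_mono powr_mono2) auto
        also have "\<dots> = 2 * H * (M powr \<alpha> * D powr (1 - \<alpha>)) * t powr (- \<theta> * (1 - \<alpha>)) * (norm h powr \<alpha> * norm h powr (1 - \<alpha>))"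
          using M(1) D t0 by (simp add: c_def powr_mult powr_powr mult_ac)
        also have "norm h powr \<alpha> * norm h powr (1 - \<alpha>) = norm h"
          by (simp flip: powr_add)
        also have "2 * H * (M powr \<alpha> * D powr (1 - \<alpha>)) * t powr (- \<theta> * (1 - \<alpha>)) * norm h
            = 2 * (M powr \<alpha> * D powr (1 - \<alpha>)) * (H * t powr (- \<theta> * (1 - \<alpha>)) * norm h)" by simp
        also have "\<dots> \<le> 2 * (M * D) * (H * t powr (- \<theta> * (1 - \<alpha>)) * norm h)"
        proof -
          have "M powr \<alpha> \<le> M powr 1" "D powr (1 - \<alpha>) \<le> D powr 1"
            using M(1) D \<alpha> by (intro powr_mono; simp)+
          then have "M powr \<alpha> * D powr (1 - \<alpha>) \<le> M * D" using M(1) D by (intro mult_mono) auto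
          moreover have "0 \<le> H * t powr (- \<theta> * (1 - \<alpha>)) * norm h"
            using H0 by simp
          ultimately show ?thesis by (intro mult_right_mono mult_left_mono) auto
        qed
        finally show ?thesis by (simp add: mult.assoc)
      qed
      from conv_op_bound[OF conv_op_fold[OF A, where hs = hs'] conv_op_bcontfun[OF A u] this]
      have "\<bar>K f z\<bar> \<le> prod_list (map c hs') * ((2 * M * D) * (H * t powr (- \<theta> * (1 - \<alpha>)) * norm h))"
        by (simp add: K_def hs')
      also have "\<dots> = (2 * M * D ^ length hs) * (H * (t powr (- \<theta> * length hs') * t powr (- \<theta> * (1 - \<alpha>))) * prod_list (map norm hs))"
        unfolding prod_c by (simp add: hs')
      also have "t powr (- \<theta> * length hs') * t powr (- \<theta> * (1 - \<alpha>)) = t powr (- \<theta> * (real (length hs) - \<alpha>))"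
        by (simp add: powr_add[symmetric] hs' algebra_simps)
      also have "(2 * M * D ^ length hs) * (H * t powr (- \<theta> * (real (length hs) - \<alpha>)) * prod_list (map norm hs))
          \<le> C * (H * t powr (- \<theta> * (real (length hs) - \<alpha>)) * prod_list (map norm hs))"
      proof (rule mult_right_mono)
        show "2 * M * D ^ length hs \<le> C" using DD[OF hs] M(1) by (simp add: C_def)
        show "0 \<le> H * t powr (- \<theta> * (real (length hs) - \<alpha>)) * prod_list (map norm hs)"
          using H0 prod_list_norm_nonneg[of hs] by simp
      qed
      finally show ?thesis by (simp add: mult.assoc)
    qed
    ultimately show "\<exists>K. conv_op (C * t powr (- \<theta> * length hs) * prod_list (map norm hs)) K \<and>
     (\<forall>f\<in>bcontfun. \<forall>x. dir_deriv (OU S Q t f) hs x = K f (S t x)) \<and>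
     (\<forall>f\<in>bcontfun. length hs < N \<longrightarrow>
        (\<forall>h. has_dir_deriv (dir_deriv (OU S Q t f) hs) h (dir_deriv (OU S Q t f) (h # hs)))) \<and>
     (hs \<noteq> [] \<longrightarrow> (\<forall>f H (\<alpha>::real) z. f \<in> bcontfun \<and> 0 < \<alpha> \<and> \<alpha> < 1 \<and> 0 \<le> H \<and>
        (\<forall>x w. \<bar>f (x + w) - f x\<bar> \<le> H * norm w powr \<alpha>) \<longrightarrow>
        \<bar>K f z\<bar> \<le> C * H * t powr (- \<theta> * (real (length hs) - \<alpha>)) * prod_list (map norm hs)))"
      using K by blast
  qed
qed

end

section \<open>Hoelder spaces through directional derivatives\<close>

lemma dir_deriv_Nil [simp]: "dir_deriv f [] = f"
  by (rule ext) simp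

declare dir_deriv.simps [simp del]

text \<open>Only directional derivatives, with no uniformity in the directions: this much passes
  through \<open>conv_op\<close> and through time integrals. Convergence in the norm of forms is
  recovered afterwards.\<close>

definition smooth_upto :: "nat \<Rightarrow> ('a::real_normed_vector \<Rightarrow> real) \<Rightarrow> bool" where
  "smooth_upto n f \<longleftrightarrow> (\<forall>hs. length hs \<le> n \<longrightarrow> dir_deriv f hs \<in> bcontfun) \<and>
     (\<forall>hs h. length hs < n \<longrightarrow> has_dir_deriv (dir_deriv f hs) h (dir_deriv f (h # hs)))"

text \<open>A candidate formula that satisfies the differentiation recursion must agree with the
  iterated \<open>deriv\<close>; concrete derivatives are identified in this way.\<close>

lemma smooth_uptoI:
  assumes nil: "D [] = f" and b: "\<And>hs. length hs \<le> n \<Longrightarrow> D hs \<in> bcontfun"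
    and d: "\<And>hs h. length hs < n \<Longrightarrow> has_dir_deriv (D hs) h (D (h # hs))"
  shows "smooth_upto n f" "length hs \<le> n \<Longrightarrow> dir_deriv f hs = D hs"
proof -
  have eq: "dir_deriv f hs = D hs" if "length hs \<le> n" for hs
    using that
  proof (induction hs)
    case (Cons h hs)
    then have "has_dir_deriv (dir_deriv f hs) h (D (h # hs))" using d[of hs h] by simp
    then show ?case by (rule has_dir_deriv_imp_dir_deriv)
  qed (simp add: nil)
  then show "length hs \<le> n \<Longrightarrow> dir_deriv f hs = D hs" .
  show "smooth_upto n f" unfolding smooth_upto_def using b d eq by simp
qed

lemma has_dir_deriv_add:
  "has_dir_deriv f h f' \<Longrightarrow> has_dir_deriv g h g' \<Longrightarrow> has_dir_deriv (\<lambda>x. f x + g x) h (\<lambda>x. f' x + g' x)"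
  by (auto simp: has_dir_deriv_def intro: DERIV_add)

lemma has_dir_deriv_cmult:
  "has_dir_deriv f h f' \<Longrightarrow> has_dir_deriv (\<lambda>x. c * f x) h (\<lambda>x. c * f' x)"
  by (auto simp: has_dir_deriv_def intro: DERIV_cmult)

lemma smooth_upto_add:
  assumes "smooth_upto n f" "smooth_upto n g"
  shows "smooth_upto n (\<lambda>x. f x + g x)"
    "length hs \<le> n \<Longrightarrow> dir_deriv (\<lambda>x. f x + g x) hs = (\<lambda>x. dir_deriv f hs x + dir_deriv g hs x)"
proof -
  let ?D = "\<lambda>hs x. dir_deriv f hs x + dir_deriv g hs x"
  have b: "?D hs \<in> bcontfun" if "length hs \<le> n" for hs
    using bcontfun_lincomb[of "dir_deriv f hs" "dir_deriv g hs" 1] assms that by (auto simp: smooth_upto_def)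
  have d: "has_dir_deriv (?D hs) h (?D (h # hs))" if "length hs < n" for hs h
    using assms that unfolding smooth_upto_def by (intro has_dir_deriv_add) auto
  show "smooth_upto n (\<lambda>x. f x + g x)"
    "length hs \<le> n \<Longrightarrow> dir_deriv (\<lambda>x. f x + g x) hs = (\<lambda>x. dir_deriv f hs x + dir_deriv g hs x)"
    by (rule smooth_uptoI[of ?D, OF _ b d]; simp)+
qed

text \<open>Directional derivatives need not be additive in the direction. Continuity in the base
  point makes the increment along \<open>k\<close> taken from \<open>x + r *\<^sub>R h\<close>
  comparable with the one taken from \<open>x\<close>.\<close>

lemma has_dir_deriv_linear:
  assumes d: "\<And>h. has_dir_deriv f h (f' h)" and cont: "\<And>h. continuous_on UNIV (f' h)"
  shows "linear (\<lambda>h. f' h x)"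
proof (rule linearI)
  show "f' (r *\<^sub>R h) x = r *\<^sub>R f' h x" for r h
    using has_dir_deriv_unique[OF d has_dir_deriv_scaleR[OF d]] by simp
  fix h k
  have "has_dir_deriv f (h + k) (\<lambda>x. f' h x + f' k x)"
    unfolding has_dir_deriv_def
  proof
    fix x
    have "((\<lambda>r. (f (x + r *\<^sub>R h + r *\<^sub>R k) - f (x + r *\<^sub>R h)) / r - f' k x) \<longlongrightarrow> 0) (at 0)"
    proof (rule tendstoI)
      fix \<epsilon> :: real assume \<epsilon>: "\<epsilon> > 0"
      obtain \<delta> where \<delta>: "\<delta> > 0" "\<And>y. dist y x < \<delta> \<Longrightarrow> dist (f' k y) (f' k x) < \<epsilon> / 2"
        using cont[of k] \<epsilon> unfolding continuous_on_iff by (meson UNIV_I half_gt_zero)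
      have "((\<lambda>r::real. \<bar>r\<bar> * (norm h + norm k)) \<longlongrightarrow> 0) (at 0)"
        by (rule tendsto_mult_left_zero) (auto intro!: tendsto_eq_intros)
      then have "\<forall>\<^sub>F r::real in at 0. \<bar>r\<bar> * (norm h + norm k) < \<delta>"
        using \<delta>(1) by (rule order_tendstoD(2))
      moreover have "\<forall>\<^sub>F r::real in at 0. r \<noteq> 0" by (simp add: eventually_at_filter)
      ultimately show "\<forall>\<^sub>F r in at 0. dist ((f (x + r *\<^sub>R h + r *\<^sub>R k) - f (x + r *\<^sub>R h)) / r - f' k x) 0 < \<epsilon>"
      proof eventually_elim
        case (elim r)
        have "\<bar>f (x + r *\<^sub>R h + r *\<^sub>R k) - f (x + r *\<^sub>R h) - r * f' k x\<bar> \<le> \<bar>r\<bar> * (\<epsilon> / 2)"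
        proof (rule has_dir_deriv_diff_le[OF has_dir_deriv_scaleR[OF d]])
          fix s :: real assume s: "0 < s" "s < 1"
          let ?y = "x + r *\<^sub>R h + s *\<^sub>R r *\<^sub>R k"
          have "norm (?y - x) \<le> norm (r *\<^sub>R h) + norm (s *\<^sub>R r *\<^sub>R k)"
            using norm_triangle_ineq[of "r *\<^sub>R h" "s *\<^sub>R r *\<^sub>R k"] by simp
          also have "norm (s *\<^sub>R r *\<^sub>R k) \<le> 1 * (\<bar>r\<bar> * norm k)"
            using s by (simp only: norm_scaleR, intro mult_mono) auto
          finally have "dist ?y x < \<delta>" using elim(1) by (simp add: dist_norm distrib_left)
          then have "\<bar>f' k ?y - f' k x\<bar> \<le> \<epsilon> / 2" using \<delta>(2) by (simp add: dist_real_def less_imp_le)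
          then have "\<bar>r\<bar> * \<bar>f' k ?y - f' k x\<bar> \<le> \<bar>r\<bar> * (\<epsilon> / 2)" by (rule mult_left_mono) simp
          then show "\<bar>r * f' k ?y - r * f' k x\<bar> \<le> \<bar>r\<bar> * (\<epsilon> / 2)"
            by (simp add: abs_mult[symmetric] right_diff_distrib)
        qed
        moreover have "\<bar>(f (x + r *\<^sub>R h + r *\<^sub>R k) - f (x + r *\<^sub>R h)) / r - f' k x\<bar>
            = \<bar>f (x + r *\<^sub>R h + r *\<^sub>R k) - f (x + r *\<^sub>R h) - r * f' k x\<bar> / \<bar>r\<bar>"
          using elim(2) by (simp add: abs_divide[symmetric] diff_divide_distrib)
        ultimately have "\<bar>(f (x + r *\<^sub>R h + r *\<^sub>R k) - f (x + r *\<^sub>R h)) / r - f' k x\<bar> \<le> \<epsilon> / 2"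
          using elim(2) by (simp add: field_simps)
        then show ?case using \<epsilon> by (simp add: dist_real_def)
      qed
    qed
    then have "((\<lambda>r. (f (x + r *\<^sub>R h + r *\<^sub>R k) - f (x + r *\<^sub>R h)) / r) \<longlongrightarrow> f' k x) (at 0)"
      by (rule LIM_zero_cancel)
    moreover have "((\<lambda>r. (f (x + r *\<^sub>R h) - f x) / r) \<longlongrightarrow> f' h x) (at 0)"
      using d[of h] by (simp add: has_dir_deriv_def has_field_derivative_iff)
    ultimately have "((\<lambda>r. (f (x + r *\<^sub>R h) - f x) / r + (f (x + r *\<^sub>R h + r *\<^sub>R k) - f (x + r *\<^sub>R h)) / r)
        \<longlongrightarrow> f' h x + f' k x) (at 0)" by (intro tendsto_add)
    then show "((\<lambda>r. f (x + r *\<^sub>R (h + k))) has_real_derivative f' h x + f' k x) (at 0)"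
      by (simp add: has_field_derivative_iff scaleR_add_right add.assoc diff_divide_distrib)
  qed
  from has_dir_deriv_unique[OF d this] show "f' (h + k) x = f' h x + f' k x" by simp
qed

text \<open>The outermost direction is linear by the preceding lemma. In the inner slots linearity
  holds before the last differentiation by induction, and differentiating that identity along the
  outermost direction preserves it.\<close>

lemma smooth_upto_linear:
  assumes f: "smooth_upto n f"
  shows "length hs \<le> n \<Longrightarrow> i < length hs \<Longrightarrow> linear (\<lambda>z. dir_deriv f (hs[i := z]) x)"
proof (induction hs arbitrary: i x)
  case (Cons h hs)
  show ?case
  proof (cases i)
    case 0
    have "linear (\<lambda>z. dir_deriv f (z # hs) x)"
    proof (rule has_dir_deriv_linear)
      show "has_dir_deriv (dir_deriv f hs) z (dir_deriv f (z # hs))" for z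
        using f Cons.prems by (simp add: smooth_upto_def)
      have "dir_deriv f (z # hs) \<in> bcontfun" for z
        using f Cons.prems by (simp add: smooth_upto_def)
      then show "continuous_on UNIV (dir_deriv f (z # hs))" for z using bcontfunD by blast
    qed
    then show ?thesis using 0 by simp
  next
    case (Suc j)
    have lin: "linear (\<lambda>z. dir_deriv f (hs[j := z]) y)" for y
      using Cons.IH[of j y] Cons.prems Suc by simp
    have d: "has_dir_deriv (dir_deriv f (hs[j := z])) h (dir_deriv f (h # hs[j := z]))" for z
      using f Cons.prems by (simp add: smooth_upto_def)
    have "linear (\<lambda>z. dir_deriv f (h # hs[j := z]) x)"
    proof (rule linearI)
      fix y z :: 'a and r :: real
      have "dir_deriv f (hs[j := y + z]) = (\<lambda>x. dir_deriv f (hs[j := y]) x + dir_deriv f (hs[j := z]) x)"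
        using linear_add[OF lin] by auto
      from has_dir_deriv_unique[OF d[of "y + z", unfolded this] has_dir_deriv_add[OF d d]]
      show "dir_deriv f (h # hs[j := y + z]) x = dir_deriv f (h # hs[j := y]) x + dir_deriv f (h # hs[j := z]) x"
        by (rule fun_cong)
      have "dir_deriv f (hs[j := r *\<^sub>R z]) = (\<lambda>x. r * dir_deriv f (hs[j := z]) x)"
        using linear_scale[OF lin] by auto
      from has_dir_deriv_unique[OF d[of "r *\<^sub>R z", unfolded this] has_dir_deriv_cmult[OF d]]
      show "dir_deriv f (h # hs[j := r *\<^sub>R z]) x = r *\<^sub>R dir_deriv f (h # hs[j := z]) x"
        by (simp add: fun_eq_iff)
    qed
    then show ?thesis using Suc by simp
  qed
qed simp

section \<open>Norms of forms and quantitative Hoelder classes\<close>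

lemma form_norm_le:
  assumes "\<And>hs. length hs = k \<Longrightarrow> \<bar>M hs\<bar> \<le> N * prod_list (map norm hs)" "0 \<le> N"
  shows "form_norm k M \<le> N"
  unfolding form_norm_def
proof (rule cSUP_least)
  have "replicate k 0 \<in> {hs. length hs = k \<and> (\<forall>h\<in>set hs. norm h \<le> 1)}" by auto
  then show "{hs::'a list. length hs = k \<and> (\<forall>h\<in>set hs. norm h \<le> 1)} \<noteq> {}" by blast
  fix hs :: "'a list" assume "hs \<in> {hs. length hs = k \<and> (\<forall>h\<in>set hs. norm h \<le> 1)}"
  then have hs: "length hs = k" "\<forall>h\<in>set hs. norm h \<le> 1" by auto
  from hs(2) have "prod_list (map norm hs) \<le> 1"
    by (induction hs) (auto intro: mult_le_one prod_list_norm_nonneg)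
  then have "N * prod_list (map norm hs) \<le> N * 1" using assms(2) by (rule mult_left_mono)
  then show "\<bar>M hs\<bar> \<le> N" using assms(1)[OF hs(1)] by simp
qed

lemma multilinear_bound_scaling:
  assumes "continuous_multilinear k M" "\<And>hs. length hs = k \<Longrightarrow> \<forall>h\<in>set hs. norm h \<le> 1 \<Longrightarrow> \<bar>M hs\<bar> \<le> N"
    and "length hs = k"
  shows "\<bar>M hs\<bar> \<le> N * prod_list (map norm hs)"
  using assms
proof (induction k arbitrary: M hs)
  case (Suc k)
  then obtain h hs' where hs: "hs = h # hs'" "length hs' = k" by (cases hs) auto
  have bl: "bounded_linear (\<lambda>z. M (z # hs'))"
    using continuous_multilinear_linear_Cons[OF Suc.prems(1) hs(2)] .
  show ?case
  proof (cases "h = 0")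
    case True
    then show ?thesis using linear_0[OF bounded_linear.linear[OF bl]] by (simp add: hs)
  next
    case False
    define u where "u = (1 / norm h) *\<^sub>R h"
    have u: "norm u = 1" "h = norm h *\<^sub>R u" using False by (simp_all add: u_def)
    have "\<bar>M (u # hs')\<bar> \<le> N * prod_list (map norm hs')"
      using Suc.prems(2) u(1) by (intro Suc.IH[OF continuous_multilinear_Cons[OF Suc.prems(1)] _ hs(2)]) auto
    then have "norm h * \<bar>M (u # hs')\<bar> \<le> norm h * (N * prod_list (map norm hs'))"
      by (rule mult_left_mono) simp
    moreover have "M (h # hs') = norm h * M (u # hs')"
      using linear_scale[OF bounded_linear.linear[OF bl], of "norm h" u] u(2) by simp
    ultimately show ?thesis by (simp add: hs abs_mult mult_ac)
  qed
qed simp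

lemma form_norm_bound:
  assumes M: "continuous_multilinear k M" and "length hs = k"
  shows "\<bar>M hs\<bar> \<le> form_norm k M * prod_list (map norm hs)"
proof (rule multilinear_bound_scaling[OF M _ assms(2)])
  fix hs :: "'a list" assume hs: "length hs = k" "\<forall>h\<in>set hs. norm h \<le> 1"
  obtain C where C: "\<And>hs. length hs = k \<Longrightarrow> \<bar>M hs\<bar> \<le> C * prod_list (map norm hs)"
    using M unfolding continuous_multilinear_def by blast
  show "\<bar>M hs\<bar> \<le> form_norm k M"
    unfolding form_norm_def
  proof (rule cSUP_upper)
    show "bdd_above ((\<lambda>hs. \<bar>M hs\<bar>) ` {hs. length hs = k \<and> (\<forall>h\<in>set hs. norm h \<le> 1)})"
    proof (rule bdd_aboveI2)
      fix hs :: "'a list" assume "hs \<in> {hs. length hs = k \<and> (\<forall>h\<in>set hs. norm h \<le> 1)}"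
      then have hs: "length hs = k" "\<forall>h\<in>set hs. norm h \<le> 1" by auto
      from hs(2) have "prod_list (map norm hs) \<le> 1"
        by (induction hs) (auto intro: mult_le_one prod_list_norm_nonneg)
      have "C * prod_list (map norm hs) \<le> \<bar>C\<bar> * prod_list (map norm hs)"
        by (rule mult_right_mono) (auto intro: prod_list_norm_nonneg)
      also have "\<dots> \<le> \<bar>C\<bar> * 1" using \<open>prod_list (map norm hs) \<le> 1\<close> by (rule mult_left_mono) simp
      finally show "\<bar>M hs\<bar> \<le> \<bar>C\<bar>" using C[OF hs(1)] by simp
    qed
  qed (use hs in auto)
qed

lemma form_norm_nonneg:
  assumes "continuous_multilinear k M"
  shows "0 \<le> form_norm k M"
proof -
  obtain C where C: "\<And>hs. length hs = k \<Longrightarrow> \<bar>M hs\<bar> \<le> C * prod_list (map norm hs)"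
    using assms unfolding continuous_multilinear_def by blast
  have "bdd_above ((\<lambda>hs. \<bar>M hs\<bar>) ` {hs. length hs = k \<and> (\<forall>h\<in>set hs. norm h \<le> 1)})"
  proof (rule bdd_aboveI2)
    fix hs :: "'a list" assume "hs \<in> {hs. length hs = k \<and> (\<forall>h\<in>set hs. norm h \<le> 1)}"
    then have hs: "length hs = k" "\<forall>h\<in>set hs. norm h \<le> 1" by auto
    from form_norm_bound[OF assms hs(1)] have "\<bar>M hs\<bar> \<le> form_norm k M * prod_list (map norm hs)" .
    also from hs(2) have "prod_list (map norm hs) \<le> 1"
      by (induction hs) (auto intro: mult_le_one prod_list_norm_nonneg)
    then have "form_norm k M * prod_list (map norm hs) \<le> \<bar>form_norm k M\<bar> * 1"
      using prod_list_norm_nonneg[of hs] by (intro mult_mono) auto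
    finally show "\<bar>M hs\<bar> \<le> \<bar>form_norm k M\<bar>" by simp
  qed
  then have "\<bar>M (replicate k 0)\<bar> \<le> form_norm k M"
    unfolding form_norm_def by (rule cSUP_upper[rotated]) auto
  then show ?thesis by linarith
qed

lemma continuous_multilinear_diff:
  assumes M: "continuous_multilinear k M" and M': "continuous_multilinear k M'"
  shows "continuous_multilinear k (\<lambda>hs. a * (M hs - M' hs))"
  unfolding continuous_multilinear_def
proof (intro conjI allI impI)
  fix hs :: "'a list" and i assume "length hs = k \<and> i < k"
  then have "linear (\<lambda>h. M (hs[i := h]))" "linear (\<lambda>h. M' (hs[i := h]))"
    using M M' by (auto simp: continuous_multilinear_def)
  then have "linear (\<lambda>h. a *\<^sub>R (M (hs[i := h]) - M' (hs[i := h])))"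
    by (intro linear_compose_scale_right linear_compose_sub)
  then show "linear (\<lambda>h. a * (M (hs[i := h]) - M' (hs[i := h])))" by simp
next
  obtain C C' where C: "\<And>hs. length hs = k \<Longrightarrow> \<bar>M hs\<bar> \<le> C * prod_list (map norm hs)"
    "\<And>hs. length hs = k \<Longrightarrow> \<bar>M' hs\<bar> \<le> C' * prod_list (map norm hs)"
    using M M' unfolding continuous_multilinear_def by blast
  have "\<bar>a * (M hs - M' hs)\<bar> \<le> (\<bar>a\<bar> * (C + C')) * prod_list (map norm hs)" if "length hs = k" for hs
  proof -
    have "\<bar>M hs - M' hs\<bar> \<le> (C + C') * prod_list (map norm hs)"
      using C(1)[OF that] C(2)[OF that] by (simp add: distrib_right)
    then show ?thesis by (simp add: abs_mult mult_left_mono mult.assoc)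
  qed
  then show "\<exists>C. \<forall>hs. length hs = k \<longrightarrow> \<bar>a * (M hs - M' hs)\<bar> \<le> C * prod_list (map norm hs)" by blast
qed

text \<open>A working form of the Hoelder norm: the constants are explicit and relative to products
  of norms, so sums and integrals can be estimated without first showing that suprema are
  finite.\<close>

definition holder_upto :: "nat \<Rightarrow> real \<Rightarrow> real \<Rightarrow> real \<Rightarrow> ('a::real_normed_vector \<Rightarrow> real) \<Rightarrow> bool" where
  "holder_upto n \<sigma> B H f \<longleftrightarrow> smooth_upto n f \<and>
     (\<forall>hs x. length hs \<le> n \<longrightarrow> \<bar>dir_deriv f hs x\<bar> \<le> B * prod_list (map norm hs)) \<and>
     (\<forall>hs x y. length hs = n \<longrightarrow> \<bar>dir_deriv f hs (x + y) - dir_deriv f hs x\<bar>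
        \<le> H * norm y powr \<sigma> * prod_list (map norm hs))"

lemma holder_upto_add:
  assumes f: "holder_upto n \<sigma> B H f" and g: "holder_upto n \<sigma> B' H' g"
  shows "holder_upto n \<sigma> (B + B') (H + H') (\<lambda>x. f x + g x)"
  unfolding holder_upto_def
proof (intro conjI allI impI)
  have s: "smooth_upto n f" "smooth_upto n g" using f g by (auto simp: holder_upto_def)
  show "smooth_upto n (\<lambda>x. f x + g x)" by (rule smooth_upto_add(1)[OF s])
  show "\<bar>dir_deriv (\<lambda>x. f x + g x) hs x\<bar> \<le> (B + B') * prod_list (map norm hs)" if hs: "length hs \<le> n" for hs x
  proof -
    have "\<bar>dir_deriv f hs x\<bar> \<le> B * prod_list (map norm hs)" "\<bar>dir_deriv g hs x\<bar> \<le> B' * prod_list (map norm hs)"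
      using f g hs by (auto simp: holder_upto_def)
    then show ?thesis by (simp add: smooth_upto_add(2)[OF s hs] distrib_right)
  qed
  show "\<bar>dir_deriv (\<lambda>x. f x + g x) hs (x + y) - dir_deriv (\<lambda>x. f x + g x) hs x\<bar>
      \<le> (H + H') * norm y powr \<sigma> * prod_list (map norm hs)" if hs: "length hs = n" for hs x y
  proof -
    have "\<bar>dir_deriv f hs (x + y) - dir_deriv f hs x\<bar> \<le> H * norm y powr \<sigma> * prod_list (map norm hs)"
      "\<bar>dir_deriv g hs (x + y) - dir_deriv g hs x\<bar> \<le> H' * norm y powr \<sigma> * prod_list (map norm hs)"
      using f g hs by (auto simp: holder_upto_def)
    then show ?thesis using hs by (simp add: smooth_upto_add(2)[OF s] distrib_right)
  qed
qed

lemma floor_frac_add: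
  assumes "0 < \<sigma>" "\<sigma> < 1"
  shows "nat \<lfloor>real n + \<sigma>\<rfloor> = n" "frac (real n + \<sigma>) = \<sigma>"
proof -
  have "\<lfloor>real n + \<sigma>\<rfloor> = int n" using assms by (intro floor_unique) auto
  then show "nat \<lfloor>real n + \<sigma>\<rfloor> = n" "frac (real n + \<sigma>) = \<sigma>" by (auto simp: frac_def)
qed

text \<open>Difference quotients must converge uniformly over unit directions. Derivatives below
  order \<open>n\<close> are Lipschitz and those of order \<open>n\<close> are \<sigma>-Hoelder,
  always relative to the product of norms, so the mean value theorem gives a remainder uniform in
  \<open>hs\<close>. The constant counts \<open>f\<close> itself, \<open>n\<close> derivatives and
  the seminorm.\<close>

theorem holder_upto_imp_C_b:
  fixes f :: "'a::real_normed_vector \<Rightarrow> real"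
  assumes f: "holder_upto n \<sigma> B H f" and \<sigma>: "0 < \<sigma>" "\<sigma> < 1" and BH: "0 \<le> B" "0 \<le> H"
    and ne: "\<exists>h::'a. h \<noteq> 0"
  shows "f \<in> C_b (real n + \<sigma>)" "C_b_norm (real n + \<sigma>) f \<le> (real n + 1) * B + H"
proof -
  have s: "smooth_upto n f"
    and B: "\<And>hs x. length hs \<le> n \<Longrightarrow> \<bar>dir_deriv f hs x\<bar> \<le> B * prod_list (map norm hs)"
    and H: "\<And>hs x y. length hs = n \<Longrightarrow> \<bar>dir_deriv f hs (x + y) - dir_deriv f hs x\<bar>
        \<le> H * norm y powr \<sigma> * prod_list (map norm hs)"
    using f by (auto simp: holder_upto_def)
  have d: "has_dir_deriv (dir_deriv f hs) h (dir_deriv f (h # hs))" if "length hs < n" for hs h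
    using s that by (simp add: smooth_upto_def)
  have ml: "continuous_multilinear k (\<lambda>hs. dir_deriv f hs x)" if "k \<le> n" for k x
    unfolding continuous_multilinear_def
    using smooth_upto_linear[OF s] B that by (intro conjI exI[of _ B]) auto
  have modulus: "\<bar>dir_deriv f hs (x + y) - dir_deriv f hs x\<bar>
      \<le> (H * norm y powr \<sigma> + B * norm y) * prod_list (map norm hs)" if hs: "length hs \<le> n" for hs x y
  proof (cases "length hs = n")
    case True
    have "0 \<le> B * norm y * prod_list (map norm hs)" using BH prod_list_norm_nonneg[of hs] by simp
    then show ?thesis using H[OF True, of x y] by (simp add: distrib_right)
  next
    case False
    then have l: "length hs < n" using hs by simp
    have "\<bar>dir_deriv f hs (x + y) - dir_deriv f hs x - 0\<bar> \<le> B * prod_list (map norm (y # hs))"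
      using l B[of "y # hs"] by (intro has_dir_deriv_diff_le[OF d[OF l]]) auto
    moreover have "0 \<le> H * norm y powr \<sigma> * prod_list (map norm hs)" using BH prod_list_norm_nonneg[of hs] by simp
    ultimately show ?thesis by (simp add: distrib_right)
  qed
  have gateaux: "has_gateaux_derivative k (\<lambda>z hs. dir_deriv f hs z) (\<lambda>hs. dir_deriv f hs x) x" if k: "k < n" for k x
    unfolding has_gateaux_derivative_def
  proof (intro conjI allI)
    show "continuous_multilinear (Suc k) (\<lambda>hs. dir_deriv f hs x)" using k by (intro ml) simp
    fix h :: 'a
    \<comment> \<open>The common modulus of all derivatives at distance
      \<open>norm (r *\<^sub>R h)\<close>, times the norm of the additional direction
      \<open>h\<close>.\<close>
    define \<rho> where "\<rho> r = (H * norm (r *\<^sub>R h) powr \<sigma> + B * norm (r *\<^sub>R h)) * norm h" for r :: real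
    have "((\<lambda>r::real. norm (r *\<^sub>R h)) \<longlongrightarrow> 0) (at 0)"
      by (rule tendsto_norm_zero) (auto intro!: tendsto_eq_intros)
    then have "(\<rho> \<longlongrightarrow> (H * 0 + B * 0) * norm h) (at 0)"
      unfolding \<rho>_def[abs_def] using \<sigma>
      by (intro tendsto_intros tendsto_zero_powrI[where b = \<sigma>]) auto
    then have \<rho>0: "(\<rho> \<longlongrightarrow> 0) (at 0)" by simp
    show "((\<lambda>r. form_norm k (\<lambda>hs. (dir_deriv f hs (x + r *\<^sub>R h) - dir_deriv f hs x) / r - dir_deriv f (h # hs) x))
        \<longlongrightarrow> 0) (at 0)"
    proof (rule Lim_null_comparison[OF _ \<rho>0])
      have "\<forall>\<^sub>F r::real in at 0. r \<noteq> 0" by (simp add: eventually_at_filter)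
      then show "\<forall>\<^sub>F r in at 0. norm (form_norm k (\<lambda>hs. (dir_deriv f hs (x + r *\<^sub>R h) - dir_deriv f hs x) / r
          - dir_deriv f (h # hs) x)) \<le> \<rho> r"
      proof eventually_elim
        case (elim r)
        let ?M = "\<lambda>hs. (dir_deriv f hs (x + r *\<^sub>R h) - dir_deriv f hs x) / r - dir_deriv f (h # hs) x"
        have "continuous_multilinear k (\<lambda>hs. 1 * ((1 / r) * (dir_deriv f hs (x + r *\<^sub>R h) - dir_deriv f hs x)
            - dir_deriv f (h # hs) x))"
          using k by (intro continuous_multilinear_diff ml continuous_multilinear_Cons[OF ml]) auto
        then have "0 \<le> form_norm k ?M" by (intro form_norm_nonneg) simp
        moreover have "form_norm k ?M \<le> \<rho> r"
        proof (rule form_norm_le)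
          fix hs :: "'a list" assume hs: "length hs = k"
          have l: "length hs < n" using hs k by simp
          have "\<bar>dir_deriv f hs (x + r *\<^sub>R h) - dir_deriv f hs x - r * dir_deriv f (h # hs) x\<bar>
              \<le> \<bar>r\<bar> * (\<rho> r * prod_list (map norm hs))"
          proof (rule has_dir_deriv_diff_le[OF has_dir_deriv_scaleR[OF d[OF l]]])
            fix s :: real assume s: "0 < s" "s < 1"
            let ?y = "s *\<^sub>R r *\<^sub>R h"
            have y: "norm ?y \<le> norm (r *\<^sub>R h)"
              using s mult_right_mono[of s 1 "\<bar>r\<bar> * norm h"] by (simp add: abs_mult mult.assoc)
            have "\<bar>dir_deriv f (h # hs) (x + ?y) - dir_deriv f (h # hs) x\<bar>
                \<le> (H * norm ?y powr \<sigma> + B * norm ?y) * prod_list (map norm (h # hs))"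
              using l by (intro modulus) simp
            also have "\<dots> \<le> (H * norm (r *\<^sub>R h) powr \<sigma> + B * norm (r *\<^sub>R h)) * prod_list (map norm (h # hs))"
              using y BH \<sigma> by (intro mult_right_mono add_mono mult_left_mono powr_mono2 prod_list_norm_nonneg) auto
            also have "\<dots> = \<rho> r * prod_list (map norm hs)" by (simp add: \<rho>_def)
            finally have "\<bar>r\<bar> * \<bar>dir_deriv f (h # hs) (x + ?y) - dir_deriv f (h # hs) x\<bar>
                \<le> \<bar>r\<bar> * (\<rho> r * prod_list (map norm hs))" by (rule mult_left_mono) simp
            then show "\<bar>r * dir_deriv f (h # hs) (x + ?y) - r * dir_deriv f (h # hs) x\<bar>
                \<le> \<bar>r\<bar> * (\<rho> r * prod_list (map norm hs))"
              by (simp only: abs_mult[symmetric] right_diff_distrib)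
          qed
          moreover have "\<bar>?M hs\<bar> = \<bar>dir_deriv f hs (x + r *\<^sub>R h) - dir_deriv f hs x - r * dir_deriv f (h # hs) x\<bar> / \<bar>r\<bar>"
            using elim by (simp only: abs_divide[symmetric] diff_divide_distrib) simp
          ultimately show "\<bar>?M hs\<bar> \<le> \<rho> r * prod_list (map norm hs)"
            using elim by (simp add: divide_le_eq mult.commute)
        next
          show "0 \<le> \<rho> r" using BH by (simp add: \<rho>_def)
        qed
        ultimately show ?case by simp
      qed
    qed
  qed
  have Cn: "f \<in> Cn_b n"
  proof -
    have b: "\<And>hs. length hs \<le> n \<Longrightarrow> dir_deriv f hs \<in> bcontfun" using s by (simp add: smooth_upto_def)
    from b[of "[]"] have "f \<in> bcontfun" by simp
    with b gateaux show ?thesis unfolding Cn_b_def by blast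
  qed
  have quot: "q \<le> H" if q: "q \<in> holder_quotients n \<sigma> f" for q
  proof -
    obtain x h where q: "q = form_norm n (\<lambda>hs. dir_deriv f hs (x + h) - dir_deriv f hs x) / norm h powr \<sigma>" "h \<noteq> 0"
      using q by (auto simp: holder_quotients_def)
    have "form_norm n (\<lambda>hs. dir_deriv f hs (x + h) - dir_deriv f hs x) \<le> H * norm h powr \<sigma>"
      using H BH by (intro form_norm_le) auto
    then show ?thesis using q by (simp add: divide_le_eq)
  qed
  have "bdd_above (holder_quotients n \<sigma> f)" by (rule bdd_aboveI) (rule quot)
  then show "f \<in> C_b (real n + \<sigma>)"
    unfolding C_b_def floor_frac_add[OF \<sigma>] using Cn by blast
  have "sup_norm f \<le> B"
    unfolding sup_norm_def using B[of "[]"] by (intro cSUP_least) auto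
  moreover have "(\<Sum>k=1..n. SUP x. form_norm k (\<lambda>hs. dir_deriv f hs x)) \<le> (\<Sum>k=1..n. B)"
    using B BH by (intro sum_mono cSUP_least form_norm_le) auto
  \<comment> \<open>A nonzero vector makes the set of quotients nonempty; a supremum over the empty
    set would carry no information.\<close>
  moreover have "Sup (holder_quotients n \<sigma> f) \<le> H"
    using ne quot by (intro cSup_least) (auto simp: holder_quotients_def)
  ultimately show "C_b_norm (real n + \<sigma>) f \<le> (real n + 1) * B + H"
    unfolding C_b_norm_def Cn_b_norm_def floor_frac_add[OF \<sigma>] using \<sigma> by (simp add: algebra_simps)
qed

text \<open>The norm of \<open>f\<close> bounds its derivatives only if the suprema in it are taken
  over bounded sets. For the form norms this is uniform boundedness for multilinear forms, which is
  where completeness of the space enters.\<close>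

theorem C_b_imp_holder_upto:
  fixes f :: "'a::banach \<Rightarrow> real"
  assumes f: "f \<in> C_b (real n + \<sigma>)" and \<sigma>: "0 < \<sigma>" "\<sigma> < 1" and ne: "\<exists>h::'a. h \<noteq> 0"
  defines "c \<equiv> C_b_norm (real n + \<sigma>) f"
  shows "holder_upto n \<sigma> c c f" "0 \<le> c"
proof -
  have Cn: "f \<in> Cn_b n" and q: "bdd_above (holder_quotients n \<sigma> f)"
    using f \<sigma> unfolding C_b_def floor_frac_add[OF \<sigma>] by auto
  have g: "has_gateaux_derivative k (\<lambda>z hs. dir_deriv f hs z) (\<lambda>hs. dir_deriv f hs x) x" if "k < n" for k x
    using Cn that by (simp add: Cn_b_def)
  have b: "dir_deriv f hs \<in> bcontfun" if "length hs \<le> n" for hs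
    using Cn that by (simp add: Cn_b_def)
  have ml: "continuous_multilinear k (\<lambda>hs. dir_deriv f hs x)" if "k \<le> n" for k x
  proof (cases k)
    case 0
    then show ?thesis by (auto simp: continuous_multilinear_def)
  next
    case (Suc j)
    then show ?thesis using g[of j x] that by (simp add: has_gateaux_derivative_def)
  qed
  have d: "has_dir_deriv (dir_deriv f hs) h (dir_deriv f (h # hs))" if l: "length hs < n" for hs h
    unfolding has_dir_deriv_def
  proof
    fix x
    let ?k = "length hs"
    let ?M = "\<lambda>r hs. (dir_deriv f hs (x + r *\<^sub>R h) - dir_deriv f hs x) / r - dir_deriv f (h # hs) x"
    have lim: "((\<lambda>r. form_norm ?k (?M r)) \<longlongrightarrow> 0) (at 0)"
      using g[OF l, of x] by (simp add: has_gateaux_derivative_def)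
    have "((\<lambda>r. ?M r hs) \<longlongrightarrow> 0) (at 0)"
    proof (rule Lim_null_comparison)
      have M: "\<bar>?M r hs\<bar> \<le> form_norm ?k (?M r) * prod_list (map norm hs)" for r
      proof (rule form_norm_bound[OF _ refl])
        have "continuous_multilinear ?k (\<lambda>hs. 1 * ((1 / r) * (dir_deriv f hs (x + r *\<^sub>R h) - dir_deriv f hs x)
            - dir_deriv f (h # hs) x))"
          using l by (intro continuous_multilinear_diff ml continuous_multilinear_Cons[OF ml]) auto
        then show "continuous_multilinear ?k (?M r)" by simp
      qed
      show "\<forall>\<^sub>F r in at 0. norm (?M r hs) \<le> form_norm ?k (?M r) * prod_list (map norm hs)"
        unfolding real_norm_def by (intro always_eventually allI M)
      show "((\<lambda>r. form_norm ?k (?M r) * prod_list (map norm hs)) \<longlongrightarrow> 0) (at 0)"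
        using tendsto_mult_right[OF lim, of "prod_list (map norm hs)"] by simp
    qed
    from LIM_zero_cancel[OF this]
    show "((\<lambda>r. dir_deriv f hs (x + r *\<^sub>R h)) has_real_derivative dir_deriv f (h # hs) x) (at 0)"
      by (simp add: has_field_derivative_iff)
  qed
  have s: "smooth_upto n f" unfolding smooth_upto_def using b d by blast
  have fn: "0 \<le> form_norm k (\<lambda>hs. dir_deriv f hs x)"
    "form_norm k (\<lambda>hs. dir_deriv f hs x) \<le> (SUP x. form_norm k (\<lambda>hs. dir_deriv f hs x))" if k: "k \<le> n" for k x
  proof -
    show "0 \<le> form_norm k (\<lambda>hs. dir_deriv f hs x)" by (rule form_norm_nonneg[OF ml[OF k]])
    have "\<exists>K. \<forall>x. \<bar>dir_deriv f hs x\<bar> \<le> K" if "length hs = k" for hs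
      using bcontfunD[OF b[of hs]] that k by auto
    from multilinear_uniform_boundedness[of k "\<lambda>x hs. dir_deriv f hs x", OF ml[OF k] this]
    obtain K where K: "K \<ge> 0" "\<And>x hs. length hs = k \<Longrightarrow> \<bar>dir_deriv f hs x\<bar> \<le> K * prod_list (map norm hs)"
      by blast
    have "bdd_above (range (\<lambda>x. form_norm k (\<lambda>hs. dir_deriv f hs x)))"
      using K by (intro bdd_aboveI2[where M = K] form_norm_le) auto
    then show "form_norm k (\<lambda>hs. dir_deriv f hs x) \<le> (SUP x. form_norm k (\<lambda>hs. dir_deriv f hs x))"
      by (rule cSUP_upper[rotated]) simp
  qed
  have fm: "\<bar>f x\<bar> \<le> sup_norm f" for x
  proof -
    obtain K where "\<And>x. \<bar>f x\<bar> \<le> K" using bcontfunD[OF b[of "[]"]] by auto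
    then have "bdd_above (range (\<lambda>x. \<bar>f x\<bar>))" by (intro bdd_aboveI2) auto
    then show ?thesis unfolding sup_norm_def by (rule cSUP_upper[rotated]) simp
  qed
  have qs: "form_norm n (\<lambda>hs. dir_deriv f hs (x + y) - dir_deriv f hs x) / norm y powr \<sigma> \<le> Sup (holder_quotients n \<sigma> f)"
    if "y \<noteq> 0" for x y
    using that by (intro cSup_upper q) (auto simp: holder_quotients_def)
  have dml: "continuous_multilinear n (\<lambda>hs. dir_deriv f hs (x + y) - dir_deriv f hs x)" for x y
    using continuous_multilinear_diff[OF ml[OF order_refl, of "x + y"] ml[OF order_refl, of x], of 1] by simp
  have sup0: "0 \<le> Sup (holder_quotients n \<sigma> f)"
  proof -
    obtain h :: 'a where "h \<noteq> 0" using ne by blast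
    from qs[OF this, of 0] form_norm_nonneg[OF dml[of 0 h]] show ?thesis
      by (meson divide_nonneg_nonneg order_trans powr_ge_zero)
  qed
  define t where "t k = (SUP x. form_norm k (\<lambda>hs. dir_deriv f hs x))" for k
  have t0: "0 \<le> t k" if "k \<le> n" for k
    unfolding t_def using order_trans[OF fn(1)[OF that] fn(2)[OF that]] by simp
  have c: "c = sup_norm f + (\<Sum>k=1..n. t k) + Sup (holder_quotients n \<sigma> f)"
    unfolding c_def C_b_norm_def Cn_b_norm_def floor_frac_add[OF \<sigma>] t_def using \<sigma> by simp
  have sn0: "0 \<le> sup_norm f" using fm[of undefined] by linarith
  have sm0: "0 \<le> (\<Sum>k=1..n. t k)" using t0 by (intro sum_nonneg) auto
  show "0 \<le> c" using c sn0 sm0 sup0 by linarith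
  show "holder_upto n \<sigma> c c f"
    unfolding holder_upto_def
  proof (intro conjI allI impI s)
    show "\<bar>dir_deriv f hs x\<bar> \<le> c * prod_list (map norm hs)" if hs: "length hs \<le> n" for hs x
    proof (cases "hs = []")
      case True
      then show ?thesis using fm[of x] c sm0 sup0 by simp
    next
      case False
      then have "1 \<le> length hs" by (cases hs) auto
      then have "t (length hs) \<le> (\<Sum>k=1..n. t k)" using hs t0 by (intro member_le_sum) auto
      then have "form_norm (length hs) (\<lambda>hs. dir_deriv f hs x) \<le> c"
        using fn(2)[OF hs, of x] c sn0 sup0 unfolding t_def by linarith
      then have "form_norm (length hs) (\<lambda>hs. dir_deriv f hs x) * prod_list (map norm hs) \<le> c * prod_list (map norm hs)"
        by (rule mult_right_mono) (rule prod_list_norm_nonneg)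
      then show ?thesis using form_norm_bound[OF ml[OF hs] refl, of x] by linarith
    qed
    show "\<bar>dir_deriv f hs (x + y) - dir_deriv f hs x\<bar> \<le> c * norm y powr \<sigma> * prod_list (map norm hs)"
      if hs: "length hs = n" for hs x y
    proof (cases "y = 0")
      case False
      have "form_norm n (\<lambda>hs. dir_deriv f hs (x + y) - dir_deriv f hs x) / norm y powr \<sigma> \<le> c"
        using qs[OF False, of x] c sn0 sm0 by linarith
      then have "form_norm n (\<lambda>hs. dir_deriv f hs (x + y) - dir_deriv f hs x) \<le> c * norm y powr \<sigma>"
        using False by (simp add: divide_le_eq)
      then have "form_norm n (\<lambda>hs. dir_deriv f hs (x + y) - dir_deriv f hs x) * prod_list (map norm hs)
          \<le> c * norm y powr \<sigma> * prod_list (map norm hs)"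
        by (rule mult_right_mono) (rule prod_list_norm_nonneg)
      then show ?thesis using form_norm_bound[OF dml hs, of x y] by linarith
    qed simp
  qed
qed

section \<open>Action of the semigroup on Hoelder classes\<close>

context ou_setting
begin

lemma bcontfun_comp_S:
  fixes f :: "'a \<Rightarrow> real"
  assumes "f \<in> bcontfun" "t \<ge> 0"
  shows "(\<lambda>x. f (S t x)) \<in> bcontfun"
proof -
  obtain c where c: "continuous_on UNIV f" "\<And>x. \<bar>f x\<bar> \<le> c" using bcontfunD[OF assms(1)] by blast
  have "continuous_on UNIV (\<lambda>x. f (S t x))"
    by (rule continuous_on_compose2[OF c(1) linear_continuous_on[OF bounded_linear_S[OF assms(2)]]]) simp
  then show ?thesis using c(2) by (rule bcontfunI)
qed

text \<open>For smooth \<open>f\<close> the derivatives fall on \<open>f\<close>, along the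
  directions transported by \<open>S t\<close>. Unlike the smoothing estimates this is not singular
  at \<open>t = 0\<close>.\<close>

lemma OU_smooth_upto:
  assumes f: "smooth_upto n f" and t: "t \<ge> 0"
  shows "smooth_upto n (OU S Q t f)"
    "length hs \<le> n \<Longrightarrow> dir_deriv (OU S Q t f) hs x = gauss_op (cov t) (dir_deriv f (map (S t) hs)) (S t x)"
proof -
  let ?D = "\<lambda>hs x. gauss_op (cov t) (dir_deriv f (map (S t) hs)) (S t x)"
  have fb: "dir_deriv f (map (S t) hs) \<in> bcontfun" if "length hs \<le> n" for hs
    using f that by (simp add: smooth_upto_def)
  have nil: "?D [] = OU S Q t f" using OU_eq_comp[OF t] fb[of "[]"] by simp
  have b: "?D hs \<in> bcontfun" if "length hs \<le> n" for hs
    using fb[OF that] by (intro bcontfun_comp_S conv_op_bcontfun[OF conv_op_gauss_cov] t)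
  have d: "has_dir_deriv (?D hs) h (?D (h # hs))" if l: "length hs < n" for hs h
  proof (rule has_dir_deriv_linear_comp[OF linear_S[OF t]], rule conv_op_has_dir_deriv[OF conv_op_gauss_cov[OF t]])
    show "dir_deriv f (map (S t) hs) \<in> bcontfun" "dir_deriv f (map (S t) (h # hs)) \<in> bcontfun"
      using l by (intro fb; simp)+
    show "has_dir_deriv (dir_deriv f (map (S t) hs)) (S t h) (dir_deriv f (map (S t) (h # hs)))"
      using f l by (simp add: smooth_upto_def)
  qed
  show "smooth_upto n (OU S Q t f)" by (rule smooth_uptoI(1)[of ?D, OF nil b d])
  show "length hs \<le> n \<Longrightarrow> dir_deriv (OU S Q t f) hs x = ?D hs x"
    using smooth_uptoI(2)[of ?D, OF nil b d] by simp
qed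

lemma prod_list_S_le:
  assumes M: "M \<ge> 1" "\<And>x. norm (S t x) \<le> M * norm x" and "length hs \<le> n"
  shows "prod_list (map norm (map (S t) hs)) \<le> M ^ n * prod_list (map norm hs)"
proof -
  have "prod_list (map norm (map (S t) hs)) \<le> M ^ length hs * prod_list (map norm hs)"
  proof (induction hs)
    case (Cons h hs)
    have "norm (S t h) * prod_list (map norm (map (S t) hs))
        \<le> (M * norm h) * (M ^ length hs * prod_list (map norm hs))"
      using Cons M by (intro mult_mono prod_list_norm_nonneg) auto
    then show ?case by (simp add: mult_ac)
  qed simp
  also have "\<dots> \<le> M ^ n * prod_list (map norm hs)"
    using M assms(3) by (intro mult_right_mono power_increasing prod_list_norm_nonneg)
  finally show ?thesis .
qed

text \<open>Transported directions contribute at most \<open>M ^ n\<close>; the transported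
  increment contributes \<open>M powr \<sigma>\<close>, which is at most one further
  \<open>M\<close>.\<close>

lemma OU_holder_upto:
  assumes f: "holder_upto n \<sigma> B H f" and BH: "0 \<le> B" "0 \<le> H" and \<sigma>: "0 < \<sigma>" "\<sigma> < 1"
    and M: "M \<ge> 1" "\<And>x. norm (S t x) \<le> M * norm x" and t: "t \<ge> 0"
  shows "holder_upto n \<sigma> (M ^ n * B) (M ^ Suc n * H) (OU S Q t f)"
  unfolding holder_upto_def
proof (intro conjI allI impI)
  have s: "smooth_upto n f"
    and B: "\<And>hs x. length hs \<le> n \<Longrightarrow> \<bar>dir_deriv f hs x\<bar> \<le> B * prod_list (map norm hs)"
    and H: "\<And>hs x y. length hs = n \<Longrightarrow> \<bar>dir_deriv f hs (x + y) - dir_deriv f hs x\<bar>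
        \<le> H * norm y powr \<sigma> * prod_list (map norm hs)"
    using f by (auto simp: holder_upto_def)
  have b: "dir_deriv f (map (S t) hs) \<in> bcontfun" if "length hs \<le> n" for hs
    using s that by (simp add: smooth_upto_def)
  show "smooth_upto n (OU S Q t f)" by (rule OU_smooth_upto(1)[OF s t])
  show "\<bar>dir_deriv (OU S Q t f) hs x\<bar> \<le> M ^ n * B * prod_list (map norm hs)" if hs: "length hs \<le> n" for hs x
  proof -
    have "\<bar>dir_deriv (OU S Q t f) hs x\<bar> \<le> 1 * (B * prod_list (map norm (map (S t) hs)))"
      unfolding OU_smooth_upto(2)[OF s t hs]
      by (intro conv_op_bound[OF conv_op_gauss_cov[OF t]] b B) (use hs in auto)
    also have "\<dots> \<le> 1 * (B * (M ^ n * prod_list (map norm hs)))"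
      using BH M hs by (intro mult_left_mono prod_list_S_le) auto
    finally show ?thesis by (simp add: mult_ac)
  qed
  show "\<bar>dir_deriv (OU S Q t f) hs (x + y) - dir_deriv (OU S Q t f) hs x\<bar>
      \<le> M ^ Suc n * H * norm y powr \<sigma> * prod_list (map norm hs)" if hs: "length hs = n" for hs x y
  proof -
    have hs': "length hs \<le> n" using hs by simp
    have "\<bar>dir_deriv (OU S Q t f) hs (x + y) - dir_deriv (OU S Q t f) hs x\<bar>
        \<le> 1 * (H * norm (S t y) powr \<sigma> * prod_list (map norm (map (S t) hs)))"
      unfolding OU_smooth_upto(2)[OF s t hs'] linear_add[OF linear_S[OF t]]
      by (intro conv_op_diff_bound[OF conv_op_gauss_cov[OF t]] b H) (use hs in auto)
    also have "\<dots> \<le> 1 * (H * (M * norm y powr \<sigma>) * (M ^ n * prod_list (map norm hs)))"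
    proof -
      have "norm (S t y) powr \<sigma> \<le> (M * norm y) powr \<sigma>" using M \<sigma> by (intro powr_mono2) auto
      also have "\<dots> = M powr \<sigma> * norm y powr \<sigma>" using M by (simp add: powr_mult)
      also have "\<dots> \<le> M powr 1 * norm y powr \<sigma>" using M \<sigma> by (intro mult_right_mono powr_mono) auto
      finally have "norm (S t y) powr \<sigma> \<le> M * norm y powr \<sigma>" using M by simp
      then show ?thesis using BH M hs
        by (intro mult_left_mono mult_mono prod_list_S_le mult_nonneg_nonneg prod_list_norm_nonneg) auto
    qed
    finally show ?thesis by (simp add: mult_ac)
  qed
qed

text \<open>The semigroup is continuous only strongly, so \<open>\<epsilon>\<close> depends on
  \<open>hs\<close>. What matters is that it serves all forms with the same bound at once, in
  particular the derivatives of a function at all points.\<close>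

lemma multilinear_S_continuous:
  assumes t0: "t0 \<in> {0..T}"
  shows "\<exists>\<epsilon>::real \<Rightarrow> real. (\<epsilon> \<longlongrightarrow> 0) (at t0 within {0..T}) \<and>
    (\<forall>t\<in>{0..T}. \<forall>m B. 0 \<le> B \<and> continuous_multilinear (length hs) m \<and>
       (\<forall>ks. length ks = length hs \<longrightarrow> \<bar>m ks\<bar> \<le> B * prod_list (map norm ks)) \<longrightarrow>
       \<bar>m (map (S t) hs) - m (map (S t0) hs)\<bar> \<le> B * \<epsilon> t)"
proof (induction hs)
  case Nil
  then show ?case by (intro exI[of _ "\<lambda>_. 0"]) auto
next
  case (Cons h hs)
  let ?F = "at t0 within {0..T}"
  obtain M where M: "M \<ge> 1" "\<And>s z. s \<in> {0..T} \<Longrightarrow> norm (S s z) \<le> M * norm z"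
    using S_bound[of T] t0 by auto
  obtain \<epsilon> :: "real \<Rightarrow> real" where \<epsilon>: "(\<epsilon> \<longlongrightarrow> 0) ?F"
    and IH: "\<And>t m B. t \<in> {0..T} \<Longrightarrow> 0 \<le> B \<Longrightarrow> continuous_multilinear (length hs) m \<Longrightarrow>
       (\<And>ks. length ks = length hs \<Longrightarrow> \<bar>m ks\<bar> \<le> B * prod_list (map norm ks)) \<Longrightarrow>
       \<bar>m (map (S t) hs) - m (map (S t0) hs)\<bar> \<le> B * \<epsilon> t"
    using Cons by blast
  define A where "A = M ^ length hs * prod_list (map norm hs)"
  \<comment> \<open>First slot changed with the rest at time \<open>t\<close>, then the rest changed
    with the first slot at time \<open>t0\<close>.\<close>
  define \<eta> where "\<eta> t = norm (S t h - S t0 h) * A + norm (S t0 h) * \<epsilon> t" for t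
  have "((\<lambda>t. S t h) \<longlongrightarrow> S t0 h) ?F"
    by (rule tendsto_S[OF tendsto_ident_at tendsto_const]) (use t0 in \<open>auto simp: eventually_at_filter\<close>)
  then have "(\<eta> \<longlongrightarrow> norm (S t0 h - S t0 h) * A + norm (S t0 h) * 0) ?F"
    unfolding \<eta>_def[abs_def] by (intro tendsto_intros \<epsilon>)
  then have "(\<eta> \<longlongrightarrow> 0) ?F" by simp
  moreover have "\<bar>m (map (S t) (h # hs)) - m (map (S t0) (h # hs))\<bar> \<le> B * \<eta> t"
    if t: "t \<in> {0..T}" and B0: "0 \<le> B" and m: "continuous_multilinear (length (h # hs)) m"
      and B: "\<And>ks. length ks = length (h # hs) \<Longrightarrow> \<bar>m ks\<bar> \<le> B * prod_list (map norm ks)" for t m B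
  proof -
    have m': "continuous_multilinear (Suc (length hs)) m" using m by simp
    have "linear (\<lambda>z. m (z # map (S t) hs))"
      using continuous_multilinear_linear_Cons[OF m', of "map (S t) hs"] by (simp add: bounded_linear.linear)
    from linear_diff[OF this, of "S t h" "S t0 h"]
    have "m (map (S t) (h # hs)) - m (map (S t0) (h # hs)) = m ((S t h - S t0 h) # map (S t) hs)
        + (m (S t0 h # map (S t) hs) - m (S t0 h # map (S t0) hs))" by simp
    moreover have "\<bar>m ((S t h - S t0 h) # map (S t) hs)\<bar> \<le> B * (norm (S t h - S t0 h) * A)"
    proof -
      have "prod_list (map norm (map (S t) hs)) \<le> A"
        unfolding A_def using M(1) M(2)[OF t] by (intro prod_list_S_le) auto
      then have "B * (norm (S t h - S t0 h) * prod_list (map norm (map (S t) hs))) \<le> B * (norm (S t h - S t0 h) * A)"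
        using B0 by (intro mult_left_mono) auto
      then show ?thesis using B[of "(S t h - S t0 h) # map (S t) hs"] by simp
    qed
    moreover have "\<bar>m (S t0 h # map (S t) hs) - m (S t0 h # map (S t0) hs)\<bar> \<le> (B * norm (S t0 h)) * \<epsilon> t"
    proof (rule IH[OF t _ continuous_multilinear_Cons[OF m']])
      show "0 \<le> B * norm (S t0 h)" using B0 by simp
      show "\<bar>m (S t0 h # ks)\<bar> \<le> B * norm (S t0 h) * prod_list (map norm ks)" if "length ks = length hs" for ks
        using B[of "S t0 h # ks"] that by (simp add: mult.assoc)
    qed
    ultimately show ?thesis by (simp add: \<eta>_def distrib_left)
  qed
  ultimately show ?case by (intro exI[of _ \<eta>]) auto
qed

text \<open>Time enters through the covariance, the directions and the evaluation point. These are
  decoupled, the directions becoming part of a function of \<open>s\<close> and \<open>x\<close>,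
  and the continuity theorem in three variables is then used at \<open>s = t\<close> and
  \<open>w = S t x\<close>.\<close>

lemma OU_jointly_continuous:
  assumes f: "holder_upto n \<sigma> B H f" and B0: "0 \<le> B" and hs: "length hs \<le> n" and T: "T \<ge> 0"
  shows "continuous_on ({0..T} \<times> UNIV) (\<lambda>(t, x). dir_deriv (OU S Q t f) hs x)"
proof -
  have s: "smooth_upto n f"
    and B: "\<And>hs x. length hs \<le> n \<Longrightarrow> \<bar>dir_deriv f hs x\<bar> \<le> B * prod_list (map norm hs)"
    using f by (auto simp: holder_upto_def)
  have b: "dir_deriv f (map (S t) hs) \<in> bcontfun" for t
    using s hs by (simp add: smooth_upto_def)
  obtain M where M: "M \<ge> 1" "\<And>s z. s \<in> {0..T} \<Longrightarrow> norm (S s z) \<le> M * norm z"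
    using S_bound[OF T] by blast
  have ml: "continuous_multilinear (length hs) (\<lambda>hs. dir_deriv f hs x)" for x
    unfolding continuous_multilinear_def
    using smooth_upto_linear[OF s] B hs by (intro conjI exI[of _ B]) auto
  define \<phi> where "\<phi> t = dir_deriv f (map (S t) hs)" for t
  have "continuous_on ({0..T} \<times> UNIV) (\<lambda>(t, x). \<phi> t x)"
    unfolding continuous_on_def
  proof
    fix p assume p: "p \<in> {0..T} \<times> (UNIV :: 'a set)"
    obtain t0 x0 where pq: "p = (t0, x0)" by (cases p)
    have t0: "t0 \<in> {0..T}" using p pq by simp
    let ?F = "at (t0, x0) within ({0..T} \<times> UNIV)"
    obtain \<epsilon> :: "real \<Rightarrow> real" where \<epsilon>: "(\<epsilon> \<longlongrightarrow> 0) (at t0 within {0..T})"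
      and est: "\<And>t m B. t \<in> {0..T} \<Longrightarrow> 0 \<le> B \<Longrightarrow> continuous_multilinear (length hs) m \<Longrightarrow>
       (\<And>ks. length ks = length hs \<Longrightarrow> \<bar>m ks\<bar> \<le> B * prod_list (map norm ks)) \<Longrightarrow>
       \<bar>m (map (S t) hs) - m (map (S t0) hs)\<bar> \<le> B * \<epsilon> t"
      using multilinear_S_continuous[OF t0, of hs] by blast
    \<comment> \<open>A limit at \<open>t0\<close> says nothing about the value there, but pairs
      \<open>(t0, x)\<close> do occur when \<open>(t0, x0)\<close> is approached; so the value at
      \<open>t0\<close> is reset to 0.\<close>
    define \<epsilon>' where "\<epsilon>' t = (if t = t0 then 0 else \<epsilon> t)" for t
    have lim_fst: "(fst \<longlongrightarrow> t0) ?F" and lim_snd: "(snd \<longlongrightarrow> x0) ?F"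
      using tendsto_fst[OF tendsto_ident_at, of "(t0, x0)" "{0..T} \<times> UNIV"]
        tendsto_snd[OF tendsto_ident_at, of "(t0, x0)" "{0..T} \<times> UNIV"] by simp_all
    have "((\<lambda>p. \<epsilon>' (fst p)) \<longlongrightarrow> 0) ?F"
    proof (rule tendstoI)
      fix e :: real assume e: "e > 0"
      have "\<forall>\<^sub>F t in at t0 within {0..T}. dist (\<epsilon> t) 0 < e" by (rule tendstoD[OF \<epsilon> e])
      then obtain \<delta> where \<delta>: "\<delta> > 0" "\<And>t. t \<in> {0..T} \<Longrightarrow> t \<noteq> t0 \<Longrightarrow> dist t t0 < \<delta> \<Longrightarrow> dist (\<epsilon> t) 0 < e"
        unfolding eventually_at by blast
      have "\<forall>\<^sub>F p in ?F. p \<in> {0..T} \<times> UNIV" by (simp add: eventually_at_filter)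
      with tendstoD[OF lim_fst \<delta>(1)] show "\<forall>\<^sub>F p in ?F. dist (\<epsilon>' (fst p)) 0 < e"
        by eventually_elim (use \<delta>(2) e in \<open>auto simp: \<epsilon>'_def\<close>)
    qed
    then have "((\<lambda>p. B * \<epsilon>' (fst p)) \<longlongrightarrow> 0) ?F" by (rule tendsto_mult_right_zero)
    moreover have "\<forall>\<^sub>F p in ?F. norm (\<phi> (fst p) (snd p) - \<phi> t0 (snd p)) \<le> B * \<epsilon>' (fst p)"
    proof -
      have "\<forall>\<^sub>F p in ?F. p \<in> {0..T} \<times> UNIV" by (simp add: eventually_at_filter)
      then show ?thesis
      proof eventually_elim
        case (elim p)
        show ?case
        proof (cases "fst p = t0")
          case False
          then show ?thesis
            using est[of "fst p" B "\<lambda>hs. dir_deriv f hs (snd p)"] elim ml B B0 hs by (auto simp: \<phi>_def \<epsilon>'_def)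
        qed (simp add: \<epsilon>'_def)
      qed
    qed
    ultimately have d1: "((\<lambda>p. \<phi> (fst p) (snd p) - \<phi> t0 (snd p)) \<longlongrightarrow> 0) ?F"
      by (rule Lim_null_comparison[rotated])
    have "continuous_on UNIV (\<phi> t0)" using bcontfunD[OF b] by (simp add: \<phi>_def)
    then have "((\<lambda>p. \<phi> t0 (snd p)) \<longlongrightarrow> \<phi> t0 x0) ?F"
      by (rule continuous_on_tendsto_compose[OF _ lim_snd]) auto
    from tendsto_add[OF d1 this]
    show "((\<lambda>(t, x). \<phi> t x) \<longlongrightarrow> (case p of (t, x) \<Rightarrow> \<phi> t x)) (at p within {0..T} \<times> UNIV)"
      by (simp add: pq case_prod_unfold)
  qed
  moreover have "\<bar>\<phi> t x\<bar> \<le> B * (M ^ n * prod_list (map norm hs))" if t: "t \<in> {0..T}" for t x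
  proof -
    have "\<bar>\<phi> t x\<bar> \<le> B * prod_list (map norm (map (S t) hs))" unfolding \<phi>_def using hs by (intro B) simp
    also have "\<dots> \<le> B * (M ^ n * prod_list (map norm hs))"
      using B0 M(1) M(2)[OF t] hs by (intro mult_left_mono prod_list_S_le) auto
    finally show ?thesis .
  qed
  ultimately have JC: "continuous_on ({0..} \<times> {0..T} \<times> UNIV) (\<lambda>(t, s, w). gauss_op (cov t) (\<phi> s) w)"
    by (rule gauss_op_jointly_continuous)
  have contS: "continuous_on ({0..T} \<times> UNIV) (\<lambda>p. S (fst p) (snd p))"
    unfolding continuous_on_def
    by (intro ballI tendsto_S tendsto_fst tendsto_snd tendsto_ident_at)
       (auto simp: eventually_at_filter intro!: always_eventually)
  have "continuous_on ({0..T} \<times> UNIV) (\<lambda>p. (\<lambda>(t, s, w). gauss_op (cov t) (\<phi> s) w) (fst p, fst p, S (fst p) (snd p)))"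
    by (rule continuous_on_compose2[OF JC]) (auto intro!: continuous_intros contS)
  then show ?thesis
    by (rule continuous_on_cong[THEN iffD1, rotated -1]) (auto simp: OU_smooth_upto(2)[OF s _ hs] \<phi>_def)
qed

end

section \<open>The Duhamel term\<close>

text \<open>By the mean value theorem the majorant of \<open>F'\<close> also dominates the
  difference quotients of \<open>F\<close>.\<close>

lemma has_dir_deriv_integral:
  fixes F F' :: "'b \<Rightarrow> 'a::real_normed_vector \<Rightarrow> real"
  assumes d: "\<And>r. has_dir_deriv (F r) h (F' r)" and b: "\<And>r x. \<bar>F' r x\<bar> \<le> b r" "integrable M b"
    and F: "\<And>x. integrable M (\<lambda>r. F r x)" and F': "\<And>x. (\<lambda>r. F' r x) \<in> borel_measurable M"
  shows "has_dir_deriv (\<lambda>x. LINT r|M. F r x) h (\<lambda>x. LINT r|M. F' r x)"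
  unfolding has_dir_deriv_def
proof
  fix x
  have "((\<lambda>s. ((LINT r|M. F r (x + s *\<^sub>R h)) - (LINT r|M. F r x)) / s) \<longlongrightarrow> (LINT r|M. F' r x)) (at 0)"
    unfolding tendsto_at_iff_sequentially
  proof (intro allI impI)
    fix s :: "nat \<Rightarrow> real" assume s: "\<forall>i. s i \<in> UNIV - {0}" "s \<longlonglongrightarrow> 0"
    have s0: "filterlim s (at 0) sequentially" using s by (simp add: filterlim_at)
    have "(\<lambda>i. LINT r|M. (F r (x + s i *\<^sub>R h) - F r x) / s i) \<longlonglongrightarrow> (LINT r|M. F' r x)"
    proof (rule integral_dominated_convergence[where w = b])
      show "(\<lambda>r. (F r (x + s i *\<^sub>R h) - F r x) / s i) \<in> borel_measurable M" for i
        using F by (intro borel_measurable_divide borel_measurable_diff borel_measurable_const) auto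
      have "((\<lambda>s. (F r (x + s *\<^sub>R h) - F r x) / s) \<longlongrightarrow> F' r x) (at 0)" for r
        using d[of r] by (simp add: has_dir_deriv_def has_field_derivative_iff)
      from filterlim_compose[OF this s0]
      show "AE r in M. (\<lambda>i. (F r (x + s i *\<^sub>R h) - F r x) / s i) \<longlonglongrightarrow> F' r x" by simp
      have "norm ((F r (x + s i *\<^sub>R h) - F r x) / s i) \<le> b r" for i r
      proof -
        have "\<bar>F r (x + s i *\<^sub>R h) - F r x - 0\<bar> \<le> \<bar>s i\<bar> * b r"
        proof (rule has_dir_deriv_diff_le[OF has_dir_deriv_scaleR[OF d]])
          show "\<bar>s i * F' r (x + u *\<^sub>R s i *\<^sub>R h) - 0\<bar> \<le> \<bar>s i\<bar> * b r" for u
            using mult_left_mono[OF b(1)[of r "x + u *\<^sub>R s i *\<^sub>R h"], of "\<bar>s i\<bar>"] by (simp add: abs_mult)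
        qed
        then show ?thesis using s(1) by (simp add: divide_le_eq mult.commute)
      qed
      then show "AE r in M. norm ((F r (x + s i *\<^sub>R h) - F r x) / s i) \<le> b r" for i by simp
    qed (use F' b in auto)
    then show "((\<lambda>s. ((LINT r|M. F r (x + s *\<^sub>R h)) - (LINT r|M. F r x)) / s) \<circ> s) \<longlonglongrightarrow> (LINT r|M. F' r x)"
      using F by (simp add: o_def)
  qed
  then show "((\<lambda>s. LINT r|M. F r (x + s *\<^sub>R h)) has_real_derivative (LINT r|M. F' r x)) (at 0)"
    by (simp add: has_field_derivative_iff)
qed

lemma has_bochner_integral_powr_0:
  fixes p \<rho> :: real
  assumes "p < 1" "\<rho> \<ge> 0"
  shows "has_bochner_integral lborel (\<lambda>r. indicator {0..\<rho>} r * r powr (- p)) (\<rho> powr (1 - p) / (1 - p))"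
proof (rule has_bochner_integral_nn_integral)
  have "((\<lambda>r. r powr (- p)) has_integral (\<rho> powr (- p + 1) / (- p + 1))) {0..\<rho>}"
    using assms by (intro has_integral_powr_from_0) auto
  from nn_integral_has_integral_lebesgue[OF _ this]
  show "(\<integral>\<^sup>+r. ennreal (indicator {0..\<rho>} r * r powr (- p)) \<partial>lborel) = ennreal (\<rho> powr (1 - p) / (1 - p))"
    by simp
qed (use assms in auto)

lemma has_bochner_integral_powr_inf:
  fixes q \<rho> :: real
  assumes "q > 1" "\<rho> > 0"
  shows "has_bochner_integral lborel (\<lambda>r. indicator {\<rho>..} r * r powr (- q)) (\<rho> powr (1 - q) / (q - 1))"
proof (rule has_bochner_integral_nn_integral)
  have "((\<lambda>r. r powr (- q)) has_integral (- (\<rho> powr (- q + 1)) / (- q + 1))) {\<rho>..}"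
    using assms by (intro has_integral_powr_to_inf) auto
  also have "- (\<rho> powr (- q + 1)) / (- q + 1) = \<rho> powr (1 - q) / (q - 1)"
    using assms by (simp add: field_simps)
  finally have "((\<lambda>r. r powr (- q)) has_integral (\<rho> powr (1 - q) / (q - 1))) {\<rho>..}" .
  from nn_integral_has_integral_lebesgue[OF _ this]
  show "(\<integral>\<^sup>+r. ennreal (indicator {\<rho>..} r * r powr (- q)) \<partial>lborel) = ennreal (\<rho> powr (1 - q) / (q - 1))"
    by simp
qed (use assms in auto)

definition duhamel ::
    "(real \<Rightarrow> 'a \<Rightarrow> 'a) \<Rightarrow> ('a \<Rightarrow> 'a) \<Rightarrow> (real \<Rightarrow> 'a \<Rightarrow> real) \<Rightarrow> real \<Rightarrow>
       'a::{real_inner, banach, polish_space} \<Rightarrow> real" where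
  "duhamel S Q g t x = integral {0..t} (\<lambda>s. OU S Q (t - s) (g s) x)"

text \<open>Both parts of the theorem in one frame: \<alpha> = 0 leaves \<open>g\<close> merely
  bounded and continuous, and \<open>G\<close> bounds the sup norm and, for positive \<alpha>, the
  Hoelder seminorm. \<open>n\<close> and \<open>\<sigma>\<close> are the integer and fractional
  parts of \<open>\<alpha> + 1 / \<theta>\<close>; order \<open>Suc n\<close> is included because
  Hoelder increments of order \<open>n\<close> use one more derivative.\<close>

locale duhamel_setting = ou_setting S Q \<theta>
  for S :: "real \<Rightarrow> 'a \<Rightarrow> 'a::{real_inner, banach, polish_space}" and Q :: "'a \<Rightarrow> 'a" and \<theta> :: real +
  fixes T \<alpha> \<sigma> C M G :: real and n :: nat and g :: "real \<Rightarrow> 'a \<Rightarrow> real"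
  assumes T: "T > 0" and \<alpha>: "0 \<le> \<alpha>" "\<alpha> < 1" and \<sigma>: "0 < \<sigma>" "\<sigma> < 1"
    and exponent: "real n + \<sigma> = \<alpha> + 1 / \<theta>"
    and C: "C > 0" and M: "M \<ge> 1" "\<And>t x. t \<in> {0..T} \<Longrightarrow> norm (S t x) \<le> M * norm x"
    and smooth: "\<And>t hs. t \<in> {0<..T} \<Longrightarrow> length hs \<le> Suc n \<Longrightarrow> \<exists>K.
     conv_op (C * t powr (- \<theta> * length hs) * prod_list (map norm hs)) K \<and>
     (\<forall>f\<in>bcontfun. \<forall>x. dir_deriv (OU S Q t f) hs x = K f (S t x)) \<and>
     (\<forall>f\<in>bcontfun. length hs < Suc n \<longrightarrow>
        (\<forall>h. has_dir_deriv (dir_deriv (OU S Q t f) hs) h (dir_deriv (OU S Q t f) (h # hs)))) \<and>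
     (hs \<noteq> [] \<longrightarrow> (\<forall>f H (\<alpha>::real) z. f \<in> bcontfun \<and> 0 < \<alpha> \<and> \<alpha> < 1 \<and> 0 \<le> H \<and>
        (\<forall>x w. \<bar>f (x + w) - f x\<bar> \<le> H * norm w powr \<alpha>) \<longrightarrow>
        \<bar>K f z\<bar> \<le> C * H * t powr (- \<theta> * (real (length hs) - \<alpha>)) * prod_list (map norm hs)))"
    and g_cont: "continuous_on ({0..T} \<times> UNIV) (\<lambda>(s, x). g s x)"
    and g_bound: "\<And>s x. s \<in> {0..T} \<Longrightarrow> \<bar>g s x\<bar> \<le> G" and G: "0 \<le> G"
    and g_holder: "\<And>s x w. \<alpha> > 0 \<Longrightarrow> s \<in> {0..T} \<Longrightarrow> \<bar>g s (x + w) - g s x\<bar> \<le> G * norm w powr \<alpha>"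
begin

text \<open>\<open>g\<close> is controlled only on \<open>[0, T]\<close>.\<close>

definition clamp :: "real \<Rightarrow> real" where
  "clamp s = max 0 (min T s)"

lemma clamp: "clamp s \<in> {0..T}" "s \<in> {0..T} \<Longrightarrow> clamp s = s"
  using T by (auto simp: clamp_def)

lemma g_tendsto:
  assumes "s \<longlonglongrightarrow> t" "\<xi> \<longlonglongrightarrow> x"
  shows "(\<lambda>j. g (clamp (s j)) (\<xi> j)) \<longlonglongrightarrow> g (clamp t) x"
proof -
  have "(\<lambda>j. (clamp (s j), \<xi> j)) \<longlonglongrightarrow> (clamp t, x)"
    unfolding clamp_def by (intro tendsto_intros assms)
  from continuous_on_tendsto_compose[OF g_cont this] show ?thesis using clamp by simp
qed

lemma g_bcontfun: "g (clamp s) \<in> bcontfun"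
proof (rule bcontfunI)
  show "continuous_on UNIV (g (clamp s))"
    unfolding continuous_on_sequentially o_def using g_tendsto[OF tendsto_const] by blast
  show "\<bar>g (clamp s) x\<bar> \<le> G" for x by (rule g_bound[OF clamp(1)])
qed

text \<open>The integrand after the substitution \<open>r = t - s\<close>, which puts the
  singularity at \<open>r = 0\<close> for every \<open>t\<close>.\<close>

definition W :: "real \<Rightarrow> real \<Rightarrow> 'a \<Rightarrow> real" where
  "W t r = OU S Q r (g (clamp (t - r)))"

definition order_exponent :: "nat \<Rightarrow> real" where
  "order_exponent m = max 0 ((real m - \<alpha>) * \<theta>)"

lemma order_exponent_less_1: "m \<le> n \<Longrightarrow> order_exponent m < 1"
proof -
  assume "m \<le> n"
  then have "real m - \<alpha> < 1 / \<theta>" using exponent \<sigma> by linarith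
  then have "(real m - \<alpha>) * \<theta> < 1" using \<theta>_pos by (simp add: field_simps)
  then show ?thesis by (simp add: order_exponent_def)
qed

lemma order_exponent_Suc: "order_exponent (Suc m) = (real m + 1 - \<alpha>) * \<theta>"
  using \<alpha> \<theta>_pos by (simp add: order_exponent_def)

text \<open>The Hoelder gain needs at least one derivative and positive \<alpha>. In the remaining
  cases the plain bound already has the stated exponent.\<close>

lemma W_bound:
  assumes r: "r \<in> {0<..T}" and hs: "length hs \<le> Suc n"
  shows "\<bar>dir_deriv (W t r) hs x\<bar> \<le> C * G * r powr (- order_exponent (length hs)) * prod_list (map norm hs)"
proof -
  obtain K where K: "conv_op (C * r powr (- \<theta> * length hs) * prod_list (map norm hs)) K"
    "\<And>f x. f \<in> bcontfun \<Longrightarrow> dir_deriv (OU S Q r f) hs x = K f (S r x)"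
    and gain: "\<And>f H (\<alpha>::real) z. hs \<noteq> [] \<Longrightarrow> f \<in> bcontfun \<Longrightarrow> 0 < \<alpha> \<Longrightarrow> \<alpha> < 1 \<Longrightarrow> 0 \<le> H \<Longrightarrow>
        (\<And>x w. \<bar>f (x + w) - f x\<bar> \<le> H * norm w powr \<alpha>) \<Longrightarrow>
        \<bar>K f z\<bar> \<le> C * H * r powr (- \<theta> * (real (length hs) - \<alpha>)) * prod_list (map norm hs)"
    using smooth[OF r hs] by blast
  have eq: "dir_deriv (W t r) hs x = K (g (clamp (t - r))) (S r x)"
    unfolding W_def by (rule K(2)[OF g_bcontfun])
  show ?thesis
  proof (cases "hs \<noteq> [] \<and> \<alpha> > 0")
    case True
    then obtain m where m: "length hs = Suc m" by (cases hs) auto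
    have "\<bar>K (g (clamp (t - r))) (S r x)\<bar>
        \<le> C * G * r powr (- \<theta> * (real (length hs) - \<alpha>)) * prod_list (map norm hs)"
      using True g_holder[OF _ clamp(1)] by (intro gain g_bcontfun \<alpha> G) auto
    also have "- \<theta> * (real (length hs) - \<alpha>) = - order_exponent (length hs)"
      unfolding m order_exponent_Suc by (simp add: algebra_simps)
    finally show ?thesis by (simp add: eq)
  next
    case False
    have "\<bar>K (g (clamp (t - r))) (S r x)\<bar> \<le> C * r powr (- \<theta> * length hs) * prod_list (map norm hs) * G"
      by (rule conv_op_bound[OF K(1) g_bcontfun g_bound[OF clamp(1)]])
    also have "- \<theta> * length hs = - order_exponent (length hs)"
    proof (cases "hs = []")
      case True
      then show ?thesis using \<alpha> \<theta>_pos by (simp add: order_exponent_def)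
    next
      case f: False
      then have "\<alpha> = 0" using False \<alpha> by simp
      then show ?thesis unfolding order_exponent_def using \<theta>_pos by (simp add: mult.commute)
    qed
    finally show ?thesis by (simp add: eq mult_ac)
  qed
qed

lemma W_has_dir_deriv:
  assumes "r \<in> {0<..T}" "length hs \<le> n"
  shows "has_dir_deriv (dir_deriv (W t r) hs) h (dir_deriv (W t r) (h # hs))"
  using smooth[of r hs] assms g_bcontfun unfolding W_def by (metis le_imp_less_Suc less_imp_le)

text \<open>For fixed \<open>r\<close> the operator \<open>K\<close> does not depend on
  \<open>t\<close>; only \<open>g\<close> does, and its joint continuity passes through
  \<open>K\<close>.\<close>

lemma W_tendsto:
  assumes r: "r \<in> {0<..T}" and hs: "length hs \<le> Suc n" and t: "\<tau> \<longlonglongrightarrow> t" and x: "\<xi> \<longlonglongrightarrow> x"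
  shows "(\<lambda>j. dir_deriv (W (\<tau> j) r) hs (\<xi> j)) \<longlonglongrightarrow> dir_deriv (W t r) hs x"
proof -
  obtain K where K: "conv_op (C * r powr (- \<theta> * length hs) * prod_list (map norm hs)) K"
    "\<And>f x. f \<in> bcontfun \<Longrightarrow> dir_deriv (OU S Q r f) hs x = K f (S r x)"
    using smooth[OF r hs] by blast
  have r0: "0 \<le> r" using r by simp
  have "(\<lambda>j. K (g (clamp (\<tau> j - r))) (S r (\<xi> j))) \<longlonglongrightarrow> K (g (clamp (t - r))) (S r x)"
  proof (rule conv_op_tendsto2[OF K(1) g_bcontfun g_bcontfun g_bound[OF clamp(1)]])
    show "(\<lambda>j. g (clamp (\<tau> j - r)) (\<zeta> j)) \<longlonglongrightarrow> g (clamp (t - r)) z" if "\<zeta> \<longlonglongrightarrow> z" for \<zeta> z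
      using t that by (intro g_tendsto tendsto_intros)
    show "(\<lambda>j. S r (\<xi> j)) \<longlonglongrightarrow> S r x"
      using r0 by (intro tendsto_S tendsto_const x) auto
  qed
  then show ?thesis by (simp add: W_def K(2)[OF g_bcontfun])
qed

lemma W_diff_smooth:
  assumes r: "r \<in> {0<..T}" and hs: "length hs = n"
  shows "\<bar>dir_deriv (W t r) hs (x + y) - dir_deriv (W t r) hs x\<bar>
    \<le> C * G * r powr (- order_exponent (Suc n)) * norm y * prod_list (map norm hs)"
proof -
  have "\<bar>dir_deriv (W t r) hs (x + y) - dir_deriv (W t r) hs x - 0\<bar>
    \<le> C * G * r powr (- order_exponent (Suc n)) * prod_list (map norm (y # hs))"
    using W_bound[OF r, of "y # hs"] hs
    by (intro has_dir_deriv_diff_le[OF W_has_dir_deriv[OF r]]) auto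
  then show ?thesis by (simp add: mult.assoc)
qed

text \<open>The power of \<open>norm y\<close> kept by the bound for small \<open>r\<close>. With
  \<open>n = 0\<close> there is no derivative to use up the Hoelder continuity of \<open>g\<close>,
  so it remains visible in the increment; otherwise it is already spent on the time
  exponent.\<close>

definition \<beta> :: real where
  "\<beta> = (if n = 0 then \<alpha> else 0)"

text \<open>Integrating \<open>r powr (- order_exponent n)\<close> up to
  \<open>norm y powr (1 / \<theta>)\<close> contributes the second summand as a power of
  \<open>norm y\<close>, so the part of the integral near 0 scales like
  \<open>norm y powr \<sigma>\<close>.\<close>

lemma beta_exponent: "\<beta> + (1 - order_exponent n) / \<theta> = \<sigma>"
proof (cases n)
  case 0
  then have "order_exponent n = 0" using \<alpha> \<theta>_pos by (simp add: order_exponent_def)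
  then show ?thesis unfolding \<beta>_def using 0 exponent by simp
next
  case (Suc m)
  then have "n \<noteq> 0" by simp
  then have "\<beta> = 0" by (simp add: \<beta>_def)
  moreover have "order_exponent n = (real n - \<alpha>) * \<theta>" using order_exponent_Suc[of m] Suc by simp
  ultimately show ?thesis using exponent \<theta>_pos by (simp add: field_simps)
qed

text \<open>Near \<open>r = 0\<close> one more derivative is too singular. The increment is bounded
  by two values, or, for \<open>n = 0\<close> and positive \<alpha>, by the increment of
  \<open>g\<close> itself through translation invariance.\<close>

lemma W_diff_rough:
  assumes r: "r \<in> {0<..T}" and hs: "length hs = n" and y: "y \<noteq> 0"
  shows "\<bar>dir_deriv (W t r) hs (x + y) - dir_deriv (W t r) hs x\<bar>
    \<le> 2 * M * C * G * r powr (- order_exponent n) * norm y powr \<beta> * prod_list (map norm hs)"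
proof (cases "n = 0 \<and> \<alpha> > 0")
  case False
  define B where "B = C * G * r powr (- order_exponent n) * prod_list (map norm hs)"
  have B: "0 \<le> B" using C G prod_list_norm_nonneg[of hs] by (simp add: B_def)
  have "\<bar>dir_deriv (W t r) hs z\<bar> \<le> B" for z
    using W_bound[OF r, of hs t z] hs by (simp add: B_def)
  from this[of "x + y"] this[of x] have "\<bar>dir_deriv (W t r) hs (x + y) - dir_deriv (W t r) hs x\<bar> \<le> 2 * B"
    by linarith
  also have "\<dots> \<le> 2 * M * B" using B M(1) mult_right_mono[of 1 M B] by simp
  \<comment> \<open>This needs \<open>y \<noteq> 0\<close>, since \<open>0 powr 0\<close> is
    0.\<close>
  also have "norm y powr \<beta> = 1" unfolding \<beta>_def using False y \<alpha> by auto
  then have "2 * M * B = 2 * M * C * G * r powr (- order_exponent n) * norm y powr \<beta> * prod_list (map norm hs)"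
    by (simp add: B_def)
  finally show ?thesis .
next
  case True
  then have hs0: "hs = []" and \<beta>: "\<beta> = \<alpha>" and p: "order_exponent n = 0"
    unfolding \<beta>_def order_exponent_def using hs \<alpha> \<theta>_pos by auto
  obtain K where K: "conv_op (C * r powr (- \<theta> * length hs) * prod_list (map norm hs)) K"
    "\<And>f x. f \<in> bcontfun \<Longrightarrow> dir_deriv (OU S Q r f) hs x = K f (S r x)"
    using smooth[OF r, of hs] hs by auto
  have r0: "0 \<le> r" "r \<in> {0..T}" using r by auto
  have "\<bar>dir_deriv (W t r) hs (x + y) - dir_deriv (W t r) hs x\<bar>
      = \<bar>K (g (clamp (t - r))) (S r x + S r y) - K (g (clamp (t - r))) (S r x)\<bar>"
    by (simp add: W_def K(2)[OF g_bcontfun] linear_add[OF linear_S[OF r0(1)]])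
  also have "\<dots> \<le> C * r powr (- \<theta> * length hs) * prod_list (map norm hs) * (G * norm (S r y) powr \<alpha>)"
    using True by (intro conv_op_diff_bound[OF K(1) g_bcontfun] g_holder clamp) auto
  also have "\<dots> = C * G * norm (S r y) powr \<alpha>" using r by (simp add: hs0)
  also have "\<dots> \<le> C * G * (M * norm y powr \<alpha>)"
  proof -
    have "norm (S r y) powr \<alpha> \<le> (M * norm y) powr \<alpha>" using M(2)[OF r0(2), of y] \<alpha> by (intro powr_mono2) auto
    also have "\<dots> = M powr \<alpha> * norm y powr \<alpha>" using M(1) by (simp add: powr_mult)
    also have "\<dots> \<le> M powr 1 * norm y powr \<alpha>" using M(1) \<alpha> by (intro mult_right_mono powr_mono) auto
    finally show ?thesis using M(1) C G by (intro mult_left_mono) auto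
  qed
  also have "\<dots> \<le> 2 * (C * G * (M * norm y powr \<alpha>))" using C G M(1) by simp
  also have "\<dots> = 2 * M * C * G * r powr (- order_exponent n) * norm y powr \<beta> * prod_list (map norm hs)"
    using r by (simp add: hs0 \<beta> p)
  finally show ?thesis .
qed

text \<open>The cut-off lets every \<open>t\<close> share one integral over the whole line, with a
  majorant supported on \<open>[0, T]\<close> that does not depend on \<open>t\<close>.\<close>

definition F :: "real \<Rightarrow> 'a list \<Rightarrow> real \<Rightarrow> 'a \<Rightarrow> real" where
  "F t hs r x = (if 0 < r \<and> r < t then dir_deriv (W t r) hs x else 0)"

definition bound_fun :: "nat \<Rightarrow> real \<Rightarrow> real" where
  "bound_fun m r = C * G * (indicator {0..T} r * r powr (- order_exponent m))"

definition bound_const :: "nat \<Rightarrow> real" where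
  "bound_const m = C * (T powr (1 - order_exponent m) / (1 - order_exponent m))"

lemma bound_fun_integral:
  assumes "m \<le> n"
  shows "has_bochner_integral lborel (bound_fun m) (G * bound_const m)"
proof -
  have "has_bochner_integral lborel (\<lambda>r. C * G * (indicator {0..T} r * r powr (- order_exponent m)))
      (C * G * (T powr (1 - order_exponent m) / (1 - order_exponent m)))"
    using order_exponent_less_1[OF assms] T
    by (intro has_bochner_integral_mult_right has_bochner_integral_powr_0) auto
  then show ?thesis by (simp add: bound_fun_def[abs_def] bound_const_def mult_ac)
qed

lemma F_bound:
  assumes "t \<le> T" "length hs \<le> n"
  shows "\<bar>F t hs r x\<bar> \<le> bound_fun (length hs) r * prod_list (map norm hs)"
proof (cases "0 < r \<and> r < t")
  case True
  then show ?thesis using W_bound[of r hs t x] assms by (simp add: F_def bound_fun_def)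
next
  case False
  have "0 \<le> bound_fun (length hs) r * prod_list (map norm hs)"
    using C G prod_list_norm_nonneg[of hs] by (simp add: bound_fun_def)
  then show ?thesis using False by (simp only: F_def if_False abs_zero)
qed

lemma F_has_dir_deriv: "t \<le> T \<Longrightarrow> length hs \<le> n \<Longrightarrow> has_dir_deriv (F t hs r) h (F t (h # hs) r)"
  using W_has_dir_deriv[of r hs t h] by (auto simp: F_def[abs_def] has_dir_deriv_def)

lemma W_continuous:
  assumes "t \<in> {0..T}"
  shows "continuous_on {0..t} (\<lambda>r. W t r x)"
proof -
  have "continuous_on ({0..T} \<times> UNIV) (\<lambda>(s, x). g s x)" by (rule g_cont)
  then have JC: "continuous_on ({0..} \<times> {0..T} \<times> UNIV) (\<lambda>(t, s, w). gauss_op (cov t) (g s) w)"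
    by (rule gauss_op_jointly_continuous[where c = G]) (rule g_bound)
  have "continuous_on {0..t} (\<lambda>r. (\<lambda>(t, s, w). gauss_op (cov t) (g s) w) (r, clamp (t - r), S r x))"
  proof (rule continuous_on_compose2[OF JC])
    show "continuous_on {0..t} (\<lambda>r. (r, clamp (t - r), S r x))"
      unfolding clamp_def by (intro continuous_intros continuous_on_subset[OF continuous_on_S]) auto
  qed (use clamp in auto)
  then show ?thesis
    by (rule continuous_on_cong[THEN iffD1, rotated -1]) (auto simp: W_def OU_eq_gauss_op g_bcontfun)
qed

text \<open>For the function itself measurability in \<open>r\<close> comes from continuity. Each
  derivative is then a pointwise limit of difference quotients, so its continuity in
  \<open>r\<close> need not be examined.\<close>

lemma F_measurable:
  assumes t: "t \<in> {0..T}"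
  shows "length hs \<le> n \<Longrightarrow> (\<lambda>r. F t hs r x) \<in> borel_measurable borel"
proof (induction hs arbitrary: x)
  case Nil
  have "(\<lambda>r. indicator {0<..<t} r *\<^sub>R W t r x) \<in> borel_measurable borel"
    by (intro borel_measurable_continuous_on_indicator continuous_on_subset[OF W_continuous[OF t]]) auto
  also have "(\<lambda>r. indicator {0<..<t} r *\<^sub>R W t r x) = (\<lambda>r. F t [] r x)"
    by (auto simp: F_def indicator_def)
  finally show ?case .
next
  case (Cons h hs)
  have seq: "filterlim (\<lambda>j. inverse (real (Suc j))) (at 0) sequentially"
    using LIMSEQ_inverse_real_of_nat by (simp add: filterlim_at del: of_nat_Suc)
  show ?case
  proof (rule borel_measurable_LIMSEQ_real)
    show "(\<lambda>j. (F t hs r (x + inverse (real (Suc j)) *\<^sub>R h) - F t hs r x) / inverse (real (Suc j))) \<longlonglongrightarrow> F t (h # hs) r x" for r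
    proof -
      have "((\<lambda>s. (F t hs r (x + s *\<^sub>R h) - F t hs r x) / s) \<longlongrightarrow> F t (h # hs) r x) (at 0)"
        using F_has_dir_deriv[of t hs r h] t Cons.prems by (simp add: has_dir_deriv_def has_field_derivative_iff)
      from filterlim_compose[OF this seq] show ?thesis .
    qed
    show "(\<lambda>r. (F t hs r (x + inverse (real (Suc j)) *\<^sub>R h) - F t hs r x) / inverse (real (Suc j))) \<in> borel_measurable borel" for j
      using Cons by (intro borel_measurable_divide borel_measurable_diff borel_measurable_const) auto
  qed
qed

lemma F_integrable:
  assumes t: "t \<in> {0..T}" and hs: "length hs \<le> n"
  shows "integrable lborel (\<lambda>r. F t hs r x)"
proof (rule Bochner_Integration.integrable_bound)
  show "integrable lborel (\<lambda>r. bound_fun (length hs) r * prod_list (map norm hs))"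
    using bound_fun_integral[OF hs] by (auto simp: has_bochner_integral_iff)
  show "AE r in lborel. norm (F t hs r x) \<le> norm (bound_fun (length hs) r * prod_list (map norm hs))"
    using F_bound[of t hs _ x] t hs by (auto intro: order_trans[OF _ abs_ge_self])
qed (use F_measurable[OF t hs] in simp)

text \<open>Reverses time and passes from the gauge integral to the Lebesgue integral; the two
  endpoints dropped by \<open>F\<close> are null.\<close>

lemma duhamel_eq:
  assumes t: "t \<in> {0..T}"
  shows "duhamel S Q g t = (\<lambda>x. LINT r|lborel. F t [] r x)"
proof
  fix x
  have "duhamel S Q g t x = integral {0..t} (\<lambda>s. W t (t - s) x)"
    unfolding duhamel_def using t by (intro integral_cong) (simp add: W_def clamp(2))
  also have "\<dots> = integral {- t..0} (\<lambda>s. W t (- s) x)"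
    using integral_shift_real_ivl[of 0 t t "\<lambda>s. W t (t - s) x"] by simp
  also have "\<dots> = integral {0..t} (\<lambda>r. W t r x)"
    using Henstock_Kurzweil_Integration.integral_reflect_real[of t 0 "\<lambda>r. W t r x"] by simp
  also have "\<dots> = (LINT r:{0..t}|lborel. W t r x)"
    by (rule set_borel_integral_eq_integral(2)[symmetric, OF borel_integrable_atLeastAtMost'[OF W_continuous[OF t]]])
  also have "\<dots> = (LINT r|lborel. F t [] r x)"
    unfolding set_lebesgue_integral_def
  proof (rule integral_cong_AE)
    have "(\<lambda>r. indicator {0..t} r *\<^sub>R W t r x) \<in> borel_measurable borel"
      by (intro borel_measurable_continuous_on_indicator W_continuous[OF t]) auto
    then show "(\<lambda>r. indicator {0..t} r *\<^sub>R W t r x) \<in> borel_measurable lborel" by simp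
    show "(\<lambda>r. F t [] r x) \<in> borel_measurable lborel" using F_measurable[OF t, of "[]"] by simp
    have "AE r in lborel. r \<noteq> 0 \<and> r \<noteq> t" using AE_lborel_singleton[of 0] AE_lborel_singleton[of t] by auto
    then show "AE r in lborel. indicator {0..t} r *\<^sub>R W t r x = F t [] r x"
      by eventually_elim (auto simp: F_def indicator_def)
  qed
  finally show "duhamel S Q g t x = (LINT r|lborel. F t [] r x)" .
qed

text \<open>Dominated convergence with a majorant independent of \<open>t\<close>. Only at
  \<open>r = t\<close>, where the cut-off jumps, can pointwise convergence fail.\<close>

lemma duhamel_deriv_tendsto:
  assumes t: "t \<in> {0..T}" "\<And>j. \<tau> j \<in> {0..T}" "\<tau> \<longlonglongrightarrow> t" and x: "\<xi> \<longlonglongrightarrow> x" and hs: "length hs \<le> n"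
  shows "(\<lambda>j. LINT r|lborel. F (\<tau> j) hs r (\<xi> j)) \<longlonglongrightarrow> (LINT r|lborel. F t hs r x)"
proof (rule integral_dominated_convergence[where w = "\<lambda>r. bound_fun (length hs) r * prod_list (map norm hs)"])
  show "integrable lborel (\<lambda>r. bound_fun (length hs) r * prod_list (map norm hs))"
    using bound_fun_integral[OF hs] by (auto simp: has_bochner_integral_iff)
  show "AE r in lborel. norm (F (\<tau> j) hs r (\<xi> j)) \<le> bound_fun (length hs) r * prod_list (map norm hs)" for j
    using F_bound[OF _ hs] t by auto
  have "AE r in lborel. r \<noteq> t" using AE_lborel_singleton[of t] by auto
  then show "AE r in lborel. (\<lambda>j. F (\<tau> j) hs r (\<xi> j)) \<longlonglongrightarrow> F t hs r x"
  proof eventually_elim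
    case (elim r)
    show ?case
    proof (cases "0 < r \<and> r < t")
      case True
      have "\<forall>\<^sub>F j in sequentially. r < \<tau> j" using order_tendstoD(1)[OF t(3)] True by blast
      then have "\<forall>\<^sub>F j in sequentially. dir_deriv (W (\<tau> j) r) hs (\<xi> j) = F (\<tau> j) hs r (\<xi> j)"
        by eventually_elim (use True in \<open>simp add: F_def\<close>)
      moreover have "(\<lambda>j. dir_deriv (W (\<tau> j) r) hs (\<xi> j)) \<longlonglongrightarrow> F t hs r x"
        using W_tendsto[of r hs \<tau> t \<xi> x] True t x hs by (simp add: F_def)
      ultimately show ?thesis by (rule Lim_transform_eventually[rotated])
    next
      case False
      have "\<forall>\<^sub>F j in sequentially. F (\<tau> j) hs r (\<xi> j) = 0"
      proof (cases "r \<le> 0")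
        case False
        then have "t < r" using \<open>\<not> (0 < r \<and> r < t)\<close> elim by simp
        from order_tendstoD(2)[OF t(3) this] show ?thesis
          by eventually_elim (simp add: F_def)
      qed (simp add: F_def)
      then have "(\<lambda>j. F (\<tau> j) hs r (\<xi> j)) \<longlonglongrightarrow> 0" by (rule tendsto_eventually)
      moreover have "F t hs r x = 0" using False by (simp only: F_def if_False)
      ultimately show ?thesis by simp
    qed
  qed
qed (use F_measurable t hs in auto)

definition holder_const :: real where
  "holder_const = 2 * M * C / (1 - order_exponent n) + C / (order_exponent (Suc n) - 1)"

lemma order_exponent_Suc_n: "order_exponent (Suc n) > 1"
proof -
  have "real n + 1 - \<alpha> > 1 / \<theta>" using exponent \<sigma> by linarith
  then show ?thesis using \<theta>_pos by (simp add: order_exponent_Suc field_simps)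
qed

lemma holder_const_nonneg: "0 \<le> holder_const"
  unfolding holder_const_def using M(1) C order_exponent_less_1[of n] order_exponent_Suc_n by simp

lemma bound_const_nonneg: "m \<le> n \<Longrightarrow> 0 \<le> bound_const m"
  unfolding bound_const_def using C order_exponent_less_1[of m] by simp

text \<open>The integrand is estimated by \<open>W_diff_rough\<close> for \<open>r \<le> \<parallel>y\<parallel> powr (1 / \<theta>)\<close> and by \<open>W_diff_smooth\<close>
  beyond; both parts then scale like \<open>\<parallel>y\<parallel> powr \<sigma>\<close>.\<close>

lemma duhamel_deriv_holder:
  assumes t: "t \<in> {0..T}" and hs: "length hs = n"
  shows "\<bar>(LINT r|lborel. F t hs r (x + y)) - (LINT r|lborel. F t hs r x)\<bar>
    \<le> G * holder_const * norm y powr \<sigma> * prod_list (map norm hs)"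
proof (cases "y = 0")
  case False
  define p where "p = order_exponent n"
  define q where "q = order_exponent (Suc n)"
  define Y where "Y = norm y"
  \<comment> \<open>Up to constants, \<open>r powr (- p) * Y powr \<beta>\<close> and
    \<open>r powr (- q) * Y\<close> coincide at this value of \<open>r\<close>.\<close>
  define \<rho> where "\<rho> = Y powr (1 / \<theta>)"
  let ?P = "prod_list (map norm hs)"
  have P: "0 \<le> ?P" by (rule prod_list_norm_nonneg)
  have Y: "Y > 0" using False by (simp add: Y_def)
  have \<rho>: "\<rho> > 0" using Y by (simp add: \<rho>_def)
  have p: "p < 1" using order_exponent_less_1[of n] by (simp add: p_def)
  have q: "q > 1" using order_exponent_Suc_n by (simp add: q_def)
  \<comment> \<open>Both parts extend to intervals that do not involve \<open>t\<close>, so the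
    bound is uniform in time and also covers \<open>\<rho>\<close> beyond \<open>t\<close>.\<close>
  define b where "b r = (2 * M * C * G * Y powr \<beta> * ?P) * (indicator {0..\<rho>} r * r powr (- p))
      + (C * G * Y * ?P) * (indicator {\<rho>..} r * r powr (- q))" for r
  have b_int: "has_bochner_integral lborel b ((2 * M * C * G * Y powr \<beta> * ?P) * (\<rho> powr (1 - p) / (1 - p))
      + (C * G * Y * ?P) * (\<rho> powr (1 - q) / (q - 1)))"
    unfolding b_def[abs_def] using p q \<rho>
    by (intro has_bochner_integral_add has_bochner_integral_mult_right
        has_bochner_integral_powr_0 has_bochner_integral_powr_inf) auto
  have Fi: "integrable lborel (\<lambda>r. F t hs r z)" for z using F_integrable[OF t] hs by simp
  have "\<bar>(LINT r|lborel. F t hs r (x + y)) - (LINT r|lborel. F t hs r x)\<bar>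
      = \<bar>LINT r|lborel. F t hs r (x + y) - F t hs r x\<bar>" using Fi by simp
  also have "\<dots> \<le> (LINT r|lborel. \<bar>F t hs r (x + y) - F t hs r x\<bar>)" by (rule integral_abs_bound)
  also have "\<dots> \<le> (LINT r|lborel. b r)"
  proof (rule integral_mono)
    show "integrable lborel (\<lambda>r. \<bar>F t hs r (x + y) - F t hs r x\<bar>)" using Fi by simp
    show "integrable lborel b" using b_int by (simp add: has_bochner_integral_iff)
    fix r
    have b1: "0 \<le> (2 * M * C * G * Y powr \<beta> * ?P) * (indicator {0..\<rho>} r * r powr (- p))"
      "0 \<le> (C * G * Y * ?P) * (indicator {\<rho>..} r * r powr (- q))"
      using M(1) C G Y P by auto
    show "\<bar>F t hs r (x + y) - F t hs r x\<bar> \<le> b r"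
    proof (cases "0 < r \<and> r < t")
      case True
      then have r: "r \<in> {0<..T}" using t by auto
      have F: "F t hs r z = dir_deriv (W t r) hs z" for z using True by (simp add: F_def)
      show ?thesis
      proof (cases "r \<le> \<rho>")
        case le: True
        have "\<bar>F t hs r (x + y) - F t hs r x\<bar> \<le> 2 * M * C * G * r powr (- p) * Y powr \<beta> * ?P"
          unfolding F p_def Y_def by (rule W_diff_rough[OF r hs False])
        also have "\<dots> = (2 * M * C * G * Y powr \<beta> * ?P) * (indicator {0..\<rho>} r * r powr (- p))"
          using le True by simp
        finally show ?thesis using b1(2) unfolding b_def by linarith
      next
        case gt: False
        have "\<bar>F t hs r (x + y) - F t hs r x\<bar> \<le> C * G * r powr (- q) * Y * ?P"
          unfolding F q_def Y_def by (rule W_diff_smooth[OF r hs])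
        also have "\<dots> = (C * G * Y * ?P) * (indicator {\<rho>..} r * r powr (- q))"
          using gt by simp
        finally show ?thesis using b1(1) unfolding b_def by linarith
      qed
    next
      case False
      then have F0: "F t hs r z = 0" for z by (simp only: F_def if_False)
      then show ?thesis using b1 unfolding b_def F0 by linarith
    qed
  qed
  also have "\<dots> = (2 * M * C * G * Y powr \<beta> * ?P) * (\<rho> powr (1 - p) / (1 - p))
      + (C * G * Y * ?P) * (\<rho> powr (1 - q) / (q - 1))"
    using b_int by (simp add: has_bochner_integral_iff)
  also have "\<dots> = G * (2 * M * C / (1 - p) * (Y powr \<beta> * \<rho> powr (1 - p)) + C / (q - 1) * (Y powr 1 * \<rho> powr (1 - q))) * ?P"
    using Y by (simp add: field_simps)
  also have "Y powr \<beta> * \<rho> powr (1 - p) = Y powr \<sigma>"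
  proof -
    have "\<beta> + (1 / \<theta>) * (1 - p) = \<sigma>" using beta_exponent by (simp add: p_def)
    then show ?thesis unfolding \<rho>_def by (simp add: powr_powr flip: powr_add)
  qed
  also have "Y powr 1 * \<rho> powr (1 - q) = Y powr \<sigma>"
  proof -
    have "1 + (1 / \<theta>) * (1 - q) = \<sigma>" using exponent \<theta>_pos by (simp add: q_def order_exponent_Suc field_simps)
    then show ?thesis unfolding \<rho>_def by (simp only: powr_powr flip: powr_add)
  qed
  also have "G * (2 * M * C / (1 - p) * Y powr \<sigma> + C / (q - 1) * Y powr \<sigma>) * ?P
      = G * holder_const * norm y powr \<sigma> * ?P"
    by (simp add: holder_const_def p_def q_def Y_def algebra_simps)
  finally show ?thesis .
qed simp

theorem duhamel_holder_upto:
  assumes t: "t \<in> {0..T}"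
  shows "holder_upto n \<sigma> (G * (\<Sum>m\<le>n. bound_const m)) (G * holder_const) (duhamel S Q g t)"
    and "length hs \<le> n \<Longrightarrow> dir_deriv (duhamel S Q g t) hs = (\<lambda>x. LINT r|lborel. F t hs r x)"
proof -
  let ?D = "\<lambda>hs x. LINT r|lborel. F t hs r x"
  have bound: "\<bar>?D hs x\<bar> \<le> G * bound_const (length hs) * prod_list (map norm hs)" if hs: "length hs \<le> n" for hs x
  proof -
    have "\<bar>?D hs x\<bar> \<le> (LINT r|lborel. \<bar>F t hs r x\<bar>)" by (rule integral_abs_bound)
    also have "\<dots> \<le> (LINT r|lborel. bound_fun (length hs) r * prod_list (map norm hs))"
      using F_integrable[OF t hs] F_bound[OF _ hs] t bound_fun_integral[OF hs]
      by (intro integral_mono) (auto simp: has_bochner_integral_iff)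
    also have "\<dots> = G * bound_const (length hs) * prod_list (map norm hs)"
      using bound_fun_integral[OF hs] by (simp add: has_bochner_integral_iff)
    finally show ?thesis .
  qed
  have b: "?D hs \<in> bcontfun" if hs: "length hs \<le> n" for hs
  proof (rule bcontfunI)
    show "continuous_on UNIV (?D hs)"
      unfolding continuous_on_sequentially o_def
      using duhamel_deriv_tendsto[OF t t tendsto_const _ hs] by blast
  qed (rule bound[OF hs])
  have d: "has_dir_deriv (?D hs) h (?D (h # hs))" if hs: "length hs < n" for hs h
  proof (rule has_dir_deriv_integral[where b = "\<lambda>r. bound_fun (length (h # hs)) r * prod_list (map norm (h # hs))"])
    show "has_dir_deriv (F t hs r) h (F t (h # hs) r)" for r using F_has_dir_deriv t hs by simp
    show "\<bar>F t (h # hs) r x\<bar> \<le> bound_fun (length (h # hs)) r * prod_list (map norm (h # hs))" for r x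
      using F_bound[of t "h # hs"] t hs by simp
    show "integrable lborel (\<lambda>r. bound_fun (length (h # hs)) r * prod_list (map norm (h # hs)))"
      using bound_fun_integral[of "length (h # hs)"] hs by (auto simp: has_bochner_integral_iff)
    show "integrable lborel (\<lambda>r. F t hs r x)" for x using F_integrable[OF t] hs by simp
    show "(\<lambda>r. F t (h # hs) r x) \<in> borel_measurable lborel" for x
      using F_measurable[OF t, of "h # hs"] hs by simp
  qed
  note smooth_uptoI[of ?D, OF duhamel_eq[OF t, symmetric] b d]
  note s = this
  show eq: "dir_deriv (duhamel S Q g t) hs = ?D hs" if "length hs \<le> n" for hs
    by (rule s(2)[OF _ _ that])
  show "holder_upto n \<sigma> (G * (\<Sum>m\<le>n. bound_const m)) (G * holder_const) (duhamel S Q g t)"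
    unfolding holder_upto_def
  proof (intro conjI allI impI)
    show "smooth_upto n (duhamel S Q g t)" by (rule s(1))
    show "\<bar>dir_deriv (duhamel S Q g t) hs x\<bar> \<le> G * (\<Sum>m\<le>n. bound_const m) * prod_list (map norm hs)"
      if hs: "length hs \<le> n" for hs x
    proof -
      have "bound_const (length hs) \<le> (\<Sum>m\<le>n. bound_const m)"
        using hs bound_const_nonneg by (intro member_le_sum) auto
      then have "G * bound_const (length hs) * prod_list (map norm hs) \<le> G * (\<Sum>m\<le>n. bound_const m) * prod_list (map norm hs)"
        using G by (intro mult_right_mono mult_left_mono prod_list_norm_nonneg)
      then show ?thesis using bound[OF hs, of x] eq[OF hs] by simp
    qed
    show "\<bar>dir_deriv (duhamel S Q g t) hs (x + y) - dir_deriv (duhamel S Q g t) hs x\<bar>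
        \<le> G * holder_const * norm y powr \<sigma> * prod_list (map norm hs)" if hs: "length hs = n" for hs x y
      using duhamel_deriv_holder[OF t hs] eq[of hs] hs by simp
  qed
qed

theorem duhamel_jointly_continuous:
  assumes hs: "length hs \<le> n"
  shows "continuous_on ({0..T} \<times> UNIV) (\<lambda>(t, x). dir_deriv (duhamel S Q g t) hs x)"
  unfolding continuous_on_sequentially
proof (intro ballI allI impI; elim conjE)
  fix p and s :: "nat \<Rightarrow> real \<times> 'a"
  assume p: "p \<in> {0..T} \<times> (UNIV :: 'a set)" and s: "\<forall>j. s j \<in> {0..T} \<times> UNIV" "s \<longlonglongrightarrow> p"
  have sj: "fst (s j) \<in> {0..T}" for j using s(1) by (auto simp: mem_Times_iff)
  have t: "fst p \<in> {0..T}" using p by auto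
  have "(\<lambda>j. LINT r|lborel. F (fst (s j)) hs r (snd (s j))) \<longlonglongrightarrow> (LINT r|lborel. F (fst p) hs r (snd p))"
    by (intro duhamel_deriv_tendsto t sj hs tendsto_fst tendsto_snd s)
  then show "((\<lambda>(t, x). dir_deriv (duhamel S Q g t) hs x) \<circ> s) \<longlonglongrightarrow> (case p of (t, x) \<Rightarrow> dir_deriv (duhamel S Q g t) hs x)"
    by (simp add: o_def case_prod_unfold duhamel_holder_upto(2)[OF sj hs] duhamel_holder_upto(2)[OF t hs])
qed

end

section \<open>Schauder estimates\<close>

text \<open>The two summands of the mild solution are estimated separately, \<open>P_t f\<close> by
  preservation of the class of \<open>f\<close> and the integral by smoothing. The constant has to
  be fixed before \<open>f\<close> and \<open>g\<close> are known.\<close>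

lemma (in ou_setting) mild_solution_estimate:
  assumes T: "T > 0" and \<alpha>: "0 \<le> \<alpha>" "\<alpha> < 1" and \<sigma>: "0 < \<sigma>" "\<sigma> < 1"
    and exponent: "real n + \<sigma> = \<alpha> + 1 / \<theta>" and ne: "\<exists>h::'a. h \<noteq> 0"
  shows "\<exists>C>0. \<forall>f g G. f \<in> C_b (real n + \<sigma>) \<and> continuous_on ({0..T} \<times> UNIV) (\<lambda>(s, x). g s x) \<and>
      (\<forall>s\<in>{0..T}. \<forall>x. \<bar>g s x\<bar> \<le> G) \<and> 0 \<le> G \<and>
      (\<alpha> > 0 \<longrightarrow> (\<forall>s\<in>{0..T}. \<forall>x w. \<bar>g s (x + w) - g s x\<bar> \<le> G * norm w powr \<alpha>)) \<longrightarrow>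
    mild_solution S Q f g \<in> C0_b T (real n + \<sigma>) \<and>
    C0_b_norm T (real n + \<sigma>) (mild_solution S Q f g) \<le> C * (C_b_norm (real n + \<sigma>) f + G)"
proof -
  obtain C where C: "C > 0" and smooth: "\<And>t hs. t \<in> {0<..T} \<Longrightarrow> length hs \<le> Suc n \<Longrightarrow> \<exists>K.
     conv_op (C * t powr (- \<theta> * length hs) * prod_list (map norm hs)) K \<and>
     (\<forall>f\<in>bcontfun. \<forall>x. dir_deriv (OU S Q t f) hs x = K f (S t x)) \<and>
     (\<forall>f\<in>bcontfun. length hs < Suc n \<longrightarrow>
        (\<forall>h. has_dir_deriv (dir_deriv (OU S Q t f) hs) h (dir_deriv (OU S Q t f) (h # hs)))) \<and>
     (hs \<noteq> [] \<longrightarrow> (\<forall>f H (\<alpha>::real) z. f \<in> bcontfun \<and> 0 < \<alpha> \<and> \<alpha> < 1 \<and> 0 \<le> H \<and>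
        (\<forall>x w. \<bar>f (x + w) - f x\<bar> \<le> H * norm w powr \<alpha>) \<longrightarrow>
        \<bar>K f z\<bar> \<le> C * H * t powr (- \<theta> * (real (length hs) - \<alpha>)) * prod_list (map norm hs)))"
    using OU_smoothing[OF T, of "Suc n"] by metis
  obtain M where M: "M \<ge> 1" "\<And>s z. s \<in> {0..T} \<Longrightarrow> norm (S s z) \<le> M * norm z"
    using S_bound[of T] T by auto
  \<comment> \<open>An instance with \<open>g = 0\<close>, made only to name the constants: they
    depend on the exponents, \<open>T\<close>, \<open>C\<close> and \<open>M\<close>, and so agree
    with those of any later \<open>g\<close>.\<close>
  interpret D0: duhamel_setting S Q \<theta> T \<alpha> \<sigma> C M 0 n "\<lambda>_ _. 0"
    by unfold_locales (use T \<alpha> \<sigma> exponent C M smooth in \<open>simp_all add: case_prod_unfold\<close>)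
  define K1 where "K1 = (\<Sum>m\<le>n. D0.bound_const m)"
  define K2 where "K2 = D0.holder_const"
  have K: "0 \<le> K1" "0 \<le> K2"
    using D0.bound_const_nonneg D0.holder_const_nonneg by (auto simp: K1_def K2_def intro: sum_nonneg)
  \<comment> \<open>Collects the coefficients of the norm of \<open>f\<close> and of
    \<open>G\<close> in \<open>(real n + 1) * B + H\<close>.\<close>
  define CC where "CC = (real n + 1) * (M ^ n + K1) + (M ^ Suc n + K2)"
  have CC: "CC > 0"
  proof -
    have "0 \<le> (real n + 1) * (M ^ n + K1)" using M(1) K by simp
    moreover have "M ^ Suc n > 0" using M(1) by simp
    ultimately show ?thesis using K unfolding CC_def by linarith
  qed
  show ?thesis
  proof (intro exI[of _ CC] conjI CC allI impI; elim conjE)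
    fix f :: "'a \<Rightarrow> real" and g :: "real \<Rightarrow> 'a \<Rightarrow> real" and G :: real
    assume f: "f \<in> C_b (real n + \<sigma>)" and g: "continuous_on ({0..T} \<times> UNIV) (\<lambda>(s, x). g s x)"
      and gG: "\<forall>s\<in>{0..T}. \<forall>x. \<bar>g s x\<bar> \<le> G" and G: "0 \<le> G"
      and gH: "\<alpha> > 0 \<longrightarrow> (\<forall>s\<in>{0..T}. \<forall>x w. \<bar>g s (x + w) - g s x\<bar> \<le> G * norm w powr \<alpha>)"
    interpret D: duhamel_setting S Q \<theta> T \<alpha> \<sigma> C M G n g
      by unfold_locales (use T \<alpha> \<sigma> exponent C M smooth g gG G gH in simp_all)
    define c where "c = C_b_norm (real n + \<sigma>) f"
    have hf: "holder_upto n \<sigma> c c f" and c: "0 \<le> c"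
      using C_b_imp_holder_upto[OF f \<sigma> ne] by (auto simp: c_def)
    define B where "B = M ^ n * c + G * K1"
    define H where "H = M ^ Suc n * c + G * K2"
    have B: "0 \<le> B" and H: "0 \<le> H" using M(1) c G K by (auto simp: B_def H_def)
    let ?v = "mild_solution S Q f g"
    have v: "?v t = (\<lambda>x. OU S Q t f x + duhamel S Q g t x)" for t
      by (auto simp: mild_solution_def duhamel_def)
    have hP: "holder_upto n \<sigma> (M ^ n * c) (M ^ Suc n * c) (OU S Q t f)"
      and hD: "holder_upto n \<sigma> (G * K1) (G * K2) (duhamel S Q g t)" if t: "t \<in> {0..T}" for t
      using OU_holder_upto[OF hf c c \<sigma> M(1) M(2)[OF t]] t D.duhamel_holder_upto(1)[OF t]
      by (auto simp: K1_def K2_def)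
    have hv: "holder_upto n \<sigma> B H (?v t)" if t: "t \<in> {0..T}" for t
      unfolding v B_def H_def by (rule holder_upto_add[OF hP[OF t] hD[OF t]])
    have dv: "dir_deriv (?v t) hs x = dir_deriv (OU S Q t f) hs x + dir_deriv (duhamel S Q g t) hs x"
      if t: "t \<in> {0..T}" and hs: "length hs \<le> n" for t hs x
      using smooth_upto_add(2)[OF _ _ hs, of "OU S Q t f" "duhamel S Q g t"] hP[OF t] hD[OF t]
      by (simp add: v holder_upto_def)
    have cont: "continuous_on ({0..T} \<times> UNIV) (\<lambda>(t, x). dir_deriv (?v t) hs x)" if hs: "length hs \<le> n" for hs
    proof -
      have "continuous_on ({0..T} \<times> UNIV) (\<lambda>p. (\<lambda>(t, x). dir_deriv (OU S Q t f) hs x) p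
          + (\<lambda>(t, x). dir_deriv (duhamel S Q g t) hs x) p)"
        using T by (intro continuous_on_add OU_jointly_continuous[OF hf c hs] D.duhamel_jointly_continuous[OF hs]) simp
      then show ?thesis
        by (rule continuous_on_cong[THEN iffD1, rotated -1]) (auto simp: dv hs)
    qed
    have norm_le: "C_b_norm (real n + \<sigma>) (?v t) \<le> CC * (c + G)" if t: "t \<in> {0..T}" for t
    proof -
      have "C_b_norm (real n + \<sigma>) (?v t) \<le> (real n + 1) * B + H"
        by (rule holder_upto_imp_C_b(2)[OF hv[OF t] \<sigma> B H ne])
      also have "\<dots> \<le> CC * (c + G)"
      proof -
        have "0 \<le> M ^ n * G" "0 \<le> K1 * c" "0 \<le> M ^ Suc n * G" "0 \<le> K2 * c" using M(1) K c G by auto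
        moreover from this(1,2) have "0 \<le> (real n + 1) * (M ^ n * G + K1 * c)" by simp
        moreover have "CC * (c + G) = (real n + 1) * B + H + (real n + 1) * (M ^ n * G + K1 * c)
            + (M ^ Suc n * G + K2 * c)"
          unfolding CC_def B_def H_def by (simp add: algebra_simps)
        ultimately show ?thesis by linarith
      qed
      finally show ?thesis .
    qed
    have "?v \<in> C_b_cyl T"
      unfolding C_b_cyl_def
    proof (intro CollectI conjI)
      show "continuous_on ({0..T} \<times> UNIV) (\<lambda>(t, x). ?v t x)" using cont[of "[]"] by simp
      have "\<bar>?v t x\<bar> \<le> B" if "t \<in> {0..T}" for t x
      proof -
        have "\<bar>dir_deriv (?v t) [] x\<bar> \<le> B * prod_list (map norm ([] :: 'a list))"
          using hv[OF that] unfolding holder_upto_def by (metis le0 list.size(3))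
        then show ?thesis by simp
      qed
      then show "bounded ((\<lambda>(t, x). ?v t x) ` ({0..T} \<times> UNIV))"
        unfolding bounded_iff by (intro exI[of _ B]) auto
    qed
    moreover have "?v t \<in> C_b (real n + \<sigma>)" if t: "t \<in> {0..T}" for t
      by (rule holder_upto_imp_C_b(1)[OF hv[OF t] \<sigma> B H ne])
    moreover have "bdd_above ((\<lambda>t. C_b_norm (real n + \<sigma>) (?v t)) ` {0..T})"
      using norm_le by (rule bdd_aboveI2)
    ultimately show "?v \<in> C0_b T (real n + \<sigma>)"
      unfolding C0_b_def floor_frac_add[OF \<sigma>] using cont by blast
    show "C0_b_norm T (real n + \<sigma>) ?v \<le> CC * (C_b_norm (real n + \<sigma>) f + G)"
      unfolding C0_b_norm_def using T norm_le by (intro cSUP_least) (auto simp: c_def)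
  qed
qed

text \<open>A positive number outside the naturals is no integer, so its fractional part is strictly
  positive; the strict inequalities for the time exponents rest on this.\<close>

lemma exponent_decomposition:
  fixes x :: real
  assumes "x > 0" "x \<notin> \<nat>"
  shows "real (nat \<lfloor>x\<rfloor>) + frac x = x" "0 < frac x" "frac x < 1"
proof -
  show "real (nat \<lfloor>x\<rfloor>) + frac x = x" using assms(1) by (simp add: frac_def)
  have "x \<notin> \<int>" using assms by (auto simp: Nats_altdef2)
  then show "0 < frac x" by (simp add: frac_gt_0_iff)
  show "frac x < 1" by (rule frac_lt_1)
qed

lemma C_b_cyl_bound:
  assumes "g \<in> C_b_cyl T" and "T \<ge> 0"
  shows "s \<in> {0..T} \<Longrightarrow> \<bar>g s x\<bar> \<le> sup_norm_cyl T g" "0 \<le> sup_norm_cyl T g"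
proof -
  have le: "\<bar>g s x\<bar> \<le> sup_norm_cyl T g" if s: "s \<in> {0..T}" for s x
  proof -
    obtain B where "\<And>p. p \<in> {0..T} \<times> UNIV \<Longrightarrow> norm (case p of (t, x) \<Rightarrow> g t x) \<le> B"
      using assms(1) unfolding C_b_cyl_def bounded_iff by auto
    then have "bdd_above ((\<lambda>(t, x). \<bar>g t x\<bar>) ` ({0..T} \<times> UNIV))"
      by (intro bdd_aboveI2[where M = B]) force
    then have "(\<lambda>(t, x). \<bar>g t x\<bar>) (s, x) \<le> sup_norm_cyl T g"
      unfolding sup_norm_cyl_def by (rule cSUP_upper[rotated]) (use s in auto)
    then show ?thesis by simp
  qed
  then show "s \<in> {0..T} \<Longrightarrow> \<bar>g s x\<bar> \<le> sup_norm_cyl T g" .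
  have "\<bar>g 0 undefined\<bar> \<le> sup_norm_cyl T g" using assms(2) by (intro le) simp
  then show "0 \<le> sup_norm_cyl T g" by linarith
qed

lemma C0_b_bound:
  fixes g :: "real \<Rightarrow> 'a::banach \<Rightarrow> real"
  assumes g: "g \<in> C0_b T \<alpha>" and \<alpha>: "0 < \<alpha>" "\<alpha> < 1" and T: "T \<ge> 0" and ne: "\<exists>h::'a. h \<noteq> 0"
  shows "s \<in> {0..T} \<Longrightarrow> \<bar>g s x\<bar> \<le> C0_b_norm T \<alpha> g" "0 \<le> C0_b_norm T \<alpha> g"
    "s \<in> {0..T} \<Longrightarrow> \<bar>g s (x + w) - g s x\<bar> \<le> C0_b_norm T \<alpha> g * norm w powr \<alpha>"
proof -
  have *: "holder_upto 0 \<alpha> (C_b_norm \<alpha> (g s)) (C_b_norm \<alpha> (g s)) (g s)" "0 \<le> C_b_norm \<alpha> (g s)"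
    "C_b_norm \<alpha> (g s) \<le> C0_b_norm T \<alpha> g" if s: "s \<in> {0..T}" for s
  proof -
    have "g s \<in> C_b (real 0 + \<alpha>)" using g s by (simp add: C0_b_def)
    from C_b_imp_holder_upto[OF this \<alpha> ne]
    show "holder_upto 0 \<alpha> (C_b_norm \<alpha> (g s)) (C_b_norm \<alpha> (g s)) (g s)" "0 \<le> C_b_norm \<alpha> (g s)" by simp_all
    show "C_b_norm \<alpha> (g s) \<le> C0_b_norm T \<alpha> g"
      unfolding C0_b_norm_def using g s by (intro cSUP_upper) (auto simp: C0_b_def)
  qed
  show "\<bar>g s x\<bar> \<le> C0_b_norm T \<alpha> g" if s: "s \<in> {0..T}"
  proof -
    have "\<bar>dir_deriv (g s) [] x\<bar> \<le> C_b_norm \<alpha> (g s) * prod_list (map norm ([] :: 'a list))"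
      using *(1)[OF s] unfolding holder_upto_def by (metis le0 list.size(3))
    then show ?thesis using *(3)[OF s] by simp
  qed
  show "\<bar>g s (x + w) - g s x\<bar> \<le> C0_b_norm T \<alpha> g * norm w powr \<alpha>" if s: "s \<in> {0..T}"
  proof -
    have "\<bar>dir_deriv (g s) [] (x + w) - dir_deriv (g s) [] x\<bar>
        \<le> C_b_norm \<alpha> (g s) * norm w powr \<alpha> * prod_list (map norm ([] :: 'a list))"
      using *(1)[OF s] unfolding holder_upto_def by (metis list.size(3))
    also have "\<dots> \<le> C0_b_norm T \<alpha> g * norm w powr \<alpha>" using *(3)[OF s] by (simp add: mult_right_mono)
    finally show ?thesis by simp
  qed
  show "0 \<le> C0_b_norm T \<alpha> g" using *(2,3)[of 0] T by simp
qed

theorem theorem5p3: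
  fixes D :: "'a::{real_inner, banach, polish_space} set"
    and A Q :: "'a \<Rightarrow> 'a"
    and S :: "real \<Rightarrow> 'a \<Rightarrow> 'a"
    and L :: "(('a \<Rightarrow>\<^sub>C real) \<times> ('a \<Rightarrow>\<^sub>C real)) set"
    and \<theta> T :: real
  assumes A1: "assumption_A1 D A S Q"
    and A2: "assumption_A2 S Q \<theta>"
    and L: "OU_generator S Q L"
    and T: "T > 0"
  shows
    "(1 / \<theta> \<notin> \<nat> \<longrightarrow>
       (\<exists>C>0. \<forall>f g. f \<in> C_b (1 / \<theta>) \<and> g \<in> C_b_cyl T \<longrightarrow>
          mild_solution S Q f g \<in> C0_b T (1 / \<theta>) \<and>
          C0_b_norm T (1 / \<theta>) (mild_solution S Q f g)
            \<le> C * (C_b_norm (1 / \<theta>) f + sup_norm_cyl T g)))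
     \<and>
     (\<forall>\<alpha>. 0 < \<alpha> \<and> \<alpha> < 1 \<and> \<alpha> + 1 / \<theta> \<notin> \<nat> \<longrightarrow>
       (\<exists>C>0. \<forall>f g. f \<in> C_b (\<alpha> + 1 / \<theta>) \<and> g \<in> C0_b T \<alpha> \<longrightarrow>
          mild_solution S Q f g \<in> C0_b T (\<alpha> + 1 / \<theta>) \<and>
          C0_b_norm T (\<alpha> + 1 / \<theta>) (mild_solution S Q f g)
            \<le> C * (C_b_norm (\<alpha> + 1 / \<theta>) f + C0_b_norm T \<alpha> g)))"
proof -
  interpret ou_setting S Q \<theta>
    by unfold_locales (use A1 A2 in \<open>auto simp: assumption_A1_def\<close>)
  \<comment> \<open>Infinite dimension provides a nonzero vector, which makes the sets of Hoelder
    quotients nonempty.\<close>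
  have ne: "\<exists>h::'a. h \<noteq> 0"
  proof (rule ccontr)
    assume "\<not> ?thesis"
    then have "span {} = (UNIV :: 'a set)" by auto
    then show False using A1 unfolding assumption_A1_def by blast
  qed
  have T0: "T \<ge> 0" using T by simp
  \<comment> \<open>Both parts are instances: for \<alpha> = 0 the Hoelder condition on
    \<open>g\<close> is void and \<open>G\<close> is the sup norm, for positive \<alpha> it is the
    Hoelder norm of \<open>g\<close>.\<close>
  have key: "\<exists>C>0. \<forall>f g G. f \<in> C_b (\<alpha> + 1 / \<theta>) \<and> continuous_on ({0..T} \<times> UNIV) (\<lambda>(s, x). g s x) \<and>
      (\<forall>s\<in>{0..T}. \<forall>x. \<bar>g s x\<bar> \<le> G) \<and> 0 \<le> G \<and>
      (\<alpha> > 0 \<longrightarrow> (\<forall>s\<in>{0..T}. \<forall>x w. \<bar>g s (x + w) - g s x\<bar> \<le> G * norm w powr \<alpha>)) \<longrightarrow>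
    mild_solution S Q f g \<in> C0_b T (\<alpha> + 1 / \<theta>) \<and>
    C0_b_norm T (\<alpha> + 1 / \<theta>) (mild_solution S Q f g) \<le> C * (C_b_norm (\<alpha> + 1 / \<theta>) f + G)"
    if \<alpha>: "0 \<le> \<alpha>" "\<alpha> < 1" and notin: "\<alpha> + 1 / \<theta> \<notin> \<nat>" for \<alpha>
  proof -
    have "\<alpha> + 1 / \<theta> > 0" using \<alpha> \<theta>_pos by (simp add: add_nonneg_pos)
    note e = exponent_decomposition[OF this notin]
    show ?thesis using mild_solution_estimate[OF T \<alpha> e(2,3) e(1) ne] unfolding e(1) .
  qed
  show ?thesis
  proof (intro conjI impI allI; (elim conjE)?)
    assume "1 / \<theta> \<notin> \<nat>"
    then obtain C where C: "C > 0" and est: "\<forall>f g G. f \<in> C_b (1 / \<theta>) \<and>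
        continuous_on ({0..T} \<times> UNIV) (\<lambda>(s, x). g s x) \<and> (\<forall>s\<in>{0..T}. \<forall>x. \<bar>g s x\<bar> \<le> G) \<and> 0 \<le> G \<longrightarrow>
        mild_solution S Q f g \<in> C0_b T (1 / \<theta>) \<and>
        C0_b_norm T (1 / \<theta>) (mild_solution S Q f g) \<le> C * (C_b_norm (1 / \<theta>) f + G)"
      using key[of 0] by auto
    show "\<exists>C>0. \<forall>f g. f \<in> C_b (1 / \<theta>) \<and> g \<in> C_b_cyl T \<longrightarrow>
          mild_solution S Q f g \<in> C0_b T (1 / \<theta>) \<and>
          C0_b_norm T (1 / \<theta>) (mild_solution S Q f g) \<le> C * (C_b_norm (1 / \<theta>) f + sup_norm_cyl T g)"
    proof (intro exI[of _ C] conjI[OF C] allI impI, elim conjE)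
      fix f :: "'a \<Rightarrow> real" and g assume f: "f \<in> C_b (1 / \<theta>)" and g: "g \<in> (C_b_cyl T :: (real \<Rightarrow> 'a \<Rightarrow> real) set)"
      show "mild_solution S Q f g \<in> C0_b T (1 / \<theta>) \<and>
          C0_b_norm T (1 / \<theta>) (mild_solution S Q f g) \<le> C * (C_b_norm (1 / \<theta>) f + sup_norm_cyl T g)"
        using f g C_b_cyl_bound[OF g T0] by (intro est[rule_format]) (auto simp: C_b_cyl_def)
    qed
  next
    fix \<alpha> :: real assume \<alpha>: "0 < \<alpha>" "\<alpha> < 1" and "\<alpha> + 1 / \<theta> \<notin> \<nat>"
    then obtain C where C: "C > 0" and est: "\<forall>f g G. f \<in> C_b (\<alpha> + 1 / \<theta>) \<and>
        continuous_on ({0..T} \<times> UNIV) (\<lambda>(s, x). g s x) \<and> (\<forall>s\<in>{0..T}. \<forall>x. \<bar>g s x\<bar> \<le> G) \<and> 0 \<le> G \<and>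
        (\<forall>s\<in>{0..T}. \<forall>x w. \<bar>g s (x + w) - g s x\<bar> \<le> G * norm w powr \<alpha>) \<longrightarrow>
        mild_solution S Q f g \<in> C0_b T (\<alpha> + 1 / \<theta>) \<and>
        C0_b_norm T (\<alpha> + 1 / \<theta>) (mild_solution S Q f g) \<le> C * (C_b_norm (\<alpha> + 1 / \<theta>) f + G)"
      using key[of \<alpha>] by auto
    show "\<exists>C>0. \<forall>f g. f \<in> C_b (\<alpha> + 1 / \<theta>) \<and> g \<in> C0_b T \<alpha> \<longrightarrow>
          mild_solution S Q f g \<in> C0_b T (\<alpha> + 1 / \<theta>) \<and>
          C0_b_norm T (\<alpha> + 1 / \<theta>) (mild_solution S Q f g)
            \<le> C * (C_b_norm (\<alpha> + 1 / \<theta>) f + C0_b_norm T \<alpha> g)"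
    proof (intro exI[of _ C] conjI[OF C] allI impI, elim conjE)
      fix f :: "'a \<Rightarrow> real" and g assume f: "f \<in> C_b (\<alpha> + 1 / \<theta>)" and g: "g \<in> (C0_b T \<alpha> :: (real \<Rightarrow> 'a \<Rightarrow> real) set)"
      note b = C0_b_bound[OF g \<alpha> T0 ne]
      show "mild_solution S Q f g \<in> C0_b T (\<alpha> + 1 / \<theta>) \<and>
          C0_b_norm T (\<alpha> + 1 / \<theta>) (mild_solution S Q f g)
            \<le> C * (C_b_norm (\<alpha> + 1 / \<theta>) f + C0_b_norm T \<alpha> g)"
        using f g b by (intro est[rule_format]) (auto simp: C0_b_def C_b_cyl_def)
    qed
  qed
qed

end
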